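(* Let $n\ge 3$, $0<\alpha<n$, $q_1,q_2>1$, $\beta_1,\beta_2\ge 0$ with $\beta_1+\beta_2\le\alpha$, and assume $$\frac{\beta_1}{n}<\frac{1}{q_1+1}<\frac{n-\alpha+\beta_1}{n},\qquad \frac{\beta_2}{n}<\frac{1}{q_2+1}<\frac{n-\alpha+\beta_2}{n}.$$ The integral system $$u(x)=\frac{1}{|x|^{\beta_1}}\int_{\mathbb{R}^n}\frac{v^{q_2}(y)}{|y|^{\beta_2}|x-y|^{n-\alpha}}\,dy,\qquad v(x)=\frac{1}{|x|^{\beta_2}}\int_{\mathbb{R}^n}\frac{u^{q_1}(y)}{|y|^{\beta_1}|x-y|^{n-\alpha}}\,dy$$ has finite energy positive solutions $u,v$ in $C^1_{loc}(\mathbb{R}^n\setminus\{0\})$ if and only if $q_1,q_2$ satisfy the critical condition $$\frac{1}{q_1+1}+\frac{1}{q_2+1}=\frac{n-\alpha+\beta_1+\beta_2}{n}.$$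
   Context: A pair of solutions $(u,v)$ of the integral system is called a pair of finite energy solutions if $(u,v)\in L^{q_1+1}(\mathbb{R}^n)\times L^{q_2+1}(\mathbb{R}^n)$. *)

theory Defs
  imports "HOL-Analysis.Analysis"
begin

text \<open>Continuously differentiable on an open set; the derivative is continuous in the operator
  norm. Continuity is a local property, so this is \<open>C\<^sup>1\<close> and \<open>C\<^sup>1\<close>-loc on \<open>S\<close> alike.\<close>

definition C1_on :: "(real ^ 'n) set \<Rightarrow> (real ^ 'n \<Rightarrow> real) \<Rightarrow> bool" where
  "C1_on S f \<longleftrightarrow>
     (\<exists>f' :: real ^ 'n \<Rightarrow> (real ^ 'n) \<Rightarrow>\<^sub>L real.
        (\<forall>x\<in>S. (f has_derivative blinfun_apply (f' x)) (at x)) \<and> continuous_on S f')"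

definition Lp_space :: "real \<Rightarrow> (real ^ 'n \<Rightarrow> real) set" where
  "Lp_space p =
     {f. f \<in> borel_measurable lebesgue \<and> integrable lebesgue (\<lambda>x. \<bar>f x\<bar> powr p)}"

definition wpot_integrand ::
  "real \<Rightarrow> real \<Rightarrow> real \<Rightarrow> (real ^ 'n \<Rightarrow> real) \<Rightarrow> real ^ 'n \<Rightarrow> real ^ 'n \<Rightarrow> real" where
  "wpot_integrand \<alpha> \<gamma> q w x y =
     w y powr q / (norm y powr \<gamma> * norm (x - y) powr (real CARD('n) - \<alpha>))"

text \<open>Solutions are considered off the origin, where the weights are singular; there the
  integrals are required to converge, since the Bochner integral of a non-integrable function is
  \<open>0\<close>. The conventions \<open>a / 0 = 0\<close> and \<open>0 powr a = 0\<close> affect the integrand only at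
  \<open>y = 0\<close> and \<open>y = x\<close>, a null set.\<close>

definition wHLS_solution ::
  "real \<Rightarrow> real \<Rightarrow> real \<Rightarrow> real \<Rightarrow> real \<Rightarrow> (real ^ 'n \<Rightarrow> real) \<Rightarrow> (real ^ 'n \<Rightarrow> real) \<Rightarrow> bool" where
  "wHLS_solution \<alpha> \<beta>\<^sub>1 \<beta>\<^sub>2 q\<^sub>1 q\<^sub>2 u v \<longleftrightarrow>
     (\<forall>x. x \<noteq> 0 \<longrightarrow>
        integrable lebesgue (wpot_integrand \<alpha> \<beta>\<^sub>2 q\<^sub>2 v x) \<and>
        u x = 1 / norm x powr \<beta>\<^sub>1 * (LINT y|lebesgue. wpot_integrand \<alpha> \<beta>\<^sub>2 q\<^sub>2 v x y) \<and>
        integrable lebesgue (wpot_integrand \<alpha> \<beta>\<^sub>1 q\<^sub>1 u x) \<and>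
        v x = 1 / norm x powr \<beta>\<^sub>2 * (LINT y|lebesgue. wpot_integrand \<alpha> \<beta>\<^sub>1 q\<^sub>1 u x y))"

definition finite_energy ::
  "real \<Rightarrow> real \<Rightarrow> (real ^ 'n \<Rightarrow> real) \<Rightarrow> (real ^ 'n \<Rightarrow> real) \<Rightarrow> bool" where
  "finite_energy q\<^sub>1 q\<^sub>2 u v \<longleftrightarrow> u \<in> Lp_space (q\<^sub>1 + 1) \<and> v \<in> Lp_space (q\<^sub>2 + 1)"

end

theory Submission
  imports Defs "HOL-Probability.Helly_Selection" "HOL-Real_Asymp.Real_Asymp"
begin

text \<open>
Necessity. Transport both solutions by the flow of a radial field \<open>c(ln |x|) x\<close> with \<open>c\<close> a cutoff, and
differentiate the equation for \<open>u\<close>, integrated against \<open>u powr q1\<close>, in the flow time. Along the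
diagonal flow the kernel changes by a bounded factor, whose quotients are dominated
despite the singularity; the change of variables in the integrals of \<open>u powr (q1 + 1)\<close> and \<open>v powr (q2 + 1)\<close>
eliminates the derivatives of \<open>u\<close> and \<open>v\<close>. As \<open>c\<close> tends to \<open>1\<close> the resulting identity becomes
\<open>n / (q1 + 1) + n / (q2 + 1) = n - \<alpha> + \<beta>1 + \<beta>2\<close>.

Existence. Under the critical condition the ansatz \<open>u(x) = |x| powr (-n / (q1 + 1)) * U(ln |x|)\<close>,
and likewise for \<open>v\<close>, turns the system into convolution equations for \<open>U\<close> and \<open>V\<close> on the line with
an integrable positive kernel \<open>K\<close>. One maximises the norm of \<open>K * G\<close> over the functions \<open>G\<close> of fixed
norm that come from radially decreasing functions on the space. A reflection argument shows that
convolution preserves this class, whose elements satisfy a uniform bound and Helly's selection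
theorem; translates of a maximising sequence then converge, since vanishing is excluded by the uniform
bound and splitting by strict superadditivity. Equality in Young's inequality gives the
Euler--Lagrange system, which up to constants is the required one. Finally \<open>U\<close> and \<open>V\<close> are \<open>C^1\<close>
because their difference quotients are uniformly Cauchy: the kernel has small \<open>L^1\<close> modulus of
continuity, so the convolution equations contract the oscillation of the quotients.
\<close>

section \<open>Polar coordinates and reflections\<close>

text \<open>The class over which the functional is maximised consists of monotone profiles, so a
  maximiser cannot be varied in arbitrary directions. The extremal system is read off from a single
  competitor instead, the function that is Hoelder dual to the maximiser; it lies in the class
  because both convolutions send radially decreasing profiles to radially decreasing ones. The same
  monotonicity bounds a profile pointwise by its norm, so Young's inequality with an integrable
  kernel and equal exponents suffices to pass from exponent \<open>Q = (q2 + 1) / q2\<close> to the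
  larger \<open>r = q1 + 1\<close>; here \<open>Q < 2 < r\<close>. In the necessity part, the pure
  dilation field \<open>x\<close> is out of reach because nothing is known about the derivatives of
  \<open>u\<close> and \<open>v\<close> near the origin and at infinity. A cutoff in
  \<open>ln |x|\<close> can be made arbitrarily flat in a scale invariant sense. Hence the relative
  change of the kernel stays bounded uniformly in the cutoff, and the cutoff is removed only after
  all derivatives of \<open>u\<close> and \<open>v\<close> have been eliminated.\<close>

lemma nn_integral_scaleR_lborel:
  fixes f :: "'a::euclidean_space \<Rightarrow> ennreal"
  assumes [measurable]: "f \<in> borel_measurable borel" and c: "c > 0"
  shows "(\<integral>\<^sup>+y. f y \<partial>lborel) = (\<integral>\<^sup>+y. ennreal (c ^ DIM('a)) * f (c *\<^sub>R y) \<partial>lborel)"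
proof -
  have "(\<integral>\<^sup>+y. f y \<partial>lborel) = (\<integral>\<^sup>+y. f y \<partial>density (distr lborel borel (\<lambda>x::'a. 0 + c *\<^sub>R x)) (\<lambda>_. ennreal (\<bar>c\<bar>^DIM('a))))"
    using lborel_affine[of c "0::'a"] c by simp
  also have "\<dots> = (\<integral>\<^sup>+y. ennreal (c ^ DIM('a)) * f (c *\<^sub>R y) \<partial>lborel)"
    using c by (simp add: nn_integral_density nn_integral_distr)
  finally show ?thesis .
qed

lemma borel_measurable_sgn_vec [measurable]:
  "(sgn :: 'a::euclidean_space \<Rightarrow> 'a) \<in> borel_measurable borel"
  unfolding sgn_div_norm by measurable

lemma nn_integral_exp_tail:
  fixes m :: real assumes "m > 0"
  shows "(\<integral>\<^sup>+t. ennreal (m * exp (- (m * t))) * indicator {a..} t \<partial>lborel) = ennreal (exp (- (m * a)))"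
proof -
  have "((\<lambda>t. - exp (- (m * t))) \<longlongrightarrow> 0) at_top"
    using assms by real_asymp
  then have "(\<integral>\<^sup>+t. ennreal (m * exp (- (m * t))) * indicator {a..} t \<partial>lborel) = ennreal (0 - (- exp (- (m * a))))"
    using assms by (intro nn_integral_FTC_atLeast) (auto intro!: derivative_eq_intros)
  then show ?thesis by simp
qed

text \<open>The sphere is encoded by the unit ball: a function of \<open>sgn y\<close> integrated
  over the ball gives \<open>1/n\<close> times its integral over the sphere, whence the factor
  \<open>DIM('a)\<close>. Shifting \<open>t\<close> by \<open>ln (norm y)\<close> turns
  \<open>sgn y\<close> into \<open>y\<close>, the substitution \<open>z = exp t *\<^sub>R y\<close>
  frees \<open>f\<close>, and the remaining integral of \<open>n * exp (- n * t)\<close> over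
  \<open>t > ln (norm z)\<close> cancels the factor \<open>norm z ^ n\<close>.\<close>

lemma nn_integral_polar:
  fixes f :: "'a::euclidean_space \<Rightarrow> ennreal"
  assumes [measurable]: "f \<in> borel_measurable borel"
  shows "(\<integral>\<^sup>+y. f y \<partial>lborel) =
    (\<integral>\<^sup>+t. (\<integral>\<^sup>+y. ennreal (DIM('a) * exp (DIM('a) * t)) * f (exp t *\<^sub>R sgn y) * indicator (ball 0 1) y \<partial>lborel) \<partial>lborel)"
    
proof -
  define B where "B = ball (0::'a) 1"
  have [measurable]: "B \<in> sets borel" by (simp add: B_def)
  have [measurable]: "ball (0::'a) r \<in> sets borel" for r by simp
  let ?R = "(\<integral>\<^sup>+t. (\<integral>\<^sup>+y. ennreal (DIM('a) * exp (DIM('a) * t)) * f (exp t *\<^sub>R sgn y) * indicator B y \<partial>lborel) \<partial>lborel)"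
  let ?n = "real DIM('a)"
  have n0: "?n > 0" by simp
  have expn: "exp (?n * t) = exp t ^ DIM('a)" for t :: real
    by (simp add: exp_of_nat_mult)
  have "?R = (\<integral>\<^sup>+y. (\<integral>\<^sup>+t. ennreal (?n * exp (?n * t)) * f (exp t *\<^sub>R sgn y) * indicator B y \<partial>lborel) \<partial>lborel)"
    by (rule lborel_pair.Fubini') measurable
  also have "\<dots> = (\<integral>\<^sup>+y. (\<integral>\<^sup>+t. ennreal (?n * exp (?n * t) * norm y ^ DIM('a)) * f (exp t *\<^sub>R y) * indicator B y \<partial>lborel) \<partial>lborel)"
  proof (rule nn_integral_cong_AE)
    have "AE y in lborel. y \<noteq> (0::'a)" by (rule AE_lborel_singleton)
    then show "AE y in lborel. (\<integral>\<^sup>+t. ennreal (?n * exp (?n * t)) * f (exp t *\<^sub>R sgn y) * indicator B y \<partial>lborel)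
      = (\<integral>\<^sup>+t. ennreal (?n * exp (?n * t) * norm y ^ DIM('a)) * f (exp t *\<^sub>R y) * indicator B y \<partial>lborel)"
    proof eventually_elim
      case (elim y)
      then have ny: "norm y > 0" by simp
      have cn: "exp (ln (norm y) + t) *\<^sub>R sgn y = exp t *\<^sub>R y" for t :: real
        using ny by (simp add: exp_add sgn_div_norm)
      have "(\<integral>\<^sup>+t. ennreal (?n * exp (?n * t)) * f (exp t *\<^sub>R sgn y) * indicator B y \<partial>lborel) =
        ennreal \<bar>1\<bar> * (\<integral>\<^sup>+t. ennreal (?n * exp (?n * (ln (norm y) + 1 * t))) * f (exp (ln (norm y) + 1 * t) *\<^sub>R sgn y) * indicator B y \<partial>lborel)"
        by (rule nn_integral_real_affine) simp_all
      also have "\<dots> = (\<integral>\<^sup>+t. ennreal (?n * exp (?n * t) * norm y ^ DIM('a)) * f (exp t *\<^sub>R y) * indicator B y \<partial>lborel)"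
        using ny by (simp add: cn) (simp add: exp_add expn power_mult_distrib distrib_left mult_ac)
      finally show ?case .
    qed
  qed
  also have "\<dots> = (\<integral>\<^sup>+t. (\<integral>\<^sup>+y. ennreal (?n * exp (?n * t) * norm y ^ DIM('a)) * f (exp t *\<^sub>R y) * indicator B y \<partial>lborel) \<partial>lborel)"
    by (rule lborel_pair.Fubini') measurable
  also have "\<dots> = (\<integral>\<^sup>+t. (\<integral>\<^sup>+z. ennreal (?n * exp (- (?n * t)) * norm z ^ DIM('a)) * f z * indicator (ball 0 (exp t)) z \<partial>lborel) \<partial>lborel)"
  proof (rule nn_integral_cong)
    fix t :: real
    have "(\<integral>\<^sup>+z. ennreal (?n * exp (- (?n * t)) * norm z ^ DIM('a)) * f z * indicator (ball 0 (exp t)) z \<partial>lborel)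
      = (\<integral>\<^sup>+y. ennreal (exp t ^ DIM('a)) * (ennreal (?n * exp (- (?n * t)) * norm (exp t *\<^sub>R y) ^ DIM('a)) * f (exp t *\<^sub>R y) * indicator (ball 0 (exp t)) (exp t *\<^sub>R y)) \<partial>lborel)"
      by (rule nn_integral_scaleR_lborel) simp_all
    also have "\<dots> = (\<integral>\<^sup>+y. ennreal (?n * exp (?n * t) * norm y ^ DIM('a)) * f (exp t *\<^sub>R y) * indicator B y \<partial>lborel)"
    proof (rule nn_integral_cong)
      fix y :: 'a
      have i: "indicator (ball 0 (exp t)) (exp t *\<^sub>R y) = (indicator B y :: ennreal)"
        by (auto simp: indicator_def B_def)
      have e: "exp t ^ DIM('a) * (?n * exp (- (?n * t)) * norm (exp t *\<^sub>R y) ^ DIM('a)) = ?n * exp (?n * t) * norm y ^ DIM('a)"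
        by (simp add: exp_minus power_mult_distrib field_simps flip: expn)
      show "ennreal (exp t ^ DIM('a)) * (ennreal (?n * exp (- (?n * t)) * norm (exp t *\<^sub>R y) ^ DIM('a)) * f (exp t *\<^sub>R y) * indicator (ball 0 (exp t)) (exp t *\<^sub>R y))
        = ennreal (?n * exp (?n * t) * norm y ^ DIM('a)) * f (exp t *\<^sub>R y) * indicator B y"
        unfolding i e[symmetric] by (simp add: ennreal_mult mult_ac)
    qed
    finally show "(\<integral>\<^sup>+y. ennreal (?n * exp (?n * t) * norm y ^ DIM('a)) * f (exp t *\<^sub>R y) * indicator B y \<partial>lborel) = 
      (\<integral>\<^sup>+z. ennreal (?n * exp (- (?n * t)) * norm z ^ DIM('a)) * f z * indicator (ball 0 (exp t)) z \<partial>lborel)" by simp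
  qed
  also have "\<dots> = (\<integral>\<^sup>+z. (\<integral>\<^sup>+t. ennreal (?n * exp (- (?n * t)) * norm z ^ DIM('a)) * f z * indicator {z. norm (fst z) < exp (snd z)} (z,t) \<partial>lborel) \<partial>lborel)"
    by (subst lborel_pair.Fubini') (auto intro!: nn_integral_cong simp: indicator_def dist_norm)
  also have "\<dots> = (\<integral>\<^sup>+z. f z \<partial>lborel)"
  proof (rule nn_integral_cong_AE)
    have "AE y in lborel. y \<noteq> (0::'a)" by (rule AE_lborel_singleton)
    then show "AE z in lborel. (\<integral>\<^sup>+t. ennreal (?n * exp (- (?n * t)) * norm z ^ DIM('a)) * f z * indicator {z. norm (fst z) < exp (snd z)} (z,t) \<partial>lborel) = f z"
    proof eventually_elim
      case (elim z)
      then have nz: "norm z > 0" by simp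
      have "(\<integral>\<^sup>+t. ennreal (?n * exp (- (?n * t)) * norm z ^ DIM('a)) * f z * indicator {z. norm (fst z) < exp (snd z)} (z,t) \<partial>lborel)
        = (\<integral>\<^sup>+t. (ennreal (norm z ^ DIM('a)) * f z) * (ennreal (?n * exp (- (?n * t))) * indicator {ln (norm z)..} t) \<partial>lborel)"
      proof (rule nn_integral_cong_AE)
        have "AE t in lborel. t \<noteq> ln (norm z)" by (rule AE_lborel_singleton)
        then show "AE t in lborel. ennreal (?n * exp (- (?n * t)) * norm z ^ DIM('a)) * f z * indicator {z. norm (fst z) < exp (snd z)} (z,t)
         = (ennreal (norm z ^ DIM('a)) * f z) * (ennreal (?n * exp (- (?n * t))) * indicator {ln (norm z)..} t)"
        proof eventually_elim
          case (elim t)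
          have "norm z < exp t \<longleftrightarrow> ln (norm z) \<le> t" using nz elim
            by (metis exp_less_cancel_iff exp_ln less_le)
          then show ?case by (simp add: indicator_def ennreal_mult mult_ac)
        qed
      qed
      also have "\<dots> = (ennreal (norm z ^ DIM('a)) * f z) * ennreal (exp (- (?n * ln (norm z))))"
        by (subst nn_integral_cmult) (simp_all add: nn_integral_exp_tail)
      also have "\<dots> = f z * ennreal (norm z ^ DIM('a) * exp (- (?n * ln (norm z))))"
        by (simp add: ennreal_mult mult_ac)
      also have "norm z ^ DIM('a) * exp (- (?n * ln (norm z))) = 1"
        using nz by (simp add: exp_minus expn)
      finally show ?case by simp
    qed
  qed
  finally show ?thesis by (simp add: B_def)
qed

text \<open>Uniqueness of translation invariant measures, played out by Tonelli against the unit ball.\<close>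

lemma distr_lborel_isometry:
  fixes R :: "'a::euclidean_space \<Rightarrow> 'a"
  assumes lin: "linear R" and nrm: "\<And>x. norm (R x) = norm x" and inv: "\<And>x. R (R x) = x"
  shows "distr lborel borel R = lborel"
proof -
  have cont: "continuous_on UNIV R"
    using lin linear_continuous_on linear_conv_bounded_linear by blast
  have [measurable]: "R \<in> borel_measurable borel"
    by (rule borel_measurable_continuous_onI) (rule cont)
  define B where "B = ball (0::'a) 1"
  have [measurable]: "B \<in> sets borel" by (simp add: B_def)
  have tr: "(\<integral>\<^sup>+y. f y \<partial>lborel) = (\<integral>\<^sup>+y. f (c + y) \<partial>lborel)" if [measurable]: "f \<in> borel_measurable borel" for f and c :: 'a
  proof -
    have "(\<integral>\<^sup>+y. f y \<partial>lborel) = (\<integral>\<^sup>+y. f y \<partial>(distr lborel borel ((+) c)))" by (simp only: lborel_distr_plus)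
    also have "\<dots> = (\<integral>\<^sup>+y. f (c + y) \<partial>lborel)" by (subst nn_integral_distr) simp_all
    finally show ?thesis .
  qed
  have ref: "(\<integral>\<^sup>+y. f y \<partial>lborel) = (\<integral>\<^sup>+y. f (- y) \<partial>lborel)" if [measurable]: "f \<in> borel_measurable borel" for f :: "'a \<Rightarrow> ennreal"
  proof -
    have "(\<integral>\<^sup>+y. f y \<partial>lborel) = (\<integral>\<^sup>+y. f y \<partial>density (distr lborel borel (\<lambda>x::'a. 0 + (-1) *\<^sub>R x)) (\<lambda>_. ennreal (\<bar>-1\<bar>^DIM('a))))"
      using lborel_affine[of "-1" "0::'a"] by simp
    also have "\<dots> = (\<integral>\<^sup>+y. f (- y) \<partial>lborel)"
      by (simp add: nn_integral_density nn_integral_distr)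
    finally show ?thesis .
  qed
  have Radd: "R (x + y) = R x + R y" for x y using lin by (simp add: linear_add)
  have RB: "indicator B (R y) = (indicator B y :: ennreal)" for y
    by (simp add: indicator_def B_def nrm)
  have mB: "emeasure lborel B \<noteq> 0" "emeasure lborel B \<noteq> \<infinity>"
    using content_ball_pos[of 1 "0::'a"] emeasure_lborel_ball_finite[of "0::'a" 1]
    by (auto simp: B_def measure_def)
  show ?thesis
  proof (rule measure_eqI)
    fix A assume "A \<in> sets (distr lborel borel R)"
    then have [measurable]: "A \<in> sets borel" by simp
    \<comment> \<open>Only translations, the reflection through the origin and the invariance of
      \<open>B\<close> under \<open>R\<close> enter. The argument of \<open>A\<close> is moved to
      \<open>R y - z\<close>, after which a shift of \<open>y\<close> by \<open>R z\<close> removes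
      \<open>z\<close>; the finite positive measure of \<open>B\<close> is cancelled at the
      end.\<close>
    have "emeasure lborel A * emeasure lborel B = (\<integral>\<^sup>+x. (\<integral>\<^sup>+y. indicator A x * indicator B y \<partial>lborel) \<partial>lborel)"
      by (simp add: nn_integral_cmult nn_integral_multc)
    also have "\<dots> = (\<integral>\<^sup>+x. (\<integral>\<^sup>+y. indicator A x * indicator B (R y - x) \<partial>lborel) \<partial>lborel)"
    proof (rule nn_integral_cong)
      fix x
      have "(\<integral>\<^sup>+y. indicator A x * indicator B (R y - x) \<partial>lborel) = (\<integral>\<^sup>+y. indicator A x * indicator B (R (R x + y) - x) \<partial>lborel)"
        by (rule tr) simp
      also have "\<dots> = (\<integral>\<^sup>+y. indicator A x * indicator B y \<partial>lborel)"
        by (simp add: Radd inv RB)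
      finally show "(\<integral>\<^sup>+y. indicator A x * indicator B y \<partial>lborel) = (\<integral>\<^sup>+y. indicator A x * indicator B (R y - x) \<partial>lborel)" by simp
    qed
    also have "\<dots> = (\<integral>\<^sup>+y. (\<integral>\<^sup>+x. indicator A x * indicator B (R y - x) \<partial>lborel) \<partial>lborel)"
      by (rule lborel_pair.Fubini') measurable
    also have "\<dots> = (\<integral>\<^sup>+y. (\<integral>\<^sup>+z. indicator A (R y - z) * indicator B z \<partial>lborel) \<partial>lborel)"
    proof (rule nn_integral_cong)
      fix y
      have "(\<integral>\<^sup>+x. indicator A x * indicator B (R y - x) \<partial>lborel) = (\<integral>\<^sup>+x. indicator A (R y + x) * indicator B (R y - (R y + x)) \<partial>lborel)"
        by (rule tr) simp
      also have "\<dots> = (\<integral>\<^sup>+x. indicator A (R y + - x) * indicator B (R y - (R y + - x)) \<partial>lborel)"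
        by (rule ref) simp
      finally show "(\<integral>\<^sup>+x. indicator A x * indicator B (R y - x) \<partial>lborel) = (\<integral>\<^sup>+z. indicator A (R y - z) * indicator B z \<partial>lborel)" by simp
    qed
    also have "\<dots> = (\<integral>\<^sup>+z. (\<integral>\<^sup>+y. indicator A (R y - z) * indicator B z \<partial>lborel) \<partial>lborel)"
      by (rule lborel_pair.Fubini') measurable
    also have "\<dots> = (\<integral>\<^sup>+z. (\<integral>\<^sup>+y. indicator A (R y) * indicator B z \<partial>lborel) \<partial>lborel)"
    proof (rule nn_integral_cong)
      fix z
      have "(\<integral>\<^sup>+y. indicator A (R y - z) * indicator B z \<partial>lborel) = (\<integral>\<^sup>+y. indicator A (R (R z + y) - z) * indicator B z \<partial>lborel)"
        by (rule tr) simp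
      then show "(\<integral>\<^sup>+y. indicator A (R y - z) * indicator B z \<partial>lborel) = (\<integral>\<^sup>+y. indicator A (R y) * indicator B z \<partial>lborel)"
        by (simp add: Radd inv)
    qed
    also have "\<dots> = (\<integral>\<^sup>+y. indicator A (R y) \<partial>lborel) * emeasure lborel B"
      by (simp add: nn_integral_cmult nn_integral_multc)
    also have "(\<integral>\<^sup>+y. indicator A (R y) \<partial>lborel) = (\<integral>\<^sup>+y. indicator A y \<partial>distr lborel borel R)"
      by (rule nn_integral_distr[symmetric]) simp_all
    also have "\<dots> = emeasure (distr lborel borel R) A" by simp
    finally show "emeasure (distr lborel borel R) A = emeasure lborel A"
      using mB by (metis ennreal_mult_divide_eq infinity_ennreal_def)
  qed simp
qed

section \<open>Householder reflections and the comparison of potentials at two points\<close>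

definition hrefl :: "'a::euclidean_space \<Rightarrow> 'a \<Rightarrow> 'a" where
  "hrefl e v = v - (2 * (v \<bullet> e)) *\<^sub>R e"

lemma linear_hrefl: "linear (hrefl e)"
  by (rule linearI) (simp_all add: hrefl_def inner_add_left algebra_simps)

lemma hrefl_involution: "norm e = 1 \<Longrightarrow> hrefl e (hrefl e v) = v"
  by (simp add: hrefl_def inner_diff_left dot_square_norm algebra_simps)

lemma norm_hrefl:
  assumes "norm e = 1"
  shows "norm (hrefl e v) = norm v"
proof -
  have ee: "e \<bullet> e = 1" using assms by (simp add: dot_square_norm)
  have "hrefl e v \<bullet> hrefl e v = v \<bullet> v - (4 * (v \<bullet> e)) * (v \<bullet> e) + 4 * (v \<bullet> e) * (v \<bullet> e) * (e \<bullet> e)"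
    unfolding hrefl_def inner_diff_left inner_diff_right inner_scaleR_left inner_scaleR_right
    by (simp add: inner_commute[of e v] algebra_simps)
  then show ?thesis by (simp add: norm_eq ee)
qed

lemma nn_integral_hrefl:
  fixes f :: "'a::euclidean_space \<Rightarrow> ennreal"
  assumes [measurable]: "f \<in> borel_measurable borel" and e: "norm e = 1"
  shows "(\<integral>\<^sup>+y. f y \<partial>lborel) = (\<integral>\<^sup>+y. f (m + hrefl e y) \<partial>lborel)"
proof -
  have [measurable]: "hrefl e \<in> borel_measurable borel"
    unfolding hrefl_def by measurable
  have "(\<integral>\<^sup>+y. f y \<partial>lborel) = (\<integral>\<^sup>+y. f y \<partial>(distr lborel borel ((+) m)))" by (simp only: lborel_distr_plus)
  also have "\<dots> = (\<integral>\<^sup>+y. f (m + y) \<partial>lborel)" by (subst nn_integral_distr) simp_all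
  also have "\<dots> = (\<integral>\<^sup>+y. f (m + y) \<partial>(distr lborel borel (hrefl e)))"
    by (simp only: distr_lborel_isometry[OF linear_hrefl norm_hrefl[OF e] hrefl_involution[OF e]])
  also have "\<dots> = (\<integral>\<^sup>+y. f (m + hrefl e y) \<partial>lborel)" by (subst nn_integral_distr) simp_all
  finally show ?thesis .
qed

text \<open>The bisecting hyperplane of two points at equal distance from the origin passes through
  the origin. Reflections therefore act transitively on unit vectors and take the place of
  rotations.\<close>

lemma hrefl_swap:
  assumes "norm a = norm b" "a \<noteq> b"
  shows "hrefl (sgn (b - a)) a = b"
proof -
  have ab: "a \<bullet> a = b \<bullet> b" using assms(1) by (simp add: norm_eq)
  have n: "(norm (b - a))\<^sup>2 = 2 * (a \<bullet> a) - 2 * (a \<bullet> b)"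
    by (simp add: power2_norm_eq_inner inner_diff_left inner_diff_right ab inner_commute)
  have nz: "norm (b - a) \<noteq> 0" using assms by simp
  have i: "a \<bullet> (b - a) = - (norm (b - a))\<^sup>2 / 2"
    by (simp add: n inner_diff_right)
  have "hrefl (sgn (b - a)) a = a - (2 * (a \<bullet> (b - a)) / (norm (b - a))\<^sup>2) *\<^sub>R (b - a)"
    by (simp add: hrefl_def sgn_div_norm power2_eq_square divide_inverse)
  also have "\<dots> = a - (-1) *\<^sub>R (b - a)" using nz by (simp add: i)
  finally show ?thesis by simp
qed

lemma ennreal_rearrange:
  fixes a b c d :: ennreal
  assumes "b \<le> a" "d \<le> c"
  shows "a * d + b * c \<le> a * c + b * d"
proof -
  obtain e where e: "c = d + e" using assms(2) le_iff_add by blast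
  have "a * d + b * c = a * d + b * d + b * e" by (simp add: e distrib_left add_ac)
  also have "\<dots> \<le> a * d + b * d + a * e" using assms(1) by (intro add_left_mono mult_right_mono) auto
  also have "\<dots> = a * c + b * d" by (simp add: e distrib_left add_ac)
  finally show ?thesis .
qed

text \<open>Pairing \<open>y\<close> with its mirror image in the bisector of \<open>x\<close> and \<open>x'\<close> reduces the
  comparison to a two-term rearrangement inequality.\<close>

lemma potential_radially_decreasing:
  fixes \<phi> G :: "'a::euclidean_space \<Rightarrow> ennreal"
  assumes [measurable]: "\<phi> \<in> borel_measurable borel" "G \<in> borel_measurable borel"
    and \<phi>: "\<And>y z. y \<noteq> 0 \<Longrightarrow> norm y \<le> norm z \<Longrightarrow> \<phi> z \<le> \<phi> y"
    and G: "\<And>y z. y \<noteq> 0 \<Longrightarrow> norm y \<le> norm z \<Longrightarrow> G z \<le> G y"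
    and xx: "norm x \<le> norm x'"
  shows "(\<integral>\<^sup>+y. \<phi> y * G (x' - y) \<partial>lborel) \<le> (\<integral>\<^sup>+y. \<phi> y * G (x - y) \<partial>lborel)"
proof (cases "x = x'")
  case False
  define e where "e = sgn (x' - x)"
  define m where "m = (1/2) *\<^sub>R (x + x')"
  \<comment> \<open>The affine reflection in the bisecting hyperplane of \<open>x\<close> and
    \<open>x'\<close>. Below, \<open>d\<close> is the signed distance to this hyperplane, negative
    at \<open>x\<close>.\<close>
  define r where "r y = (m - hrefl e m) + hrefl e y" for y
  define d where "d y = (y - m) \<bullet> e" for y
  have ne: "norm e = 1" using False by (simp add: e_def norm_sgn)
  have ee: "e \<bullet> e = 1" using ne by (simp add: dot_square_norm)
  have r: "r y = y - (2 * d y) *\<^sub>R e" for y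
    by (simp add: r_def hrefl_def d_def inner_diff_left algebra_simps)
  have rr: "r (r y) = y" for y
    by (simp add: r d_def inner_diff_left ee algebra_simps)
  have rdist: "norm (r y - r z) = norm (y - z)" for y z
  proof -
    have "r y - r z = hrefl e (y - z)" by (simp add: r_def linear_diff[OF linear_hrefl])
    then show ?thesis using norm_hrefl[OF ne] by simp
  qed
  have dx: "d x = - norm (x' - x) / 2"
  proof -
    have "x - m = (- 1/2) *\<^sub>R (x' - x)" by (simp add: m_def algebra_simps flip: scaleR_add_left)
    then have "d x = (- 1/2) * ((x' - x) \<bullet> e)" by (simp add: d_def)
    also have "(x' - x) \<bullet> e = norm (x' - x)"
      using False by (simp add: e_def sgn_div_norm dot_square_norm power2_eq_square)
    finally show ?thesis by simp
  qed
  have rx: "r x = x'" using False by (simp add: r dx e_def sgn_div_norm)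
  have rx': "r x' = x" using rr rx by metis
  \<comment> \<open>Since \<open>norm x \<le> norm x'\<close>, the origin lies on the side of
    \<open>x\<close> or on the hyperplane. This is why reflecting a point away from that side cannot
    decrease its norm.\<close>
  have me: "m \<bullet> e \<ge> 0"
  proof -
    have "(x + x') \<bullet> (x' - x) = (norm x')\<^sup>2 - (norm x)\<^sup>2"
      by (simp add: power2_norm_eq_inner inner_diff_right inner_add_left inner_commute[of x' x])
    also have "\<dots> \<ge> 0" using xx by simp
    finally have *: "(x + x') \<bullet> (x' - x) \<ge> 0" .
    have "m \<bullet> e = ((x + x') \<bullet> (x' - x)) / (2 * norm (x' - x))"
      by (simp add: m_def e_def sgn_div_norm divide_simps)
    then show ?thesis using * by simp
  qed
  have nr: "norm y \<le> norm (r y)" if "d y \<le> 0" for y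
  proof -
    have "(norm (r y))\<^sup>2 = (norm y)\<^sup>2 - 4 * d y * (m \<bullet> e)"
      unfolding power2_norm_eq_inner r
      by (simp add: inner_diff_left inner_diff_right ee inner_commute[of e y] d_def algebra_simps)
    moreover have "d y * (m \<bullet> e) \<le> 0" using that me by (simp add: mult_nonpos_nonneg)
    ultimately have "(norm y)\<^sup>2 \<le> (norm (r y))\<^sup>2" by simp
    then show ?thesis by (rule power2_le_imp_le) simp
  qed
  have nxy: "norm (x - y) \<le> norm (x' - y)" if "d y \<le> 0" for y
  proof -
    have "(norm (x' - y))\<^sup>2 = (norm (x - y))\<^sup>2 + 4 * (d x * d y)"
      unfolding power2_norm_eq_inner rx[symmetric] r
      by (simp add: inner_diff_left inner_diff_right ee inner_commute[of e x] inner_commute[of e y] inner_commute[of y x] d_def algebra_simps)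
    moreover have "d x * d y \<ge> 0" using that by (simp add: dx mult_nonneg_nonpos)
    ultimately have "(norm (x - y))\<^sup>2 \<le> (norm (x' - y))\<^sup>2" by simp
    then show ?thesis by (rule power2_le_imp_le) simp
  qed
  have dr: "d (r y) = - d y" for y
    by (simp add: r d_def inner_diff_left ee algebra_simps)
  have Geq: "G y = G z" if "norm y = norm z" "y \<noteq> 0" for y z
    using that by (intro antisym G) auto
  have main: "\<phi> y * G (x' - y) + \<phi> (r y) * G (x' - r y) \<le> \<phi> y * G (x - y) + \<phi> (r y) * G (x - r y)"
    if "y \<noteq> 0" "y \<noteq> x" "y \<noteq> x'" "d y \<le> 0" for y
  proof -
    have 1: "norm (x' - r y) = norm (x - y)" using rdist[of x y] rx by simp
    have 2: "norm (x - r y) = norm (x' - y)" using rdist[of x' y] rx' by simp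
    have "G (x' - r y) = G (x - y)" "G (x - r y) = G (x' - y)"
      using that Geq[OF 1[symmetric]] Geq[OF 2[symmetric]] by simp_all
    moreover have "\<phi> (r y) \<le> \<phi> y" "G (x' - y) \<le> G (x - y)"
      using that nr[of y] nxy[of y] \<phi>[of y "r y"] G[of "x - y" "x' - y"] by simp_all
    ultimately show ?thesis using ennreal_rearrange by simp
  qed
  \<comment> \<open>Symmetrisation: after this step the integrands can be compared for each mirror
    pair, although neither term of a pair need be comparable alone.\<close>
  have tw: "2 * (\<integral>\<^sup>+y. F y \<partial>lborel) = (\<integral>\<^sup>+y. F y + F (r y) \<partial>lborel)"
    if [measurable]: "F \<in> borel_measurable borel" for F :: "'a \<Rightarrow> ennreal"
  proof -
    have [measurable]: "r \<in> borel_measurable borel" unfolding r_def hrefl_def by measurable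
    have "(\<integral>\<^sup>+y. F y + F (r y) \<partial>lborel) = (\<integral>\<^sup>+y. F y \<partial>lborel) + (\<integral>\<^sup>+y. F (r y) \<partial>lborel)"
      by (rule nn_integral_add) measurable
    also have "(\<integral>\<^sup>+y. F (r y) \<partial>lborel) = (\<integral>\<^sup>+y. F y \<partial>lborel)"
      unfolding r_def by (rule nn_integral_hrefl[symmetric]) (simp_all add: ne)
    finally show ?thesis by (simp add: mult_2)
  qed
  have "2 * (\<integral>\<^sup>+y. \<phi> y * G (x' - y) \<partial>lborel) = (\<integral>\<^sup>+y. \<phi> y * G (x' - y) + \<phi> (r y) * G (x' - r y) \<partial>lborel)"
    by (rule tw) measurable
  also have "\<dots> \<le> (\<integral>\<^sup>+y. \<phi> y * G (x - y) + \<phi> (r y) * G (x - r y) \<partial>lborel)"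
  proof (rule nn_integral_mono_AE)
    \<comment> \<open>Monotonicity of \<open>\<phi>\<close> and \<open>G\<close> says nothing about
      their values at the origin, so the points where an argument of \<open>\<phi>\<close> or
      \<open>G\<close> vanishes, for \<open>y\<close> or for its mirror image, are removed.\<close>
    have "AE y in lborel. y \<noteq> 0 \<and> y \<noteq> x \<and> y \<noteq> x' \<and> y \<noteq> r 0"
      by (intro AE_conjI AE_lborel_singleton)
    then show "AE y in lborel. \<phi> y * G (x' - y) + \<phi> (r y) * G (x' - r y) \<le> \<phi> y * G (x - y) + \<phi> (r y) * G (x - r y)"
    proof eventually_elim
      case (elim y)
      show ?case
      proof (cases "d y \<le> 0")
        case True
        then show ?thesis using main elim by blast
      next
        case False
        have "r y \<noteq> 0" "r y \<noteq> x" "r y \<noteq> x'" "d (r y) \<le> 0"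
          using elim False rr rx rx' dr by (metis, metis, metis, simp add: dr)
        from main[OF this] show ?thesis by (simp add: rr add.commute)
      qed
    qed
  qed
  also have "\<dots> = 2 * (\<integral>\<^sup>+y. \<phi> y * G (x - y) \<partial>lborel)"
    by (rule tw[symmetric]) measurable
  finally show ?thesis by (simp add: ennreal_mult_le_mult_iff)
qed simp

section \<open>The radial kernel\<close>

lemma AE_lborel_nonzero: "AE y in lborel. y \<noteq> (0::'a::euclidean_space)"
  by (rule AE_lborel_singleton)

lemma nn_integral_radial:
  fixes W :: "real \<Rightarrow> ennreal"
  assumes [measurable]: "W \<in> borel_measurable borel"
  shows "(\<integral>\<^sup>+y. W (ln (norm (y::'a::euclidean_space))) \<partial>lborel) =
    ennreal (DIM('a)) * emeasure lborel (ball (0::'a) 1) * (\<integral>\<^sup>+\<sigma>. ennreal (exp (DIM('a) * \<sigma>)) * W \<sigma> \<partial>lborel)"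
proof -
  have [measurable]: "ball (0::'a) r \<in> sets borel" for r by simp
  have "(\<integral>\<^sup>+y. W (ln (norm (y::'a))) \<partial>lborel) = 
    (\<integral>\<^sup>+\<sigma>. (\<integral>\<^sup>+y. ennreal (DIM('a) * exp (DIM('a) * \<sigma>)) * W (ln (norm (exp \<sigma> *\<^sub>R sgn (y::'a)))) * indicator (ball 0 1) y \<partial>lborel) \<partial>lborel)"
    by (rule nn_integral_polar) simp
  also have "\<dots> = (\<integral>\<^sup>+\<sigma>. (ennreal (DIM('a)) * emeasure lborel (ball (0::'a) 1)) * (ennreal (exp (DIM('a) * \<sigma>)) * W \<sigma>) \<partial>lborel)"
  proof (rule nn_integral_cong)
    fix \<sigma> :: real
    have "(\<integral>\<^sup>+y. ennreal (DIM('a) * exp (DIM('a) * \<sigma>)) * W (ln (norm (exp \<sigma> *\<^sub>R sgn (y::'a)))) * indicator (ball 0 1) y \<partial>lborel)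
      = (\<integral>\<^sup>+y. (ennreal (DIM('a) * exp (DIM('a) * \<sigma>)) * W \<sigma>) * indicator (ball (0::'a) 1) y \<partial>lborel)"
      by (intro nn_integral_cong_AE eventually_mono[OF AE_lborel_nonzero]) (auto simp: norm_sgn)
    also have "\<dots> = (ennreal (DIM('a)) * emeasure lborel (ball (0::'a) 1)) * (ennreal (exp (DIM('a) * \<sigma>)) * W \<sigma>)"
      by (subst nn_integral_cmult_indicator) (simp_all add: ennreal_mult mult_ac)
    finally show "(\<integral>\<^sup>+y. ennreal (DIM('a) * exp (DIM('a) * \<sigma>)) * W (ln (norm (exp \<sigma> *\<^sub>R sgn (y::'a)))) * indicator (ball 0 1) y \<partial>lborel)
       = (ennreal (DIM('a)) * emeasure lborel (ball (0::'a) 1)) * (ennreal (exp (DIM('a) * \<sigma>)) * W \<sigma>)" .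
  qed
  also have "\<dots> = ennreal (DIM('a)) * emeasure lborel (ball (0::'a) 1) * (\<integral>\<^sup>+\<sigma>. ennreal (exp (DIM('a) * \<sigma>)) * W \<sigma> \<partial>lborel)"
    by (rule nn_integral_cmult) simp
  finally show ?thesis .
qed

lemma nn_integral_exp_head:
  fixes m :: real assumes "m > 0"
  shows "(\<integral>\<^sup>+t. ennreal (exp (m * t)) * indicator {..a} t \<partial>lborel) < \<infinity>"
    and "(\<integral>\<^sup>+t. ennreal (exp (- (m * t))) * indicator {a..} t \<partial>lborel) < \<infinity>"
proof -
  have t: "(\<integral>\<^sup>+t. ennreal (exp (- (m * t))) * indicator {a..} t \<partial>lborel) < \<infinity>" for a
  proof -
    have "(\<integral>\<^sup>+t. ennreal (exp (- (m * t))) * indicator {a..} t \<partial>lborel) =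
      (\<integral>\<^sup>+t. ennreal (1/m) * (ennreal (m * exp (- (m * t))) * indicator {a..} t) \<partial>lborel)"
      using assms by (intro nn_integral_cong) (simp add: mult.assoc[symmetric] ennreal_mult[symmetric])
    also have "\<dots> = ennreal (1/m) * ennreal (exp (- (m * a)))"
      using assms by (subst nn_integral_cmult) (simp_all add: nn_integral_exp_tail)
    finally show ?thesis using assms by (simp add: ennreal_mult_less_top)
  qed
  show "(\<integral>\<^sup>+t. ennreal (exp (- (m * t))) * indicator {a..} t \<partial>lborel) < \<infinity>" by (rule t)
  have "(\<integral>\<^sup>+t. ennreal (exp (m * t)) * indicator {..a} t \<partial>lborel) =
    ennreal \<bar>-1\<bar> * (\<integral>\<^sup>+t. ennreal (exp (m * (0 + -1 * t))) * indicator {..a} (0 + -1 * t) \<partial>lborel)"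
    by (rule nn_integral_real_affine) simp_all
  also have "\<dots> = (\<integral>\<^sup>+t. ennreal (exp (- (m * t))) * indicator {-a..} t \<partial>lborel)"
    by (auto intro!: nn_integral_cong simp: indicator_def)
  finally show "(\<integral>\<^sup>+t. ennreal (exp (m * t)) * indicator {..a} t \<partial>lborel) < \<infinity>" using t by simp
qed

lemma nn_integral_norm_powr_ball:
  fixes p r :: real
  assumes "p > 0" "r > 0"
  shows "(\<integral>\<^sup>+y. ennreal (norm y powr (p - DIM('a))) * indicator {y. norm y \<le> r} (y::'a::euclidean_space) \<partial>lborel) < \<infinity>"
proof -
  have "(\<integral>\<^sup>+y. ennreal (norm y powr (p - DIM('a))) * indicator {y. norm y \<le> r} (y::'a) \<partial>lborel) =
    (\<integral>\<^sup>+y. ennreal (exp ((p - DIM('a)) * ln (norm (y::'a)))) * indicator {..ln r} (ln (norm y)) \<partial>lborel)"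
    using assms by (intro nn_integral_cong_AE eventually_mono[OF AE_lborel_nonzero]) (auto simp: indicator_def powr_def)
  also have "\<dots> = ennreal (DIM('a)) * emeasure lborel (ball (0::'a) 1) * (\<integral>\<^sup>+\<sigma>. ennreal (exp (DIM('a) * \<sigma>)) * (ennreal (exp ((p - DIM('a)) * \<sigma>)) * indicator {..ln r} \<sigma>) \<partial>lborel)"
    by (rule nn_integral_radial) simp
  also have "(\<integral>\<^sup>+\<sigma>. ennreal (exp (DIM('a) * \<sigma>)) * (ennreal (exp ((p - DIM('a)) * \<sigma>)) * indicator {..ln r} \<sigma>) \<partial>lborel)
     = (\<integral>\<^sup>+\<sigma>. ennreal (exp (p * \<sigma>)) * indicator {..ln r} \<sigma> \<partial>lborel)"
    by (intro nn_integral_cong) (auto simp: indicator_def ennreal_mult[symmetric] exp_add[symmetric] algebra_simps)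
  finally show ?thesis
    using nn_integral_exp_head(1)[OF assms(1), of "ln r"] emeasure_lborel_ball_finite[of "0::'a" 1]
    by (simp add: ennreal_mult_less_top)
qed

lemma nn_integral_norm_powr_cocompl:
  fixes p r :: real
  assumes "p > 0" "r > 0"
  shows "(\<integral>\<^sup>+y. ennreal (norm y powr (- p - DIM('a))) * indicator {y. r \<le> norm y} (y::'a::euclidean_space) \<partial>lborel) < \<infinity>"
proof -
  have "(\<integral>\<^sup>+y. ennreal (norm y powr (- p - DIM('a))) * indicator {y. r \<le> norm y} (y::'a) \<partial>lborel) =
    (\<integral>\<^sup>+y. ennreal (exp ((- p - DIM('a)) * ln (norm (y::'a)))) * indicator {ln r..} (ln (norm y)) \<partial>lborel)"
    using assms by (intro nn_integral_cong_AE eventually_mono[OF AE_lborel_nonzero]) (auto simp: indicator_def powr_def)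
  also have "\<dots> = ennreal (DIM('a)) * emeasure lborel (ball (0::'a) 1) * (\<integral>\<^sup>+\<sigma>. ennreal (exp (DIM('a) * \<sigma>)) * (ennreal (exp ((- p - DIM('a)) * \<sigma>)) * indicator {ln r..} \<sigma>) \<partial>lborel)"
    by (rule nn_integral_radial) simp
  also have "(\<integral>\<^sup>+\<sigma>. ennreal (exp (DIM('a) * \<sigma>)) * (ennreal (exp ((- p - DIM('a)) * \<sigma>)) * indicator {ln r..} \<sigma>) \<partial>lborel)
     = (\<integral>\<^sup>+\<sigma>. ennreal (exp (- (p * \<sigma>))) * indicator {ln r..} \<sigma> \<partial>lborel)"
    by (intro nn_integral_cong) (auto simp: indicator_def ennreal_mult[symmetric] exp_add[symmetric] algebra_simps)
  finally show ?thesis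
    using nn_integral_exp_head(2)[OF assms(1), of "ln r"] emeasure_lborel_ball_finite[of "0::'a" 1]
    by (simp add: ennreal_mult_less_top)
qed

text \<open>The singularity at the origin has order \<open>c - n > - n\<close>, the one at
  \<open>\<theta>\<close> has order \<open>- s > - n\<close>, and at infinity the total order
  \<open>c - s - n\<close> is below \<open>- n\<close>. The functions \<open>f1\<close>,
  \<open>f2\<close>, \<open>f3\<close> dominate the integrand in these three regions.\<close>

lemma nn_integral_two_point_singularity:
  fixes \<theta> :: "'a::euclidean_space" and c s :: real
  assumes \<theta>: "norm \<theta> = 1" and c: "0 < c" "c < s" "s < DIM('a)"
  shows "(\<integral>\<^sup>+y. ennreal (norm y powr (c - DIM('a)) * norm (\<theta> - y) powr (- s)) \<partial>lborel) < \<infinity>"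
proof -
  let ?n = "real DIM('a)"
  define f1 where "f1 y = ennreal (2 powr s) * (ennreal (norm y powr (c - ?n)) * indicator {y. norm y \<le> 1/2} y)" for y :: 'a
  define f2 where "f2 y = ennreal (2 powr (?n - c)) * (ennreal (norm y powr ((?n - s) - ?n)) * indicator {y. norm y \<le> 1/2} y)" for y :: 'a
  define f3 where "f3 y = ennreal (4 powr s) * (ennreal (norm y powr (- (s - c) - ?n)) * indicator {y. 1/2 \<le> norm y} y)" for y :: 'a
  have ptw: "ennreal (norm y powr (c - ?n) * norm (\<theta> - y) powr (- s)) \<le> f1 y + f2 (y - \<theta>) + f3 y" for y
  proof -
    have tri: "norm y + norm (\<theta> - y) \<ge> 1" using norm_triangle_ineq[of y "\<theta> - y"] \<theta> by simp
    have tri2: "norm (\<theta> - y) \<ge> norm y - 1" using norm_triangle_ineq[of \<theta> "y - \<theta>"] \<theta> by (simp add: norm_minus_commute)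
    consider "norm y \<le> 1/2" | "norm (\<theta> - y) \<le> 1/2" "norm y > 1/2" | "norm y > 1/2" "norm (\<theta> - y) > 1/2" by linarith
    then show ?thesis
    proof cases
      case 1
      have "norm (\<theta> - y) powr (- s) \<le> (1/2) powr (- s)"
        using 1 tri c by (intro powr_mono2') auto
      also have "(1/2::real) powr (- s) = 2 powr s" by (simp add: powr_minus_divide powr_divide)
      finally have "ennreal (norm y powr (c - ?n) * norm (\<theta> - y) powr (- s)) \<le> ennreal (2 powr s * norm y powr (c - ?n))"
        by (intro ennreal_leI) (simp add: mult.commute mult_right_mono)
      also have "\<dots> = f1 y" using 1 by (simp add: f1_def ennreal_mult)
      finally show ?thesis by (simp add: add.assoc add_increasing2)
    next
      case 2
      have "norm y powr (c - ?n) \<le> (1/2) powr (c - ?n)"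
        using 2 c by (intro powr_mono2') auto
      also have "(1/2::real) powr (c - ?n) = 2 powr (?n - c)"
        using powr_minus_divide[of "1/2::real" "?n - c"] by (simp add: powr_divide)
      finally have "ennreal (norm y powr (c - ?n) * norm (\<theta> - y) powr (- s)) \<le> ennreal (2 powr (?n - c) * norm (y - \<theta>) powr (- s))"
        by (intro ennreal_leI) (simp add: mult_right_mono norm_minus_commute)
      also have "\<dots> = f2 (y - \<theta>)" using 2 by (simp add: f2_def ennreal_mult norm_minus_commute)
      finally show ?thesis by (simp add: add_increasing add_increasing2)
    next
      case 3
      \<comment> \<open>For \<open>norm y \<le> 2\<close> the left side exceeds \<open>1/2\<close>;
        beyond that it is at least \<open>norm y - 1\<close>.\<close>
      have "norm (\<theta> - y) \<ge> norm y / 4" using 3 tri2 by linarith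
      then have "norm (\<theta> - y) powr (- s) \<le> (norm y / 4) powr (- s)"
        using 3 c by (intro powr_mono2') auto
      also have "\<dots> = 4 powr s * norm y powr (- s)" by (simp add: powr_divide powr_minus_divide)
      finally have "norm y powr (c - ?n) * norm (\<theta> - y) powr (- s) \<le> norm y powr (c - ?n) * (4 powr s * norm y powr (- s))"
        by (intro mult_left_mono) auto
      also have "\<dots> = 4 powr s * norm y powr (- (s - c) - ?n)"
        by (simp add: powr_add[symmetric] algebra_simps)
      finally have "ennreal (norm y powr (c - ?n) * norm (\<theta> - y) powr (- s)) \<le> ennreal (4 powr s * norm y powr (- (s - c) - ?n))"
        by (rule ennreal_leI)
      also have "\<dots> = f3 y" using 3 by (simp add: f3_def ennreal_mult)
      finally show ?thesis by (simp add: add_increasing)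
    qed
  qed
  have [measurable]: "f1 \<in> borel_measurable borel" "f2 \<in> borel_measurable borel" "f3 \<in> borel_measurable borel"
    unfolding f1_def[abs_def] f2_def[abs_def] f3_def[abs_def] by measurable
  have m1: "(\<integral>\<^sup>+y. f1 y \<partial>lborel) < \<infinity>" 
    unfolding f1_def using nn_integral_norm_powr_ball[of c "1/2", where 'a='a] c
    by (subst nn_integral_cmult) (auto simp: ennreal_mult_less_top)
  have m2: "(\<integral>\<^sup>+y. f2 y \<partial>lborel) < \<infinity>"
    unfolding f2_def using nn_integral_norm_powr_ball[of "?n - s" "1/2", where 'a='a] c
    by (subst nn_integral_cmult) (auto simp: ennreal_mult_less_top)
  have m3: "(\<integral>\<^sup>+y. f3 y \<partial>lborel) < \<infinity>"
    unfolding f3_def using nn_integral_norm_powr_cocompl[of "s - c" "1/2", where 'a='a] c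
    by (subst nn_integral_cmult) (auto simp: ennreal_mult_less_top)
  have "(\<integral>\<^sup>+y. f2 y \<partial>lborel) = (\<integral>\<^sup>+y. f2 y \<partial>(distr lborel borel ((+) (- \<theta>))))" by (simp only: lborel_distr_plus)
  also have "\<dots> = (\<integral>\<^sup>+y. f2 (y - \<theta>) \<partial>lborel)" by (subst nn_integral_distr) simp_all
  finally have m2': "(\<integral>\<^sup>+y. f2 (y - \<theta>) \<partial>lborel) < \<infinity>" using m2 by simp
  have "(\<integral>\<^sup>+y. ennreal (norm y powr (c - ?n) * norm (\<theta> - y) powr (- s)) \<partial>lborel) \<le> (\<integral>\<^sup>+y. f1 y + f2 (y - \<theta>) + f3 y \<partial>lborel)"
    by (rule nn_integral_mono) (rule ptw)
  also have "\<dots> = (\<integral>\<^sup>+y. f1 y \<partial>lborel) + (\<integral>\<^sup>+y. f2 (y - \<theta>) \<partial>lborel) + (\<integral>\<^sup>+y. f3 y \<partial>lborel)"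
    by (simp add: nn_integral_add)
  also have "\<dots> < \<infinity>" using m1 m2' m3 by simp
  finally show ?thesis .
qed

text \<open>The integral of
  \<open>norm (\<theta> - exp \<sigma> *\<^sub>R \<omega>) powr (- s)\<close> over unit vectors
  \<open>\<omega>\<close>, with the sphere encoded by the unit ball as in
  \<open>nn_integral_polar\<close>. It takes values in \<open>ennreal\<close> because it may diverge
  at \<open>\<sigma> = 0\<close>.\<close>

definition sphere_pot :: "real \<Rightarrow> 'a::euclidean_space \<Rightarrow> real \<Rightarrow> ennreal" where
  "sphere_pot s \<theta> \<sigma> = (\<integral>\<^sup>+y. ennreal (DIM('a) * norm (\<theta> - exp \<sigma> *\<^sub>R sgn y) powr (- s)) * indicator (ball 0 1) y \<partial>lborel)"

lemma borel_measurable_sphere_pot [measurable]: "sphere_pot s \<theta> \<in> borel_measurable borel"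
proof -
  have [measurable]: "ball (0::'a) r \<in> sets borel" for r by simp
  show ?thesis unfolding sphere_pot_def[abs_def] by measurable
qed

lemma sphere_pot_unit_vector_indep:
  fixes \<theta> \<theta>' :: "'a::euclidean_space"
  assumes "norm \<theta> = 1" "norm \<theta>' = 1"
  shows "sphere_pot s \<theta> \<sigma> = sphere_pot s \<theta>' \<sigma>"
proof (cases "\<theta> = \<theta>'")
  case False
  have [measurable]: "ball (0::'a) r \<in> sets borel" for r by simp
  define e where "e = sgn (\<theta>' - \<theta>)"
  have ne: "norm e = 1" using False by (simp add: e_def norm_sgn)
  have sw: "hrefl e \<theta> = \<theta>'" using False assms by (simp add: e_def hrefl_swap)
  have sg: "sgn (hrefl e y) = hrefl e (sgn y)" for y
    by (simp add: sgn_div_norm norm_hrefl[OF ne] linear_cmul[OF linear_hrefl])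
  have "sphere_pot s \<theta>' \<sigma> = (\<integral>\<^sup>+y. ennreal (DIM('a) * norm (\<theta>' - exp \<sigma> *\<^sub>R sgn (0 + hrefl e y)) powr (- s)) * indicator (ball 0 1) (0 + hrefl e y) \<partial>lborel)"
    unfolding sphere_pot_def by (rule nn_integral_hrefl) (simp_all add: ne)
  also have "\<dots> = sphere_pot s \<theta> \<sigma>"
    unfolding sphere_pot_def
  proof (rule nn_integral_cong)
    fix y :: 'a
    have "\<theta>' - exp \<sigma> *\<^sub>R hrefl e (sgn y) = hrefl e (\<theta> - exp \<sigma> *\<^sub>R sgn y)"
      by (simp add: linear_diff[OF linear_hrefl] linear_cmul[OF linear_hrefl] sw)
    then have "norm (\<theta>' - exp \<sigma> *\<^sub>R sgn (0 + hrefl e y)) = norm (\<theta> - exp \<sigma> *\<^sub>R sgn y)"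
      by (simp add: sg norm_hrefl[OF ne])
    then show "ennreal (DIM('a) * norm (\<theta>' - exp \<sigma> *\<^sub>R sgn (0 + hrefl e y)) powr (- s)) * indicator (ball 0 1) (0 + hrefl e y)
      = ennreal (DIM('a) * norm (\<theta> - exp \<sigma> *\<^sub>R sgn y) powr (- s)) * indicator (ball 0 1) y"
      by (simp add: indicator_def norm_hrefl[OF ne])
  qed
  finally show ?thesis by simp
qed simp

lemma nn_integral_radial_potential:
  fixes W :: "real \<Rightarrow> ennreal" and x \<theta> :: "'a::euclidean_space"
  assumes [measurable]: "W \<in> borel_measurable borel" and \<theta>: "norm \<theta> = 1" and x: "x \<noteq> 0"
  shows "(\<integral>\<^sup>+y. W (ln (norm y)) * ennreal (norm (x - y) powr (- s)) \<partial>lborel) =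
    (\<integral>\<^sup>+\<sigma>. ennreal (exp (DIM('a) * \<sigma>)) * W \<sigma> * ennreal (exp (- s * ln (norm x))) * sphere_pot s \<theta> (\<sigma> - ln (norm x)) \<partial>lborel)"
proof -
  have [measurable]: "ball (0::'a) r \<in> sets borel" for r by simp
  define t where "t = ln (norm x)"
  have xt: "x = exp t *\<^sub>R sgn x" using x by (simp add: t_def sgn_div_norm)
  have nt: "norm (sgn x) = 1" using x by (simp add: norm_sgn)
  have "(\<integral>\<^sup>+y. W (ln (norm y)) * ennreal (norm (x - y) powr (- s)) \<partial>lborel) =
    (\<integral>\<^sup>+\<sigma>. (\<integral>\<^sup>+y. ennreal (DIM('a) * exp (DIM('a) * \<sigma>)) * (W (ln (norm (exp \<sigma> *\<^sub>R sgn (y::'a)))) * ennreal (norm (x - exp \<sigma> *\<^sub>R sgn y) powr (- s))) * indicator (ball 0 1) y \<partial>lborel) \<partial>lborel)"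
    by (rule nn_integral_polar) simp
  also have "\<dots> = (\<integral>\<^sup>+\<sigma>. ennreal (exp (DIM('a) * \<sigma>)) * W \<sigma> * ennreal (exp (- s * t)) * sphere_pot s \<theta> (\<sigma> - t) \<partial>lborel)"
  proof (rule nn_integral_cong)
    fix \<sigma> :: real
    have "(\<integral>\<^sup>+y. ennreal (DIM('a) * exp (DIM('a) * \<sigma>)) * (W (ln (norm (exp \<sigma> *\<^sub>R sgn (y::'a)))) * ennreal (norm (x - exp \<sigma> *\<^sub>R sgn y) powr (- s))) * indicator (ball 0 1) y \<partial>lborel)
      = (\<integral>\<^sup>+y. (ennreal (exp (DIM('a) * \<sigma>)) * W \<sigma> * ennreal (exp (- s * t))) * (ennreal (DIM('a) * norm (sgn x - exp (\<sigma> - t) *\<^sub>R sgn y) powr (- s)) * indicator (ball 0 1) y) \<partial>lborel)"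
    proof (rule nn_integral_cong_AE)
      show "AE y in lborel. ennreal (DIM('a) * exp (DIM('a) * \<sigma>)) * (W (ln (norm (exp \<sigma> *\<^sub>R sgn (y::'a)))) * ennreal (norm (x - exp \<sigma> *\<^sub>R sgn y) powr (- s))) * indicator (ball 0 1) y
        = (ennreal (exp (DIM('a) * \<sigma>)) * W \<sigma> * ennreal (exp (- s * t))) * (ennreal (DIM('a) * norm (sgn x - exp (\<sigma> - t) *\<^sub>R sgn y) powr (- s)) * indicator (ball 0 1) y)"
        using AE_lborel_nonzero
      proof eventually_elim
        case (elim y)
        have "x - exp \<sigma> *\<^sub>R sgn y = exp t *\<^sub>R (sgn x - exp (\<sigma> - t) *\<^sub>R sgn y)"
          by (subst xt) (simp add: scaleR_diff_right exp_diff)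
        then have "norm (x - exp \<sigma> *\<^sub>R sgn y) = exp t * norm (sgn x - exp (\<sigma> - t) *\<^sub>R sgn y)" by simp
        then have "norm (x - exp \<sigma> *\<^sub>R sgn y) powr (- s) = exp (- s * t) * norm (sgn x - exp (\<sigma> - t) *\<^sub>R sgn y) powr (- s)"
          by (simp add: powr_mult exp_powr_real mult.commute)
        moreover have "ln (norm (exp \<sigma> *\<^sub>R sgn y)) = \<sigma>" using elim by (simp add: norm_sgn)
        ultimately show ?case by (simp add: ennreal_mult mult_ac)
      qed
    qed
    also have "\<dots> = (ennreal (exp (DIM('a) * \<sigma>)) * W \<sigma> * ennreal (exp (- s * t))) * sphere_pot s (sgn x) (\<sigma> - t)"
      unfolding sphere_pot_def by (rule nn_integral_cmult) simp
    finally show "(\<integral>\<^sup>+y. ennreal (DIM('a) * exp (DIM('a) * \<sigma>)) * (W (ln (norm (exp \<sigma> *\<^sub>R sgn (y::'a)))) * ennreal (norm (x - exp \<sigma> *\<^sub>R sgn y) powr (- s))) * indicator (ball 0 1) y \<partial>lborel) =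
      ennreal (exp (DIM('a) * \<sigma>)) * W \<sigma> * ennreal (exp (- s * t)) * sphere_pot s \<theta> (\<sigma> - t)"
      using sphere_pot_unit_vector_indep[OF nt \<theta>] by simp
  qed
  finally show ?thesis by (simp add: t_def)
qed

lemma norm_unit_diff_swap:
  fixes \<theta> \<omega> :: "'a::real_inner"
  assumes "norm \<theta> = 1" "norm \<omega> = 1"
  shows "norm (r *\<^sub>R \<theta> - \<omega>) = norm (\<theta> - r *\<^sub>R \<omega>)"
proof -
  have "\<theta> \<bullet> \<theta> = 1" "\<omega> \<bullet> \<omega> = 1" using assms by (simp_all add: dot_square_norm)
  then have "(r *\<^sub>R \<theta> - \<omega>) \<bullet> (r *\<^sub>R \<theta> - \<omega>) = (\<theta> - r *\<^sub>R \<omega>) \<bullet> (\<theta> - r *\<^sub>R \<omega>)"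
    unfolding inner_diff_left inner_diff_right inner_scaleR_left inner_scaleR_right
    by (simp add: inner_commute[of \<omega> \<theta>] algebra_simps)
  then show ?thesis by (simp add: norm_eq)
qed

text \<open>Inversion in the unit sphere: for unit vectors, multiplying either one by
  \<open>r\<close> gives the same distance to the other. This makes the adjoint of the radial kernel
  a kernel of the same family, with \<open>s - c\<close> in place of \<open>c\<close>.\<close>

lemma sphere_pot_minus:
  fixes \<theta> :: "'a::euclidean_space"
  assumes \<theta>: "norm \<theta> = 1"
  shows "sphere_pot s \<theta> (- \<tau>) = ennreal (exp (s * \<tau>)) * sphere_pot s \<theta> \<tau>"
proof -
  have [measurable]: "ball (0::'a) r \<in> sets borel" for r by simp
  have "sphere_pot s \<theta> (- \<tau>) = (\<integral>\<^sup>+y. ennreal (exp (s * \<tau>)) * (ennreal (DIM('a) * norm (\<theta> - exp \<tau> *\<^sub>R sgn y) powr (- s)) * indicator (ball 0 1) y) \<partial>lborel)"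
    unfolding sphere_pot_def
  proof (intro nn_integral_cong_AE eventually_mono[OF AE_lborel_nonzero])
    fix y :: 'a assume "y \<noteq> 0"
    then have ns: "norm (sgn y) = 1" by (simp add: norm_sgn)
    have "\<theta> - exp (- \<tau>) *\<^sub>R sgn y = exp (- \<tau>) *\<^sub>R (exp \<tau> *\<^sub>R \<theta> - sgn y)"
      by (simp add: scaleR_diff_right exp_add[symmetric])
    then have "norm (\<theta> - exp (- \<tau>) *\<^sub>R sgn y) = exp (- \<tau>) * norm (\<theta> - exp \<tau> *\<^sub>R sgn y)"
      using norm_unit_diff_swap[OF \<theta> ns, of "exp \<tau>"] by simp
    then have "norm (\<theta> - exp (- \<tau>) *\<^sub>R sgn y) powr (- s) = exp (s * \<tau>) * norm (\<theta> - exp \<tau> *\<^sub>R sgn y) powr (- s)"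
      by (simp add: powr_mult exp_powr_real mult.commute)
    then show "ennreal (DIM('a) * norm (\<theta> - exp (- \<tau>) *\<^sub>R sgn y) powr (- s)) * indicator (ball 0 1) y =
      ennreal (exp (s * \<tau>)) * (ennreal (DIM('a) * norm (\<theta> - exp \<tau> *\<^sub>R sgn y) powr (- s)) * indicator (ball 0 1) y)"
      by (simp add: ennreal_mult mult_ac)
  qed
  also have "\<dots> = ennreal (exp (s * \<tau>)) * sphere_pot s \<theta> \<tau>"
    unfolding sphere_pot_def by (rule nn_integral_cmult) simp
  finally show ?thesis .
qed

definition sphere_potr :: "real \<Rightarrow> 'a::euclidean_space \<Rightarrow> real \<Rightarrow> real" where
  "sphere_potr s \<theta> \<tau> = (LINT y|lborel. DIM('a) * norm (\<theta> - exp \<tau> *\<^sub>R sgn y) powr (- s) * indicator (ball 0 1) y)"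

text \<open>Off \<open>\<tau> = 0\<close> the point \<open>\<theta>\<close> has distance at least
  \<open>\<bar>1 - exp \<tau>\<bar>\<close> from the sphere of radius \<open>exp \<tau>\<close>. The
  integrand is then bounded on the ball, locally uniformly in \<open>\<tau>\<close>, and dominated
  convergence gives continuity.\<close>

lemma sphere_pot_off_zero:
  fixes \<theta> :: "'a::euclidean_space"
  assumes \<theta>: "norm \<theta> = 1" and s: "0 < s" and \<tau>: "\<tau> \<noteq> 0"
  shows "sphere_pot s \<theta> \<tau> = ennreal (sphere_potr s \<theta> \<tau>)" 
    and "sphere_potr s \<theta> \<tau> > 0" and "isCont (sphere_potr s \<theta>) \<tau>"
proof -
  have [measurable]: "ball (0::'a) r \<in> sets borel" for r by simp
  let ?n = "real DIM('a)"
  define g where "g \<tau> y = ?n * norm (\<theta> - exp \<tau> *\<^sub>R sgn y) powr (- s) * indicator (ball 0 1) y" for \<tau> and y :: 'a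
  have [measurable]: "g \<tau> \<in> borel_measurable borel" for \<tau> unfolding g_def[abs_def] by measurable
  have lb: "norm (\<theta> - exp \<tau> *\<^sub>R sgn y) \<ge> \<bar>1 - exp \<tau>\<bar>" if "y \<noteq> 0" for \<tau> and y :: 'a
    using norm_triangle_ineq3[of \<theta> "exp \<tau> *\<^sub>R sgn y"] that \<theta> by (simp add: norm_sgn)
  have gb: "norm (g \<tau> y) \<le> ?n * d powr (- s) * indicator (ball 0 1) y" if "y \<noteq> 0" "0 < d" "d \<le> \<bar>1 - exp \<tau>\<bar>" for \<tau> d y
  proof -
    have "norm (\<theta> - exp \<tau> *\<^sub>R sgn y) powr (- s) \<le> d powr (- s)"
      using lb[OF that(1), of \<tau>] that s by (intro powr_mono2') auto
    then show ?thesis by (simp add: g_def indicator_def)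
  qed
  have iB: "integrable lborel (\<lambda>y. C * indicator (ball (0::'a) 1) y)" for C :: real
    using emeasure_lborel_ball_finite[of "0::'a" 1] by (intro integrable_mult_right integrable_real_indicator) auto
  have gi: "integrable lborel (g \<tau>)" if "\<tau> \<noteq> 0" for \<tau>
  proof (rule Bochner_Integration.integrable_bound[OF iB[of "?n * \<bar>1 - exp \<tau>\<bar> powr (- s)"]])
    show "AE y in lborel. norm (g \<tau> y) \<le> norm (?n * \<bar>1 - exp \<tau>\<bar> powr (- s) * indicator (ball 0 1) y)"
    proof (rule eventually_mono[OF AE_lborel_nonzero])
      fix y :: 'a assume "y \<noteq> 0"
      then have "norm (g \<tau> y) \<le> ?n * \<bar>1 - exp \<tau>\<bar> powr (- s) * indicator (ball 0 1) y"
        using that by (intro gb) auto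
      also have "\<dots> \<le> norm (?n * \<bar>1 - exp \<tau>\<bar> powr (- s) * indicator (ball 0 1) y)" by (simp add: indicator_def)
      finally show "norm (g \<tau> y) \<le> norm (?n * \<bar>1 - exp \<tau>\<bar> powr (- s) * indicator (ball 0 1) y)" .
    qed
  qed simp
  have gnn: "g \<tau> y \<ge> 0" for \<tau> y by (simp add: g_def)
  have pr: "sphere_potr s \<theta> \<tau> = (LINT y|lborel. g \<tau> y)" for \<tau> by (simp add: sphere_potr_def g_def)
  have sp: "sphere_pot s \<theta> \<tau> = (\<integral>\<^sup>+y. ennreal (g \<tau> y) \<partial>lborel)" for \<tau>
    unfolding sphere_pot_def by (intro nn_integral_cong) (auto simp: g_def indicator_def)
  show "sphere_pot s \<theta> \<tau> = ennreal (sphere_potr s \<theta> \<tau>)"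
    unfolding sp pr by (rule nn_integral_eq_integral[OF gi[OF \<tau>]]) (simp add: gnn)
  show "sphere_potr s \<theta> \<tau> > 0"
  proof -
    let ?C = "?n * (1 + exp \<tau>) powr (- s)"
    have "?C * measure lborel (ball (0::'a) 1) > 0" 
      using content_ball_pos[of 1 "0::'a"] by (intro mult_pos_pos) (auto simp: add_pos_pos less_imp_neq[THEN not_sym])
    also have "?C * measure lborel (ball (0::'a) 1) = (LINT y|lborel. ?C * indicator (ball (0::'a) 1) y)" by simp
    also have "\<dots> \<le> (LINT y|lborel. g \<tau> y)"
    proof (rule integral_mono_AE[OF iB gi[OF \<tau>]])
      show "AE y in lborel. ?C * indicator (ball 0 1) y \<le> g \<tau> y"
      proof (rule eventually_mono[OF AE_lborel_nonzero])
        fix y :: 'a assume y: "y \<noteq> 0"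
        have "norm (\<theta> - exp \<tau> *\<^sub>R sgn y) \<le> 1 + exp \<tau>"
          using norm_triangle_ineq4[of \<theta> "exp \<tau> *\<^sub>R sgn y"] y \<theta> by (simp add: norm_sgn)
        moreover have "norm (\<theta> - exp \<tau> *\<^sub>R sgn y) > 0" 
          using lb[OF y, of \<tau>] \<tau> by (smt (verit) exp_eq_one_iff)
        ultimately have "(1 + exp \<tau>) powr (- s) \<le> norm (\<theta> - exp \<tau> *\<^sub>R sgn y) powr (- s)"
          using s by (intro powr_mono2') auto
        then show "?C * indicator (ball 0 1) y \<le> g \<tau> y" by (simp add: g_def indicator_def)
      qed
    qed
    finally show ?thesis by (simp add: pr)
  qed
  show "isCont (sphere_potr s \<theta>) \<tau>"
    unfolding continuous_at_sequentially comp_def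
  proof (intro allI impI)
    fix x :: "nat \<Rightarrow> real" assume x: "x \<longlonglongrightarrow> \<tau>"
    define d where "d = \<bar>1 - exp \<tau>\<bar> / 2"
    have d: "d > 0" using \<tau> by (simp add: d_def)
    have "(\<lambda>k. \<bar>1 - exp (x k)\<bar>) \<longlonglongrightarrow> \<bar>1 - exp \<tau>\<bar>" by (intro tendsto_intros x)
    then have "\<forall>\<^sub>F k in sequentially. d < \<bar>1 - exp (x k)\<bar>"
      by (rule order_tendstoD) (use d in \<open>simp add: d_def\<close>)
    then obtain N where N: "\<And>k. k \<ge> N \<Longrightarrow> d < \<bar>1 - exp (x k)\<bar>" by (auto simp: eventually_sequentially)
    have "(\<lambda>k. LINT y|lborel. g (x (k + N)) y) \<longlonglongrightarrow> (LINT y|lborel. g \<tau> y)"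
    proof (rule integral_dominated_convergence[OF _ _ iB[of "?n * d powr (- s)"]])
      show "AE y in lborel. (\<lambda>k. g (x (k + N)) y) \<longlonglongrightarrow> g \<tau> y"
      proof (rule eventually_mono[OF AE_lborel_nonzero])
        fix y :: 'a assume y: "y \<noteq> 0"
        have nz: "norm (\<theta> - exp \<tau> *\<^sub>R sgn y) \<noteq> 0" 
          using lb[OF y, of \<tau>] \<tau> by (smt (verit) exp_eq_one_iff)
        have "(\<lambda>k. x (k + N)) \<longlonglongrightarrow> \<tau>" using x by (rule LIMSEQ_ignore_initial_segment)
        then show "(\<lambda>k. g (x (k + N)) y) \<longlonglongrightarrow> g \<tau> y"
          unfolding g_def using nz by (intro tendsto_intros) auto
      qed
      show "AE y in lborel. norm (g (x (k + N)) y) \<le> ?n * d powr (- s) * indicator (ball 0 1) y" for k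
        by (intro eventually_mono[OF AE_lborel_nonzero] gb) (use d N[of "k + N"] in auto)
    qed simp_all
    then show "(\<lambda>k. sphere_potr s \<theta> (x k)) \<longlonglongrightarrow> sphere_potr s \<theta> \<tau>"
      unfolding pr by (rule LIMSEQ_offset)
  qed
qed

text \<open>The kernel is made for \<open>wker_potential\<close>: in the variable
  \<open>ln (norm x)\<close>, the potential of order \<open>s\<close> of a density homogeneous of
  degree \<open>c - n\<close> times a radial profile becomes a convolution, up to the power
  \<open>norm x powr (- (s - c))\<close>. A possible infinite value at \<open>\<tau> = 0\<close> is
  turned into \<open>0\<close> by \<open>enn2real\<close>, which changes the kernel at one point
  only.\<close>

definition wker :: "real \<Rightarrow> real \<Rightarrow> 'a::euclidean_space \<Rightarrow> real \<Rightarrow> real" where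
  "wker s c \<theta> \<tau> = enn2real (ennreal (exp (- c * \<tau>)) * sphere_pot s \<theta> (- \<tau>))"

lemma borel_measurable_wker [measurable]: "wker s c \<theta> \<in> borel_measurable borel"
  unfolding wker_def[abs_def] by measurable

lemma wker_nonneg: "wker s c \<theta> \<tau> \<ge> 0"
  by (simp add: wker_def)

context
  fixes \<theta> :: "'a::euclidean_space" and s c :: real
  assumes \<theta>: "norm \<theta> = 1" and sc: "0 < c" "c < s" "s < DIM('a)"
begin

lemma wker_off_zero:
  assumes "\<tau> \<noteq> 0"
  shows "wker s c \<theta> \<tau> = exp (- c * \<tau>) * sphere_potr s \<theta> (- \<tau>)"
proof -
  have p: "sphere_pot s \<theta> (- \<tau>) = ennreal (sphere_potr s \<theta> (- \<tau>))" "sphere_potr s \<theta> (- \<tau>) > 0"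
    using sphere_pot_off_zero[OF \<theta>, of s "- \<tau>"] assms sc by auto
  then show ?thesis by (simp add: wker_def ennreal_mult[symmetric])
qed

lemma wker_pos: "\<tau> \<noteq> 0 \<Longrightarrow> wker s c \<theta> \<tau> > 0"
  using sphere_pot_off_zero(2)[OF \<theta>, of s "- \<tau>"] sc by (simp add: wker_off_zero)

lemma isCont_wker:
  assumes "\<tau> \<noteq> 0" shows "isCont (wker s c \<theta>) \<tau>"
proof -
  have "isCont (\<lambda>t. exp (- c * t) * sphere_potr s \<theta> (- t)) \<tau>"
    using assms sc sphere_pot_off_zero(3)[OF \<theta>, of s "- \<tau>"]
    by (intro continuous_intros isCont_o2[where g="sphere_potr s \<theta>" and f=uminus]) auto
  moreover have "\<forall>\<^sub>F t in nhds \<tau>. exp (- c * t) * sphere_potr s \<theta> (- t) = wker s c \<theta> t"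
    using t1_space_nhds[OF assms] by eventually_elim (simp add: wker_off_zero)
  ultimately show ?thesis by (simp add: isCont_cong)
qed

lemma ennreal_wker:
  assumes "\<tau> \<noteq> 0"
  shows "ennreal (wker s c \<theta> \<tau>) = ennreal (exp (- c * \<tau>)) * sphere_pot s \<theta> (- \<tau>)"
  using sphere_pot_off_zero[OF \<theta>, of s "- \<tau>"] assms sc
  by (simp add: wker_off_zero ennreal_mult)

lemma wker_reflect: "wker s (s - c) \<theta> \<tau> = wker s c \<theta> (- \<tau>)"
proof -
  have "ennreal (exp (- (s - c) * \<tau>)) * sphere_pot s \<theta> (- \<tau>) = ennreal (exp (- (s - c) * \<tau>) * exp (s * \<tau>)) * sphere_pot s \<theta> \<tau>"
    by (simp add: sphere_pot_minus[OF \<theta>] ennreal_mult mult.assoc)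
  also have "exp (- (s - c) * \<tau>) * exp (s * \<tau>) = exp (- c * - \<tau>)"
    by (simp add: exp_add[symmetric] algebra_simps)
  finally show ?thesis by (simp add: wker_def)
qed

lemma wker_potential:
  fixes w :: "real \<Rightarrow> ennreal" and x :: 'a
  assumes [measurable]: "w \<in> borel_measurable borel" and x: "x \<noteq> 0"
  shows "(\<integral>\<^sup>+y. ennreal (norm y powr (c - DIM('a))) * w (ln (norm y)) * ennreal (norm (x - y) powr (- s)) \<partial>lborel)
    = ennreal (norm x powr (- (s - c))) * (\<integral>\<^sup>+\<sigma>. ennreal (wker s c \<theta> (ln (norm x) - \<sigma>)) * w \<sigma> \<partial>lborel)"
proof -
  let ?n = "real DIM('a)"
  let ?t = "ln (norm x)"
  have "(\<integral>\<^sup>+y. ennreal (norm y powr (c - ?n)) * w (ln (norm y)) * ennreal (norm (x - y) powr (- s)) \<partial>lborel)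
    = (\<integral>\<^sup>+y. (ennreal (exp ((c - ?n) * ln (norm y))) * w (ln (norm y))) * ennreal (norm (x - y) powr (- s)) \<partial>lborel)"
    by (intro nn_integral_cong_AE eventually_mono[OF AE_lborel_nonzero]) (simp add: powr_def)
  also have "\<dots> = (\<integral>\<^sup>+\<sigma>. ennreal (exp (?n * \<sigma>)) * (ennreal (exp ((c - ?n) * \<sigma>)) * w \<sigma>) * ennreal (exp (- s * ?t)) * sphere_pot s \<theta> (\<sigma> - ?t) \<partial>lborel)"
    using nn_integral_radial_potential[of "\<lambda>u. ennreal (exp ((c - ?n) * u)) * w u" \<theta> x s, OF _ \<theta> x] by simp
  also have "\<dots> = (\<integral>\<^sup>+\<sigma>. ennreal (norm x powr (- (s - c))) * (ennreal (wker s c \<theta> (?t - \<sigma>)) * w \<sigma>) \<partial>lborel)"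
  proof (intro nn_integral_cong_AE)
    have "AE \<sigma> in lborel. \<sigma> \<noteq> ?t" by (rule AE_lborel_singleton)
    then show "AE \<sigma> in lborel. ennreal (exp (?n * \<sigma>)) * (ennreal (exp ((c - ?n) * \<sigma>)) * w \<sigma>) * ennreal (exp (- s * ?t)) * sphere_pot s \<theta> (\<sigma> - ?t)
      = ennreal (norm x powr (- (s - c))) * (ennreal (wker s c \<theta> (?t - \<sigma>)) * w \<sigma>)"
    proof eventually_elim
      case (elim \<sigma>)
      have e: "exp (?n * \<sigma>) * exp ((c - ?n) * \<sigma>) * exp (- s * ?t) = norm x powr (- (s - c)) * exp (- c * (?t - \<sigma>))"
        using x by (simp add: powr_def exp_add[symmetric] algebra_simps)
      have "ennreal (exp (?n * \<sigma>)) * (ennreal (exp ((c - ?n) * \<sigma>)) * w \<sigma>) * ennreal (exp (- s * ?t)) * sphere_pot s \<theta> (\<sigma> - ?t)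
        = ennreal (exp (?n * \<sigma>) * exp ((c - ?n) * \<sigma>) * exp (- s * ?t)) * (w \<sigma> * sphere_pot s \<theta> (\<sigma> - ?t))"
        by (simp add: ennreal_mult mult_ac)
      also have "\<dots> = ennreal (norm x powr (- (s - c))) * (ennreal (exp (- c * (?t - \<sigma>))) * sphere_pot s \<theta> (- (?t - \<sigma>)) * w \<sigma>)"
        unfolding e by (simp add: ennreal_mult mult_ac)
      also have "\<dots> = ennreal (norm x powr (- (s - c))) * (ennreal (wker s c \<theta> (?t - \<sigma>)) * w \<sigma>)"
        using elim by (subst ennreal_wker) auto
      finally show ?case .
    qed
  qed
  also have "\<dots> = ennreal (norm x powr (- (s - c))) * (\<integral>\<^sup>+\<sigma>. ennreal (wker s c \<theta> (?t - \<sigma>)) * w \<sigma> \<partial>lborel)"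
    by (rule nn_integral_cmult) simp
  finally show ?thesis .
qed

text \<open>With the constant profile \<open>1\<close> and \<open>x = \<theta>\<close>, the total
  mass of the kernel is the integral with two singular points bounded above; its convergence is
  exactly where \<open>0 < c < s < n\<close> is used.\<close>

lemma integrable_wker: "integrable lborel (wker s c \<theta>)"
proof -
  have "\<theta> \<noteq> 0" using \<theta> by auto
  from wker_potential[of "\<lambda>_. 1", OF _ this]
  have "(\<integral>\<^sup>+\<sigma>. ennreal (wker s c \<theta> (- \<sigma>)) \<partial>lborel) = (\<integral>\<^sup>+y. ennreal (norm y powr (c - DIM('a)) * norm (\<theta> - y) powr (- s)) \<partial>lborel)"
    using \<theta> by (simp add: ennreal_mult)
  also have "\<dots> < \<infinity>" by (rule nn_integral_two_point_singularity) (use \<theta> sc in auto)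
  finally have "(\<integral>\<^sup>+\<sigma>. ennreal (wker s c \<theta> (- \<sigma>)) \<partial>lborel) < \<infinity>" .
  moreover have "(\<integral>\<^sup>+\<sigma>. ennreal (wker s c \<theta> \<sigma>) \<partial>lborel) = ennreal \<bar>-1\<bar> * (\<integral>\<^sup>+\<sigma>. ennreal (wker s c \<theta> (0 + -1 * \<sigma>)) \<partial>lborel)"
    by (rule nn_integral_real_affine) simp_all
  ultimately show ?thesis by (intro integrableI_nonneg) (auto simp: wker_nonneg)
qed

text \<open>This is \<open>potential_radially_decreasing\<close> read along the ray through
  \<open>\<theta>\<close>: the exponential factors are the powers of the radius that separate a
  function on space from its profile on the line.\<close>

lemma wker_conv_antimono:
  fixes w :: "real \<Rightarrow> ennreal"
  assumes [measurable]: "w \<in> borel_measurable borel"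
    and w: "\<And>\<sigma> \<sigma>'. \<sigma> \<le> \<sigma>' \<Longrightarrow> ennreal (exp ((c - DIM('a)) * \<sigma>')) * w \<sigma>' \<le> ennreal (exp ((c - DIM('a)) * \<sigma>)) * w \<sigma>"
    and tt: "t \<le> t'"
  shows "ennreal (exp (- (s - c) * t')) * (\<integral>\<^sup>+\<sigma>. ennreal (wker s c \<theta> (t' - \<sigma>)) * w \<sigma> \<partial>lborel)
    \<le> ennreal (exp (- (s - c) * t)) * (\<integral>\<^sup>+\<sigma>. ennreal (wker s c \<theta> (t - \<sigma>)) * w \<sigma> \<partial>lborel)"
proof -
  define \<phi> where "\<phi> y = ennreal (norm y powr (c - DIM('a))) * w (ln (norm y))" for y :: 'a
  have [measurable]: "\<phi> \<in> borel_measurable borel" unfolding \<phi>_def[abs_def] by measurable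
  have "\<theta> \<noteq> 0" using \<theta> by auto
  have eq: "(\<integral>\<^sup>+y. \<phi> y * ennreal (norm (exp t *\<^sub>R \<theta> - y) powr (- s)) \<partial>lborel)
     = ennreal (exp (- (s - c) * t)) * (\<integral>\<^sup>+\<sigma>. ennreal (wker s c \<theta> (t - \<sigma>)) * w \<sigma> \<partial>lborel)" for t
    unfolding \<phi>_def using \<theta> \<open>\<theta> \<noteq> 0\<close> by (subst wker_potential) (simp_all add: exp_powr_real mult.commute)
  have "(\<integral>\<^sup>+y. \<phi> y * ennreal (norm (exp t' *\<^sub>R \<theta> - y) powr (- s)) \<partial>lborel) \<le> (\<integral>\<^sup>+y. \<phi> y * ennreal (norm (exp t *\<^sub>R \<theta> - y) powr (- s)) \<partial>lborel)"
  proof (rule potential_radially_decreasing[where G="\<lambda>z. ennreal (norm z powr (- s))"])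
    show "\<phi> z \<le> \<phi> y" if "y \<noteq> 0" "norm y \<le> norm z" for y z
    proof -
      have "z \<noteq> 0" using that by auto
      then show ?thesis using w[of "ln (norm y)" "ln (norm z)"] that by (simp add: \<phi>_def powr_def)
    qed
    show "ennreal (norm z powr - s) \<le> ennreal (norm y powr - s)" if "y \<noteq> 0" "norm y \<le> norm z" for y z :: 'a
      using that sc by (intro ennreal_leI powr_mono2') auto
    show "norm (exp t *\<^sub>R \<theta>) \<le> norm (exp t' *\<^sub>R \<theta>)" using tt \<theta> by simp
  qed simp_all
  then show ?thesis by (simp add: eq)
qed

end

section \<open>Convolutions on the line\<close>

definition conv :: "(real \<Rightarrow> real) \<Rightarrow> (real \<Rightarrow> real) \<Rightarrow> real \<Rightarrow> real" where
  "conv K W t = (LINT s|lborel. K (t - s) * W s)"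

lemma conv_shift: "conv K W t = (LINT s|lborel. K s * W (t - s))"
  using lborel_integral_real_affine[of "-1" "\<lambda>s. K (t - s) * W s" t] by (simp add: conv_def)

lemma conv_translate: "conv K (\<lambda>s. W (s + h)) t = conv K W (t + h)"
  by (simp add: conv_shift algebra_simps)

lemma nn_integral_reflect_real:
  fixes f :: "real \<Rightarrow> ennreal"
  assumes [measurable]: "f \<in> borel_measurable borel"
  shows "(\<integral>\<^sup>+s. f (t - s) \<partial>lborel) = (\<integral>\<^sup>+s. f s \<partial>lborel)"
  using nn_integral_real_affine[of f "-1" t] by simp

lemma nn_integral_translate_real:
  fixes f :: "real \<Rightarrow> ennreal"
  assumes [measurable]: "f \<in> borel_measurable borel"
  shows "(\<integral>\<^sup>+s. f (s + t) \<partial>lborel) = (\<integral>\<^sup>+s. f s \<partial>lborel)"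
  using nn_integral_real_affine[of f 1 t] by (simp add: add.commute)

text \<open>The convex function \<open>w powr r\<close> lies above its tangent at \<open>m\<close>.
  Integrated against a kernel, this yields Jensen's inequality.\<close>

lemma powr_tangent:
  fixes w m r :: real
  assumes "w \<ge> 0" "m > 0" "r > 1"
  shows "w * m powr (r - 1) \<le> w powr r / r + (r - 1) / r * m powr r"
proof -
  have "w * m powr (r - 1) \<le> w powr r / r + (m powr (r - 1)) powr (r / (r - 1)) / (r / (r - 1))"
    using assms by (intro Youngs_inequality) (auto simp: field_simps)
  also have "(m powr (r - 1)) powr (r / (r - 1)) = m powr r" using assms by (simp add: powr_powr)
  finally show ?thesis by (simp add: mult.commute)
qed

lemma integrable_powr_exponent_mono:
  fixes W :: "'a \<Rightarrow> real"
  assumes [measurable]: "W \<in> borel_measurable M" and W: "\<And>x. 0 \<le> W x" "\<And>x. W x \<le> C"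
    and i: "integrable M (\<lambda>x. W x powr Q)" and r: "Q \<le> r"
  shows "integrable M (\<lambda>x. W x powr r)"
    and "(LINT x|M. W x powr r) \<le> C powr (r - Q) * (LINT x|M. W x powr Q)"
proof -
  have le: "W x powr r \<le> C powr (r - Q) * W x powr Q" for x
  proof -
    have "W x powr r = W x powr (r - Q) * W x powr Q" by (simp add: powr_add[symmetric])
    also have "\<dots> \<le> C powr (r - Q) * W x powr Q"
      using W r by (intro mult_right_mono powr_mono2) auto
    finally show ?thesis .
  qed
  show I: "integrable M (\<lambda>x. W x powr r)"
    by (rule Bochner_Integration.integrable_bound[OF integrable_mult_right[OF i, of "C powr (r - Q)"]])
       (use le in \<open>auto intro!: AE_I2 order_trans[OF le]\<close>)
  have "(LINT x|M. W x powr r) \<le> (LINT x|M. C powr (r - Q) * W x powr Q)"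
    by (intro integral_mono I integrable_mult_right i le)
  then show "(LINT x|M. W x powr r) \<le> C powr (r - Q) * (LINT x|M. W x powr Q)" by simp
qed

locale kernel =
  fixes K :: "real \<Rightarrow> real"
  assumes K_meas [measurable]: "K \<in> borel_measurable borel"
    and K_nonneg: "\<And>t. 0 \<le> K t"
    and K_int: "integrable lborel K"
begin

definition k1 :: real where "k1 = (LINT t|lborel. K t)"

lemma k1_nonneg: "k1 \<ge> 0" by (simp add: k1_def K_nonneg)

lemma kernel_reflect: "kernel (\<lambda>t. K (- t))"
proof
  show "integrable lborel (\<lambda>t. K (- t))"
    using lborel_integrable_real_affine[OF K_int, of "-1" 0] by simp
qed (simp_all add: K_nonneg)

lemma K_int_shift: "integrable lborel (\<lambda>s. K (t - s))"
  using lborel_integrable_real_affine[OF K_int, of "-1" t] by simp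

lemma K_lint_shift: "(LINT s|lborel. K (t - s)) = k1"
  using lborel_integral_real_affine[of "-1" K t] by (simp add: k1_def)

lemma K_nn: "(\<integral>\<^sup>+t. ennreal (K t) \<partial>lborel) = ennreal k1"
  unfolding k1_def by (rule nn_integral_eq_integral[OF K_int]) (simp add: K_nonneg)

context
  fixes W :: "real \<Rightarrow> real" and C :: real
  assumes W_meas [measurable]: "W \<in> borel_measurable borel" and W_bd: "\<And>t. \<bar>W t\<bar> \<le> C"
begin

lemma conv_integrable: "integrable lborel (\<lambda>s. K (t - s) * W s)"
proof (rule Bochner_Integration.integrable_bound[OF integrable_mult_right[OF K_int_shift, of C]])
  show "AE s in lborel. norm (K (t - s) * W s) \<le> norm (C * K (t - s))"
  proof (rule AE_I2)
    fix s
    have "norm (K (t - s) * W s) = \<bar>W s\<bar> * K (t - s)" by (simp add: abs_mult K_nonneg)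
    also have "\<dots> \<le> \<bar>C\<bar> * K (t - s)" using W_bd[of s] by (intro mult_right_mono K_nonneg) auto
    finally show "norm (K (t - s) * W s) \<le> norm (C * K (t - s))" by (simp add: abs_mult K_nonneg)
  qed
qed simp

lemma conv_integrable_shift: "integrable lborel (\<lambda>s. K s * W (t - s))"
  using lborel_integrable_real_affine[OF conv_integrable[of t], of "-1" t] by simp

lemma conv_abs_le: "\<bar>conv K W t\<bar> \<le> k1 * C"
proof -
  have "\<bar>conv K W t\<bar> \<le> (LINT s|lborel. C * K (t - s))"
    unfolding conv_def
  proof (rule order_trans[OF integral_abs_bound], rule integral_mono)
    show "integrable lborel (\<lambda>s. \<bar>K (t - s) * W s\<bar>)" using conv_integrable by simp
    show "\<bar>K (t - s) * W s\<bar> \<le> C * K (t - s)" for s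
      using W_bd[of s] K_nonneg by (simp add: abs_mult mult.commute mult_right_mono)
  qed (simp add: K_int_shift)
  then show ?thesis by (simp add: K_lint_shift mult.commute)
qed

lemma conv_measurable [measurable]: "conv K W \<in> borel_measurable borel"
  unfolding conv_def[abs_def] by measurable

end

context
  fixes W :: "real \<Rightarrow> real" and C :: real
  assumes W_meas [measurable]: "W \<in> borel_measurable borel" and W_nn: "\<And>t. 0 \<le> W t" and W_le: "\<And>t. W t \<le> C"
begin

lemma W_abs: "\<bar>W t\<bar> \<le> C" using W_nn W_le by (simp add: abs_le_iff)

lemma conv_nonneg: "0 \<le> conv K W t"
  unfolding conv_def by (intro integral_nonneg_AE) (simp add: K_nonneg W_nn)

lemma conv_le: "conv K W t \<le> k1 * C"
  using conv_abs_le[OF W_meas W_abs, of t] by simp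

lemma conv_nn: "ennreal (conv K W t) = (\<integral>\<^sup>+s. ennreal (K (t - s)) * ennreal (W s) \<partial>lborel)"
proof -
  have "(\<integral>\<^sup>+s. ennreal (K (t - s) * W s) \<partial>lborel) = ennreal (conv K W t)"
    unfolding conv_def by (rule nn_integral_eq_integral[OF conv_integrable[OF W_meas W_abs]]) (simp add: K_nonneg W_nn)
  then show ?thesis by (simp add: ennreal_mult K_nonneg W_nn)
qed

text \<open>Jensen's inequality for the measure with density \<open>K (t - s)\<close>, whose mass is
  \<open>k1\<close>: the tangent inequality is taken at the mean value \<open>m\<close> and
  integrated.\<close>

lemma conv_powr_le:
  assumes r: "r > 1"
  shows "conv K W t powr r \<le> k1 powr (r - 1) * conv K (\<lambda>s. W s powr r) t"
proof (cases "conv K W t = 0")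
  case True
  have "0 \<le> conv K (\<lambda>s. W s powr r) t"
    unfolding conv_def by (intro integral_nonneg_AE) (simp add: K_nonneg)
  then show ?thesis using r True by simp
next
  case False
  then have h: "conv K W t > 0" using conv_nonneg[of t] by simp
  have k: "k1 > 0"
  proof (rule ccontr)
    assume "\<not> k1 > 0"
    then have "k1 = 0" using k1_nonneg by simp
    then show False using conv_le[of t] h by simp
  qed
  define m where "m = conv K W t / k1"
  have m: "m > 0" using h k by (simp add: m_def)
  have Wr: "\<bar>W t powr r\<bar> \<le> C powr r" for t using W_nn W_le r by (auto intro!: powr_mono2)
  have i1: "integrable lborel (\<lambda>s. m powr (r - 1) * (K (t - s) * W s))"
    by (intro integrable_mult_right conv_integrable[OF W_meas W_abs])
  have i2: "integrable lborel (\<lambda>s. K (t - s) * W s powr r)"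
    by (rule conv_integrable[OF _ Wr]) simp
  have i3: "integrable lborel (\<lambda>s. 1 / r * (K (t - s) * W s powr r) + ((r - 1) / r * m powr r) * K (t - s))"
    by (intro Bochner_Integration.integrable_add integrable_mult_right i2 K_int_shift)
  have "(LINT s|lborel. m powr (r - 1) * (K (t - s) * W s)) \<le>
     (LINT s|lborel. 1 / r * (K (t - s) * W s powr r) + ((r - 1) / r * m powr r) * K (t - s))"
  proof (rule integral_mono[OF i1 i3])
    fix s
    have "K (t - s) * (W s * m powr (r - 1)) \<le> K (t - s) * (W s powr r / r + (r - 1) / r * m powr r)"
      by (intro mult_left_mono powr_tangent W_nn m r K_nonneg)
    then show "m powr (r - 1) * (K (t - s) * W s) \<le> 1 / r * (K (t - s) * W s powr r) + ((r - 1) / r * m powr r) * K (t - s)"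
      by (simp add: algebra_simps)
  qed
  also have "\<dots> = 1 / r * conv K (\<lambda>s. W s powr r) t + ((r - 1) / r * m powr r) * k1"
    by (subst Bochner_Integration.integral_add)
       (auto intro!: integrable_mult_right i2 K_int_shift simp del: times_divide_eq_left simp: conv_def K_lint_shift)
  finally have A: "m powr (r - 1) * conv K W t \<le> 1 / r * conv K (\<lambda>s. W s powr r) t + ((r - 1) / r * m powr r) * k1"
    by (simp add: conv_def)
  have hm: "conv K W t = m * k1" using k by (simp add: m_def)
  have mm: "m powr (r - 1) * m = m powr r" using m by (simp add: powr_diff)
  have "m powr (r - 1) * conv K W t = m powr r * k1"
    unfolding hm mult.assoc[symmetric] mm ..
  with A have "m powr r * k1 \<le> 1 / r * conv K (\<lambda>s. W s powr r) t + ((r - 1) / r * m powr r) * k1" by simp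
  then have "m powr r * k1 \<le> conv K (\<lambda>s. W s powr r) t" using r by (simp add: field_simps)
  then have "k1 powr (r - 1) * (m powr r * k1) \<le> k1 powr (r - 1) * conv K (\<lambda>s. W s powr r) t"
    by (intro mult_left_mono) auto
  moreover have "k1 powr (r - 1) * (m powr r * k1) = conv K W t powr r"
    using k m by (simp add: hm powr_mult powr_diff)
  ultimately show ?thesis by simp
qed

text \<open>Young's inequality with the same exponent on both sides: the pointwise Jensen bound is
  integrated, and Tonelli releases one more factor \<open>k1\<close>.\<close>

lemma conv_young:
  assumes r: "r > 1" and i: "integrable lborel (\<lambda>t. W t powr r)"
  shows "integrable lborel (\<lambda>t. conv K W t powr r)"
    and "(LINT t|lborel. conv K W t powr r) \<le> k1 powr r * (LINT t|lborel. W t powr r)"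
proof -
  have [measurable]: "conv K W \<in> borel_measurable borel" by (rule conv_measurable[OF W_meas W_abs])
  have Wr: "W t powr r \<le> C powr r" for t using W_nn W_le r by (auto intro!: powr_mono2)
  have nnW: "(\<integral>\<^sup>+t. ennreal (W t powr r) \<partial>lborel) = ennreal (LINT t|lborel. W t powr r)"
    by (rule nn_integral_eq_integral[OF i]) simp
  have "(\<integral>\<^sup>+t. ennreal (conv K W t powr r) \<partial>lborel) \<le> (\<integral>\<^sup>+t. ennreal (k1 powr (r - 1)) * ennreal (conv K (\<lambda>s. W s powr r) t) \<partial>lborel)"
    by (intro nn_integral_mono) (simp add: ennreal_mult'[symmetric] ennreal_leI conv_powr_le r)
  also have "\<dots> = (\<integral>\<^sup>+t. ennreal (k1 powr (r - 1)) * (\<integral>\<^sup>+s. ennreal (K (t - s)) * ennreal (W s powr r) \<partial>lborel) \<partial>lborel)"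
  proof (intro nn_integral_cong)
    fix t
    have "(\<integral>\<^sup>+s. ennreal (K (t - s) * W s powr r) \<partial>lborel) = ennreal (conv K (\<lambda>s. W s powr r) t)"
      unfolding conv_def 
      by (rule nn_integral_eq_integral[OF conv_integrable[of _ "C powr r"]]) (auto simp: K_nonneg Wr)
    then show "ennreal (k1 powr (r - 1)) * ennreal (conv K (\<lambda>s. W s powr r) t) = ennreal (k1 powr (r - 1)) * (\<integral>\<^sup>+s. ennreal (K (t - s)) * ennreal (W s powr r) \<partial>lborel)"
      by (simp add: ennreal_mult K_nonneg)
  qed
  also have "\<dots> = ennreal (k1 powr (r - 1)) * (\<integral>\<^sup>+t. (\<integral>\<^sup>+s. ennreal (K (t - s)) * ennreal (W s powr r) \<partial>lborel) \<partial>lborel)"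
    by (rule nn_integral_cmult) measurable
  also have "(\<integral>\<^sup>+t. (\<integral>\<^sup>+s. ennreal (K (t - s)) * ennreal (W s powr r) \<partial>lborel) \<partial>lborel)
     = (\<integral>\<^sup>+s. (\<integral>\<^sup>+t. ennreal (K (t - s)) * ennreal (W s powr r) \<partial>lborel) \<partial>lborel)"
    by (rule lborel_pair.Fubini') measurable
  also have "\<dots> = (\<integral>\<^sup>+s. ennreal k1 * ennreal (W s powr r) \<partial>lborel)"
  proof (intro nn_integral_cong)
    fix s
    have "(\<integral>\<^sup>+t. ennreal (K (t - s)) * ennreal (W s powr r) \<partial>lborel) = (\<integral>\<^sup>+t. ennreal (K (t + (- s))) \<partial>lborel) * ennreal (W s powr r)"
      by (simp add: nn_integral_multc)
    also have "(\<integral>\<^sup>+t. ennreal (K (t + (- s))) \<partial>lborel) = ennreal k1"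
      by (subst nn_integral_translate_real) (simp_all add: K_nn)
    finally show "(\<integral>\<^sup>+t. ennreal (K (t - s)) * ennreal (W s powr r) \<partial>lborel) = ennreal k1 * ennreal (W s powr r)" .
  qed
  also have "\<dots> = ennreal k1 * ennreal (LINT t|lborel. W t powr r)"
    by (simp add: nn_integral_cmult nnW)
  also have "ennreal (k1 powr (r - 1)) * (ennreal k1 * ennreal (LINT t|lborel. W t powr r)) = ennreal (k1 powr r * (LINT t|lborel. W t powr r))"
    using k1_nonneg r
    by (cases "k1 = 0") (simp_all add: ennreal_mult'[symmetric] mult.assoc[symmetric] powr_diff)
  finally have le: "(\<integral>\<^sup>+t. ennreal (conv K W t powr r) \<partial>lborel) \<le> ennreal (k1 powr r * (LINT t|lborel. W t powr r))" .
  then show I: "integrable lborel (\<lambda>t. conv K W t powr r)"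
    by (intro integrableI_nonneg) (auto intro: le_less_trans)
  have "ennreal (LINT t|lborel. conv K W t powr r) \<le> ennreal (k1 powr r * (LINT t|lborel. W t powr r))"
    using le by (subst nn_integral_eq_integral[symmetric, OF I]) auto
  then show "(LINT t|lborel. conv K W t powr r) \<le> k1 powr r * (LINT t|lborel. W t powr r)"
    by (subst (asm) ennreal_le_iff) auto
qed

end

lemma conv_mono:
  assumes [measurable]: "W \<in> borel_measurable borel" "W' \<in> borel_measurable borel"
    and "\<And>t. \<bar>W t\<bar> \<le> C" "\<And>t. \<bar>W' t\<bar> \<le> C'" "\<And>t. W t \<le> W' t"
  shows "conv K W t \<le> conv K W' t"
  unfolding conv_def using assms
  by (intro integral_mono conv_integrable[of _ C] conv_integrable[of _ C'] mult_left_mono K_nonneg) auto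

lemma conv_add:
  assumes [measurable]: "W \<in> borel_measurable borel" "W' \<in> borel_measurable borel"
    and "\<And>t. \<bar>W t\<bar> \<le> C" "\<And>t. \<bar>W' t\<bar> \<le> C'"
  shows "conv K (\<lambda>t. W t + W' t) t = conv K W t + conv K W' t"
  unfolding conv_def distrib_left using assms
  by (intro Bochner_Integration.integral_add conv_integrable[of _ C] conv_integrable[of _ C']) auto

lemma conv_cmult: "conv K (\<lambda>t. c * W t) t = c * conv K W t"
  unfolding conv_def by (simp add: mult.left_commute)

lemma conv_adjoint:
  assumes [measurable]: "W \<in> borel_measurable borel" "Z \<in> borel_measurable borel"
    and W: "\<And>t. 0 \<le> W t" "\<And>t. W t \<le> C" and Z: "\<And>t. 0 \<le> Z t" "\<And>t. Z t \<le> D"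
  shows "(\<integral>\<^sup>+t. ennreal (Z t * conv K W t) \<partial>lborel) = (\<integral>\<^sup>+s. ennreal (conv (\<lambda>t. K (- t)) Z s * W s) \<partial>lborel)"
proof -
  interpret R: kernel "\<lambda>t. K (- t)" by (rule kernel_reflect)
  have "(\<integral>\<^sup>+t. ennreal (Z t * conv K W t) \<partial>lborel) = (\<integral>\<^sup>+t. (\<integral>\<^sup>+s. ennreal (Z t) * (ennreal (K (t - s)) * ennreal (W s)) \<partial>lborel) \<partial>lborel)"
    using conv_nn[of W C] W Z by (intro nn_integral_cong) (simp add: ennreal_mult conv_nonneg[of W C] nn_integral_cmult)
  also have "\<dots> = (\<integral>\<^sup>+s. (\<integral>\<^sup>+t. ennreal (Z t) * (ennreal (K (t - s)) * ennreal (W s)) \<partial>lborel) \<partial>lborel)"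
    by (rule lborel_pair.Fubini') measurable
  also have "\<dots> = (\<integral>\<^sup>+s. ennreal (conv (\<lambda>t. K (- t)) Z s * W s) \<partial>lborel)"
  proof (intro nn_integral_cong)
    fix s
    have "(\<integral>\<^sup>+t. ennreal (Z t) * (ennreal (K (t - s)) * ennreal (W s)) \<partial>lborel) = (\<integral>\<^sup>+t. (ennreal (K (- (s - t))) * ennreal (Z t)) * ennreal (W s) \<partial>lborel)"
      by (simp add: mult_ac)
    also have "\<dots> = ennreal (conv (\<lambda>t. K (- t)) Z s) * ennreal (W s)"
      using R.conv_nn[of Z D] Z by (subst nn_integral_multc) auto
    finally show "(\<integral>\<^sup>+t. ennreal (Z t) * (ennreal (K (t - s)) * ennreal (W s)) \<partial>lborel) = ennreal (conv (\<lambda>t. K (- t)) Z s * W s)"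
      using W Z by (simp add: ennreal_mult R.conv_nonneg[of Z D])
  qed
  finally show ?thesis .
qed

end

text \<open>With \<open>(1 + \<eta>) powr r = 1 + \<epsilon>\<close>, either \<open>e\<close> is at
  most \<open>\<eta> * x\<close> and is absorbed into the first term, or \<open>x\<close> is at most
  \<open>e / \<eta>\<close> and the second term takes all. The lemma compares integrals of
  \<open>r\<close>-th powers where a perturbation is small, with leading constant as close to
  \<open>1\<close> as desired.\<close>

lemma powr_add_le_eps:
  fixes r \<epsilon> :: real
  assumes r: "r > 0" and \<epsilon>: "\<epsilon> > 0"
  shows "\<exists>c\<ge>0. \<forall>x\<ge>0. \<forall>e\<ge>0. (x + e) powr r \<le> (1 + \<epsilon>) * x powr r + c * e powr r"
proof -
  define \<eta> where "\<eta> = (1 + \<epsilon>) powr (1 / r) - 1"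
  have "1 powr (1/r) < (1 + \<epsilon>) powr (1 / r)" using r \<epsilon> by (intro powr_less_mono2) auto
  then have \<eta>: "\<eta> > 0" by (simp add: \<eta>_def)
  have \<eta>r: "(1 + \<eta>) powr r = 1 + \<epsilon>" using r \<epsilon> by (simp add: \<eta>_def powr_powr)
  show ?thesis
  proof (intro exI[of _ "(1 + 1 / \<eta>) powr r"] conjI allI impI)
    fix x e :: real assume xe: "x \<ge> 0" "e \<ge> 0"
    show "(x + e) powr r \<le> (1 + \<epsilon>) * x powr r + (1 + 1 / \<eta>) powr r * e powr r"
    proof (cases "e \<le> \<eta> * x")
      case True
      then have "(x + e) powr r \<le> ((1 + \<eta>) * x) powr r"
        using xe r by (intro powr_mono2) (auto simp: algebra_simps)
      also have "\<dots> = (1 + \<epsilon>) * x powr r" using \<eta> xe by (simp add: powr_mult \<eta>r)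
      finally show ?thesis by (simp add: add_increasing2)
    next
      case False
      then have "x \<le> e / \<eta>" using \<eta> by (simp add: field_simps)
      then have "(x + e) powr r \<le> ((1 + 1 / \<eta>) * e) powr r"
        using xe r by (intro powr_mono2) (auto simp: algebra_simps)
      also have "\<dots> = (1 + 1 / \<eta>) powr r * e powr r" using \<eta> xe by (simp add: powr_mult)
      finally show ?thesis using \<epsilon> by (simp add: add_increasing)
    qed
  qed simp
qed

lemma powr_add_le_two:
  fixes x y r :: real
  assumes "x \<ge> 0" "y \<ge> 0" "r > 0"
  shows "(x + y) powr r \<le> 2 powr r * (x powr r + y powr r)"
proof -
  have "(x + y) powr r \<le> (2 * max x y) powr r" using assms by (intro powr_mono2) auto
  also have "\<dots> = 2 powr r * max x y powr r" using assms by (simp add: powr_mult)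
  also have "max x y powr r \<le> x powr r + y powr r" by (simp add: max_def)
  finally show ?thesis by simp
qed

lemma exp_head_integral:
  fixes m a :: real assumes "m > 0"
  shows "integrable lborel (\<lambda>t. exp (m * t) * indicator {..a} t)"
    and "(LINT t|lborel. exp (m * t) * indicator {..a} t) = exp (m * a) / m"
proof -
  have "(\<integral>\<^sup>+t. ennreal (m * exp (m * t) * indicator {..a} t) \<partial>lborel) = (\<integral>\<^sup>+t. ennreal (m * exp (m * (0 - t)) * indicator {..a} (0 - t)) \<partial>lborel)"
    by (rule nn_integral_reflect_real[symmetric]) simp
  also have "\<dots> = (\<integral>\<^sup>+t. ennreal (m * exp (- (m * t))) * indicator {-a..} t \<partial>lborel)"
    by (intro nn_integral_cong) (auto simp: indicator_def)
  also have "\<dots> = ennreal (exp (m * a))" by (simp add: nn_integral_exp_tail assms)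
  finally have n: "(\<integral>\<^sup>+t. ennreal (m * exp (m * t) * indicator {..a} t) \<partial>lborel) = ennreal (exp (m * a))" .
  have h: "has_bochner_integral lborel (\<lambda>t. m * exp (m * t) * indicator {..a} t) (exp (m * a))"
    by (rule has_bochner_integral_nn_integral[OF _ _ _ n]) (use assms in \<open>auto simp: indicator_def\<close>)
  have h2: "has_bochner_integral lborel (\<lambda>t. (1/m) * (m * exp (m * t) * indicator {..a} t)) ((1/m) * exp (m * a))"
    by (rule has_bochner_integral_mult_right) (rule h)
  have e: "(\<lambda>t. (1/m) * (m * exp (m * t) * indicator {..a} t)) = (\<lambda>t. exp (m * t) * indicator {..a} t)"
    using assms by auto
  show "integrable lborel (\<lambda>t. exp (m * t) * indicator {..a} t)"
    and "(LINT t|lborel. exp (m * t) * indicator {..a} t) = exp (m * a) / m"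
    using h2 unfolding e has_bochner_integral_iff by simp_all
qed

lemma not_AE_lborel_avoids_interval:
  fixes a b :: real assumes "a < b"
  shows "\<not> (AE t in lborel. t \<notin> {a..b})"
proof
  assume "AE t in lborel. t \<notin> {a..b}"
  then have "emeasure lborel {a..b} = 0" by (subst (asm) AE_iff_measurable[of "{a..b}"]) auto
  then show False using assms by simp
qed

section \<open>The class of radially decreasing profiles and the variational problem\<close>

locale wconv = kernel +
  fixes \<beta> Q r :: real
  assumes \<beta>: "\<beta> > 0" and Q: "Q > 1" and rQ: "r > Q"
    and K_pos: "\<And>t. t \<noteq> 0 \<Longrightarrow> K t > 0"
begin

lemma r1: "r > 1" using Q rQ by simp

text \<open>The weight \<open>exp (- \<beta> * t)\<close> converts a profile into the radial
  function it comes from; in the application \<open>\<beta> = b * q2\<close>, and \<open>G\<close>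
  stands for the profile of a power \<open>v powr q2\<close>. Right-continuity fixes a
  representative of the kind that Helly's theorem handles.\<close>

definition cls :: "(real \<Rightarrow> real) set" where
  "cls = {G. (\<forall>t. 0 \<le> G t) \<and> (\<forall>s t. s \<le> t \<longrightarrow> exp (- \<beta> * t) * G t \<le> exp (- \<beta> * s) * G s) \<and>
     (\<forall>t. continuous (at_right t) G) \<and> integrable lborel (\<lambda>t. G t powr Q)}"

definition mass :: "(real \<Rightarrow> real) \<Rightarrow> real set \<Rightarrow> real" where
  "mass G S = (LINT t|lborel. G t powr Q * indicator S t)"

definition J :: "(real \<Rightarrow> real) \<Rightarrow> real" where
  "J G = (LINT t|lborel. conv K G t powr r)"

definition Lam :: real where
  "Lam = Sup (J ` {G \<in> cls. mass G UNIV \<le> 1})"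

lemma clsD:
  assumes "G \<in> cls"
  shows "0 \<le> G t" and "s \<le> t \<Longrightarrow> exp (- \<beta> * t) * G t \<le> exp (- \<beta> * s) * G s"
    and "continuous (at_right t) G" and "integrable lborel (\<lambda>t. G t powr Q)"
  using assms by (auto simp: cls_def)

lemma exp_antimono_measurable:
  fixes G :: "real \<Rightarrow> real" and b :: real
  assumes "\<And>s t. s \<le> t \<Longrightarrow> exp (- b * t) * G t \<le> exp (- b * s) * G s"
  shows "G \<in> borel_measurable borel"
proof -
  have "mono (\<lambda>t. - (exp (- b * t) * G t))" using assms by (intro monoI) auto
  then have "(\<lambda>t. - (exp (- b * t) * G t)) \<in> borel_measurable borel" by (rule borel_measurable_mono)
  then have "(\<lambda>t. (- exp (b * t)) * (- (exp (- b * t) * G t))) \<in> borel_measurable borel"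
    by (rule borel_measurable_times[rotated]) measurable
  moreover have "(- exp (b * t)) * (- (exp (- b * t) * G t)) = G t" for t
    by (simp add: exp_minus)
  ultimately show ?thesis by (simp only:)
qed

lemma cls_measurable: "G \<in> cls \<Longrightarrow> G \<in> borel_measurable borel"
  by (rule exp_antimono_measurable[of \<beta>]) (rule clsD(2))

lemma mass_integrable:
  assumes "integrable lborel (\<lambda>t. G t powr Q)" "S \<in> sets borel"
  shows "integrable lborel (\<lambda>t. G t powr Q * indicator S t)"
  using integrable_mult_indicator[of S lborel "\<lambda>t. G t powr Q"] assms by (simp add: mult.commute)

lemma mass_nonneg: "mass G S \<ge> 0"
  unfolding mass_def by (intro integral_nonneg_AE) simp

lemma mass_mono:
  assumes "integrable lborel (\<lambda>t. G t powr Q)" "S \<in> sets borel" "T \<in> sets borel" "S \<subseteq> T"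
  shows "mass G S \<le> mass G T"
  unfolding mass_def using assms
  by (intro integral_mono mass_integrable mult_left_mono) (auto simp: indicator_def)

lemma mass_Un:
  assumes "integrable lborel (\<lambda>t. G t powr Q)" "S \<in> sets borel" "T \<in> sets borel" "S \<inter> T = {}"
  shows "mass G (S \<union> T) = mass G S + mass G T"
proof -
  have "mass G (S \<union> T) = (LINT t|lborel. G t powr Q * indicator S t + G t powr Q * indicator T t)"
    unfolding mass_def using assms(4)
    by (intro Bochner_Integration.integral_cong) (auto simp: indicator_def)
  also have "\<dots> = mass G S + mass G T"
    unfolding mass_def using assms by (intro Bochner_Integration.integral_add mass_integrable) auto
  finally show ?thesis .
qed

lemma mass_UNIV: "mass G UNIV = (LINT t|lborel. G t powr Q)"
  by (simp add: mass_def)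

text \<open>Going left from \<open>t\<close> by at most one, a member of the class loses at most the
  factor \<open>exp (- \<beta>)\<close>. A large value thus forces mass on the preceding unit
  interval, which gives a pointwise bound in terms of local mass.\<close>

lemma cls_local:
  assumes G: "G \<in> cls"
  shows "G t powr Q \<le> exp (\<beta> * Q) * mass G {t - 1..<t}"
proof -
  have "exp (- \<beta> * Q) * G t powr Q * measure lborel {t - 1..<t} = (LINT s|lborel. exp (- \<beta> * Q) * G t powr Q * indicator {t - 1..<t} s)"
    by simp
  also have "\<dots> \<le> mass G {t - 1..<t}"
    unfolding mass_def
  proof (rule integral_mono)
    show "integrable lborel (\<lambda>s. G s powr Q * indicator {t - 1..<t} s)"
      by (rule mass_integrable) (use clsD[OF G] in auto)
    fix s
    show "exp (- \<beta> * Q) * G t powr Q * indicator {t - 1..<t} s \<le> G s powr Q * indicator {t - 1..<t} s"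
    proof (cases "s \<in> {t - 1..<t}")
      case True
      then have "exp (- \<beta> * t) * G t \<le> exp (- \<beta> * s) * G s" using clsD(2)[OF G] by simp
      then have "exp (\<beta> * s) * (exp (- \<beta> * t) * G t) \<le> exp (\<beta> * s) * (exp (- \<beta> * s) * G s)" by (intro mult_left_mono) auto
      then have "exp (\<beta> * s - \<beta> * t) * G t \<le> G s" by (simp add: mult.assoc[symmetric] exp_add[symmetric])
      moreover have "exp (- \<beta>) * G t \<le> exp (\<beta> * s - \<beta> * t) * G t"
      proof (intro mult_right_mono clsD(1)[OF G])
        have "\<beta> * (t - s) \<le> \<beta> * 1" using True \<beta> by (intro mult_left_mono) auto
        then show "exp (- \<beta>) \<le> exp (\<beta> * s - \<beta> * t)" by (simp add: algebra_simps)
      qed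
      ultimately have "exp (- \<beta>) * G t \<le> G s" by simp
      then have "(exp (- \<beta>) * G t) powr Q \<le> G s powr Q"
        using Q clsD(1)[OF G] by (intro powr_mono2) auto
      moreover have "(exp (- \<beta>) * G t) powr Q = exp (- \<beta> * Q) * G t powr Q"
        using clsD(1)[OF G] by (simp add: powr_mult exp_powr_real)
      ultimately show ?thesis using True by simp
    qed simp
  qed simp
  finally have "exp (- \<beta> * Q) * G t powr Q \<le> mass G {t - 1..<t}" by simp
  then have "exp (\<beta> * Q) * (exp (- \<beta> * Q) * G t powr Q) \<le> exp (\<beta> * Q) * mass G {t - 1..<t}" by (intro mult_left_mono) auto
  then show ?thesis by (simp add: mult.assoc[symmetric] exp_add[symmetric])
qed

lemma cls_bound:
  assumes G: "G \<in> cls"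
  shows "G t \<le> exp \<beta> * mass G UNIV powr (1 / Q)"
proof -
  have "mass G {t - 1..<t} \<le> mass G UNIV"
    by (rule mass_mono[OF clsD(4)[OF G]]) auto
  then have "exp (\<beta> * Q) * mass G {t - 1..<t} \<le> exp (\<beta> * Q) * mass G UNIV" by (intro mult_left_mono) auto
  then have "G t powr Q \<le> exp (\<beta> * Q) * mass G UNIV"
    using cls_local[OF G, of t] by linarith
  then have "(G t powr Q) powr (1 / Q) \<le> (exp (\<beta> * Q) * mass G UNIV) powr (1 / Q)"
    using Q by (intro powr_mono2) auto
  then show ?thesis using Q clsD(1)[OF G] by (simp add: powr_powr powr_mult mass_nonneg exp_powr_real)
qed

lemma cls_bound1:
  assumes G: "G \<in> cls" and m: "mass G UNIV \<le> 1"
  shows "G t \<le> exp \<beta>"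
proof -
  have "mass G UNIV powr (1 / Q) \<le> 1 powr (1 / Q)" using m Q mass_nonneg by (intro powr_mono2) auto
  then have "exp \<beta> * mass G UNIV powr (1 / Q) \<le> exp \<beta> * 1" by (intro mult_left_mono) auto
  then show ?thesis using cls_bound[OF G, of t] by linarith
qed

text \<open>Young's inequality in exponent \<open>r\<close>, followed by interpolation between
  exponent \<open>Q\<close> and the supremum. The factor \<open>C powr (r - Q)\<close> makes
  \<open>J\<close> small on uniformly small functions. The bound holds for all bounded functions
  because it is also applied to truncations and to differences, which leave the class.\<close>

lemma J_bound:
  assumes [measurable]: "G \<in> borel_measurable borel" and G: "\<And>t. 0 \<le> G t" "\<And>t. G t \<le> C"
    and i: "integrable lborel (\<lambda>t. G t powr Q)"
  shows "integrable lborel (\<lambda>t. conv K G t powr r)"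
    and "J G \<le> k1 powr r * (C powr (r - Q) * mass G UNIV)"
proof -
  have i': "integrable lborel (\<lambda>t. G t powr r)" and le: "(LINT t|lborel. G t powr r) \<le> C powr (r - Q) * mass G UNIV"
    using integrable_powr_exponent_mono[of G lborel C Q r] G i rQ by (auto simp: mass_UNIV)
  show "integrable lborel (\<lambda>t. conv K G t powr r)"
    by (rule conv_young[of G C]) (use G r1 i' in auto)
  have "J G \<le> k1 powr r * (LINT t|lborel. G t powr r)"
    unfolding J_def by (rule conv_young[of G C]) (use G r1 i' in auto)
  also have "\<dots> \<le> k1 powr r * (C powr (r - Q) * mass G UNIV)"
    using le by (intro mult_left_mono) auto
  finally show "J G \<le> k1 powr r * (C powr (r - Q) * mass G UNIV)" .
qed

lemma J_integrable: "G \<in> cls \<Longrightarrow> integrable lborel (\<lambda>t. conv K G t powr r)"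
  by (rule J_bound(1)[of G "exp \<beta> * mass G UNIV powr (1 / Q)"]) (auto intro: cls_measurable clsD cls_bound)

lemma J_nonneg: "J G \<ge> 0"
  unfolding J_def by (intro integral_nonneg_AE) simp

lemma J_bdd: "bdd_above (J ` {G \<in> cls. mass G UNIV \<le> 1})"
proof (rule bdd_aboveI2)
  fix G assume "G \<in> {G \<in> cls. mass G UNIV \<le> 1}"
  then have G: "G \<in> cls" "mass G UNIV \<le> 1" by auto
  have "J G \<le> k1 powr r * (exp \<beta> powr (r - Q) * mass G UNIV)"
    by (rule J_bound(2)) (use G in \<open>auto intro: cls_measurable clsD cls_bound1\<close>)
  also have "\<dots> \<le> k1 powr r * (exp \<beta> powr (r - Q) * 1)"
    using G by (intro mult_left_mono) auto
  finally show "J G \<le> k1 powr r * (exp \<beta> powr (r - Q) * 1)" .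
qed

lemma J_le_Lam: "G \<in> cls \<Longrightarrow> mass G UNIV \<le> 1 \<Longrightarrow> J G \<le> Lam"
  unfolding Lam_def using J_bdd by (intro cSup_upper) auto

lemma cls_scale:
  assumes G: "G \<in> cls" and c: "c \<ge> 0"
  shows "(\<lambda>t. c * G t) \<in> cls" and "mass (\<lambda>t. c * G t) S = c powr Q * mass G S"
    and "J (\<lambda>t. c * G t) = c powr r * J G"
proof -
  have e: "(c * G t) powr Q = c powr Q * G t powr Q" for t
    using c clsD(1)[OF G] by (simp add: powr_mult)
  have "exp (- \<beta> * t) * (c * G t) \<le> exp (- \<beta> * s) * (c * G s)" if "s \<le> t" for s t
    using mult_left_mono[OF clsD(2)[OF G that] c] by (simp add: mult_ac)
  moreover have "integrable lborel (\<lambda>t. (c * G t) powr Q)"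
    unfolding e by (intro integrable_mult_right clsD(4)[OF G])
  ultimately show "(\<lambda>t. c * G t) \<in> cls"
    using c clsD[OF G] unfolding cls_def by (auto intro!: continuous_intros)
  show "mass (\<lambda>t. c * G t) S = c powr Q * mass G S"
    unfolding mass_def e by (simp add: mult.assoc)
  have "0 \<le> conv K G t" for t
    by (rule conv_nonneg[OF cls_measurable[OF G] clsD(1)[OF G] cls_bound[OF G]])
  then show "J (\<lambda>t. c * G t) = c powr r * J G"
    unfolding J_def using c by (simp add: conv_cmult powr_mult)
qed

text \<open>\<open>J\<close> is homogeneous of degree \<open>r\<close> and \<open>mass\<close> of
  degree \<open>Q\<close>, so normalising the mass to one gives the exponent \<open>r / Q\<close>.
  That this exponent exceeds one is the source of strict superadditivity.\<close>

lemma J_le_Lam_mass: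
  assumes G: "G \<in> cls"
  shows "J G \<le> Lam * mass G UNIV powr (r / Q)"
proof (cases "mass G UNIV = 0")
  case True
  have "G t = 0" for t
    using cls_bound[OF G, of t] clsD(1)[OF G, of t] True by simp
  then have "G = (\<lambda>t. 0)" by auto
  then have "J G = 0" by (simp add: J_def conv_def)
  then show ?thesis using True by simp
next
  case False
  define m where "m = mass G UNIV"
  have m: "m > 0" using False mass_nonneg[of G UNIV] by (simp add: m_def)
  define c where "c = m powr (- 1 / Q)"
  have c: "c \<ge> 0" by (simp add: c_def)
  have "c powr Q = m powr (- 1 / Q * Q)" by (simp only: c_def powr_powr)
  then have "c powr Q = 1 / m" using Q m by (simp add: powr_minus_divide)
  then have "mass (\<lambda>t. c * G t) UNIV = 1" using m by (simp add: cls_scale(2)[OF G c] flip: m_def)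
  then have "J (\<lambda>t. c * G t) \<le> Lam" by (intro J_le_Lam cls_scale(1)[OF G c]) simp
  then have "c powr r * J G \<le> Lam" by (simp add: cls_scale(3)[OF G c])
  then have "m powr (r / Q) * (c powr r * J G) \<le> m powr (r / Q) * Lam" by (intro mult_left_mono) auto
  moreover have "m powr (r / Q) * c powr r = 1"
    using m by (simp add: c_def powr_powr powr_add[symmetric])
  ultimately show ?thesis by (metis m_def mult.assoc mult.commute mult_1)
qed

lemma conv_pos:
  assumes [measurable]: "G \<in> borel_measurable borel" and G: "\<And>t. 0 \<le> G t" "\<And>t. G t \<le> C"
    and p: "\<And>t. t \<le> t0 \<Longrightarrow> G t > 0"
  shows "conv K G t > 0"
proof (rule ccontr)
  assume "\<not> conv K G t > 0"
  then have z: "conv K G t = 0" using conv_nonneg[of G C t] G by simp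
  have i: "integrable lborel (\<lambda>s. K (t - s) * G s)" by (rule conv_integrable[of G C]) (use G in \<open>auto simp: abs_le_iff\<close>)
  have "AE s in lborel. K (t - s) * G s = 0"
    using integral_nonneg_eq_0_iff_AE[OF i] z K_nonneg G unfolding conv_def by simp
  then have "AE s in lborel. s \<notin> {min t t0 - 2 .. min t t0 - 1}"
  proof eventually_elim
    case (elim s)
    show ?case
    proof
      assume "s \<in> {min t t0 - 2 .. min t t0 - 1}"
      then have "t - s \<noteq> 0" "s \<le> t0" by auto
      then have "K (t - s) > 0" "G s > 0" using K_pos p by auto
      then show False using elim by simp
    qed
  qed
  then show False using not_AE_lborel_avoids_interval by auto
qed

lemma Lam_pos: "Lam > 0"
proof -
  \<comment> \<open>The profile of the indicator function of the unit ball.\<close>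
  define G where "G t = exp (\<beta> * t) * indicator {..<0} t" for t :: real
  have Gr: "continuous (at_right t) G" for t
  proof (cases "t < 0")
    case True
    have "((\<lambda>s. exp (\<beta> * s)) \<longlongrightarrow> exp (\<beta> * t)) (at_right t)" by (intro tendsto_intros)
    moreover have "\<forall>\<^sub>F s in at_right t. exp (\<beta> * s) = G s"
      using eventually_at_right[OF True] by (auto simp: G_def True intro!: exI[of _ 0])
    ultimately have "(G \<longlongrightarrow> exp (\<beta> * t)) (at_right t)" by (rule Lim_transform_eventually)
    then show ?thesis using True by (simp add: continuous_within G_def)
  next
    case False
    have "\<forall>\<^sub>F s in at_right t. 0 = G s"
      using eventually_at_right[of t "t + 1"] False by (auto simp: G_def intro!: exI[of _ "t + 1"])
    then have "(G \<longlongrightarrow> 0) (at_right t)" by (rule Lim_transform_eventually[OF tendsto_const])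
    then show ?thesis using False by (simp add: continuous_within G_def)
  qed
  have Gm: "exp (- \<beta> * t) * G t = indicator {..<0} t" for t
    by (simp add: G_def mult.assoc[symmetric] exp_add[symmetric])
  have Gi: "integrable lborel (\<lambda>t. G t powr Q)"
  proof (rule Bochner_Integration.integrable_bound[OF exp_head_integral(1)[of "\<beta> * Q" 0]])
    show "AE t in lborel. norm (G t powr Q) \<le> norm (exp (\<beta> * Q * t) * indicator {..0} t)"
      by (rule AE_I2) (auto simp: G_def indicator_def exp_powr_real mult_ac)
  qed (use \<beta> Q in \<open>auto simp: G_def\<close>)
  have "0 \<le> G t" for t by (simp add: G_def)
  moreover have "exp (- \<beta> * t) * G t \<le> exp (- \<beta> * s) * G s" if "s \<le> t" for s t
    unfolding Gm using that by (simp add: indicator_def)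
  ultimately have G: "G \<in> cls" unfolding cls_def using Gr Gi by blast
  have "conv K G t > 0" for t
    by (rule conv_pos[OF cls_measurable[OF G] clsD(1)[OF G] cls_bound[OF G], of "-1"]) (auto simp: G_def)
  then have "conv K G t powr r > 0" for t by (simp add: less_imp_neq[THEN not_sym])
  then have nz: "conv K G t powr r \<noteq> 0" for t by (metis less_irrefl)
  have "\<not> (AE t in lborel. conv K G t powr r = 0)"
  proof
    assume "AE t in lborel. conv K G t powr r = 0"
    then have "AE t in lborel. t \<notin> {0..1::real}" by (rule eventually_mono) (use nz in blast)
    then show False using not_AE_lborel_avoids_interval[of 0 1] by simp
  qed
  then have "J G \<noteq> 0"
    unfolding J_def using J_integrable[OF G] by (subst integral_nonneg_eq_0_iff_AE) auto
  then have "J G > 0" using J_nonneg[of G] by simp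
  then have "0 < Lam * mass G UNIV powr (r / Q)" using J_le_Lam_mass[OF G] by simp
  then show ?thesis by (simp add: zero_less_mult_iff)
qed

end

section \<open>Compactness of maximising sequences\<close>

text \<open>When both parts are bounded below and sum to at most one, each is at most
  \<open>1 - 2 * \<theta>\<close>. On \<open>[0, 1 - \<theta>]\<close> the power is below the line
  of slope \<open>p < 1\<close>; the half of \<open>2 * \<theta>\<close> left over makes room for
  the perturbation \<open>\<eta>\<close> of the second part.\<close>

lemma powr_split_gap:
  fixes \<kappa> a b :: real
  assumes "\<kappa> > 1" "a > 0" "b > 0"
  shows "\<exists>\<eta>>0. \<forall>A B. a \<le> A \<longrightarrow> b \<le> B \<longrightarrow> A + B \<le> 1 \<longrightarrow> A powr \<kappa> + (B + \<eta>) powr \<kappa> \<le> 1 - \<eta>"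
proof -
  define \<theta> where "\<theta> = min (min a b) 1 / 2"
  have \<theta>: "\<theta> > 0" "\<theta> < 1" "2 * \<theta> \<le> a" "2 * \<theta> \<le> b" using assms by (auto simp: \<theta>_def)
  define p where "p = (1 - \<theta>) powr (\<kappa> - 1)"
  have "p < 1 powr (\<kappa> - 1)" unfolding p_def using \<theta> assms by (intro powr_less_mono2) auto
  then have p: "p < 1" "p \<ge> 0" by (auto simp: p_def)
  define \<eta> where "\<eta> = min \<theta> ((1 - p) / 2)"
  have \<eta>: "\<eta> > 0" "\<eta> \<le> \<theta>" "2 * \<eta> \<le> 1 - p" using \<theta> p by (auto simp: \<eta>_def min_def field_simps)
  have "A powr \<kappa> + (B + \<eta>) powr \<kappa> \<le> 1 - \<eta>" if AB: "a \<le> A" "b \<le> B" "A + B \<le> 1" for A B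
  proof -
    have pw: "x powr \<kappa> \<le> x * p" if "0 \<le> x" "x \<le> 1 - \<theta>" for x
    proof -
      have "x powr \<kappa> = x * x powr (\<kappa> - 1)" using that by (cases "x = 0") (auto simp: powr_diff)
      also have "\<dots> \<le> x * p" unfolding p_def using that assms by (intro mult_left_mono powr_mono2) auto
      finally show ?thesis .
    qed
    have "A powr \<kappa> + (B + \<eta>) powr \<kappa> \<le> A * p + (B + \<eta>) * p"
      by (intro add_mono pw) (use AB \<theta> \<eta> assms in auto)
    also have "\<dots> = (A + B) * p + \<eta> * p" by (simp add: algebra_simps)
    also have "\<dots> \<le> 1 * p + \<eta> * 1"
      using AB \<eta> p by (intro add_mono mult_right_mono mult_left_mono) auto
    also have "\<dots> \<le> 1 - \<eta>" using \<eta> by simp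
    finally show ?thesis .
  qed
  then show ?thesis using \<eta> by blast
qed

lemma continuous_at_right_if:
  fixes f g :: "real \<Rightarrow> real"
  assumes "\<And>t. continuous (at_right t) f" "\<And>t. continuous (at_right t) g"
  shows "continuous (at_right t) (\<lambda>t. if t < c then f t else g t)"
proof (cases "t < c")
  case True
  have ev: "\<forall>\<^sub>F s in at_right t. f s = (if s < c then f s else g s)"
    using eventually_at_right[OF True] True by (auto intro!: exI[of _ c])
  have "((\<lambda>s. if s < c then f s else g s) \<longlongrightarrow> f t) (at_right t)"
    by (rule Lim_transform_eventually[OF _ ev]) (use assms(1)[of t] in \<open>simp add: continuous_within\<close>)
  then show ?thesis using True by (simp add: continuous_within)
next
  case False
  have ev: "\<forall>\<^sub>F s in at_right t. g s = (if s < c then f s else g s)"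
    using eventually_at_right[of t "t + 1"] False by (auto intro!: exI[of _ "t + 1"])
  have "((\<lambda>s. if s < c then f s else g s) \<longlongrightarrow> g t) (at_right t)"
    by (rule Lim_transform_eventually[OF _ ev]) (use assms(2)[of t] in \<open>simp add: continuous_within\<close>)
  then show ?thesis using False by (simp add: continuous_within)
qed

context wconv
begin

lemma cls_ratio:
  assumes G: "G \<in> cls" and "s \<le> t"
  shows "exp (- \<beta> * (t - s)) * G t \<le> G s"
proof -
  have "exp (\<beta> * s) * (exp (- \<beta> * t) * G t) \<le> exp (\<beta> * s) * (exp (- \<beta> * s) * G s)"
    using clsD(2)[OF G assms(2)] by (intro mult_left_mono) auto
  then show ?thesis by (simp add: mult.assoc[symmetric] exp_add[symmetric] right_diff_distrib)
qed

lemma cls_cut_left: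
  assumes G: "G \<in> cls"
  shows "(\<lambda>t. if t < t1 then G t else 0) \<in> cls"
    and "mass (\<lambda>t. if t < t1 then G t else 0) UNIV = mass G {..<t1}"
proof -
  have e: "(\<lambda>t. (if t < t1 then G t else 0) powr Q) = (\<lambda>t. G t powr Q * indicator {..<t1} t)"
    by (auto simp: indicator_def)
  have "integrable lborel (\<lambda>t. (if t < t1 then G t else 0) powr Q)"
    unfolding e by (intro mass_integrable clsD(4)[OF G]) simp
  moreover have "continuous (at_right t) (\<lambda>t. if t < t1 then G t else 0)" for t
    by (intro continuous_at_right_if clsD(3)[OF G] continuous_const)
  moreover have "exp (- \<beta> * t) * (if t < t1 then G t else 0) \<le> exp (- \<beta> * s) * (if s < t1 then G s else 0)" if "s \<le> t" for s t
    using clsD(2)[OF G that] clsD(1)[OF G, of s] that by auto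
  ultimately show "(\<lambda>t. if t < t1 then G t else 0) \<in> cls"
    unfolding cls_def using clsD(1)[OF G] by auto
  show "mass (\<lambda>t. if t < t1 then G t else 0) UNIV = mass G {..<t1}"
    unfolding mass_def by (intro Bochner_Integration.integral_cong) (auto simp: indicator_def)
qed

text \<open>Setting \<open>G\<close> to zero on the left would destroy the monotonicity, so the
  right part is continued to the left by the least extension allowed in the class, an exponential
  with constant weighted value. The mass added is \<open>G t2 powr Q / (\<beta> * Q)\<close>, and
  \<open>cls_local\<close> bounds it by the mass on the unit interval before the cut.\<close>

lemma cls_cut_right:
  fixes t2 :: real
  defines "E \<equiv> \<lambda>G t. if t < t2 then exp (\<beta> * (t - t2)) * G t2 else G t"
  assumes G: "G \<in> cls"
  shows "E G \<in> cls"
    and "mass (E G) UNIV \<le> mass G {t2..} + exp (\<beta> * Q) / (\<beta> * Q) * mass G {t2 - 1..<t2}"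
proof -
  have bQ: "\<beta> * Q > 0" using \<beta> Q by simp
  have nn: "0 \<le> E G t" for t using clsD(1)[OF G] by (simp add: E_def)
  have e: "E G t powr Q \<le> (exp (- (\<beta> * Q * t2)) * G t2 powr Q) * (exp (\<beta> * Q * t) * indicator {..t2} t) + G t powr Q * indicator {t2..} t" for t
  proof (cases "t < t2")
    case True
    have "E G t powr Q = exp (\<beta> * (t - t2) * Q) * G t2 powr Q"
      using True clsD(1)[OF G] by (simp add: E_def powr_mult exp_powr_real)
    also have "exp (\<beta> * (t - t2) * Q) = exp (- (\<beta> * Q * t2)) * exp (\<beta> * Q * t)"
      by (simp add: exp_add[symmetric] algebra_simps)
    finally show ?thesis using True by (simp add: mult_ac)
  qed (simp add: E_def)
  have [measurable]: "G \<in> borel_measurable borel" by (rule cls_measurable[OF G])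
  have i1: "integrable lborel (\<lambda>t. (exp (- (\<beta> * Q * t2)) * G t2 powr Q) * (exp (\<beta> * Q * t) * indicator {..t2} t) + G t powr Q * indicator {t2..} t)"
    by (intro Bochner_Integration.integrable_add integrable_mult_right exp_head_integral(1)[OF bQ] mass_integrable clsD(4)[OF G]) auto
  have i: "integrable lborel (\<lambda>t. E G t powr Q)"
    by (rule Bochner_Integration.integrable_bound[OF i1])
       (use e in \<open>auto intro!: AE_I2 simp: E_def intro: order_trans[OF e]\<close>)
  have mono: "exp (- \<beta> * t) * E G t \<le> exp (- \<beta> * s) * E G s" if st: "s \<le> t" for s t
  proof -
    have x: "exp (- (\<beta> * s)) * (exp (\<beta> * (s - t2)) * G t2) = exp (- (\<beta> * t2)) * G t2" for s
      by (simp add: mult.assoc[symmetric] exp_add[symmetric] right_diff_distrib)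
    show ?thesis
      using clsD(2)[OF G st] clsD(2)[OF G, of t2 t] st unfolding E_def by (auto simp: x)
  qed
  have "continuous (at_right t) (\<lambda>t. exp (\<beta> * (t - t2)) * G t2)" for t
    by (intro continuous_intros)
  then have "continuous (at_right t) (E G)" for t
    unfolding E_def by (intro continuous_at_right_if clsD(3)[OF G])
  then show "E G \<in> cls" unfolding cls_def using nn mono i by blast
  have "mass (E G) UNIV = (LINT t|lborel. E G t powr Q)" by (simp add: mass_UNIV)
  also have "\<dots> \<le> (LINT t|lborel. (exp (- (\<beta> * Q * t2)) * G t2 powr Q) * (exp (\<beta> * Q * t) * indicator {..t2} t) + G t powr Q * indicator {t2..} t)"
    by (rule integral_mono[OF i i1 e])
  also have "\<dots> = (exp (- (\<beta> * Q * t2)) * G t2 powr Q) * (exp (\<beta> * Q * t2) / (\<beta> * Q)) + mass G {t2..}"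
    by (subst Bochner_Integration.integral_add)
      (auto intro!: integrable_mult_right exp_head_integral(1)[OF bQ] mass_integrable clsD(4)[OF G] simp: exp_head_integral(2)[OF bQ] mass_def)
  also have "(exp (- (\<beta> * Q * t2)) * G t2 powr Q) * (exp (\<beta> * Q * t2) / (\<beta> * Q)) = G t2 powr Q / (\<beta> * Q)"
    by (simp add: exp_minus)
  also have "\<dots> \<le> (exp (\<beta> * Q) * mass G {t2 - 1..<t2}) / (\<beta> * Q)"
    using bQ by (intro divide_right_mono cls_local[OF G]) auto
  finally show "mass (E G) UNIV \<le> mass G {t2..} + exp (\<beta> * Q) / (\<beta> * Q) * mass G {t2 - 1..<t2}"
    by (simp add: add.commute)
qed

section \<open>Kernel tails and the cost of splitting\<close>

definition ktail :: "real \<Rightarrow> real" where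
  "ktail L = (LINT t|lborel. K t * indicator {t. L / 2 \<le> \<bar>t\<bar>} t)"

lemma kernel_tail: "kernel (\<lambda>t. K t * indicator {t. L / 2 \<le> \<bar>t\<bar>} t)"
proof
  show "integrable lborel (\<lambda>t. K t * indicator {t. L / 2 \<le> \<bar>t\<bar>} t)"
    using integrable_mult_indicator[of "{t. L / 2 \<le> \<bar>t\<bar>}" lborel K] K_int by (simp add: mult.commute)
qed (auto simp: K_nonneg)

lemma ktail_nonneg: "0 \<le> ktail L"
  unfolding ktail_def by (intro integral_nonneg_AE) (simp add: K_nonneg)

lemma ktail_tendsto: "(\<lambda>m. ktail (real m)) \<longlonglongrightarrow> 0"
proof -
  have "(\<lambda>m. LINT t|lborel. K t * indicator {t. real m / 2 \<le> \<bar>t\<bar>} t) \<longlonglongrightarrow> (LINT t|(lborel::real measure). 0)"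
  proof (rule integral_dominated_convergence[where w=K])
    show "AE t in lborel. (\<lambda>m. K t * indicator {t. real m / 2 \<le> \<bar>t\<bar>} t) \<longlonglongrightarrow> 0"
    proof (rule AE_I2)
      fix t :: real
      obtain N :: nat where "2 * \<bar>t\<bar> < real N" using reals_Archimedean2 by blast
      then have "\<forall>\<^sub>F m in sequentially. 0 = K t * indicator {t. real m / 2 \<le> \<bar>t\<bar>} t"
        by (intro eventually_sequentiallyI[of N]) (auto simp: indicator_def)
      then show "(\<lambda>m. K t * indicator {t. real m / 2 \<le> \<bar>t\<bar>} t) \<longlonglongrightarrow> 0"
        by (rule Lim_transform_eventually[OF tendsto_const])
    qed
  qed (auto simp: K_int K_nonneg indicator_def)
  then show ?thesis by (simp add: ktail_def)
qed

text \<open>Splitting a function of the class at a wide gap carrying little mass: the two far pieces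
  interact only through the tail of \<open>K\<close>, so the functional is nearly additive.\<close>

lemma dichotomy:
  assumes G: "G \<in> cls" and m: "mass G UNIV \<le> 1" and L: "L \<ge> 1" and \<epsilon>: "\<epsilon> > 0"
    and c: "c \<ge> 0" "\<And>x e. 0 \<le> x \<Longrightarrow> 0 \<le> e \<Longrightarrow> (x + e) powr r \<le> (1 + \<epsilon>) * x powr r + c * e powr r"
  shows "J G \<le> (1 + \<epsilon>) * Lam * (mass G {..<t1} powr (r / Q) +
      (mass G {t1 + L..} + exp (\<beta> * Q) / (\<beta> * Q) * mass G {t1..<t1 + L}) powr (r / Q))
    + c * 2 powr r * exp \<beta> powr (r - Q) * (k1 powr r * mass G {t1..<t1 + L} + ktail L powr r)"
proof -
  define t2 where "t2 = t1 + L"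
  interpret T: kernel "\<lambda>t. K t * indicator {t. L / 2 \<le> \<bar>t\<bar>} t" by (rule kernel_tail)
  have [measurable]: "G \<in> borel_measurable borel" by (rule cls_measurable[OF G])
  define C where "C = exp \<beta>"
  have G0: "0 \<le> G t" and GC: "G t \<le> C" for t
    using clsD(1)[OF G] cls_bound1[OF G m] by (auto simp: C_def)
  have C0: "C \<ge> 0" by (simp add: C_def)
  define GA where "GA t = (if t < t1 then G t else 0)" for t
  define GM where "GM t = G t * indicator {t1..<t2} t" for t
  define GB where "GB t = G t * indicator {t2..} t" for t
  \<comment> \<open>The right piece \<open>GB\<close> is not in the class; \<open>GE\<close> is its
    admissible extension and dominates it, so the optimal constant can be applied to
    \<open>GE\<close>.\<close>
  define GE where "GE t = (if t < t2 then exp (\<beta> * (t - t2)) * G t2 else G t)" for t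
  have GAc: "GA \<in> cls" "mass GA UNIV = mass G {..<t1}"
    unfolding GA_def[abs_def] by (rule cls_cut_left[OF G])+
  have GEc: "GE \<in> cls" and GEm: "mass GE UNIV \<le> mass G {t2..} + exp (\<beta> * Q) / (\<beta> * Q) * mass G {t2 - 1..<t2}"
    unfolding GE_def[abs_def] by (rule cls_cut_right[OF G])+
  have [measurable]: "GA \<in> borel_measurable borel" "GE \<in> borel_measurable borel" "GM \<in> borel_measurable borel" "GB \<in> borel_measurable borel"
    using cls_measurable[OF GAc(1)] cls_measurable[OF GEc] unfolding GM_def[abs_def] GB_def[abs_def] by simp_all
  have bA: "0 \<le> GA t" "GA t \<le> C" and bM: "0 \<le> GM t" "GM t \<le> C" and bB: "0 \<le> GB t" "GB t \<le> C" for t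
    using G0[of t] GC[of t] C0 by (auto simp: GA_def GM_def GB_def indicator_def)
  have GE0: "0 \<le> GE t" for t by (rule clsD(1)[OF GEc])
  define D where "D = exp \<beta> * mass GE UNIV powr (1 / Q)"
  have GED: "GE t \<le> D" for t unfolding D_def by (rule cls_bound[OF GEc])
  have t12: "t1 < t2" using L by (simp add: t2_def)
  have G3: "G t = GA t + (GM t + GB t)" for t
    using t12 by (auto simp: GA_def GM_def GB_def indicator_def)
  have abs: "\<bar>GA t\<bar> \<le> C" "\<bar>GM t\<bar> \<le> C" "\<bar>GB t\<bar> \<le> C" "\<bar>GM t + GB t\<bar> \<le> 2 * C" "\<bar>GE t\<bar> \<le> D" "\<bar>G t\<bar> \<le> C" for t
    using bA[of t] bM[of t] bB[of t] GE0[of t] GED[of t] G0[of t] GC[of t] by (simp_all add: abs_le_iff)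
  have le: "GB t \<le> GE t" "GB t \<le> G t" "GA t \<le> G t" for t
    using G0[of t] clsD(1)[OF G, of t2] by (auto simp: GA_def GB_def GE_def indicator_def)
  have cG: "conv K G t = conv K GA t + (conv K GM t + conv K GB t)" for t
  proof -
    have "conv K G t = conv K (\<lambda>t. GA t + (GM t + GB t)) t" by (simp add: G3[symmetric])
    also have "\<dots> = conv K GA t + conv K (\<lambda>t. GM t + GB t) t"
      by (rule conv_add[of _ _ C "2 * C"]) (simp_all add: abs)
    also have "conv K (\<lambda>t. GM t + GB t) t = conv K GM t + conv K GB t"
      by (rule conv_add[of _ _ C C]) (simp_all add: abs)
    finally show ?thesis .
  qed
  let ?T = "\<lambda>t. conv (\<lambda>t. K t * indicator {t. L / 2 \<le> \<bar>t\<bar>} t) G t"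
  \<comment> \<open>The middle of the gap. To its left every point carrying \<open>GB\<close> is at
    distance at least \<open>L / 2\<close>, to its right the same holds for \<open>GA\<close>; this
    is the threshold in \<open>ktail\<close>.\<close>
  let ?mid = "t1 + L / 2"
  have nA: "0 \<le> conv K GA t" and nM: "0 \<le> conv K GM t" and nB: "0 \<le> conv K GB t" and nE: "0 \<le> conv K GE t" and nT: "0 \<le> ?T t" for t
    using conv_nonneg[of GA C] conv_nonneg[of GM C] conv_nonneg[of GB C] conv_nonneg[of GE D] T.conv_nonneg[of G C] bA bM bB GE0 GED G0 GC by auto
  have BE: "conv K GB t \<le> conv K GE t" for t
    by (rule conv_mono[of _ _ C D]) (simp_all add: abs le)
  have BT: "conv K GB t \<le> ?T t" if "t < ?mid" for t
  proof -
    have "conv K GB t = conv (\<lambda>t. K t * indicator {t. L / 2 \<le> \<bar>t\<bar>} t) GB t"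
      unfolding conv_def using that by (intro Bochner_Integration.integral_cong) (auto simp: GB_def indicator_def t2_def abs_if field_simps split: if_splits)
    also have "\<dots> \<le> ?T t"
      by (rule T.conv_mono[of _ _ C C]) (simp_all add: abs le)
    finally show ?thesis .
  qed
  have AT: "conv K GA t \<le> ?T t" if "\<not> t < ?mid" for t
  proof -
    have "conv K GA t = conv (\<lambda>t. K t * indicator {t. L / 2 \<le> \<bar>t\<bar>} t) GA t"
      unfolding conv_def using that by (intro Bochner_Integration.integral_cong) (auto simp: GA_def indicator_def abs_if field_simps split: if_splits)
    also have "\<dots> \<le> ?T t"
      by (rule T.conv_mono[of _ _ C C]) (simp_all add: abs le)
    finally show ?thesis .
  qed
  have ptw: "conv K G t powr r \<le> (1 + \<epsilon>) * (conv K GA t powr r + conv K GE t powr r) + c * 2 powr r * (conv K GM t powr r + ?T t powr r)" for t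
  proof -
    \<comment> \<open>At each point only one of the two outer pieces contributes beyond the tail
      term, so their maximum suffices. The \<open>r\<close>-th power of a maximum is at most the sum
      of the \<open>r\<close>-th powers, with no cross term.\<close>
    define x where "x = max (conv K GA t) (conv K GE t)"
    define e where "e = conv K GM t + ?T t"
    have x0: "x \<ge> 0" and e0: "e \<ge> 0" using nA[of t] nM[of t] nT[of t] by (auto simp: x_def e_def)
    have "conv K G t \<le> x + e"
      using cG[of t] BE[of t] BT[of t] AT[of t] by (cases "t < ?mid") (auto simp: x_def e_def)
    then have "conv K G t powr r \<le> (x + e) powr r"
      using r1 nA[of t] nM[of t] nB[of t] by (intro powr_mono2) (auto simp: cG)
    also have "\<dots> \<le> (1 + \<epsilon>) * x powr r + c * e powr r" by (rule c(2)[OF x0 e0])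
    also have "\<dots> \<le> (1 + \<epsilon>) * (conv K GA t powr r + conv K GE t powr r) + c * (2 powr r * (conv K GM t powr r + ?T t powr r))"
    proof (intro add_mono mult_left_mono)
      show "x powr r \<le> conv K GA t powr r + conv K GE t powr r" by (simp add: x_def max_def)
      show "e powr r \<le> 2 powr r * (conv K GM t powr r + ?T t powr r)"
        unfolding e_def by (rule powr_add_le_two[OF nM nT]) (use r1 in simp)
    qed (use \<epsilon> c in auto)
    finally show ?thesis by (simp add: mult.assoc)
  qed
  have GMQ: "(\<lambda>t. GM t powr Q) = (\<lambda>t. G t powr Q * indicator {t1..<t2} t)"
    by (auto simp: GM_def indicator_def)
  have iM: "integrable lborel (\<lambda>t. GM t powr Q)"
    unfolding GMQ by (intro mass_integrable clsD(4)[OF G]) simp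
  have mM: "mass GM UNIV = mass G {t1..<t2}"
    unfolding mass_UNIV GMQ by (simp add: mass_def)
  note JM = J_bound[of GM C, OF _ bM iM]
  have iGr: "integrable lborel (\<lambda>t. G t powr r)" and lGr: "(LINT t|lborel. G t powr r) \<le> C powr (r - Q) * mass G UNIV"
    using integrable_powr_exponent_mono[of G lborel C Q r] G0 GC clsD(4)[OF G] rQ by (auto simp: mass_UNIV)
  have iT: "integrable lborel (\<lambda>t. ?T t powr r)" and lT: "(LINT t|lborel. ?T t powr r) \<le> ktail L powr r * (C powr (r - Q) * 1)"
  proof -
    show "integrable lborel (\<lambda>t. ?T t powr r)" by (rule T.conv_young[of G C]) (use G0 GC r1 iGr in auto)
    have "(LINT t|lborel. ?T t powr r) \<le> T.k1 powr r * (LINT t|lborel. G t powr r)"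
      by (rule T.conv_young[of G C]) (use G0 GC r1 iGr in auto)
    also have "\<dots> \<le> T.k1 powr r * (C powr (r - Q) * 1)"
      by (intro mult_left_mono order_trans[OF lGr] m) auto
    finally show "(LINT t|lborel. ?T t powr r) \<le> ktail L powr r * (C powr (r - Q) * 1)"
      unfolding ktail_def T.k1_def .
  qed
  have "J G \<le> (LINT t|lborel. (1 + \<epsilon>) * (conv K GA t powr r + conv K GE t powr r) + c * 2 powr r * (conv K GM t powr r + ?T t powr r))"
    unfolding J_def using iT JM(1) J_integrable[OF GAc(1)] J_integrable[OF GEc]
    by (intro integral_mono J_integrable[OF G] ptw) auto
  also have "\<dots> = (1 + \<epsilon>) * (J GA + J GE) + c * 2 powr r * (J GM + (LINT t|lborel. ?T t powr r))"
    unfolding J_def using iT JM(1) J_integrable[OF GAc(1)] J_integrable[OF GEc] by simp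
  also have "\<dots> \<le> (1 + \<epsilon>) * (Lam * mass G {..<t1} powr (r / Q) + Lam * (mass G {t2..} + exp (\<beta> * Q) / (\<beta> * Q) * mass G {t1..<t2}) powr (r / Q))
     + c * 2 powr r * (k1 powr r * (C powr (r - Q) * mass G {t1..<t2}) + ktail L powr r * (C powr (r - Q) * 1))"
  proof (intro add_mono mult_left_mono)
    show "J GA \<le> Lam * mass G {..<t1} powr (r / Q)" using J_le_Lam_mass[OF GAc(1)] GAc(2) by simp
    have "mass GE UNIV \<le> mass G {t2..} + exp (\<beta> * Q) / (\<beta> * Q) * mass G {t1..<t2}"
    proof -
      have "mass G {t2 - 1..<t2} \<le> mass G {t1..<t2}"
        using L by (intro mass_mono clsD(4)[OF G]) (auto simp: t2_def)
      then have "exp (\<beta> * Q) / (\<beta> * Q) * mass G {t2 - 1..<t2} \<le> exp (\<beta> * Q) / (\<beta> * Q) * mass G {t1..<t2}"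
        using \<beta> Q by (intro mult_left_mono) auto
      then show ?thesis using GEm by linarith
    qed
    then have "mass GE UNIV powr (r / Q) \<le> (mass G {t2..} + exp (\<beta> * Q) / (\<beta> * Q) * mass G {t1..<t2}) powr (r / Q)"
      using mass_nonneg rQ Q by (intro powr_mono2) auto
    then show "J GE \<le> Lam * (mass G {t2..} + exp (\<beta> * Q) / (\<beta> * Q) * mass G {t1..<t2}) powr (r / Q)"
      using J_le_Lam_mass[OF GEc] Lam_pos by (meson less_imp_le mult_left_mono order_trans)
    show "J GM \<le> k1 powr r * (C powr (r - Q) * mass G {t1..<t2})" using JM(2) mM by simp
  qed (use \<epsilon> c lT in auto)
  finally show ?thesis by (simp add: t2_def C_def algebra_simps)
qed

text \<open>Strict superadditivity of \<open>s powr (r / Q)\<close> rules out that a nearly optimal function splits.\<close>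

lemma no_splitting:
  assumes a: "a > 0" and b: "b > 0"
  shows "\<exists>\<nu>>0. \<forall>G t1 L. G \<in> cls \<longrightarrow> mass G UNIV \<le> 1 \<longrightarrow> L \<ge> 1 \<longrightarrow> mass G {t1..<t1 + L} \<le> \<nu> \<longrightarrow> ktail L \<le> \<nu> \<longrightarrow>
    a \<le> mass G {..<t1} \<longrightarrow> b \<le> mass G {t1 + L..} \<longrightarrow> J G \<le> Lam - \<nu>"
proof -
  have "r / Q > 1" using Q rQ by simp
  from powr_split_gap[OF this a b] obtain \<eta> where \<eta>: "\<eta> > 0"
    and gap: "\<And>A B. a \<le> A \<Longrightarrow> b \<le> B \<Longrightarrow> A + B \<le> 1 \<Longrightarrow> A powr (r / Q) + (B + \<eta>) powr (r / Q) \<le> 1 - \<eta>" by blast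
  have r0: "r > 0" using r1 by simp
  from powr_add_le_eps[OF r0 \<eta>] obtain c where c: "c \<ge> 0"
    "\<And>x e. 0 \<le> x \<Longrightarrow> 0 \<le> e \<Longrightarrow> (x + e) powr r \<le> (1 + \<eta>) * x powr r + c * e powr r" by blast
  define c1 where "c1 = exp (\<beta> * Q) / (\<beta> * Q)"
  have c1: "c1 > 0" using \<beta> Q by (simp add: c1_def)
  define c2 where "c2 = c * 2 powr r * exp \<beta> powr (r - Q)"
  have c2: "c2 \<ge> 0" using c by (simp add: c2_def)
  \<comment> \<open>\<open>F \<nu>\<close> collects the errors caused by the mass in the gap and by
    the kernel tail, together with the deficit \<open>\<nu>\<close> to be proved. The gain comes
    from \<open>(1 + \<eta>) * (1 - \<eta>) = 1 - \<eta>\<^sup>2\<close>, so it is enough that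
    \<open>F \<nu>\<close> stays below \<open>Lam * \<eta>\<^sup>2\<close>.\<close>
  define F where "F \<nu> = c2 * (k1 powr r * \<nu> + \<nu> powr r) + \<nu>" for \<nu>
  have "(F \<longlongrightarrow> c2 * (k1 powr r * 0 + 0 powr r) + 0) (at_right 0)"
    unfolding F_def using r0 by (intro tendsto_intros tendsto_powr2) (auto intro: eventually_mono[OF eventually_at_right_less[of 0]])
  then have "\<forall>\<^sub>F \<nu> in at_right 0. F \<nu> < Lam * \<eta>\<^sup>2"
    using r0 Lam_pos \<eta> by (intro order_tendstoD(2)) auto
  moreover have "\<forall>\<^sub>F \<nu> in at_right 0. \<nu> < \<eta> / c1"
    using \<eta> c1 by (intro eventually_mono[OF eventually_at_right_real[of 0 "\<eta> / c1"]]) auto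
  moreover have "\<forall>\<^sub>F \<nu> in at_right 0. \<nu> > (0::real)" by (rule eventually_at_right_less)
  ultimately have "\<forall>\<^sub>F \<nu> in at_right 0. F \<nu> < Lam * \<eta>\<^sup>2 \<and> \<nu> < \<eta> / c1 \<and> \<nu> > 0"
    by eventually_elim auto
  then obtain \<nu> where \<nu>: "F \<nu> < Lam * \<eta>\<^sup>2" "\<nu> < \<eta> / c1" "\<nu> > 0"
    using eventually_happens'[OF trivial_limit_at_right_real] by auto
  show ?thesis
  proof (intro exI[of _ \<nu>] conjI allI impI \<nu>)
    fix G t1 L assume G: "G \<in> cls" and m: "mass G UNIV \<le> 1" and L: "(1::real) \<le> L"
      and g: "mass G {t1..<t1 + L} \<le> \<nu>" and k: "ktail L \<le> \<nu>" and A: "a \<le> mass G {..<t1}" and B: "b \<le> mass G {t1 + L..}"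
    have "mass G {..<t1} + mass G {t1 + L..} = mass G ({..<t1} \<union> {t1 + L..})"
      using L by (intro mass_Un[symmetric] clsD(4)[OF G]) auto
    also have "\<dots> \<le> mass G UNIV" by (intro mass_mono clsD(4)[OF G]) auto
    finally have AB: "mass G {..<t1} + mass G {t1 + L..} \<le> 1" using m by simp
    have cg: "c1 * mass G {t1..<t1 + L} \<le> \<eta>"
    proof -
      have "c1 * mass G {t1..<t1 + L} \<le> c1 * \<nu>" using g c1 by (intro mult_left_mono) auto
      also have "\<dots> \<le> \<eta>" using \<nu>(2) c1 by (simp add: field_simps)
      finally show ?thesis .
    qed
    have "(mass G {t1 + L..} + c1 * mass G {t1..<t1 + L}) powr (r / Q) \<le> (mass G {t1 + L..} + \<eta>) powr (r / Q)"
      using cg c1 mass_nonneg r0 Q by (intro powr_mono2 add_nonneg_nonneg mult_nonneg_nonneg) auto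
    then have 1: "mass G {..<t1} powr (r / Q) + (mass G {t1 + L..} + c1 * mass G {t1..<t1 + L}) powr (r / Q) \<le> 1 - \<eta>"
      using gap[OF A B AB] by linarith
    have "J G \<le> (1 + \<eta>) * Lam * (mass G {..<t1} powr (r / Q) + (mass G {t1 + L..} + c1 * mass G {t1..<t1 + L}) powr (r / Q))
      + c2 * (k1 powr r * mass G {t1..<t1 + L} + ktail L powr r)"
      unfolding c1_def c2_def by (rule dichotomy[OF G m L \<eta> c])
    also have "\<dots> \<le> (1 + \<eta>) * Lam * (1 - \<eta>) + c2 * (k1 powr r * \<nu> + \<nu> powr r)"
      using 1 g k \<eta> c2 Lam_pos ktail_nonneg r0 by (intro add_mono mult_left_mono powr_mono2) auto
    also have "\<dots> = Lam - Lam * \<eta>\<^sup>2 + (F \<nu> - \<nu>)" by (simp add: F_def algebra_simps power2_eq_square)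
    also have "\<dots> \<le> Lam - \<nu>" using \<nu>(1) by simp
    finally show "J G \<le> Lam - \<nu>" .
  qed
qed

end

lemma integrable_indicator_Ico: "integrable lborel (indicator {u..<v} :: real \<Rightarrow> real)"
  by (cases "u \<le> v") (auto intro!: integrable_real_indicator)

section \<open>Vanishing, selection of limits and tightness\<close>

context wconv
begin

lemma cls_translate:
  assumes G: "G \<in> cls"
  shows "(\<lambda>t. G (t + h)) \<in> cls" and "mass (\<lambda>t. G (t + h)) UNIV = mass G UNIV"
    and "J (\<lambda>t. G (t + h)) = J G"
proof -
  have i: "integrable lborel (\<lambda>t. G (t + h) powr Q)"
    using lborel_integrable_real_affine[OF clsD(4)[OF G], of 1 h] by (simp add: add.commute)
  have c: "continuous (at_right t) (\<lambda>t. G (t + h))" for t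
  proof -
    have "(G \<longlongrightarrow> G (t + h)) (at_right (t + h))" using clsD(3)[OF G, of "t + h"] by (simp add: continuous_within)
    moreover have "filterlim (\<lambda>s. s + h) (at_right (t + h)) (at_right t)"
      unfolding filterlim_at using eventually_at_right_less[of t] by (auto intro!: tendsto_intros elim: eventually_mono)
    ultimately have "((\<lambda>t. G (t + h)) \<longlongrightarrow> G (t + h)) (at_right t)"
      by (rule filterlim_compose)
    then show ?thesis by (simp add: continuous_within)
  qed
  have "exp (- \<beta> * t) * G (t + h) \<le> exp (- \<beta> * s) * G (s + h)" if "s \<le> t" for s t
  proof -
    have "exp (\<beta> * h) * (exp (- \<beta> * (t + h)) * G (t + h)) \<le> exp (\<beta> * h) * (exp (- \<beta> * (s + h)) * G (s + h))"
      using clsD(2)[OF G, of "s + h" "t + h"] that by (intro mult_left_mono) auto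
    then show ?thesis by (simp add: mult.assoc[symmetric] exp_add[symmetric] distrib_left)
  qed
  then show "(\<lambda>t. G (t + h)) \<in> cls" unfolding cls_def using i c clsD(1)[OF G] by auto
  show "mass (\<lambda>t. G (t + h)) UNIV = mass G UNIV"
    using lborel_integral_real_affine[of 1 "\<lambda>t. G t powr Q" h] by (simp add: mass_UNIV add.commute)
  show "J (\<lambda>t. G (t + h)) = J G"
    using lborel_integral_real_affine[of 1 "\<lambda>t. conv K G t powr r" h] by (simp add: J_def conv_translate add.commute)
qed

text \<open>Vanishing is excluded because \<open>r > Q\<close>: a function bounded by
  \<open>c\<close> has \<open>J\<close> at most \<open>k1 powr r * c powr (r - Q)\<close>, which
  cannot exceed half the supremum for small \<open>c\<close>.\<close>

lemma cls_not_small: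
  shows "\<exists>c>0. \<forall>G\<in>cls. mass G UNIV \<le> 1 \<longrightarrow> Lam / 2 < J G \<longrightarrow> (\<exists>t. G t > c)"
proof -
  \<comment> \<open>The solution of \<open>(k1 powr r + 1) * c powr (r - Q) = Lam / 2\<close>; the
    added one makes the denominator visibly positive.\<close>
  define c where "c = (Lam / (2 * (k1 powr r + 1))) powr (1 / (r - Q))"
  have kp: "k1 powr r + 1 > 0" by (simp add: add_nonneg_pos)
  have c: "c > 0" using Lam_pos kp by (simp add: c_def)
  have cp: "c powr (r - Q) = Lam / (2 * (k1 powr r + 1))" using rQ Lam_pos kp by (simp add: c_def powr_powr)
  show ?thesis
  proof (rule exI[of _ c], intro conjI c ballI impI)
    fix G assume G: "G \<in> cls" and m: "mass G UNIV \<le> 1" and J: "Lam / 2 < J G"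
    show "\<exists>t. G t > c"
    proof (rule ccontr)
      assume "\<not> (\<exists>t. G t > c)"
      then have "J G \<le> k1 powr r * (c powr (r - Q) * mass G UNIV)"
        by (intro J_bound(2) cls_measurable[OF G] clsD[OF G]) (auto simp: not_less)
      also have "\<dots> \<le> k1 powr r * (c powr (r - Q) * 1)" using m by (intro mult_left_mono) auto
      also have "\<dots> = k1 powr r / (k1 powr r + 1) * (Lam / 2)" by (simp add: cp)
      also have "\<dots> \<le> 1 * (Lam / 2)" using Lam_pos kp by (intro mult_right_mono) (auto simp: divide_le_eq_1)
      finally show False using J by simp
    qed
  qed
qed

text \<open>Helly's theorem needs bounded nondecreasing functions, whereas the weighted profiles are
  nonincreasing and unbounded to the left. The map \<open>exp (- z)\<close> repairs both defects and
  is undone by the logarithm in the limit. Fatou's lemma shows that the mass does not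
  increase.\<close>

lemma helly_cls:
  assumes Y: "\<And>n. Y n \<in> cls" and m: "\<And>n. mass (Y n) UNIV \<le> 1"
  shows "\<exists>s G. strict_mono (s :: nat \<Rightarrow> nat) \<and> G \<in> cls \<and> mass G UNIV \<le> 1 \<and> (AE t in lborel. (\<lambda>n. Y (s n) t) \<longlonglongrightarrow> G t)"
proof -
  define \<phi> where "\<phi> n t = exp (- (exp (- \<beta> * t) * Y n t))" for n t
  have rc: "continuous (at_right t) (\<phi> n)" for n t
    unfolding \<phi>_def by (intro continuous_intros clsD(3)[OF Y])
  have mo: "mono (\<phi> n)" for n
    unfolding \<phi>_def using clsD(2)[OF Y] by (intro monoI) auto
  have bd: "\<bar>\<phi> n t\<bar> \<le> 1" for n t
    using clsD(1)[OF Y] by (simp add: \<phi>_def)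
  from Helly_selection[of \<phi> 1, OF rc mo bd] obtain s F where s: "strict_mono (s :: nat \<Rightarrow> nat)"
    and F: "\<And>t. continuous (at_right t) F" "mono F" "\<And>t. \<bar>F t\<bar> \<le> 1"
    and lim: "\<And>t. continuous (at t) F \<Longrightarrow> (\<lambda>n. \<phi> (s n) t) \<longlonglongrightarrow> F t" by blast
  have cnt: "countable {t. \<not> isCont F t}" by (rule mono_ctble_discont[OF F(2)])
  \<comment> \<open>The uniform pointwise bound on the class keeps the limit away from
    \<open>0\<close> at continuity points, hence everywhere by monotonicity, so its logarithm is
    finite.\<close>
  have lbF: "F t \<ge> exp (- exp (\<beta> - \<beta> * t))" if "isCont F t" for t
  proof (rule LIMSEQ_le_const[OF lim[OF that]], intro exI[of _ 0] allI impI)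
    fix n
    have "exp (- \<beta> * t) * Y (s n) t \<le> exp (- \<beta> * t) * exp \<beta>"
      using cls_bound1[OF Y m] by (intro mult_left_mono) auto
    also have "\<dots> = exp (\<beta> - \<beta> * t)" by (simp add: exp_add[symmetric])
    finally show "exp (- exp (\<beta> - \<beta> * t)) \<le> \<phi> (s n) t" by (simp add: \<phi>_def)
  qed
  have Fpos: "F t > 0" for t
  proof -
    have "uncountable {t - 1<..<t}" by (simp add: uncountable_open_interval)
    then have "\<not> {t - 1<..<t} \<subseteq> {t. \<not> isCont F t}" using cnt countable_subset by blast
    then obtain t' where "t' < t" "isCont F t'" by auto
    then have "0 < F t'" using lbF[of t'] by (smt (verit) exp_gt_zero)
    then show ?thesis using monoD[OF F(2), of t' t] \<open>t' < t\<close> by simp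
  qed
  have F1: "F t \<le> 1" for t using F(3)[of t] by simp
  define G where "G t = exp (\<beta> * t) * (- ln (F t))" for t
  have eG: "exp (- \<beta> * t) * G t = - ln (F t)" for t by (simp add: G_def exp_minus)
  have Gn: "0 \<le> G t" for t using F1 Fpos by (simp add: G_def mult_nonneg_nonpos)
  have Ga: "exp (- \<beta> * t) * G t \<le> exp (- \<beta> * s) * G s" if "s \<le> t" for s t
    unfolding eG using monoD[OF F(2) that] Fpos[of s] Fpos[of t] by simp
  have Gc: "continuous (at_right t) G" for t
    unfolding G_def using Fpos[of t] by (intro continuous_intros F(1)) auto
  have "(\<lambda>n. Y (s n) t) \<longlonglongrightarrow> G t" if "isCont F t" for t
  proof -
    have "(\<lambda>n. exp (\<beta> * t) * (- ln (\<phi> (s n) t))) \<longlonglongrightarrow> G t"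
      unfolding G_def using Fpos[of t] by (intro tendsto_intros lim[OF that]) auto
    moreover have "exp (\<beta> * t) * (- ln (\<phi> (s n) t)) = Y (s n) t" for n
      by (simp add: \<phi>_def, simp add: exp_minus)
    ultimately show ?thesis by simp
  qed
  moreover have "AE t in lborel. isCont F t"
  proof -
    have "{t. \<not> isCont F t} \<in> null_sets lborel" by (rule countable_imp_null_set_lborel[OF cnt])
    then show ?thesis by (rule AE_I') auto
  qed
  ultimately have conv: "AE t in lborel. (\<lambda>n. Y (s n) t) \<longlonglongrightarrow> G t" by (auto elim: eventually_mono)
  have [measurable]: "Y n \<in> borel_measurable borel" for n by (rule cls_measurable[OF Y])
  have [measurable]: "G \<in> borel_measurable borel" using Ga by (rule exp_antimono_measurable)
  have nY: "(\<integral>\<^sup>+t. ennreal (Y n t powr Q) \<partial>lborel) \<le> 1" for n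
    using m[of n] by (subst nn_integral_eq_integral[OF clsD(4)[OF Y]]) (auto simp: mass_UNIV ennreal_le_1)
  have "(\<integral>\<^sup>+t. ennreal (G t powr Q) \<partial>lborel) = (\<integral>\<^sup>+t. liminf (\<lambda>n. ennreal (Y (s n) t powr Q)) \<partial>lborel)"
  proof (rule nn_integral_cong_AE)
    show "AE t in lborel. ennreal (G t powr Q) = liminf (\<lambda>n. ennreal (Y (s n) t powr Q))"
      using conv
    proof eventually_elim
      case (elim t)
      have "(\<lambda>n. Y (s n) t powr Q) \<longlonglongrightarrow> G t powr Q"
        using elim Q clsD(1)[OF Y] by (intro tendsto_powr2 tendsto_const) auto
      then have "(\<lambda>n. ennreal (Y (s n) t powr Q)) \<longlonglongrightarrow> ennreal (G t powr Q)" by (rule tendsto_ennrealI)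
      then show ?case by (intro lim_imp_Liminf[symmetric]) auto
    qed
  qed
  also have "\<dots> \<le> liminf (\<lambda>n. \<integral>\<^sup>+t. ennreal (Y (s n) t powr Q) \<partial>lborel)"
    by (rule nn_integral_liminf) simp
  also have "\<dots> \<le> 1" by (intro Liminf_le) (auto simp: nY)
  finally have nG: "(\<integral>\<^sup>+t. ennreal (G t powr Q) \<partial>lborel) \<le> 1" .
  then have iG: "integrable lborel (\<lambda>t. G t powr Q)"
    by (intro integrableI_nonneg) (auto intro: le_less_trans)
  have "mass G UNIV \<le> 1"
    using nG by (subst (asm) nn_integral_eq_integral[OF iG]) (auto simp: mass_UNIV ennreal_le_1)
  then show ?thesis using s conv iG Gn Ga Gc unfolding cls_def by blast
qed

section \<open>Strong convergence of a maximising sequence centred at the origin\<close>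

context
  fixes X :: "nat \<Rightarrow> real \<Rightarrow> real" and G :: "real \<Rightarrow> real" and c0 :: real
  assumes X: "\<And>n. X n \<in> cls" "\<And>n. mass (X n) UNIV \<le> 1" and G: "G \<in> cls" "mass G UNIV \<le> 1"
    and lim: "AE t in lborel. (\<lambda>n. X n t) \<longlonglongrightarrow> G t"
    and JX: "(\<lambda>n. J (X n)) \<longlonglongrightarrow> Lam" and c0: "c0 > 0" "\<And>n. X n 0 \<ge> c0"
begin

lemma [measurable]: "X n \<in> borel_measurable borel" "G \<in> borel_measurable borel"
  using cls_measurable X G by auto

lemma diff_bound: "\<bar>X n t - G t\<bar> \<le> exp \<beta>"
  using cls_bound1[OF X, of n t] cls_bound1[OF G, of t] clsD(1)[OF X(1), of n t] clsD(1)[OF G(1), of t] by linarith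

lemma local_mass_tendsto: "(\<lambda>n. mass (X n) {u..<v}) \<longlonglongrightarrow> mass G {u..<v}"
  unfolding mass_def
proof (rule integral_dominated_convergence[where w="\<lambda>t. exp (\<beta> * Q) * indicator {u..<v} t"])
  show "AE t in lborel. (\<lambda>n. X n t powr Q * indicator {u..<v} t) \<longlonglongrightarrow> G t powr Q * indicator {u..<v} t"
    using lim
  proof eventually_elim
    case (elim t)
    then show ?case using Q clsD(1)[OF X(1)] by (intro tendsto_intros tendsto_powr2) auto
  qed
  show "AE t in lborel. norm (X n t powr Q * indicator {u..<v} t) \<le> exp (\<beta> * Q) * indicator {u..<v} t" for n
  proof (rule AE_I2)
    fix t
    have "X n t powr Q \<le> exp \<beta> powr Q"
      using cls_bound1[OF X, of n t] clsD(1)[OF X(1)] Q by (intro powr_mono2) auto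
    then show "norm (X n t powr Q * indicator {u..<v} t) \<le> exp (\<beta> * Q) * indicator {u..<v} t"
      by (simp add: indicator_def exp_powr_real)
  qed
qed (auto intro!: integrable_mult_right integrable_indicator_Ico)

lemma local_diff_tendsto: "(\<lambda>n. LINT t|lborel. \<bar>X n t - G t\<bar> powr Q * indicator {u..<v} t) \<longlonglongrightarrow> 0"
proof -
  have "(\<lambda>n. LINT t|lborel. \<bar>X n t - G t\<bar> powr Q * indicator {u..<v} t) \<longlonglongrightarrow> (LINT t|(lborel::real measure). 0)"
  proof (rule integral_dominated_convergence[where w="\<lambda>t. exp (\<beta> * Q) * indicator {u..<v} t"])
    show "AE t in lborel. (\<lambda>n. \<bar>X n t - G t\<bar> powr Q * indicator {u..<v} t) \<longlonglongrightarrow> 0"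
      using lim
    proof eventually_elim
      case (elim t)
      have "(\<lambda>n. \<bar>X n t - G t\<bar> powr Q * indicator {u..<v} t) \<longlonglongrightarrow> \<bar>G t - G t\<bar> powr Q * indicator {u..<v} t"
        using Q elim by (intro tendsto_intros tendsto_powr2) auto
      then show ?case by simp
    qed
    show "AE t in lborel. norm (\<bar>X n t - G t\<bar> powr Q * indicator {u..<v} t) \<le> exp (\<beta> * Q) * indicator {u..<v} t" for n
    proof (rule AE_I2)
      fix t
      have "\<bar>X n t - G t\<bar> powr Q \<le> exp \<beta> powr Q"
        using diff_bound Q by (intro powr_mono2) auto
      then show "norm (\<bar>X n t - G t\<bar> powr Q * indicator {u..<v} t) \<le> exp (\<beta> * Q) * indicator {u..<v} t"
        by (simp add: indicator_def exp_powr_real)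
    qed
  qed (auto intro!: integrable_mult_right integrable_indicator_Ico)
  then show ?thesis by simp
qed

text \<open>The value at \<open>0\<close> is bounded below, and going left by at most one costs at
  most \<open>exp (- \<beta>)\<close>. A fixed amount of mass therefore stays in one fixed interval
  and serves as the first of the two pieces in \<open>no_splitting\<close>.\<close>

lemma core_mass:
  "(exp (- \<beta>) * c0) powr Q > 0" "(exp (- \<beta>) * c0) powr Q \<le> mass (X n) {-1..<0}"
proof -
  show "(exp (- \<beta>) * c0) powr Q > 0" using c0 by simp
  have "(exp (- \<beta>) * c0) powr Q = (LINT t|lborel. (exp (- \<beta>) * c0) powr Q * indicator {-1..<0::real} t)" by simp
  also have "\<dots> \<le> mass (X n) {-1..<0}"
    unfolding mass_def
  proof (rule integral_mono[OF _ mass_integrable[OF clsD(4)[OF X(1)]]])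
    fix t :: real
    show "(exp (- \<beta>) * c0) powr Q * indicator {-1..<0} t \<le> X n t powr Q * indicator {-1..<0} t"
    proof (cases "t \<in> {-1..<0}")
      case True
      have "\<beta> * (- 1) \<le> \<beta> * t" using True \<beta> by (intro mult_left_mono) auto
      then have "exp (- \<beta>) \<le> exp (- \<beta> * (0 - t))" by simp
      then have "exp (- \<beta>) * c0 \<le> exp (- \<beta> * (0 - t)) * X n 0" using c0 by (intro mult_mono) auto
      also have "\<dots> \<le> X n t" using True by (intro cls_ratio X) auto
      finally show ?thesis using True c0 Q by (auto intro!: powr_mono2)
    qed simp
  qed (auto intro!: integrable_mult_right integrable_indicator_Ico)
  finally show "(exp (- \<beta>) * c0) powr Q \<le> mass (X n) {-1..<0}" .
qed

lemma mass_tail_G: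
  "(\<lambda>m. mass G {real m..}) \<longlonglongrightarrow> 0" "(\<lambda>m. mass G {..<- real m}) \<longlonglongrightarrow> 0"
proof -
  have *: "(\<lambda>m. mass G (S m)) \<longlonglongrightarrow> 0"
    if S: "\<And>m. S m \<in> sets borel" and ev: "\<And>t. \<forall>\<^sub>F m in sequentially. t \<notin> S m" for S :: "nat \<Rightarrow> real set"
  proof -
    have "(\<lambda>m. mass G (S m)) \<longlonglongrightarrow> (LINT t|(lborel::real measure). 0)"
      unfolding mass_def
    proof (rule integral_dominated_convergence[where w="\<lambda>t. G t powr Q"])
      show "AE t in lborel. (\<lambda>m. G t powr Q * indicator (S m) t) \<longlonglongrightarrow> 0"
      proof (rule AE_I2)
        fix t
        have "\<forall>\<^sub>F m in sequentially. 0 = G t powr Q * indicator (S m) t"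
          using ev[of t] by eventually_elim simp
        then show "(\<lambda>m. G t powr Q * indicator (S m) t) \<longlonglongrightarrow> 0"
          by (rule Lim_transform_eventually[OF tendsto_const])
      qed
    qed (use S clsD(4)[OF G(1)] in \<open>auto simp: indicator_def\<close>)
    then show ?thesis by simp
  qed
  have "\<forall>\<^sub>F m in sequentially. t < real m" for t
    using filterlim_real_sequentially by (simp add: filterlim_at_top_dense)
  then have ev: "\<forall>\<^sub>F m in sequentially. \<bar>t\<bar> < real m" for t :: real by blast
  have "\<forall>\<^sub>F m in sequentially. t \<notin> {real m..}" for t :: real
    using ev[of t] by (rule eventually_mono) auto
  then show "(\<lambda>m. mass G {real m..}) \<longlonglongrightarrow> 0" by (intro *) simp_all
  have "\<forall>\<^sub>F m in sequentially. t \<notin> {..<- real m}" for t :: real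
    using ev[of t] by (rule eventually_mono) auto
  then show "(\<lambda>m. mass G {..<- real m}) \<longlonglongrightarrow> 0" by (intro *) simp_all
qed

text \<open>The limit has little mass beyond some \<open>m\<close>, and local convergence transfers
  this to the window \<open>{m..<2 m}\<close> of the sequence. Substantial mass beyond
  \<open>2 m\<close> would then be separated from the core by a wide, nearly empty gap, and
  \<open>J\<close> would stay below the supremum by a fixed amount.\<close>

lemma tight_right:
  assumes \<delta>: "\<delta> > 0"
  shows "\<exists>T\<ge>1. \<forall>\<^sub>F n in sequentially. mass (X n) {T..} \<le> \<delta>"
proof -
  let ?a = "(exp (- \<beta>) * c0) powr Q"
  from no_splitting[OF core_mass(1) \<delta>] obtain \<nu> where \<nu>: "\<nu> > 0"
    and ns: "\<And>G t1 L. G \<in> cls \<Longrightarrow> mass G UNIV \<le> 1 \<Longrightarrow> L \<ge> 1 \<Longrightarrow> mass G {t1..<t1 + L} \<le> \<nu> \<Longrightarrow> ktail L \<le> \<nu> \<Longrightarrow>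
      ?a \<le> mass G {..<t1} \<Longrightarrow> \<delta> \<le> mass G {t1 + L..} \<Longrightarrow> J G \<le> Lam - \<nu>" by blast
  have "\<forall>\<^sub>F m in sequentially. ktail (real m) < \<nu> \<and> mass G {real m..} < \<nu> \<and> m \<ge> 1"
    using order_tendstoD(2)[OF ktail_tendsto \<nu>] order_tendstoD(2)[OF mass_tail_G(1) \<nu>] eventually_ge_at_top[of 1]
    by eventually_elim auto
  then obtain m where m: "ktail (real m) < \<nu>" "mass G {real m..} < \<nu>" "m \<ge> 1"
    by (auto simp: eventually_sequentially)
  have "mass G {real m..<real m + real m} \<le> mass G {real m..}"
    by (intro mass_mono clsD(4)[OF G(1)]) auto
  then have "\<forall>\<^sub>F n in sequentially. mass (X n) {real m..<real m + real m} < \<nu>"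
    using m by (intro order_tendstoD(2)[OF local_mass_tendsto]) auto
  moreover have "\<forall>\<^sub>F n in sequentially. Lam - \<nu> < J (X n)"
    using \<nu> by (intro order_tendstoD(1)[OF JX]) auto
  ultimately have "\<forall>\<^sub>F n in sequentially. mass (X n) {real m + real m..} \<le> \<delta>"
  proof eventually_elim
    case (elim n)
    have "mass (X n) {-1..<0} \<le> mass (X n) {..<real m}"
      by (intro mass_mono clsD(4)[OF X(1)]) auto
    then have "?a \<le> mass (X n) {..<real m}" using core_mass(2)[of n] by linarith
    then show ?case using ns[OF X, of "real m" n "real m"] elim m by linarith
  qed
  then show ?thesis using m by (intro exI[of _ "real m + real m"]) auto
qed

lemma tight_left:
  assumes \<delta>: "\<delta> > 0"
  shows "\<exists>T\<ge>1. \<forall>\<^sub>F n in sequentially. mass (X n) {..<- T} \<le> \<delta>"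
proof -
  let ?a = "(exp (- \<beta>) * c0) powr Q"
  from no_splitting[OF \<delta> core_mass(1)] obtain \<nu> where \<nu>: "\<nu> > 0"
    and ns: "\<And>G t1 L. G \<in> cls \<Longrightarrow> mass G UNIV \<le> 1 \<Longrightarrow> L \<ge> 1 \<Longrightarrow> mass G {t1..<t1 + L} \<le> \<nu> \<Longrightarrow> ktail L \<le> \<nu> \<Longrightarrow>
      \<delta> \<le> mass G {..<t1} \<Longrightarrow> ?a \<le> mass G {t1 + L..} \<Longrightarrow> J G \<le> Lam - \<nu>" by blast
  have "\<forall>\<^sub>F m in sequentially. ktail (real m) < \<nu> \<and> mass G {..<- real m} < \<nu> \<and> m \<ge> 1"
    using order_tendstoD(2)[OF ktail_tendsto \<nu>] order_tendstoD(2)[OF mass_tail_G(2) \<nu>] eventually_ge_at_top[of 1]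
    by eventually_elim auto
  then obtain m where m: "ktail (real m) < \<nu>" "mass G {..<- real m} < \<nu>" "m \<ge> 1"
    by (auto simp: eventually_sequentially)
  define t1 where "t1 = - real m - real m"
  have t1: "t1 + real m = - real m" by (simp add: t1_def)
  have "mass G {t1..<t1 + real m} \<le> mass G {..<- real m}"
    unfolding t1 by (intro mass_mono clsD(4)[OF G(1)]) auto
  then have "\<forall>\<^sub>F n in sequentially. mass (X n) {t1..<t1 + real m} < \<nu>"
    using m by (intro order_tendstoD(2)[OF local_mass_tendsto]) auto
  moreover have "\<forall>\<^sub>F n in sequentially. Lam - \<nu> < J (X n)"
    using \<nu> by (intro order_tendstoD(1)[OF JX]) auto
  ultimately have "\<forall>\<^sub>F n in sequentially. mass (X n) {..<t1} \<le> \<delta>"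
  proof eventually_elim
    case (elim n)
    have "mass (X n) {-1..<0} \<le> mass (X n) {- real m..}"
      using m by (intro mass_mono clsD(4)[OF X(1)]) auto
    then have "?a \<le> mass (X n) {t1 + real m..}" using core_mass(2)[of n] unfolding t1 by linarith
    then show ?case using ns[OF X, of "real m" n t1] elim m by linarith
  qed
  then show ?thesis using m by (intro exI[of _ "- t1"]) (auto simp: t1_def)
qed

text \<open>Tightness upgrades convergence almost everywhere to convergence in the
  \<open>Q\<close>-norm. The differences have bounded values, so their \<open>J\<close> tends to
  zero by \<open>J_bound\<close>, and \<open>powr_add_le_eps\<close> passes the supremum to the
  limit with a factor \<open>1 + \<epsilon>\<close> that is removed at the end.\<close>

lemma limit_maximises: "J G = Lam"
proof -
  define D where "D n t = \<bar>X n t - G t\<bar>" for n t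
  have [measurable]: "D n \<in> borel_measurable borel" for n unfolding D_def[abs_def] by measurable
  have DQ: "D n t powr Q \<le> X n t powr Q + G t powr Q" for n t
  proof -
    have "D n t \<le> max (X n t) (G t)" using clsD(1)[OF X(1), of n t] clsD(1)[OF G(1), of t] by (auto simp: D_def)
    then have "D n t powr Q \<le> max (X n t) (G t) powr Q" using Q by (intro powr_mono2) (auto simp: D_def)
    also have "\<dots> \<le> X n t powr Q + G t powr Q" by (simp add: max_def)
    finally show ?thesis .
  qed
  have iD: "integrable lborel (\<lambda>t. D n t powr Q)" for n
    by (rule Bochner_Integration.integrable_bound[OF Bochner_Integration.integrable_add[OF clsD(4)[OF X(1)[of n]] clsD(4)[OF G(1)]]])
       (auto intro!: AE_I2 order_trans[OF DQ])
  \<comment> \<open>Five contributions: the two tails of the sequence, the two tails of the limit,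
    and the difference on the middle interval.\<close>
  have small: "\<forall>\<^sub>F n in sequentially. mass (D n) UNIV < 5 * \<delta>" if \<delta>: "\<delta> > 0" for \<delta>
  proof -
    obtain T1 where T1: "T1 \<ge> 1" "\<forall>\<^sub>F n in sequentially. mass (X n) {T1..} \<le> \<delta>" using tight_right[OF \<delta>] by blast
    obtain T2 where T2: "T2 \<ge> 1" "\<forall>\<^sub>F n in sequentially. mass (X n) {..<- T2} \<le> \<delta>" using tight_left[OF \<delta>] by blast
    have "\<forall>\<^sub>F m in sequentially. mass G {real m..} < \<delta> \<and> mass G {..<- real m} < \<delta> \<and> max T1 T2 < real m"
      using order_tendstoD(2)[OF mass_tail_G(1) \<delta>] order_tendstoD(2)[OF mass_tail_G(2) \<delta>]
        filterlim_at_top_dense[THEN iffD1, OF filterlim_real_sequentially, rule_format, of "max T1 T2"]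
      by eventually_elim auto
    then obtain m where m: "mass G {real m..} < \<delta>" "mass G {..<- real m} < \<delta>" "T1 < real m" "T2 < real m"
      by (auto simp: eventually_sequentially)
    have "\<forall>\<^sub>F n in sequentially. (LINT t|lborel. \<bar>X n t - G t\<bar> powr Q * indicator {- real m..<real m} t) < \<delta>"
      using \<delta> by (intro order_tendstoD(2)[OF local_diff_tendsto]) auto
    with T1(2) T2(2) show ?thesis
    proof eventually_elim
      case (elim n)
      have tail: "mass (D n) S \<le> mass (X n) S + mass G S" if "S \<in> sets borel" for S
      proof -
        have "mass (D n) S \<le> (LINT t|lborel. X n t powr Q * indicator S t + G t powr Q * indicator S t)"
          unfolding mass_def using that DQ
          by (intro integral_mono Bochner_Integration.integrable_add mass_integrable iD clsD(4)[OF X(1)] clsD(4)[OF G(1)])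
             (auto simp: indicator_def)
        also have "\<dots> = mass (X n) S + mass G S"
          unfolding mass_def using that by (intro Bochner_Integration.integral_add mass_integrable clsD(4)[OF X(1)] clsD(4)[OF G(1)])
        finally show ?thesis .
      qed
      have "UNIV = ({..<- real m} \<union> {real m..}) \<union> {- real m..<real m}" by auto
      then have "mass (D n) UNIV = mass (D n) (({..<- real m} \<union> {real m..}) \<union> {- real m..<real m})" by simp
      also have "\<dots> = mass (D n) {..<- real m} + mass (D n) {real m..} + mass (D n) {- real m..<real m}"
        by (subst mass_Un[OF iD], simp, simp, force, subst mass_Un[OF iD]) auto
      also have "\<dots> < (\<delta> + \<delta>) + (\<delta> + \<delta>) + \<delta>"
      proof (intro add_le_less_mono add_mono)
        have "mass (X n) {..<- real m} \<le> mass (X n) {..<- T2}" using m by (intro mass_mono clsD(4)[OF X(1)]) auto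
        then show "mass (D n) {..<- real m} \<le> \<delta> + \<delta>" using tail[of "{..<- real m}"] m elim by simp
        have "mass (X n) {real m..} \<le> mass (X n) {T1..}" using m by (intro mass_mono clsD(4)[OF X(1)]) auto
        then show "mass (D n) {real m..} \<le> \<delta> + \<delta>" using tail[of "{real m..}"] m elim by simp
        show "mass (D n) {- real m..<real m} < \<delta>" using elim by (simp add: mass_def D_def)
      qed
      finally show ?case by simp
    qed
  qed
  have mD: "(\<lambda>n. mass (D n) UNIV) \<longlonglongrightarrow> 0"
  proof (rule order_tendstoI)
    fix a :: real assume "a < 0"
    then show "\<forall>\<^sub>F n in sequentially. a < mass (D n) UNIV" using mass_nonneg less_le_trans by (intro always_eventually) blast
  next
    fix a :: real assume "0 < a"
    then show "\<forall>\<^sub>F n in sequentially. mass (D n) UNIV < a" using small[of "a / 5"] by simp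
  qed
  have Db: "0 \<le> D n t" "D n t \<le> exp \<beta>" for n t using diff_bound by (auto simp: D_def)
  have JDlim: "(\<lambda>n. J (D n)) \<longlonglongrightarrow> 0"
  proof (rule tendsto_sandwich[OF _ _ tendsto_const])
    show "\<forall>\<^sub>F n in sequentially. J (D n) \<le> k1 powr r * (exp \<beta> powr (r - Q) * mass (D n) UNIV)"
      using J_bound(2)[OF _ Db iD] by simp
    have "(\<lambda>n. k1 powr r * (exp \<beta> powr (r - Q) * mass (D n) UNIV)) \<longlonglongrightarrow> k1 powr r * (exp \<beta> powr (r - Q) * 0)"
      by (intro tendsto_intros mD)
    then show "(\<lambda>n. k1 powr r * (exp \<beta> powr (r - Q) * mass (D n) UNIV)) \<longlonglongrightarrow> 0" by simp
  qed (simp add: J_nonneg)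
  have G0: "0 \<le> G t" "G t \<le> exp \<beta>" and X0: "0 \<le> X n t" "X n t \<le> exp \<beta>" for n t
    using clsD(1)[OF G(1)] cls_bound1[OF G] clsD(1)[OF X(1)] cls_bound1[OF X] by auto
  have "Lam \<le> (1 + \<epsilon>) * J G" if \<epsilon>: "\<epsilon> > 0" for \<epsilon>
  proof -
    have r0: "r > 0" using r1 by simp
    from powr_add_le_eps[OF r0 \<epsilon>] obtain c where c: "c \<ge> 0"
      "\<And>x e. 0 \<le> x \<Longrightarrow> 0 \<le> e \<Longrightarrow> (x + e) powr r \<le> (1 + \<epsilon>) * x powr r + c * e powr r" by blast
    have "J (X n) \<le> (1 + \<epsilon>) * J G + c * J (D n)" for n
    proof -
      have "conv K (X n) t powr r \<le> (1 + \<epsilon>) * conv K G t powr r + c * conv K (D n) t powr r" for t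
      proof -
        have "conv K (X n) t \<le> conv K (\<lambda>t. G t + D n t) t"
        proof (rule conv_mono[of _ _ "exp \<beta>" "2 * exp \<beta>"])
          show "\<bar>X n t\<bar> \<le> exp \<beta>" "\<bar>G t + D n t\<bar> \<le> 2 * exp \<beta>" "X n t \<le> G t + D n t" for t
            using G0[of t] X0[of n t] Db[of n t] by (auto simp: D_def)
        qed simp_all
        also have "\<dots> = conv K G t + conv K (D n) t"
          by (rule conv_add[of _ _ "exp \<beta>" "exp \<beta>"]) (use G0 Db in \<open>auto simp: abs_le_iff\<close>)
        finally have "conv K (X n) t powr r \<le> (conv K G t + conv K (D n) t) powr r"
          using r0 conv_nonneg[OF _ X0] by (intro powr_mono2) auto
        also have "\<dots> \<le> (1 + \<epsilon>) * conv K G t powr r + c * conv K (D n) t powr r"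
          by (intro c(2) conv_nonneg[OF _ G0] conv_nonneg[OF _ Db]) auto
        finally show ?thesis .
      qed
      then have "J (X n) \<le> (LINT t|lborel. (1 + \<epsilon>) * conv K G t powr r + c * conv K (D n) t powr r)"
        unfolding J_def using J_bound(1)[OF _ Db iD] J_integrable[OF G(1)]
        by (intro integral_mono J_integrable X) auto
      also have "\<dots> = (1 + \<epsilon>) * J G + c * J (D n)"
        unfolding J_def using J_bound(1)[OF _ Db iD] J_integrable[OF G(1)] by simp
      finally show ?thesis .
    qed
    moreover have "(\<lambda>n. (1 + \<epsilon>) * J G + c * J (D n)) \<longlonglongrightarrow> (1 + \<epsilon>) * J G + c * 0"
      by (intro tendsto_intros JDlim)
    ultimately show ?thesis using LIMSEQ_le[OF JX] by auto
  qed
  then have "Lam \<le> J G"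
  proof -
    assume *: "\<And>\<epsilon>. \<epsilon> > 0 \<Longrightarrow> Lam \<le> (1 + \<epsilon>) * J G"
    have "((\<lambda>\<epsilon>. (1 + \<epsilon>) * J G) \<longlongrightarrow> (1 + 0) * J G) (at_right 0)" by (intro tendsto_intros)
    moreover have "\<forall>\<^sub>F \<epsilon> in at_right 0. Lam \<le> (1 + \<epsilon>) * J G"
      using eventually_at_right_less[of "0::real"] by eventually_elim (rule *)
    ultimately show ?thesis using tendsto_lowerbound[of "\<lambda>\<epsilon>. (1 + \<epsilon>) * J G" "(1 + 0) * J G" "at_right 0" Lam] by simp
  qed
  then show ?thesis using J_le_Lam[OF G] by simp
qed

end

theorem maximiser_exists: "\<exists>G\<in>cls. mass G UNIV \<le> 1 \<and> J G = Lam"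
proof -
  obtain c where c: "c > 0" and cs: "\<And>G. G \<in> cls \<Longrightarrow> mass G UNIV \<le> 1 \<Longrightarrow> Lam / 2 < J G \<Longrightarrow> \<exists>t. G t > c"
    using cls_not_small by blast
  \<comment> \<open>The offset \<open>2\<close> keeps every member above \<open>Lam / 2\<close>, so
    that each one exceeds the threshold \<open>c\<close> somewhere; it is translated to bring such a
    point to the origin.\<close>
  have "\<exists>Y. Y \<in> cls \<and> mass Y UNIV \<le> 1 \<and> Lam - Lam / (real n + 2) < J Y \<and> Y 0 \<ge> c" for n
  proof -
    let ?S = "J ` {G \<in> cls. mass G UNIV \<le> 1}"
    have ne: "?S \<noteq> {}"
    proof -
      have "(\<lambda>t. 0) \<in> cls" by (simp add: cls_def)
      moreover have "mass (\<lambda>t. 0) UNIV \<le> 1" by (simp add: mass_def)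
      ultimately show ?thesis by blast
    qed
    have "Lam - Lam / (real n + 2) < Sup ?S" using Lam_pos by (simp add: Lam_def[symmetric])
    then obtain G where G: "G \<in> cls" "mass G UNIV \<le> 1" "Lam - Lam / (real n + 2) < J G"
      using less_cSupE[OF _ ne] by blast
    have "Lam / (real n + 2) \<le> Lam / 2" using Lam_pos by (intro divide_left_mono) auto
    then have "Lam / 2 < J G" using G(3) by simp
    then obtain t where t: "G t > c" using cs G by blast
    show ?thesis
      using G t cls_translate[OF G(1), of t] by (intro exI[of _ "\<lambda>s. G (s + t)"]) auto
  qed
  then obtain Y where Y: "\<And>n. Y n \<in> cls" "\<And>n. mass (Y n) UNIV \<le> 1" "\<And>n. Lam - Lam / (real n + 2) < J (Y n)" "\<And>n. Y n 0 \<ge> c"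
    by metis
  have JY: "(\<lambda>n. J (Y n)) \<longlonglongrightarrow> Lam"
  proof (rule tendsto_sandwich[OF _ _ _ tendsto_const])
    show "\<forall>\<^sub>F n in sequentially. Lam - Lam / (real n + 2) \<le> J (Y n)" by (intro always_eventually allI less_imp_le Y(3))
    show "\<forall>\<^sub>F n in sequentially. J (Y n) \<le> Lam" using J_le_Lam Y by auto
    show "(\<lambda>n. Lam - Lam / (real n + 2)) \<longlonglongrightarrow> Lam"
    proof -
      have z: "(\<lambda>n. 1 / (real n + 2)) \<longlonglongrightarrow> 0" by real_asymp
      have "(\<lambda>n. Lam - Lam * (1 / (real n + 2))) \<longlonglongrightarrow> Lam - Lam * 0" by (intro tendsto_intros z)
      then show ?thesis by simp
    qed
  qed
  obtain s G where s: "strict_mono (s :: nat \<Rightarrow> nat)" and G: "G \<in> cls" "mass G UNIV \<le> 1"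
    and lim: "AE t in lborel. (\<lambda>n. Y (s n) t) \<longlonglongrightarrow> G t"
    using helly_cls[of Y, OF Y(1,2)] by blast
  have "J G = Lam"
  proof (rule limit_maximises[where X="\<lambda>n. Y (s n)", OF Y(1,2) G lim _ c Y(4)])
    show "(\<lambda>n. J (Y (s n))) \<longlonglongrightarrow> Lam" using LIMSEQ_subseq_LIMSEQ[OF JY s] by (simp add: comp_def)
  qed
  then show ?thesis using G by blast
qed

end

section \<open>The convolution system\<close>

text \<open>For fixed \<open>x\<close>, the function \<open>h s = s powr q / q - x * s\<close>
  strictly decreases up to \<open>m = x powr (p - 1)\<close>, strictly increases afterwards, and has
  minimum \<open>- (x powr p / p)\<close>. Equality says that \<open>y\<close> attains it.
  Derivatives are used at positive arguments only, since \<open>m\<close> or \<open>y\<close> may be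
  \<open>0\<close>.\<close>

lemma Youngs_equality:
  fixes x y p q :: real
  assumes pq: "p > 1" "q > 1" "1 / p + 1 / q = 1" and xy: "x \<ge> 0" "y \<ge> 0"
    and eq: "x powr p / p + y powr q / q = x * y"
  shows "y = x powr (p - 1)"
proof (rule ccontr)
  assume ne: "y \<noteq> x powr (p - 1)"
  define m where "m = x powr (p - 1)"
  define h where "h s = s powr q / q - x * s" for s
  have qp: "(p - 1) * q = p" using pq by (simp add: field_simps)
  have mq: "m powr q = x powr p" by (simp add: m_def powr_powr qp)
  have xm: "x * m = x powr p"
    using xy pq by (cases "x = 0") (auto simp: m_def powr_diff)
  have mq1: "m powr (q - 1) = x"
  proof -
    have "(p - 1) * (q - 1) = 1" using pq by (simp add: field_simps)
    then show ?thesis using xy by (simp add: m_def powr_powr)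
  qed
  have hm: "h m = - (x powr p / p)"
  proof -
    have "1 / q = 1 - 1 / p" using pq by simp
    then have "x powr p / q = x powr p * (1 - 1 / p)" by (metis divide_inverse inverse_eq_divide)
    moreover have "h m = x powr p / q - x powr p" by (simp add: h_def mq xm)
    ultimately show ?thesis by (simp add: algebra_simps)
  qed
  have hy: "h y = h m" using eq by (simp add: hm) (simp add: h_def)
  have m0: "m \<ge> 0" by (simp add: m_def)
  have cont: "continuous_on S h" if "S \<subseteq> {0..}" for S
    unfolding h_def using that pq by (intro continuous_intros continuous_on_powr') auto
  have der: "(h has_real_derivative (s powr (q - 1) - x)) (at s)" if "s > 0" for s
    unfolding h_def using that pq by (auto intro!: derivative_eq_intros simp: field_simps)
  have dif: "h differentiable (at s)" if "s > 0" for s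
    using der[OF that] real_differentiable_def by blast
  consider "m < y" | "y < m" using ne[folded m_def] by linarith
  then show False
  proof cases
    case 1
    have "\<exists>l z. m < z \<and> z < y \<and> DERIV h z :> l \<and> h y - h m = (y - m) * l"
      using 1 m0 by (intro MVT cont dif) auto
    then obtain l z where z: "m < z" "z < y" "DERIV h z :> l" "h y - h m = (y - m) * l" by blast
    have "l = z powr (q - 1) - x" using DERIV_unique[OF z(3) der] z m0 by simp
    moreover have "m powr (q - 1) < z powr (q - 1)" using z m0 pq by (intro powr_less_mono2) auto
    ultimately have "l > 0" by (simp add: mq1)
    then show False using z(4) 1 hy by simp
  next
    case 2
    have "\<exists>l z. y < z \<and> z < m \<and> DERIV h z :> l \<and> h m - h y = (m - y) * l"
      using 2 xy by (intro MVT cont dif) auto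
    then obtain l z where z: "y < z" "z < m" "DERIV h z :> l" "h m - h y = (m - y) * l" by blast
    have "l = z powr (q - 1) - x" using DERIV_unique[OF z(3) der] z xy by simp
    moreover have "z powr (q - 1) < m powr (q - 1)" using z xy pq by (intro powr_less_mono2) auto
    ultimately have "l < 0" by (simp add: mq1)
    then show False using z(4) 2 hy by simp
  qed
qed

section \<open>Kernels continuous off the origin and their \<open>L^1\<close> modulus of
  continuity\<close>

locale cont_kernel = kernel +
  assumes K_cont: "\<And>t. t \<noteq> 0 \<Longrightarrow> isCont K t"
begin

definition modL1 :: "real \<Rightarrow> real" where
  "modL1 h = (LINT t|lborel. \<bar>K (t + h) - K t\<bar>)"

lemma K_int_translate: "integrable lborel (\<lambda>t. K (t + h))"
  using lborel_integrable_real_affine[OF K_int, of 1 h] by (simp add: add.commute)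

lemma modL1_tendsto: "(modL1 \<longlongrightarrow> 0) (at 0)"
  unfolding tendsto_at_iff_sequentially comp_def
proof (intro allI impI)
  fix X :: "nat \<Rightarrow> real" assume X: "X \<longlonglongrightarrow> 0"
  have same: "(\<integral>\<^sup>+ t. ennreal (norm (K (t + h))) \<partial>lborel) = (\<integral>\<^sup>+ t. ennreal (norm (K t)) \<partial>lborel)" for h
    by (rule nn_integral_translate_real) simp
  have L: "(\<lambda>n. \<integral>\<^sup>+ t. norm (K (t + X n) - K t) \<partial>lborel) \<longlonglongrightarrow> 0"
  proof (rule Scheffe_lemma1[OF K_int_translate K_int])
    have "AE t in lborel. t \<noteq> (0::real)" by (rule AE_lborel_singleton)
    then show "AE t in lborel. (\<lambda>n. K (t + X n)) \<longlonglongrightarrow> K t"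
    proof eventually_elim
      case (elim t)
      have "(\<lambda>n. t + X n) \<longlonglongrightarrow> t + 0" by (intro tendsto_intros X)
      then show ?case using isCont_tendsto_compose[OF K_cont[OF elim]] by simp
    qed
    show "limsup (\<lambda>n. \<integral>\<^sup>+ t. norm (K (t + X n)) \<partial>lborel) \<le> (\<integral>\<^sup>+ t. norm (K t) \<partial>lborel)"
      unfolding same by (simp add: Limsup_const)
  qed
  have e: "(\<integral>\<^sup>+ t. norm (K (t + h) - K t) \<partial>lborel) = ennreal (modL1 h)" for h
    unfolding modL1_def real_norm_def
    by (rule nn_integral_eq_integral) (auto intro!: K_int_translate K_int)
  have nn: "0 \<le> modL1 h" for h unfolding modL1_def by (intro integral_nonneg_AE) simp
  show "(\<lambda>n. modL1 (X n)) \<longlonglongrightarrow> 0"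
    using L unfolding e by (subst (asm) ennreal_0[symmetric], subst (asm) tendsto_ennreal_iff) (auto simp: nn)
qed

lemma conv_modulus:
  assumes [measurable]: "W \<in> borel_measurable borel" and W: "\<And>t. \<bar>W t\<bar> \<le> C"
  shows "\<bar>conv K W (t + h) - conv K W t\<bar> \<le> C * modL1 h"
proof -
  have W0: "C \<ge> 0" using W[of 0] by simp
  have i1: "integrable lborel (\<lambda>s. K (s + h) * W (t - s))"
    using lborel_integrable_real_affine[OF conv_integrable_shift[of W C "t + h"], of 1 h] W by (simp add: add.commute diff_diff_eq algebra_simps)
  have i2: "integrable lborel (\<lambda>s. K s * W (t - s))" by (rule conv_integrable_shift[of W C]) (simp_all add: W)
  have e1: "conv K W (t + h) = (LINT s|lborel. K (s + h) * W (t - s))"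
    using lborel_integral_real_affine[of 1 "\<lambda>s. K s * W (t + h - s)" h] by (simp add: conv_shift add.commute algebra_simps)
  have "conv K W (t + h) - conv K W t = (LINT s|lborel. K (s + h) * W (t - s) - K s * W (t - s))"
    unfolding e1 conv_shift[of K W t] by (rule Bochner_Integration.integral_diff[symmetric, OF i1 i2])
  also have "\<bar>\<dots>\<bar> \<le> (LINT s|lborel. C * \<bar>K (s + h) - K s\<bar>)"
  proof (rule order_trans[OF integral_abs_bound], rule integral_mono)
    show "integrable lborel (\<lambda>s. \<bar>K (s + h) * W (t - s) - K s * W (t - s)\<bar>)"
      by (intro integrable_abs Bochner_Integration.integrable_diff i1 i2)
    show "integrable lborel (\<lambda>s. C * \<bar>K (s + h) - K s\<bar>)"
      by (intro integrable_mult_right integrable_abs Bochner_Integration.integrable_diff K_int_translate K_int)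
    fix s
    have "\<bar>K (s + h) * W (t - s) - K s * W (t - s)\<bar> = \<bar>W (t - s)\<bar> * \<bar>K (s + h) - K s\<bar>"
      by (simp add: abs_mult[symmetric] algebra_simps)
    also have "\<dots> \<le> C * \<bar>K (s + h) - K s\<bar>" by (intro mult_right_mono W) auto
    finally show "\<bar>K (s + h) * W (t - s) - K s * W (t - s)\<bar> \<le> C * \<bar>K (s + h) - K s\<bar>" .
  qed
  finally show ?thesis by (simp add: modL1_def)
qed

lemma conv_uniformly_continuous:
  assumes [measurable]: "W \<in> borel_measurable borel" and W: "\<And>t. \<bar>W t\<bar> \<le> C"
  shows "uniformly_continuous_on UNIV (conv K W)"
  unfolding uniformly_continuous_on_def
proof (intro allI impI)
  fix e :: real assume e: "e > 0"
  have W0: "C \<ge> 0" using W[of 0] by simp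
  have "e / (C + 1) > 0" using e W0 by simp
  then have "\<forall>\<^sub>F h in at 0. modL1 h < e / (C + 1)" by (rule order_tendstoD(2)[OF modL1_tendsto])
  then obtain d where d: "d > 0" "\<And>h. h \<noteq> 0 \<Longrightarrow> \<bar>h\<bar> < d \<Longrightarrow> modL1 h < e / (C + 1)"
    by (auto simp: eventually_at dist_real_def)
  show "\<exists>d>0. \<forall>x\<in>UNIV. \<forall>x'\<in>UNIV. dist x' x < d \<longrightarrow> dist (conv K W x') (conv K W x) < e"
  proof (intro exI[of _ d] conjI ballI impI d)
    fix x x' :: real assume dd: "dist x' x < d"
    show "dist (conv K W x') (conv K W x) < e"
    proof (cases "x' = x")
      case False
      have "modL1 (x' - x) < e / (C + 1)" using d(2)[of "x' - x"] dd False by (simp add: dist_real_def)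
      then have "C * modL1 (x' - x) \<le> C * (e / (C + 1))" using W0 by (intro mult_left_mono) auto
      also have "\<dots> < e" using W0 e by (simp add: field_simps)
      finally have "C * modL1 (x' - x) < e" .
      then show ?thesis using conv_modulus[of W C x "x' - x"] W by (simp add: dist_real_def)
    qed (use e in simp)
  qed
qed

lemma conv_isCont:
  assumes "W \<in> borel_measurable borel" "\<And>t. \<bar>W t\<bar> \<le> C"
  shows "isCont (conv K W) t"
  using uniformly_continuous_imp_continuous[OF conv_uniformly_continuous[OF assms]]
  by (simp add: continuous_on_eq_continuous_at)

lemma cont_kernel_reflect: "cont_kernel (\<lambda>t. K (- t))"
proof -
  interpret R: kernel "\<lambda>t. K (- t)" by (rule kernel_reflect)
  show ?thesis
  proof
    show "isCont (\<lambda>t. K (- t)) t" if "t \<noteq> 0" for t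
      using that by (intro isCont_o2[where g=K and f=uminus] continuous_intros K_cont) auto
  qed
qed

end

text \<open>The two monotonicity assumptions are the trace on the line of the fact that a potential
  of a radially decreasing density is radially decreasing: a profile decreasing with the weight of
  \<open>v powr q2\<close> is sent to one decreasing with the weight of \<open>u\<close>, and
  conversely for the reflected kernel.\<close>

locale conv_system = cont_kernel +
  fixes a b q1 q2 :: real
  assumes ab: "a > 0" "b > 0" and q: "q1 > 1" "q2 > 1"
    and K_pos: "\<And>t. t \<noteq> 0 \<Longrightarrow> K t > 0"
    and mono1: "\<And>w C s t. w \<in> borel_measurable borel \<Longrightarrow> (\<And>t. 0 \<le> w t) \<Longrightarrow> (\<And>t. w t \<le> C) \<Longrightarrow>
      (\<And>s t. s \<le> t \<Longrightarrow> exp (- (b * q2) * t) * w t \<le> exp (- (b * q2) * s) * w s) \<Longrightarrow> s \<le> t \<Longrightarrow>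
      exp (- a * t) * conv K w t \<le> exp (- a * s) * conv K w s"
    and mono2: "\<And>w C s t. w \<in> borel_measurable borel \<Longrightarrow> (\<And>t. 0 \<le> w t) \<Longrightarrow> (\<And>t. w t \<le> C) \<Longrightarrow>
      (\<And>s t. s \<le> t \<Longrightarrow> exp (- (a * q1) * t) * w t \<le> exp (- (a * q1) * s) * w s) \<Longrightarrow> s \<le> t \<Longrightarrow>
      exp (- b * t) * conv (\<lambda>t. K (- t)) w t \<le> exp (- b * s) * conv (\<lambda>t. K (- t)) w s"
begin

text \<open>The function \<open>V\<close> is eliminated: one maximises over \<open>G\<close>, which
  stands for \<open>V powr q2\<close>, and recovers \<open>V\<close> by applying the reflected
  kernel to the \<open>q1\<close>-th power of \<open>K * G\<close>. Normalising the
  \<open>q2\<close>-th power of the result gives the competitor \<open>G'\<close>; its comparison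
  with \<open>G\<close> forces equality in Hoelder's inequality, hence the system up to a
  scalar.\<close>

theorem solution_exists:
  "\<exists>U V C. (\<forall>t. 0 < U t \<and> U t \<le> C) \<and> (\<forall>t. 0 < V t \<and> V t \<le> C) \<and>
     U \<in> borel_measurable borel \<and> V \<in> borel_measurable borel \<and>
     integrable lborel (\<lambda>t. U t powr (q1 + 1)) \<and> integrable lborel (\<lambda>t. V t powr (q2 + 1)) \<and>
     (\<forall>t. U t = conv K (\<lambda>s. V s powr q2) t) \<and> (\<forall>t. V t = conv (\<lambda>t. K (- t)) (\<lambda>s. U s powr q1) t)"
proof -
  define \<beta> where "\<beta> = b * q2"
  \<comment> \<open>The exponent conjugate to \<open>q2 + 1\<close>. It is below \<open>2\<close>,
    while \<open>r\<close> is above \<open>2\<close>, which is how \<open>q1, q2 > 1\<close>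
    enters.\<close>
  define Q where "Q = (q2 + 1) / q2"
  define r where "r = q1 + 1"
  have \<beta>: "\<beta> > 0" using ab q by (simp add: \<beta>_def)
  have Q1: "Q > 1" using q by (simp add: Q_def field_simps)
  have Q2: "Q < 2" using q by (simp add: Q_def field_simps)
  have Qr: "r > Q" using Q2 q by (simp add: r_def)
  interpret W: wconv K \<beta> Q r by unfold_locales (use \<beta> Q1 Qr K_pos in auto)
  interpret R: cont_kernel "\<lambda>t. K (- t)" by (rule cont_kernel_reflect)
  interpret RW: wconv "\<lambda>t. K (- t)" \<beta> Q r by unfold_locales (use \<beta> Q1 Qr K_pos in auto)
  obtain G where G: "G \<in> W.cls" "W.mass G UNIV \<le> 1" "W.J G = W.Lam" using W.maximiser_exists by blast
  have Lam: "W.Lam > 0" by (rule W.Lam_pos)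
  have [measurable]: "G \<in> borel_measurable borel" by (rule W.cls_measurable[OF G(1)])
  have G0: "0 \<le> G t" and GC: "G t \<le> exp \<beta>" for t using W.clsD(1)[OF G(1)] W.cls_bound1[OF G(1,2)] by auto
  have "\<exists>t0. G t0 > 0"
  proof (rule ccontr)
    assume "\<not> (\<exists>t0. G t0 > 0)"
    then have "G t = 0" for t using G0[of t] by (metis less_eq_real_def)
    then have "G = (\<lambda>t. 0)" by auto
    then have "W.J G = 0" by (simp add: W.J_def conv_def)
    then show False using Lam G(3) by simp
  qed
  then obtain t0 where t0: "G t0 > 0" by blast
  have Gp: "G t > 0" if "t \<le> t0" for t
    using W.cls_ratio[OF G(1) that] t0 by (smt (verit) exp_gt_zero mult_pos_pos)
  define U0 where "U0 = conv K G"
  define D where "D = k1 * exp \<beta>"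
  have Uc: "isCont U0 t" for t unfolding U0_def by (rule conv_isCont[of _ "exp \<beta>"]) (use G0 GC in \<open>auto simp: abs_le_iff intro: order_trans[OF _ exp_ge_zero]\<close>)
  have [measurable]: "U0 \<in> borel_measurable borel" using Uc by (intro borel_measurable_continuous_onI continuous_at_imp_continuous_on) auto
  have Up: "U0 t > 0" for t unfolding U0_def by (rule W.conv_pos[OF _ G0 GC Gp]) simp
  have UD: "U0 t \<le> D" for t unfolding U0_def D_def by (rule conv_le[OF _ G0 GC]) simp
  have Ua: "exp (- a * t) * U0 t \<le> exp (- a * s) * U0 s" if "s \<le> t" for s t
    unfolding U0_def using that W.clsD(2)[OF G(1)] by (intro mono1[OF _ G0 GC]) (auto simp: \<beta>_def)
  have iU: "integrable lborel (\<lambda>t. U0 t powr r)" unfolding U0_def by (rule W.J_integrable[OF G(1)])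
  have JU: "(LINT t|lborel. U0 t powr r) = W.Lam" using G(3) by (simp add: W.J_def U0_def)
  have pmono: "exp (- (c * p) * t) * f t powr p \<le> exp (- (c * p) * s) * f s powr p"
    if f: "\<And>t. f t > 0" "\<And>s t. s \<le> t \<Longrightarrow> exp (- c * t) * f t \<le> exp (- c * s) * f s" and p: "p > 0" and st: "s \<le> t"
    for f :: "real \<Rightarrow> real" and c p s t :: real
  proof -
    have "exp (- c * t) * f t \<le> exp (- c * s) * f s" by (rule f(2)) (rule st)
    moreover have "0 \<le> exp (- c * t) * f t" using f(1)[of t] by simp
    ultimately have "(exp (- c * t) * f t) powr p \<le> (exp (- c * s) * f s) powr p"
      using p by (intro powr_mono2) simp_all
    then show ?thesis using f(1)[of t] f(1)[of s] by (simp add: powr_mult exp_powr_real mult_ac)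
  qed
  define Z where "Z t = U0 t powr q1" for t
  have [measurable]: "Z \<in> borel_measurable borel" unfolding Z_def[abs_def] by measurable
  have Zp: "Z t > 0" for t using Up[of t] by (simp add: Z_def less_imp_neq[THEN not_sym])
  have ZD: "Z t \<le> D powr q1" for t unfolding Z_def using Up[of t] UD[of t] q by (intro powr_mono2) auto
  define V0 where "V0 = conv (\<lambda>t. K (- t)) Z"
  define E where "E = R.k1 * D powr q1"
  have Z0: "0 \<le> Z t" for t using Zp[of t] by simp
  have Zabs: "\<bar>Z t\<bar> \<le> D powr q1" for t using Z0 ZD by simp
  have Vc: "isCont V0 t" for t unfolding V0_def by (rule R.conv_isCont[OF _ Zabs]) simp
  have [measurable]: "V0 \<in> borel_measurable borel" using Vc by (intro borel_measurable_continuous_onI continuous_at_imp_continuous_on) auto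
  have Vp: "V0 t > 0" for t unfolding V0_def by (rule RW.conv_pos[OF _ Z0 ZD Zp]) simp
  have VE: "V0 t \<le> E" for t unfolding V0_def E_def by (rule R.conv_le[OF _ Z0 ZD]) simp
  have Va: "exp (- b * t) * V0 t \<le> exp (- b * s) * V0 s" if st: "s \<le> t" for s t
    unfolding V0_def
  proof (rule mono2[OF _ Z0 ZD _ st])
    show "exp (- (a * q1) * t) * Z t \<le> exp (- (a * q1) * s) * Z s" if "s \<le> t" for s t
      unfolding Z_def using Up Ua q that by (intro pmono) auto
  qed simp
  define r' where "r' = (q1 + 1) / q1"
  have r': "r' > 1" using q by (simp add: r'_def field_simps)
  have Zr: "Z t powr r' = U0 t powr r" for t using q by (simp add: Z_def powr_powr r'_def r_def)
  \<comment> \<open>\<open>Z\<close> is bounded and belongs to exponent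
    \<open>r' < 2 < q2 + 1\<close>, hence to exponent \<open>q2 + 1\<close>, where Young's
    inequality with equal exponents applies.\<close>
  have iV: "integrable lborel (\<lambda>t. V0 t powr (q2 + 1))"
    unfolding V0_def
  proof (rule R.conv_young[OF _ Z0 ZD])
    have "r' < 2" using q by (simp add: r'_def field_simps)
    then have rq: "r' \<le> q2 + 1" using q by simp
    show "integrable lborel (\<lambda>t. Z t powr (q2 + 1))"
      by (rule integrable_powr_exponent_mono(1)[where Q=r', OF _ Z0 ZD]) (simp_all add: Zr iU rq)
  qed (use q in auto)
  define I where "I = (LINT t|lborel. V0 t powr (q2 + 1))"
  have I: "I > 0"
  proof -
    have nz: "V0 t powr (q2 + 1) \<noteq> 0" for t using Vp[of t] by simp
    have "\<not> (AE t in lborel. V0 t powr (q2 + 1) = 0)"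
    proof
      assume "AE t in lborel. V0 t powr (q2 + 1) = 0"
      then have "AE t in lborel. t \<notin> {0..1::real}" by (rule eventually_mono) (use nz in blast)
      then show False using not_AE_lborel_avoids_interval[of 0 1] by simp
    qed
    then have "I \<noteq> 0" unfolding I_def using iV by (subst integral_nonneg_eq_0_iff_AE) auto
    moreover have "I \<ge> 0" unfolding I_def by (intro integral_nonneg_AE) simp
    ultimately show ?thesis by simp
  qed
  \<comment> \<open>The \<open>Q\<close>-norm of \<open>V0 powr q2\<close>, because
    \<open>q2 * Q = q2 + 1\<close>; dividing by it gives the competitor unit mass.\<close>
  define c where "c = I powr (1 / Q)"
  have c: "c > 0" using I by (simp add: c_def)
  have cQ: "c powr Q = I" using I Q1 by (simp add: c_def powr_powr)
  have qQ: "q2 * Q = q2 + 1" using q by (simp add: Q_def)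
  define G' where "G' t = V0 t powr q2 / c" for t
  have G'Q: "G' t powr Q = V0 t powr (q2 + 1) / I" for t
    using c Vp[of t] by (simp add: G'_def powr_divide powr_powr qQ cQ)
  have G': "G' \<in> W.cls"
    unfolding W.cls_def mem_Collect_eq
  proof (intro conjI allI impI)
    show "0 \<le> G' t" for t using c by (simp add: G'_def)
    show "exp (- \<beta> * t) * G' t \<le> exp (- \<beta> * s) * G' s" if "s \<le> t" for s t
      using pmono[of V0 b q2 s t, OF Vp Va] q that c by (simp add: G'_def \<beta>_def divide_right_mono)
    show "continuous (at_right t) G'" for t
    proof -
      have "V0 t \<noteq> 0" using Vp[of t] by simp
      then have "isCont (\<lambda>t. V0 t powr q2 / c) t" using c by (intro continuous_intros Vc) auto
      then show ?thesis unfolding G'_def[abs_def] by (rule continuous_at_imp_continuous_at_within)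
    qed
    show "integrable lborel (\<lambda>t. G' t powr Q)" unfolding G'Q using iV by simp
  qed
  have mG': "W.mass G' UNIV \<le> 1"
    using I by (simp add: W.mass_UNIV G'Q I_def[symmetric])
  have [measurable]: "G' \<in> borel_measurable borel" by (rule W.cls_measurable[OF G'])
  have VG': "V0 t * G' t = V0 t powr (q2 + 1) / c" for t
    using Vp[of t] by (simp add: G'_def powr_add)
  have iVG': "integrable lborel (\<lambda>t. V0 t * G' t)" unfolding VG' using iV by simp
  have lVG': "(LINT t|lborel. V0 t * G' t) = I / c" unfolding VG' by (simp add: I_def)
  text \<open>\<open>G'\<close> competes with \<open>G\<close>, so maximality forces equality in the Hoelder inequality below.\<close>
  have IL: "I / c \<le> W.Lam"
  proof -
    have H0: "0 \<le> conv K G' t" for t by (rule conv_nonneg[OF _ W.clsD(1)[OF G'] W.cls_bound1[OF G' mG']]) simp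
    have [measurable]: "conv K G' \<in> borel_measurable borel"
      by (rule conv_measurable[of _ "exp \<beta>"]) (use W.clsD(1)[OF G'] W.cls_bound1[OF G' mG'] in \<open>auto simp: abs_le_iff intro: order_trans[OF _ exp_ge_zero]\<close>)
    have ptw: "Z t * conv K G' t \<le> U0 t powr r / r' + conv K G' t powr r / r" for t
    proof -
      have "Z t * conv K G' t \<le> Z t powr r' / r' + conv K G' t powr r / r"
        using r' Z0 H0 q by (intro Youngs_inequality) (auto simp: r'_def r_def field_simps)
      then show ?thesis by (simp add: Zr)
    qed
    have iJ: "integrable lborel (\<lambda>t. conv K G' t powr r)" by (rule W.J_integrable[OF G'])
    have "ennreal (I / c) = (\<integral>\<^sup>+t. ennreal (V0 t * G' t) \<partial>lborel)"
      using lVG' nn_integral_eq_integral[OF iVG'] Vp W.clsD(1)[OF G'] by (simp add: less_imp_le)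
    also have "\<dots> = (\<integral>\<^sup>+t. ennreal (Z t * conv K G' t) \<partial>lborel)"
      unfolding V0_def by (rule conv_adjoint[symmetric, OF _ _ W.clsD(1)[OF G'] W.cls_bound1[OF G' mG'] Z0 ZD]) simp_all
    also have "\<dots> \<le> (\<integral>\<^sup>+t. ennreal (U0 t powr r / r' + conv K G' t powr r / r) \<partial>lborel)"
      by (intro nn_integral_mono ennreal_leI ptw)
    also have "\<dots> = ennreal (LINT t|lborel. U0 t powr r / r' + conv K G' t powr r / r)"
      by (rule nn_integral_eq_integral) (use iU iJ r' W.r1 in auto)
    finally have "I / c \<le> (LINT t|lborel. U0 t powr r / r' + conv K G' t powr r / r)"
      using r' W.r1 by (subst (asm) ennreal_le_iff) (auto intro!: integral_nonneg_AE)
    also have "\<dots> = W.Lam / r' + W.J G' / r"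
      using iU iJ by (simp add: JU W.J_def)
    also have "\<dots> \<le> W.Lam / r' + W.Lam / r"
      using W.J_le_Lam[OF G' mG'] W.r1 by (intro add_left_mono divide_right_mono) auto
    also have "\<dots> = W.Lam * (1 / r' + 1 / r)" by (simp add: distrib_left)
    also have "1 / r' + 1 / r = 1" using q by (simp add: r'_def r_def field_simps)
    finally show ?thesis by simp
  qed
  \<comment> \<open>The bound \<open>I / c \<le> Lam\<close> says that \<open>V0\<close> has norm at
    most \<open>Lam\<close> in exponent \<open>q2 + 1\<close>, while its pairing with
    \<open>G\<close> is exactly \<open>Lam\<close>. After division, two functions of norm at most
    one have pairing one.\<close>
  define V1 where "V1 t = V0 t / W.Lam" for t
  have V1p: "V1 t > 0" for t using Vp Lam by (simp add: V1_def)
  have V1q: "V1 t powr (q2 + 1) = V0 t powr (q2 + 1) / W.Lam powr (q2 + 1)" for t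
    using Vp[of t] Lam by (simp add: V1_def powr_divide)
  have iV1: "integrable lborel (\<lambda>t. V1 t powr (q2 + 1))" unfolding V1q using iV by simp
  have lV1: "(LINT t|lborel. V1 t powr (q2 + 1)) \<le> 1"
  proof -
    have "I / c = I powr (1 / (q2 + 1))"
    proof -
      have "1 - 1 / Q = 1 / (q2 + 1)" using q by (simp add: Q_def field_simps)
      then show ?thesis using I by (metis c_def powr_diff powr_one less_imp_le)
    qed
    then have "I powr (1 / (q2 + 1)) \<le> W.Lam" using IL by simp
    then have "(I powr (1 / (q2 + 1))) powr (q2 + 1) \<le> W.Lam powr (q2 + 1)" using q by (intro powr_mono2) auto
    then have "I \<le> W.Lam powr (q2 + 1)" using q I by (simp add: powr_powr)
    then show ?thesis unfolding V1q using Lam by (simp add: I_def[symmetric] divide_le_eq_1)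
  qed
  have nVG: "(\<integral>\<^sup>+t. ennreal (V0 t * G t) \<partial>lborel) = ennreal W.Lam"
  proof -
    have "(\<integral>\<^sup>+t. ennreal (V0 t * G t) \<partial>lborel) = (\<integral>\<^sup>+t. ennreal (Z t * conv K G t) \<partial>lborel)"
      unfolding V0_def by (rule conv_adjoint[symmetric, OF _ _ G0 GC Z0 ZD]) simp_all
    also have "\<dots> = (\<integral>\<^sup>+t. ennreal (U0 t powr r) \<partial>lborel)"
      using Up q by (intro nn_integral_cong) (simp add: Z_def U0_def[symmetric] r_def powr_add abs_of_pos)
    also have "\<dots> = ennreal W.Lam" using nn_integral_eq_integral[OF iU] by (simp add: JU)
    finally show ?thesis .
  qed
  have hVG: "has_bochner_integral lborel (\<lambda>t. V0 t * G t) W.Lam"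
    by (rule has_bochner_integral_nn_integral[OF _ _ _ nVG]) (use Vp G0 Lam in \<open>auto simp: less_imp_le\<close>)
  have iVG: "integrable lborel (\<lambda>t. V1 t * G t)" and lVG: "(LINT t|lborel. V1 t * G t) = 1"
    using has_bochner_integral_divide_zero[OF hVG, of W.Lam] Lam
    by (auto simp: has_bochner_integral_iff V1_def)
  \<comment> \<open>The defect in Young's inequality for \<open>V1\<close> and \<open>G\<close>. It
    is nonnegative and has nonpositive integral, so it vanishes almost everywhere.\<close>
  define f where "f t = V1 t powr (q2 + 1) / (q2 + 1) + G t powr Q / Q - V1 t * G t" for t
  have conj: "1 / (q2 + 1) + 1 / Q = 1" using q by (simp add: Q_def field_simps)
  have f0: "f t \<ge> 0" for t
    using Youngs_inequality[of "q2 + 1" Q "V1 t" "G t"] q Q1 conj V1p[of t] G0[of t] by (simp add: f_def)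
  have fi: "integrable lborel f"
    unfolding f_def using iV1 W.clsD(4)[OF G(1)] iVG by auto
  have "(LINT t|lborel. f t) = (LINT t|lborel. V1 t powr (q2 + 1)) / (q2 + 1) + W.mass G UNIV / Q - 1"
    unfolding f_def using iV1 W.clsD(4)[OF G(1)] iVG by (simp add: lVG W.mass_UNIV)
  also have "\<dots> \<le> 1 / (q2 + 1) + 1 / Q - 1"
    using lV1 G(2) q Q1 by (intro diff_right_mono add_mono divide_right_mono) auto
  also have "\<dots> = 0" using conj by simp
  finally have "(LINT t|lborel. f t) = 0" using integral_nonneg_AE[of f lborel] f0 by (simp add: antisym)
  then have "AE t in lborel. f t = 0" using integral_nonneg_eq_0_iff_AE[OF fi] f0 by simp
  then have GV: "AE t in lborel. G t = V1 t powr q2"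
  proof eventually_elim
    case (elim t)
    have "G t = V1 t powr (q2 + 1 - 1)"
      using elim V1p[of t] G0[of t] q Q1 conj by (intro Youngs_equality[of "q2 + 1" Q]) (auto simp: f_def)
    then show ?case by simp
  qed
  have U0eq: "U0 t = W.Lam powr (- q2) * conv K (\<lambda>s. V0 s powr q2) t" for t
  proof -
    have "U0 t = conv K (\<lambda>s. V1 s powr q2) t"
      unfolding U0_def conv_def
    proof (rule integral_cong_AE)
      show "AE s in lborel. K (t - s) * G s = K (t - s) * V1 s powr q2" using GV by eventually_elim simp
    qed (auto simp: V1_def)
    also have "(\<lambda>s. V1 s powr q2) = (\<lambda>s. W.Lam powr (- q2) * V0 s powr q2)"
      using Vp Lam by (auto simp: V1_def powr_divide powr_minus_divide less_imp_le)
    finally show ?thesis by (simp only: conv_cmult)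
  qed
  \<comment> \<open>The factors \<open>l0\<close> of \<open>U0\<close> and \<open>\<mu>\<close> of
    \<open>V0\<close> must satisfy \<open>\<mu> = l0 powr q1\<close> and
    \<open>l0 = (\<mu> * Lam) powr q2\<close>. Elimination gives
    \<open>l0 powr (1 - q1 * q2) = Lam powr q2\<close>, which is solvable because
    \<open>q1 * q2 > 1\<close>.\<close>
  define l0 where "l0 = W.Lam powr (q2 / (1 - q1 * q2))"
  define \<mu> where "\<mu> = l0 powr q1"
  have l0: "l0 > 0" and \<mu>: "\<mu> > 0" using Lam by (auto simp: l0_def \<mu>_def)
  have "1 * 1 < q1 * q2" using q by (intro mult_strict_mono) auto
  then have q12: "1 - q1 * q2 \<noteq> 0" by simp
  have l0eq: "l0 = (\<mu> * W.Lam) powr q2"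
  proof -
    have "(\<mu> * W.Lam) powr q2 = W.Lam powr (q2 / (1 - q1 * q2) * q1 * q2 + q2)"
      using Lam \<mu> by (simp add: powr_mult \<mu>_def l0_def powr_powr powr_add mult_ac)
    also have "q2 / (1 - q1 * q2) * q1 * q2 + q2 = q2 / (1 - q1 * q2)"
      using q12 by (simp add: field_simps)
    finally show ?thesis by (simp add: l0_def)
  qed
  define U where "U t = l0 * U0 t" for t
  define V where "V t = \<mu> * V0 t" for t
  have "U t = conv K (\<lambda>s. V s powr q2) t" for t
  proof -
    have "conv K (\<lambda>s. V s powr q2) t = \<mu> powr q2 * conv K (\<lambda>s. V0 s powr q2) t"
      using \<mu> Vp by (simp add: V_def powr_mult less_imp_le conv_cmult)
    also have "conv K (\<lambda>s. V0 s powr q2) t = W.Lam powr q2 * U0 t"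
      using Lam by (simp add: U0eq powr_minus field_simps)
    finally show ?thesis using Lam \<mu> by (simp add: U_def l0eq powr_mult)
  qed
  moreover have "V t = conv (\<lambda>t. K (- t)) (\<lambda>s. U s powr q1) t" for t
    using l0 Up by (simp add: U_def V_def powr_mult less_imp_le R.conv_cmult \<mu>_def V0_def Z_def[abs_def])
  moreover have "0 < U t" "U t \<le> max (l0 * D) (\<mu> * E)" "0 < V t" "V t \<le> max (l0 * D) (\<mu> * E)" for t
    using Up[of t] Vp[of t] UD[of t] VE[of t] l0 \<mu> by (auto simp: U_def V_def le_max_iff_disj)
  moreover have "integrable lborel (\<lambda>t. U t powr (q1 + 1))" "integrable lborel (\<lambda>t. V t powr (q2 + 1))"
    using iU iV l0 \<mu> Up Vp by (simp_all add: U_def V_def powr_mult less_imp_le r_def)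
  moreover have "U \<in> borel_measurable borel" "V \<in> borel_measurable borel"
    unfolding U_def[abs_def] V_def[abs_def] by simp_all
  ultimately show ?thesis by blast
qed

end

section \<open>Regularity through difference quotients\<close>

definition dq :: "(real \<Rightarrow> real) \<Rightarrow> real \<Rightarrow> real \<Rightarrow> real" where
  "dq f h t = (f (t + h) - f t) / h"

lemma powr_mean_value:
  fixes p x y :: real
  assumes "p > 1" "x > 0" "y > 0"
  shows "\<exists>z. min x y \<le> z \<and> z \<le> max x y \<and> x powr p - y powr p = p * z powr (p - 1) * (x - y)"
proof -
  have *: "\<exists>z. u \<le> z \<and> z \<le> v \<and> v powr p - u powr p = p * z powr (p - 1) * (v - u)" if "0 < u" "u < v" for u v :: real
  proof -
    have "\<exists>z. u < z \<and> z < v \<and> v powr p - u powr p = (v - u) * (p * z powr (p - 1))"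
      using that by (intro MVT2) (auto intro!: derivative_eq_intros)
    then show ?thesis by (auto simp: mult_ac intro!: less_imp_le)
  qed
  consider "x < y" | "y < x" | "x = y" by linarith
  then show ?thesis
  proof cases
    case 1
    then obtain z where "x \<le> z" "z \<le> y" "y powr p - x powr p = p * z powr (p - 1) * (y - x)" using *[of x y] assms by blast
    then show ?thesis using 1 by (intro exI[of _ z]) (auto simp: algebra_simps)
  next
    case 2
    then obtain z where "y \<le> z" "z \<le> x" "x powr p - y powr p = p * z powr (p - 1) * (x - y)" using *[of y x] assms by blast
    then show ?thesis using 2 by (intro exI[of _ z]) auto
  qed auto
qed

lemma powr_lipschitz:
  fixes p x y C :: real
  assumes p: "p > 1" and xy: "0 < x" "x \<le> C" "0 < y" "y \<le> C"
  shows "\<bar>x powr p - y powr p\<bar> \<le> p * C powr (p - 1) * \<bar>x - y\<bar>"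
proof -
  obtain z where z: "min x y \<le> z" "z \<le> max x y" "x powr p - y powr p = p * z powr (p - 1) * (x - y)"
    using powr_mean_value[OF p xy(1,3)] by blast
  have "z powr (p - 1) \<le> C powr (p - 1)" using z xy p by (intro powr_mono2) auto
  then show ?thesis unfolding z(3) using p by (simp add: abs_mult mult_right_mono)
qed

text \<open>Since \<open>p > 1\<close>, the derivative is a multiple of
  \<open>z powr (p - 1)\<close>, which is uniformly continuous on the compact interval
  \<open>{0..C}\<close>. The linearisation is therefore uniform even for arguments near
  \<open>0\<close>.\<close>

lemma powr_uniform_derivative:
  fixes p C e :: real
  assumes p: "p > 1" and e: "e > 0"
  shows "\<exists>d>0. \<forall>x y. 0 < x \<longrightarrow> x \<le> C \<longrightarrow> 0 < y \<longrightarrow> y \<le> C \<longrightarrow> \<bar>x - y\<bar> < d \<longrightarrow>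
    \<bar>x powr p - y powr p - p * y powr (p - 1) * (x - y)\<bar> \<le> e * \<bar>x - y\<bar>"
proof -
  have "continuous_on {0..C} (\<lambda>z. z powr (p - 1))"
    using p by (intro continuous_on_powr') (auto intro!: continuous_intros)
  then have "uniformly_continuous_on {0..C} (\<lambda>z. z powr (p - 1))" by (intro compact_uniformly_continuous) auto
  moreover have "e / p > 0" using e p by simp
  ultimately obtain d where d: "d > 0" "\<And>x y. x \<in> {0..C} \<Longrightarrow> y \<in> {0..C} \<Longrightarrow> dist y x < d \<Longrightarrow> dist (y powr (p - 1)) (x powr (p - 1)) < e / p"
    unfolding uniformly_continuous_on_def by meson
  show ?thesis
  proof (intro exI[of _ d] conjI d allI impI)
    fix x y assume xy: "0 < x" "x \<le> C" "0 < y" "y \<le> C" "\<bar>x - y\<bar> < d"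
    obtain z where z: "min x y \<le> z" "z \<le> max x y" "x powr p - y powr p = p * z powr (p - 1) * (x - y)"
      using powr_mean_value[OF p xy(1,3)] by blast
    have "dist (z powr (p - 1)) (y powr (p - 1)) < e / p"
      using z xy by (intro d) (auto simp: dist_real_def min_def max_def split: if_splits)
    then have "p * \<bar>z powr (p - 1) - y powr (p - 1)\<bar> \<le> e" using p by (simp add: dist_real_def field_simps)
    then have "p * \<bar>z powr (p - 1) - y powr (p - 1)\<bar> * \<bar>x - y\<bar> \<le> e * \<bar>x - y\<bar>" by (intro mult_right_mono) auto
    moreover have "x powr p - y powr p - p * y powr (p - 1) * (x - y) = p * (z powr (p - 1) - y powr (p - 1)) * (x - y)"
      unfolding z(3) by (simp add: algebra_simps)
    ultimately show "\<bar>x powr p - y powr p - p * y powr (p - 1) * (x - y)\<bar> \<le> e * \<bar>x - y\<bar>"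
      using p by (simp add: abs_mult)
  qed
qed

text \<open>The step estimate is applied to the supremum. The bound \<open>B\<close> only guarantees
  that the supremum is finite and leaves no trace in the conclusion, so it may depend on the
  increment \<open>h\<close> in the applications.\<close>

lemma half_contraction_bound:
  fixes f :: "'i \<Rightarrow> real"
  assumes bd: "\<And>i. f i \<le> B" and step: "\<And>s. (\<And>i. f i \<le> s) \<Longrightarrow> (\<And>i. f i \<le> A + s / 2)"
  shows "f i \<le> 2 * A"
proof -
  define S where "S = Sup (range f)"
  have up: "f i \<le> S" for i unfolding S_def using bd by (intro cSup_upper bdd_aboveI2) auto
  have "Sup (range f) \<le> A + S / 2" by (rule cSup_least) (use step[OF up] in auto)
  then have "S \<le> A + S / 2" by (simp only: S_def)
  then show ?thesis using up[of i] by linarith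
qed

lemma uniform_dq_derivative:
  fixes U :: "real \<Rightarrow> real"
  assumes cont: "\<And>t. isCont U t"
    and cauchy: "\<And>e. e > 0 \<Longrightarrow> \<exists>d>0. \<forall>h h' t. h \<noteq> 0 \<longrightarrow> \<bar>h\<bar> < d \<longrightarrow> h' \<noteq> 0 \<longrightarrow> \<bar>h'\<bar> < d \<longrightarrow> \<bar>dq U h t - dq U h' t\<bar> \<le> e"
  shows "\<exists>g. continuous_on UNIV g \<and> (\<forall>t. (U has_real_derivative g t) (at t))"
proof -
  define x where "x n = 1 / (real n + 1)" for n :: nat
  have x0: "x n \<noteq> 0" for n by (simp add: x_def)
  have xl: "x \<longlonglongrightarrow> 0" unfolding x_def by real_asymp
  have ev: "\<exists>N. \<forall>n\<ge>N. \<bar>x n\<bar> < d" if "d > 0" for d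
    using LIMSEQ_D[OF xl that] by simp
  have Cau: "Cauchy (\<lambda>n. dq U (x n) t)" for t
  proof (rule CauchyI)
    fix e :: real assume e: "e > 0"
    obtain d where d: "d > 0" "\<forall>h h' t. h \<noteq> 0 \<longrightarrow> \<bar>h\<bar> < d \<longrightarrow> h' \<noteq> 0 \<longrightarrow> \<bar>h'\<bar> < d \<longrightarrow> \<bar>dq U h t - dq U h' t\<bar> \<le> e / 2"
      using cauchy[of "e / 2"] e by auto
    obtain N where "\<forall>n\<ge>N. \<bar>x n\<bar> < d" using ev[OF d(1)] by blast
    then show "\<exists>M. \<forall>m\<ge>M. \<forall>n\<ge>M. norm (dq U (x m) t - dq U (x n) t) < e"
      using d(2) x0 e by (intro exI[of _ N] allI impI) (smt (verit) real_norm_def field_sum_of_halves)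
  qed
  define g where "g t = lim (\<lambda>n. dq U (x n) t)" for t
  have glim: "(\<lambda>n. dq U (x n) t) \<longlonglongrightarrow> g t" for t
    unfolding g_def using Cauchy_convergent[OF Cau] by (simp add: convergent_LIMSEQ_iff)
  have unif: "\<exists>d>0. \<forall>h t. h \<noteq> 0 \<longrightarrow> \<bar>h\<bar> < d \<longrightarrow> \<bar>dq U h t - g t\<bar> \<le> e" if e: "e > 0" for e
  proof -
    obtain d where d: "d > 0" "\<forall>h h' t. h \<noteq> 0 \<longrightarrow> \<bar>h\<bar> < d \<longrightarrow> h' \<noteq> 0 \<longrightarrow> \<bar>h'\<bar> < d \<longrightarrow> \<bar>dq U h t - dq U h' t\<bar> \<le> e"
      using cauchy[OF e] by auto
    obtain N where N: "\<forall>n\<ge>N. \<bar>x n\<bar> < d" using ev[OF d(1)] by blast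
    show ?thesis
    proof (intro exI[of _ d] conjI d(1) allI impI)
      fix h t :: real assume h: "h \<noteq> 0" "\<bar>h\<bar> < d"
      have "(\<lambda>n. \<bar>dq U h t - dq U (x n) t\<bar>) \<longlonglongrightarrow> \<bar>dq U h t - g t\<bar>" by (intro tendsto_intros glim)
      then show "\<bar>dq U h t - g t\<bar> \<le> e"
        by (rule LIMSEQ_le_const2) (use N d(2) h x0 in blast)
    qed
  qed
  have der: "(U has_real_derivative g t) (at t)" for t
    unfolding DERIV_def
  proof (rule LIM_I)
    fix e :: real assume e: "e > 0"
    obtain d where d: "d > 0" "\<forall>h t. h \<noteq> 0 \<longrightarrow> \<bar>h\<bar> < d \<longrightarrow> \<bar>dq U h t - g t\<bar> \<le> e / 2" using unif[of "e / 2"] e by auto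
    show "\<exists>s>0. \<forall>h. h \<noteq> 0 \<and> norm (h - 0) < s \<longrightarrow> norm ((U (t + h) - U t) / h - g t) < e"
    proof (intro exI[of _ d] conjI d(1) allI impI)
      fix h :: real assume "h \<noteq> 0 \<and> norm (h - 0) < d"
      then have "\<bar>dq U h t - g t\<bar> \<le> e / 2" using d(2) by simp
      then show "norm ((U (t + h) - U t) / h - g t) < e" using e by (simp add: dq_def)
    qed
  qed
  have "continuous_on UNIV g"
  proof (rule uniform_limit_theorem)
    show "uniform_limit UNIV (\<lambda>n. dq U (x n)) g sequentially"
      unfolding uniform_limit_iff
    proof (intro allI impI)
      fix e :: real assume e: "e > 0"
      obtain d where d: "d > 0" "\<forall>h t. h \<noteq> 0 \<longrightarrow> \<bar>h\<bar> < d \<longrightarrow> \<bar>dq U h t - g t\<bar> \<le> e / 2" using unif[of "e / 2"] e by auto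
      obtain N where N: "\<forall>n\<ge>N. \<bar>x n\<bar> < d" using ev[OF d(1)] by blast
      show "\<forall>\<^sub>F n in sequentially. \<forall>t\<in>UNIV. dist (dq U (x n) t) (g t) < e"
      proof (intro eventually_sequentiallyI[of N] ballI)
        fix n t assume "N \<le> n"
        then have "\<bar>dq U (x n) t - g t\<bar> \<le> e / 2" using N d(2) x0 by blast
        then show "dist (dq U (x n) t) (g t) < e" using e by (simp add: dist_real_def)
      qed
    qed
    have cU: "continuous_on UNIV U" using cont by (simp add: continuous_on_eq_continuous_at)
    have "continuous_on UNIV (\<lambda>t. U (t + h))" for h
      by (rule continuous_on_compose2[OF cU]) (auto intro!: continuous_intros)
    then have "continuous_on UNIV (dq U h)" if "h \<noteq> 0" for h
      unfolding dq_def[abs_def] using that by (intro continuous_on_divide continuous_on_diff cU continuous_on_const) auto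
    then show "\<forall>\<^sub>F n in sequentially. continuous_on UNIV (dq U (x n))" using x0 by auto
  qed simp
  then show ?thesis using der by blast
qed

context cont_kernel
begin

lemma modL1_small:
  assumes "\<epsilon> > 0"
  shows "\<exists>\<eta>>0. \<forall>s. \<bar>s\<bar> \<le> \<eta> \<longrightarrow> modL1 s \<le> \<epsilon>"
proof -
  have "\<forall>\<^sub>F h in at 0. modL1 h < \<epsilon>" by (rule order_tendstoD(2)[OF modL1_tendsto assms])
  then obtain d where d: "d > 0" "\<And>h. h \<noteq> 0 \<Longrightarrow> \<bar>h\<bar> < d \<Longrightarrow> modL1 h < \<epsilon>"
    by (auto simp: eventually_at dist_real_def)
  have "modL1 s \<le> \<epsilon>" if "\<bar>s\<bar> \<le> d / 2" for s
    using d(2)[of s] that d(1) assms by (cases "s = 0") (auto simp: modL1_def)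
  then show ?thesis using d(1) by (intro exI[of _ "d / 2"]) auto
qed

text \<open>A convolution oscillates little on short intervals, so it is close to its mean over
  \<open>{t..t + \<eta>}\<close>, which the primitive \<open>\<Psi>\<close> controls.\<close>

lemma conv_le_mean:
  assumes [measurable]: "Y \<in> borel_measurable borel" and Y: "\<And>t. \<bar>Y t\<bar> \<le> S"
    and \<eta>: "\<eta> > 0" "\<And>s. \<bar>s\<bar> \<le> \<eta> \<Longrightarrow> modL1 s \<le> \<epsilon>"
    and \<Psi>: "\<And>s. (\<Psi> has_real_derivative conv K Y s) (at s)"
  shows "\<bar>conv K Y t\<bar> \<le> \<bar>\<Psi> (t + \<eta>) - \<Psi> t\<bar> / \<eta> + \<epsilon> * S"
proof -
  have S: "S \<ge> 0" using Y[of 0] by simp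
  have "\<exists>z. t < z \<and> z < t + \<eta> \<and> \<Psi> (t + \<eta>) - \<Psi> t = (t + \<eta> - t) * conv K Y z"
    by (rule MVT2) (use \<eta> \<Psi> in auto)
  then obtain z where z: "t < z" "z < t + \<eta>" "\<Psi> (t + \<eta>) - \<Psi> t = \<eta> * conv K Y z" by auto
  have "\<bar>conv K Y (t + (z - t)) - conv K Y t\<bar> \<le> S * modL1 (z - t)" by (rule conv_modulus) (simp_all add: Y)
  also have "\<dots> \<le> S * \<epsilon>" using z S by (intro mult_left_mono \<eta>(2)) auto
  finally have "\<bar>conv K Y z - conv K Y t\<bar> \<le> \<epsilon> * S" by (simp add: mult.commute)
  moreover have "\<bar>\<Psi> (t + \<eta>) - \<Psi> t\<bar> / \<eta> = \<bar>conv K Y z\<bar>" using \<eta> by (simp add: z(3) abs_mult)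
  ultimately show ?thesis by linarith
qed

lemma conv_diff:
  assumes [measurable]: "W \<in> borel_measurable borel" "W' \<in> borel_measurable borel"
    and "\<And>t. \<bar>W t\<bar> \<le> C" "\<And>t. \<bar>W' t\<bar> \<le> C'"
  shows "conv K (\<lambda>t. W t - W' t) t = conv K W t - conv K W' t"
  unfolding conv_def right_diff_distrib using assms
  by (intro Bochner_Integration.integral_diff conv_integrable[of _ C] conv_integrable[of _ C']) auto

lemma dq_conv:
  assumes [measurable]: "W \<in> borel_measurable borel" and W: "\<And>t. \<bar>W t\<bar> \<le> C"
  shows "dq (conv K W) h t = conv K (dq W h) t"
proof -
  have "conv K (\<lambda>s. (1 / h) * (W (s + h) - W s)) t = (1 / h) * (conv K (\<lambda>s. W (s + h)) t - conv K W t)"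
    unfolding conv_cmult by (subst conv_diff[of _ _ C C]) (auto simp: W)
  then show ?thesis by (simp add: dq_def[abs_def] conv_translate)
qed

text \<open>The mean \<open>\<psi> h\<close> of \<open>U\<close> over an interval of length
  \<open>\<bar>h\<bar>\<close> has derivative \<open>dq U h\<close>, which is the convolution of
  \<open>K\<close> with \<open>dq W h\<close>. Hence \<open>conv_le_mean\<close> bounds
  \<open>dq U h\<close> by the oscillation of \<open>\<psi> h\<close>, which involves no derivative,
  plus a small multiple of the bound for \<open>dq W h\<close>. In the second estimate both means
  lie within \<open>\<omega>\<close> of \<open>U\<close>, so their difference changes by at most
  \<open>4 * \<omega>\<close>.\<close>

lemma dq_conv_le:
  assumes [measurable]: "W \<in> borel_measurable borel" and W: "\<And>t. \<bar>W t\<bar> \<le> C"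
    and U: "\<And>t. U t = conv K W t" and Ub: "\<And>t. \<bar>U t\<bar> \<le> B"
    and \<eta>: "\<eta> > 0" "\<And>s. \<bar>s\<bar> \<le> \<eta> \<Longrightarrow> modL1 s \<le> \<epsilon>" 
  shows "h \<noteq> 0 \<Longrightarrow> (\<And>t. \<bar>dq W h t\<bar> \<le> S) \<Longrightarrow> \<bar>dq U h t\<bar> \<le> 2 * B / \<eta> + \<epsilon> * S"
    and "h \<noteq> 0 \<Longrightarrow> h' \<noteq> 0 \<Longrightarrow> (\<And>t. \<bar>dq W h t - dq W h' t\<bar> \<le> S) \<Longrightarrow>
      (\<And>s t. \<bar>s\<bar> \<le> max \<bar>h\<bar> \<bar>h'\<bar> \<Longrightarrow> \<bar>U (t + s) - U t\<bar> \<le> \<omega>) \<Longrightarrow>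
      \<bar>dq U h t - dq U h' t\<bar> \<le> 4 * \<omega> / \<eta> + \<epsilon> * S"
proof -
  have Ue: "U = conv K W" using U by auto
  have Uc: "isCont U t" for t unfolding Ue by (rule conv_isCont[of _ C]) (simp_all add: W)
  obtain \<Phi> where \<Phi>: "\<And>t. (\<Phi> has_real_derivative U t) (at t)"
    using einterval_antiderivative[of "-\<infinity>" "\<infinity>" U] Uc
    by (auto simp: has_real_derivative_iff_has_vector_derivative)
  define \<psi> where "\<psi> h s = (\<Phi> (s + h) - \<Phi> s) / h" for h s
  have \<psi>d: "(\<psi> h has_real_derivative dq U h s) (at s)" if "h \<noteq> 0" for h s
  proof -
    have "((\<lambda>s. \<Phi> (s + h)) has_real_derivative U (s + h)) (at s)"
      using \<Phi>[of "s + h"] by (simp add: DERIV_shift)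
    then show ?thesis unfolding \<psi>_def[abs_def] dq_def by (intro DERIV_cdivide DERIV_diff \<Phi>)
  qed
  have \<psi>m: "\<exists>z. \<bar>z\<bar> \<le> \<bar>h\<bar> \<and> \<psi> h s = U (s + z)" if h: "h \<noteq> 0" for h s
  proof (cases "h > 0")
    case True
    have "\<exists>z. s < z \<and> z < s + h \<and> \<Phi> (s + h) - \<Phi> s = (s + h - s) * U z" by (rule MVT2) (use True \<Phi> in auto)
    then obtain z where z: "s < z" "z < s + h" "\<Phi> (s + h) - \<Phi> s = (s + h - s) * U z" by blast
    then show ?thesis using h by (intro exI[of _ "z - s"]) (auto simp: \<psi>_def)
  next
    case False
    have "\<exists>z. s + h < z \<and> z < s \<and> \<Phi> s - \<Phi> (s + h) = (s - (s + h)) * U z" by (rule MVT2) (use False h \<Phi> in auto)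
    then obtain z where z: "s + h < z" "z < s" "\<Phi> s - \<Phi> (s + h) = (s - (s + h)) * U z" by blast
    then have "\<Phi> (s + h) - \<Phi> s = h * U z" by simp
    then show ?thesis using h z False by (intro exI[of _ "z - s"]) (auto simp: \<psi>_def)
  qed
  have dqm [measurable]: "dq W h \<in> borel_measurable borel" for h unfolding dq_def[abs_def] by measurable
  show "\<bar>dq U h t\<bar> \<le> 2 * B / \<eta> + \<epsilon> * S" if h: "h \<noteq> 0" and S: "\<And>t. \<bar>dq W h t\<bar> \<le> S"
  proof -
    have e: "dq U h s = conv K (dq W h) s" for s unfolding Ue by (rule dq_conv[of _ C]) (simp_all add: W)
    have "\<bar>conv K (dq W h) t\<bar> \<le> \<bar>\<psi> h (t + \<eta>) - \<psi> h t\<bar> / \<eta> + \<epsilon> * S"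
      by (rule conv_le_mean[OF dqm S \<eta>]) (simp_all add: e[symmetric] \<psi>d h)
    moreover have "\<bar>\<psi> h s\<bar> \<le> B" for s using \<psi>m[OF h, of s] Ub by metis
    then have "\<bar>\<psi> h (t + \<eta>) - \<psi> h t\<bar> \<le> 2 * B" by (smt (verit))
    then have "\<bar>\<psi> h (t + \<eta>) - \<psi> h t\<bar> / \<eta> \<le> 2 * B / \<eta>" using \<eta> by (intro divide_right_mono) auto
    ultimately show ?thesis unfolding e by linarith
  qed
  show "\<bar>dq U h t - dq U h' t\<bar> \<le> 4 * \<omega> / \<eta> + \<epsilon> * S"
    if h: "h \<noteq> 0" "h' \<noteq> 0" and S: "\<And>t. \<bar>dq W h t - dq W h' t\<bar> \<le> S"
      and \<omega>: "\<And>s t. \<bar>s\<bar> \<le> max \<bar>h\<bar> \<bar>h'\<bar> \<Longrightarrow> \<bar>U (t + s) - U t\<bar> \<le> \<omega>"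
  proof -
    have b: "\<bar>dq W h t\<bar> \<le> 2 * C / \<bar>h\<bar>" for h t
    proof -
      have "\<bar>W (t + h) - W t\<bar> \<le> 2 * C" using W[of "t + h"] W[of t] by linarith
      then show ?thesis by (simp add: dq_def abs_divide divide_right_mono)
    qed
    have e: "dq U h s - dq U h' s = conv K (\<lambda>s. dq W h s - dq W h' s) s" for s
      unfolding Ue by (subst conv_diff[OF dqm dqm b b]) (simp add: dq_conv[of _ C] W)
    have "\<bar>conv K (\<lambda>s. dq W h s - dq W h' s) t\<bar> \<le> \<bar>(\<lambda>s. \<psi> h s - \<psi> h' s) (t + \<eta>) - (\<lambda>s. \<psi> h s - \<psi> h' s) t\<bar> / \<eta> + \<epsilon> * S"
      by (rule conv_le_mean[OF _ S \<eta>]) (auto simp: e[symmetric] intro!: DERIV_diff \<psi>d h)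
    moreover have "\<bar>\<psi> h s - \<psi> h' s\<bar> \<le> 2 * \<omega>" for s
    proof -
      obtain z where z: "\<bar>z\<bar> \<le> \<bar>h\<bar>" "\<psi> h s = U (s + z)" using \<psi>m[OF h(1)] by blast
      obtain z' where z': "\<bar>z'\<bar> \<le> \<bar>h'\<bar>" "\<psi> h' s = U (s + z')" using \<psi>m[OF h(2)] by blast
      have "\<bar>U (s + z) - U s\<bar> \<le> \<omega>" "\<bar>U (s + z') - U s\<bar> \<le> \<omega>" using z z' by (auto intro!: \<omega>)
      then show ?thesis unfolding z z' by linarith
    qed
    then have "\<bar>(\<psi> h (t + \<eta>) - \<psi> h' (t + \<eta>)) - (\<psi> h t - \<psi> h' t)\<bar> \<le> 4 * \<omega>" by (smt (verit))
    then have "\<bar>(\<psi> h (t + \<eta>) - \<psi> h' (t + \<eta>)) - (\<psi> h t - \<psi> h' t)\<bar> / \<eta> \<le> 4 * \<omega> / \<eta>" using \<eta> by (intro divide_right_mono) auto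
    ultimately show ?thesis unfolding e by linarith
  qed
qed

text \<open>The contraction argument runs twice: first on the difference quotients, giving a
  Lipschitz bound \<open>M\<close> independent of the increment, then on the differences of two
  quotients, giving the uniform Cauchy property. The powers link the quotients of \<open>U\<close>
  and \<open>V\<close> with a bounded factor, and the modulus of continuity of the kernel makes the
  product of factors equal to one half.\<close>

theorem system_C1:
  assumes q: "q1 > 1" "q2 > 1"
    and [measurable]: "U \<in> borel_measurable borel" "V \<in> borel_measurable borel"
    and Ub: "\<And>t. 0 < U t" "\<And>t. U t \<le> C" and Vb: "\<And>t. 0 < V t" "\<And>t. V t \<le> C"
    and Ueq: "\<And>t. U t = conv K (\<lambda>s. V s powr q2) t"
    and Veq: "\<And>t. V t = conv (\<lambda>t. K (- t)) (\<lambda>s. U s powr q1) t"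
  shows "\<exists>g. continuous_on UNIV g \<and> (\<forall>t. (U has_real_derivative g t) (at t))"
    and "\<exists>g. continuous_on UNIV g \<and> (\<forall>t. (V has_real_derivative g t) (at t))"
proof -
  interpret R: cont_kernel "\<lambda>t. K (- t)" by (rule cont_kernel_reflect)
  have Cp: "C > 0" using Ub[of 0] by simp
  define X where "X s = V s powr q2" for s
  define Y where "Y s = U s powr q1" for s
  have [measurable]: "X \<in> borel_measurable borel" "Y \<in> borel_measurable borel"
    unfolding X_def[abs_def] Y_def[abs_def] by measurable
  have UX: "U t = conv K X t" and VY: "V t = conv (\<lambda>t. K (- t)) Y t" for t
    unfolding X_def[abs_def] Y_def[abs_def] by (rule Ueq, rule Veq)
  have Xb: "\<bar>X t\<bar> \<le> C powr q2" and Yb: "\<bar>Y t\<bar> \<le> C powr q1" for t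
    using Ub[of t] Vb[of t] q by (auto simp: X_def Y_def intro!: powr_mono2)
  have Ua: "\<bar>U t\<bar> \<le> C" and Va: "\<bar>V t\<bar> \<le> C" for t using Ub[of t] Vb[of t] by auto
  have Uu: "uniformly_continuous_on UNIV U" 
  proof -
    have "U = conv K X" by (rule ext) (rule UX)
    then show ?thesis using conv_uniformly_continuous[OF _ Xb] by simp
  qed
  have Vu: "uniformly_continuous_on UNIV V" 
  proof -
    have "V = conv (\<lambda>t. K (- t)) Y" by (rule ext) (rule VY)
    then show ?thesis using R.conv_uniformly_continuous[OF _ Yb] by simp
  qed
  define L where "L = max (q1 * C powr (q1 - 1)) (q2 * C powr (q2 - 1)) + 1"
  have L1: "q1 * C powr (q1 - 1) \<le> L" "q2 * C powr (q2 - 1) \<le> L" by (auto simp: L_def)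
  have "0 \<le> q1 * C powr (q1 - 1)" using q by simp
  then have L: "L > 0" unfolding L_def by linarith
  \<comment> \<open>\<open>L\<close> is a Lipschitz constant of both powers on the range of the
    solution, and \<open>\<epsilon>\<close> is chosen so that
    \<open>\<epsilon> * L = 1 / 2\<close>.\<close>
  define \<epsilon> where "\<epsilon> = 1 / (2 * L)"
  have \<epsilon>: "\<epsilon> > 0" "\<epsilon> * L = 1 / 2" using L by (auto simp: \<epsilon>_def)
  obtain \<eta>1 where \<eta>1: "\<eta>1 > 0" "\<And>s. \<bar>s\<bar> \<le> \<eta>1 \<Longrightarrow> modL1 s \<le> \<epsilon>" using modL1_small[OF \<epsilon>(1)] by blast
  obtain \<eta>2 where \<eta>2: "\<eta>2 > 0" "\<And>s. \<bar>s\<bar> \<le> \<eta>2 \<Longrightarrow> R.modL1 s \<le> \<epsilon>" using R.modL1_small[OF \<epsilon>(1)] by blast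
  define \<eta> where "\<eta> = min \<eta>1 \<eta>2"
  have \<eta>: "\<eta> > 0" "\<And>s. \<bar>s\<bar> \<le> \<eta> \<Longrightarrow> modL1 s \<le> \<epsilon>" "\<And>s. \<bar>s\<bar> \<le> \<eta> \<Longrightarrow> R.modL1 s \<le> \<epsilon>"
    using \<eta>1 \<eta>2 by (auto simp: \<eta>_def)
  have dX: "\<bar>dq X h t\<bar> \<le> L * \<bar>dq V h t\<bar>" for h t
  proof -
    have "\<bar>X (t + h) - X t\<bar> \<le> L * \<bar>V (t + h) - V t\<bar>"
      unfolding X_def by (rule order_trans[OF powr_lipschitz[OF q(2) Vb(1,2) Vb(1,2)]]) (use L1 in \<open>auto intro: mult_right_mono\<close>)
    then show ?thesis by (simp add: dq_def abs_divide divide_right_mono)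
  qed
  have dY: "\<bar>dq Y h t\<bar> \<le> L * \<bar>dq U h t\<bar>" for h t
  proof -
    have "\<bar>Y (t + h) - Y t\<bar> \<le> L * \<bar>U (t + h) - U t\<bar>"
      unfolding Y_def by (rule order_trans[OF powr_lipschitz[OF q(1) Ub(1,2) Ub(1,2)]]) (use L1 in \<open>auto intro: mult_right_mono\<close>)
    then show ?thesis by (simp add: dq_def abs_divide divide_right_mono)
  qed
  define M where "M = 2 * (2 * C / \<eta>)"
  have M0: "M \<ge> 0" using Cp \<eta> by (simp add: M_def)
  have lip: "max \<bar>dq U h t\<bar> \<bar>dq V h t\<bar> \<le> M" if h: "h \<noteq> 0" for h t
    unfolding M_def
  proof (rule half_contraction_bound[where f="\<lambda>t. max \<bar>dq U h t\<bar> \<bar>dq V h t\<bar>" and B="2 * C / \<bar>h\<bar>"])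
    show "max \<bar>dq U h t\<bar> \<bar>dq V h t\<bar> \<le> 2 * C / \<bar>h\<bar>" for t
    proof -
      have "\<bar>U (t + h) - U t\<bar> \<le> 2 * C" "\<bar>V (t + h) - V t\<bar> \<le> 2 * C"
        using Ua[of "t + h"] Ua[of t] Va[of "t + h"] Va[of t] by linarith+
      then show ?thesis by (auto simp: dq_def abs_divide intro!: divide_right_mono)
    qed
    fix s t assume s: "\<And>i. max \<bar>dq U h i\<bar> \<bar>dq V h i\<bar> \<le> s"
    have "\<bar>dq X h t\<bar> \<le> L * s" "\<bar>dq Y h t\<bar> \<le> L * s" for t
      using dX[of h t] dY[of h t] s[of t] L by (smt (verit) mult_left_mono)+
    then have "\<bar>dq U h t\<bar> \<le> 2 * C / \<eta> + \<epsilon> * (L * s)" "\<bar>dq V h t\<bar> \<le> 2 * C / \<eta> + \<epsilon> * (L * s)"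
      using dq_conv_le(1)[OF _ Xb UX Ua \<eta>(1,2) h] R.dq_conv_le(1)[OF _ Yb VY Va \<eta>(1,3) h] by auto
    then show "max \<bar>dq U h t\<bar> \<bar>dq V h t\<bar> \<le> 2 * C / \<eta> + s / 2"
      using \<epsilon>(2) by (simp add: mult.assoc[symmetric])
  qed
  have cauchy: "\<exists>d>0. \<forall>h h' t. h \<noteq> 0 \<longrightarrow> \<bar>h\<bar> < d \<longrightarrow> h' \<noteq> 0 \<longrightarrow> \<bar>h'\<bar> < d \<longrightarrow>
     max \<bar>dq U h t - dq U h' t\<bar> \<bar>dq V h t - dq V h' t\<bar> \<le> e" if e: "e > 0" for e
  proof -
    \<comment> \<open>Two error terms are allotted \<open>e / 4\<close> each:
      \<open>4 * \<omega> / \<eta>\<close> from the oscillation of the solution, and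
      \<open>\<epsilon> * (2 * e1 * M)\<close> from the linearisation error of the two
      quotients.\<close>
    define \<omega> where "\<omega> = e * \<eta> / 16"
    have \<omega>: "\<omega> > 0" using e \<eta> by (simp add: \<omega>_def)
    define e1 where "e1 = e / (8 * (M + 1) * \<epsilon>)"
    have e1: "e1 > 0" using e M0 \<epsilon> by (simp add: e1_def)
    have e1M: "\<epsilon> * (2 * e1 * M) \<le> e / 4"
    proof -
      have "8 * (M + 1) * \<epsilon> \<noteq> 0" "M + 1 \<noteq> 0" using \<epsilon>(1) M0 by auto
      then have "\<epsilon> * (2 * e1 * M) = e / 4 * (M / (M + 1))" unfolding e1_def by (simp add: divide_simps)
      also have "\<dots> \<le> e / 4 * 1" using e M0 by (intro mult_left_mono) auto
      finally show ?thesis by simp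
    qed
    obtain d1 where d1: "d1 > 0" "\<And>x y. 0 < x \<Longrightarrow> x \<le> C \<Longrightarrow> 0 < y \<Longrightarrow> y \<le> C \<Longrightarrow> \<bar>x - y\<bar> < d1 \<Longrightarrow>
       \<bar>x powr q1 - y powr q1 - q1 * y powr (q1 - 1) * (x - y)\<bar> \<le> e1 * \<bar>x - y\<bar>"
      using powr_uniform_derivative[OF q(1) e1, of C] by blast
    obtain d2 where d2: "d2 > 0" "\<And>x y. 0 < x \<Longrightarrow> x \<le> C \<Longrightarrow> 0 < y \<Longrightarrow> y \<le> C \<Longrightarrow> \<bar>x - y\<bar> < d2 \<Longrightarrow>
       \<bar>x powr q2 - y powr q2 - q2 * y powr (q2 - 1) * (x - y)\<bar> \<le> e1 * \<bar>x - y\<bar>"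
      using powr_uniform_derivative[OF q(2) e1, of C] by blast
    define \<rho> where "\<rho> = min \<omega> (min d1 d2)"
    have \<rho>: "\<rho> > 0" using \<omega> d1 d2 by (simp add: \<rho>_def)
    obtain dU where dU: "dU > 0" "\<And>x x'. dist x' x < dU \<Longrightarrow> dist (U x') (U x) < \<rho>"
      using Uu[unfolded uniformly_continuous_on_def, rule_format, OF \<rho>] by auto
    obtain dV where dV: "dV > 0" "\<And>x x'. dist x' x < dV \<Longrightarrow> dist (V x') (V x) < \<rho>"
      using Vu[unfolded uniformly_continuous_on_def, rule_format, OF \<rho>] by auto
    define d where "d = min dU dV"
    have osc: "\<bar>U (t + s) - U t\<bar> < \<rho>" "\<bar>V (t + s) - V t\<bar> < \<rho>" if "\<bar>s\<bar> < d" for s t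
      using dU(2)[of "t + s" t] dV(2)[of "t + s" t] that by (auto simp: dist_real_def d_def)
    \<comment> \<open>The coefficient of the linearisation does not depend on \<open>h\<close>, so
      in the difference of two quotients it multiplies a difference of quotients of the solution,
      which is the quantity being contracted.\<close>
    have lin: "\<bar>dq X h t - q2 * V t powr (q2 - 1) * dq V h t\<bar> \<le> e1 * M" "\<bar>dq Y h t - q1 * U t powr (q1 - 1) * dq U h t\<bar> \<le> e1 * M"
      if h: "h \<noteq> 0" "\<bar>h\<bar> < d" for h t
    proof -
      have eX: "dq X h t - q2 * V t powr (q2 - 1) * dq V h t = (X (t + h) - X t - q2 * V t powr (q2 - 1) * (V (t + h) - V t)) / h"
        using h by (simp add: dq_def field_simps)
      have "\<bar>X (t + h) - X t - q2 * V t powr (q2 - 1) * (V (t + h) - V t)\<bar> \<le> e1 * \<bar>V (t + h) - V t\<bar>"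
        unfolding X_def using osc[OF h(2), of t] by (intro d2 Vb) (auto simp: \<rho>_def)
      then have "\<bar>X (t + h) - X t - q2 * V t powr (q2 - 1) * (V (t + h) - V t)\<bar> / \<bar>h\<bar> \<le> e1 * \<bar>V (t + h) - V t\<bar> / \<bar>h\<bar>"
        by (intro divide_right_mono) auto
      then have "\<bar>dq X h t - q2 * V t powr (q2 - 1) * dq V h t\<bar> \<le> e1 * \<bar>dq V h t\<bar>"
        unfolding eX by (simp add: dq_def)
      also have "\<dots> \<le> e1 * M" using lip[OF h(1), of t] e1 by (intro mult_left_mono) auto
      finally show "\<bar>dq X h t - q2 * V t powr (q2 - 1) * dq V h t\<bar> \<le> e1 * M" .
      have eY: "dq Y h t - q1 * U t powr (q1 - 1) * dq U h t = (Y (t + h) - Y t - q1 * U t powr (q1 - 1) * (U (t + h) - U t)) / h"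
        using h by (simp add: dq_def field_simps)
      have "\<bar>Y (t + h) - Y t - q1 * U t powr (q1 - 1) * (U (t + h) - U t)\<bar> \<le> e1 * \<bar>U (t + h) - U t\<bar>"
        unfolding Y_def using osc[OF h(2), of t] by (intro d1 Ub) (auto simp: \<rho>_def)
      then have "\<bar>Y (t + h) - Y t - q1 * U t powr (q1 - 1) * (U (t + h) - U t)\<bar> / \<bar>h\<bar> \<le> e1 * \<bar>U (t + h) - U t\<bar> / \<bar>h\<bar>"
        by (intro divide_right_mono) auto
      then have "\<bar>dq Y h t - q1 * U t powr (q1 - 1) * dq U h t\<bar> \<le> e1 * \<bar>dq U h t\<bar>"
        unfolding eY by (simp add: dq_def)
      also have "\<dots> \<le> e1 * M" using lip[OF h(1), of t] e1 by (intro mult_left_mono) auto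
      finally show "\<bar>dq Y h t - q1 * U t powr (q1 - 1) * dq U h t\<bar> \<le> e1 * M" .
    qed
    show ?thesis
    proof (intro exI[of _ d] conjI allI impI)
      show "d > 0" using dU dV by (simp add: d_def)
      fix h h' t assume h: "h \<noteq> 0" "\<bar>h\<bar> < d" "h' \<noteq> 0" "\<bar>h'\<bar> < d"
      have "max \<bar>dq U h t - dq U h' t\<bar> \<bar>dq V h t - dq V h' t\<bar> \<le> 2 * (e / 2)"
      proof (rule half_contraction_bound[where f="\<lambda>t. max \<bar>dq U h t - dq U h' t\<bar> \<bar>dq V h t - dq V h' t\<bar>" and B="2 * M"])
        show "max \<bar>dq U h t - dq U h' t\<bar> \<bar>dq V h t - dq V h' t\<bar> \<le> 2 * M" for t
          using lip[OF h(1), of t] lip[OF h(3), of t] by (smt (verit))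
        fix s t assume s: "\<And>i. max \<bar>dq U h i - dq U h' i\<bar> \<bar>dq V h i - dq V h' i\<bar> \<le> s"
        have DX: "\<bar>dq X h t - dq X h' t\<bar> \<le> L * s + 2 * e1 * M" for t
        proof -
          have "\<bar>q2 * V t powr (q2 - 1) * dq V h t - q2 * V t powr (q2 - 1) * dq V h' t\<bar> = q2 * V t powr (q2 - 1) * \<bar>dq V h t - dq V h' t\<bar>"
            using q by (simp add: right_diff_distrib[symmetric] abs_mult)
          also have "\<dots> \<le> L * s"
          proof (intro mult_mono)
            have "V t powr (q2 - 1) \<le> C powr (q2 - 1)" using Vb[of t] q by (intro powr_mono2) auto
            then have "q2 * V t powr (q2 - 1) \<le> q2 * C powr (q2 - 1)" using q by (intro mult_left_mono) auto
            then show "q2 * V t powr (q2 - 1) \<le> L" using L1 by linarith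
          qed (use s[of t] L in auto)
          finally show ?thesis using lin(1)[OF h(1,2), of t] lin(1)[OF h(3,4), of t] by linarith
        qed
        have DY: "\<bar>dq Y h t - dq Y h' t\<bar> \<le> L * s + 2 * e1 * M" for t
        proof -
          have "\<bar>q1 * U t powr (q1 - 1) * dq U h t - q1 * U t powr (q1 - 1) * dq U h' t\<bar> = q1 * U t powr (q1 - 1) * \<bar>dq U h t - dq U h' t\<bar>"
            using q by (simp add: right_diff_distrib[symmetric] abs_mult)
          also have "\<dots> \<le> L * s"
          proof (intro mult_mono)
            have "U t powr (q1 - 1) \<le> C powr (q1 - 1)" using Ub[of t] q by (intro powr_mono2) auto
            then have "q1 * U t powr (q1 - 1) \<le> q1 * C powr (q1 - 1)" using q by (intro mult_left_mono) auto
            then show "q1 * U t powr (q1 - 1) \<le> L" using L1 by linarith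
          qed (use s[of t] L in auto)
          finally show ?thesis using lin(2)[OF h(1,2), of t] lin(2)[OF h(3,4), of t] by linarith
        qed
        have oU: "\<bar>U (t + s) - U t\<bar> \<le> \<omega>" and oV: "\<bar>V (t + s) - V t\<bar> \<le> \<omega>" if "\<bar>s\<bar> \<le> max \<bar>h\<bar> \<bar>h'\<bar>" for s t
        proof -
          have "\<bar>s\<bar> < d" using that h by linarith
          then show "\<bar>U (t + s) - U t\<bar> \<le> \<omega>" "\<bar>V (t + s) - V t\<bar> \<le> \<omega>"
            using osc[of s t] by (auto simp: \<rho>_def)
        qed
        have bnd: "4 * \<omega> / \<eta> + \<epsilon> * (L * s + 2 * e1 * M) \<le> e / 2 + s / 2"
        proof -
          have "4 * \<omega> / \<eta> = e / 4" using \<eta> by (simp add: \<omega>_def)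
          moreover have "\<epsilon> * (L * s + 2 * e1 * M) = (\<epsilon> * L) * s + \<epsilon> * (2 * e1 * M)" by (simp only: distrib_left mult.assoc)
          ultimately show ?thesis using e1M \<epsilon>(2) by simp
        qed
        have "\<bar>dq U h t - dq U h' t\<bar> \<le> 4 * \<omega> / \<eta> + \<epsilon> * (L * s + 2 * e1 * M)"
          by (rule dq_conv_le(2)[OF _ Xb UX Ua \<eta>(1,2) h(1,3) DX oU]) simp_all
        moreover have "\<bar>dq V h t - dq V h' t\<bar> \<le> 4 * \<omega> / \<eta> + \<epsilon> * (L * s + 2 * e1 * M)"
          by (rule R.dq_conv_le(2)[OF _ Yb VY Va \<eta>(1,3) h(1,3) DY oV]) simp_all
        ultimately show "max \<bar>dq U h t - dq U h' t\<bar> \<bar>dq V h t - dq V h' t\<bar> \<le> e / 2 + s / 2"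
          using bnd by simp
      qed
      then show "max \<bar>dq U h t - dq U h' t\<bar> \<bar>dq V h t - dq V h' t\<bar> \<le> e" by simp
    qed
  qed
  have Uc: "isCont U t" and Vc: "isCont V t" for t
    using uniformly_continuous_imp_continuous[OF Uu] uniformly_continuous_imp_continuous[OF Vu]
    by (simp_all add: continuous_on_eq_continuous_at)
  show "\<exists>g. continuous_on UNIV g \<and> (\<forall>t. (U has_real_derivative g t) (at t))"
  proof (rule uniform_dq_derivative[OF Uc])
    fix e :: real assume "e > 0"
    from cauchy[OF this] show "\<exists>d>0. \<forall>h h' t. h \<noteq> 0 \<longrightarrow> \<bar>h\<bar> < d \<longrightarrow> h' \<noteq> 0 \<longrightarrow> \<bar>h'\<bar> < d \<longrightarrow> \<bar>dq U h t - dq U h' t\<bar> \<le> e"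
      unfolding max.bounded_iff by meson
  qed
  show "\<exists>g. continuous_on UNIV g \<and> (\<forall>t. (V has_real_derivative g t) (at t))"
  proof (rule uniform_dq_derivative[OF Vc])
    fix e :: real assume "e > 0"
    from cauchy[OF this] show "\<exists>d>0. \<forall>h h' t. h \<noteq> 0 \<longrightarrow> \<bar>h\<bar> < d \<longrightarrow> h' \<noteq> 0 \<longrightarrow> \<bar>h'\<bar> < d \<longrightarrow> \<bar>dq V h t - dq V h' t\<bar> \<le> e"
      unfolding max.bounded_iff by meson
  qed
qed

end

section \<open>From profiles on the line to radial functions in space\<close>

lemma wker_conv_weighted_antimono:
  fixes \<theta> :: "'a::euclidean_space" and c s p p' :: real
  assumes \<theta>: "norm \<theta> = 1" and sc: "0 < c" "c < s" "s < DIM('a)" and p: "p \<ge> 0" "p' \<ge> 0"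
    and [measurable]: "w \<in> borel_measurable borel" and w0: "\<And>t. 0 \<le> w t" and wC: "\<And>t. w t \<le> C"
    and w: "\<And>s t. s \<le> t \<Longrightarrow> exp ((c - DIM('a) + p) * t) * w t \<le> exp ((c - DIM('a) + p) * s) * w s"
    and tt: "t \<le> t'"
  shows "exp (- (s - c + p') * t') * conv (wker s c \<theta>) w t' \<le> exp (- (s - c + p') * t) * conv (wker s c \<theta>) w t"
proof -
  interpret kernel "wker s c \<theta>"
    by unfold_locales (use wker_nonneg integrable_wker[OF \<theta> sc] in auto)
  have nn: "(\<integral>\<^sup>+\<sigma>. ennreal (wker s c \<theta> (t - \<sigma>)) * ennreal (w \<sigma>) \<partial>lborel) = ennreal (conv (wker s c \<theta>) w t)" for t
    by (rule conv_nn[OF _ w0 wC, symmetric]) simp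
  have c0: "0 \<le> conv (wker s c \<theta>) w t" for t by (rule conv_nonneg[OF _ w0 wC]) simp
  have "ennreal (exp (- (s - c) * t')) * (\<integral>\<^sup>+\<sigma>. ennreal (wker s c \<theta> (t' - \<sigma>)) * ennreal (w \<sigma>) \<partial>lborel)
    \<le> ennreal (exp (- (s - c) * t)) * (\<integral>\<^sup>+\<sigma>. ennreal (wker s c \<theta> (t - \<sigma>)) * ennreal (w \<sigma>) \<partial>lborel)"
  proof (rule wker_conv_antimono[OF \<theta> sc _ _ tt])
    fix \<sigma> \<sigma>' :: real assume st: "\<sigma> \<le> \<sigma>'"
    have e: "exp ((c - DIM('a)) * \<sigma>) = exp (- p * \<sigma>) * exp ((c - DIM('a) + p) * \<sigma>)" for \<sigma>
      by (simp add: exp_add[symmetric] algebra_simps)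
    \<comment> \<open>Multiplication by the nonincreasing factor \<open>exp (- p * \<sigma>)\<close>
      accounts for the weight inside the integral. The weight in front of the potential, with
      exponent \<open>p'\<close>, is treated in the same way at the end.\<close>
    have "exp (- p * \<sigma>') * (exp ((c - DIM('a) + p) * \<sigma>') * w \<sigma>') \<le> exp (- p * \<sigma>) * (exp ((c - DIM('a) + p) * \<sigma>) * w \<sigma>)"
      using st p w0 by (intro mult_mono w) (auto simp: mult_left_mono)
    then show "ennreal (exp ((c - DIM('a)) * \<sigma>')) * ennreal (w \<sigma>') \<le> ennreal (exp ((c - DIM('a)) * \<sigma>)) * ennreal (w \<sigma>)"
      unfolding e by (simp add: ennreal_mult'[symmetric] ennreal_leI mult.assoc del: ennreal_le_iff2)
  qed simp
  then have 1: "exp (- (s - c) * t') * conv (wker s c \<theta>) w t' \<le> exp (- (s - c) * t) * conv (wker s c \<theta>) w t"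
    unfolding nn using c0 by (simp add: ennreal_mult'[symmetric] mult_nonneg_nonneg)
  have "exp (- p' * t') * (exp (- (s - c) * t') * conv (wker s c \<theta>) w t') \<le> exp (- p' * t) * (exp (- (s - c) * t) * conv (wker s c \<theta>) w t)"
    by (rule mult_mono[OF _ 1]) (use tt p c0 in \<open>auto simp: mult_left_mono\<close>)
  moreover have "exp (- (s - c + p') * t) = exp (- p' * t) * exp (- (s - c) * t)" for t
    by (simp add: exp_add[symmetric] algebra_simps)
  ultimately show ?thesis by (simp only: mult.assoc)
qed

lemma C1_on_radial:
  fixes H :: "real \<Rightarrow> real"
  assumes H: "\<And>t. (H has_real_derivative h t) (at t)" and h: "continuous_on UNIV h"
  shows "C1_on (- {0}) (\<lambda>x :: real ^ 'n. H (ln (norm x)))"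
proof -
  define f' :: "real ^ 'n \<Rightarrow> (real ^ 'n) \<Rightarrow>\<^sub>L real" where
    "f' x = (h (ln (norm x)) / norm x) *\<^sub>R blinfun_inner_left (sgn x)" for x
  have "((\<lambda>x. H (ln (norm x))) has_derivative blinfun_apply (f' x)) (at x)" if x: "x \<noteq> 0" for x :: "real ^ 'n"
  proof -
    have n: "(norm has_derivative (\<lambda>v. v \<bullet> sgn x)) (at x)"
      using has_derivative_norm[of x] x by (simp add: inner_commute)
    have l: "((\<lambda>t. H (ln t)) has_real_derivative h (ln (norm x)) * (1 / norm x)) (at (norm x))"
      using x by (intro DERIV_chain2[where f=H and g=ln] H) (auto intro!: derivative_eq_intros)
    have "((\<lambda>x. H (ln (norm x))) has_derivative (\<lambda>v. h (ln (norm x)) * (1 / norm x) * (v \<bullet> sgn x))) (at x)"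
      using has_derivative_compose[OF n l[unfolded has_field_derivative_def]] by simp
    moreover have "blinfun_apply (f' x) = (\<lambda>v. h (ln (norm x)) * (1 / norm x) * (v \<bullet> sgn x))"
      by (rule ext) (simp add: f'_def blinfun.scaleR_left)
    ultimately show ?thesis by simp
  qed
  moreover have "continuous_on (- {0}) f'"
    unfolding f'_def sgn_div_norm
    by (intro continuous_intros continuous_on_compose2[OF h] bounded_linear.continuous_on[OF bounded_linear_blinfun_inner_left]) auto
  ultimately show ?thesis unfolding C1_on_def by auto
qed

text \<open>Assumption \<open>e\<close> matches homogeneities: the \<open>q\<close>-th power of the
  radial function divided by \<open>norm y powr \<gamma>\<close> is a density of degree
  \<open>c - n\<close> times the profile \<open>V powr q\<close>, as required by
  \<open>wker_potential\<close>.\<close>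

lemma radial_potential_solution:
  fixes \<theta> :: "real ^ 'n" and V :: "real \<Rightarrow> real" and \<alpha> b c q \<gamma> :: real
  defines "s \<equiv> real CARD('n) - \<alpha>"
  assumes \<theta>: "norm \<theta> = 1" and sc: "0 < c" "c < s" "s < CARD('n)"
    and [measurable]: "V \<in> borel_measurable borel" and V0: "\<And>t. 0 < V t" and VC: "\<And>t. V t \<le> C"
    and q: "q > 0" and e: "- (b * q) - \<gamma> = c - CARD('n)" and x: "x \<noteq> 0"
  shows "integrable lebesgue (wpot_integrand \<alpha> \<gamma> q (\<lambda>y :: real ^ 'n. exp (- b * ln (norm y)) * V (ln (norm y))) x)"
    and "(LINT y|lebesgue. wpot_integrand \<alpha> \<gamma> q (\<lambda>y :: real ^ 'n. exp (- b * ln (norm y)) * V (ln (norm y))) x y)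
      = norm x powr (- (s - c)) * conv (wker s c \<theta>) (\<lambda>t. V t powr q) (ln (norm x))"
proof -
  let ?F = "wpot_integrand \<alpha> \<gamma> q (\<lambda>y :: real ^ 'n. exp (- b * ln (norm y)) * V (ln (norm y))) x"
  have D: "real DIM(real ^ 'n) = CARD('n)" by simp
  have sc': "0 < c" "c < s" "s < DIM(real ^ 'n)" using sc by auto
  interpret kernel "wker s c \<theta>"
    by unfold_locales (use wker_nonneg integrable_wker[OF \<theta> sc'] in auto)
  have W: "0 \<le> V t powr q" "V t powr q \<le> C powr q" for t
    using V0[of t] VC[of t] q by (auto intro!: powr_mono2)
  have F0: "0 \<le> ?F y" for y by (simp add: wpot_integrand_def)
  have Fm [measurable]: "?F \<in> borel_measurable borel" unfolding wpot_integrand_def[abs_def] by measurable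
  let ?val = "norm x powr (- (s - c)) * conv (wker s c \<theta>) (\<lambda>t. V t powr q) (ln (norm x))"
  have v0: "0 \<le> ?val" using conv_nonneg[OF _ W] by simp
  have "(\<integral>\<^sup>+y. ennreal (?F y) \<partial>lborel) = (\<integral>\<^sup>+y. ennreal (norm y powr (c - DIM(real ^ 'n))) * ennreal (V (ln (norm y)) powr q) * ennreal (norm (x - y) powr (- s)) \<partial>lborel)"
  proof (intro nn_integral_cong_AE eventually_mono[OF AE_lborel_nonzero])
    fix y :: "real ^ 'n" assume y: "y \<noteq> 0"
    have "(exp (- b * ln (norm y)) * V (ln (norm y))) powr q = exp (- (b * q) * ln (norm y)) * V (ln (norm y)) powr q"
      using V0[of "ln (norm y)"] by (simp add: powr_mult exp_powr_real mult_ac)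
    then have "?F y = exp (- (b * q) * ln (norm y)) * V (ln (norm y)) powr q / (exp (\<gamma> * ln (norm y)) * norm (x - y) powr s)"
      using y by (simp add: wpot_integrand_def s_def powr_def)
    also have "\<dots> = (exp (- (b * q) * ln (norm y)) / exp (\<gamma> * ln (norm y))) * V (ln (norm y)) powr q * norm (x - y) powr (- s)"
      by (simp add: powr_minus divide_simps)
    also have "exp (- (b * q) * ln (norm y)) / exp (\<gamma> * ln (norm y)) = exp ((- (b * q) - \<gamma>) * ln (norm y))"
      by (simp add: exp_diff[symmetric] algebra_simps)
    also have "\<dots> = norm y powr (c - DIM(real ^ 'n))" using y by (simp add: e powr_def)
    finally show "ennreal (?F y) = ennreal (norm y powr (c - DIM(real ^ 'n))) * ennreal (V (ln (norm y)) powr q) * ennreal (norm (x - y) powr (- s))"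
      by (simp add: ennreal_mult)
  qed
  also have "\<dots> = ennreal (norm x powr (- (s - c))) * (\<integral>\<^sup>+\<sigma>. ennreal (wker s c \<theta> (ln (norm x) - \<sigma>)) * ennreal (V \<sigma> powr q) \<partial>lborel)"
    by (rule wker_potential[OF \<theta> sc' _ x]) simp
  also have "(\<integral>\<^sup>+\<sigma>. ennreal (wker s c \<theta> (ln (norm x) - \<sigma>)) * ennreal (V \<sigma> powr q) \<partial>lborel) = ennreal (conv (wker s c \<theta>) (\<lambda>t. V t powr q) (ln (norm x)))"
    by (rule conv_nn[OF _ W, symmetric]) simp
  also have "ennreal (norm x powr (- (s - c))) * \<dots> = ennreal ?val" using v0 by (simp add: ennreal_mult')
  finally have n: "(\<integral>\<^sup>+y. ennreal (?F y) \<partial>lborel) = ennreal ?val" .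
  have h: "has_bochner_integral lborel ?F ?val"
    by (rule has_bochner_integral_nn_integral[OF _ _ v0 n]) (use F0 Fm in auto)
  have Fl: "?F \<in> borel_measurable lborel" using Fm by simp
  show "integrable lebesgue ?F"
    unfolding integrable_completion[OF Fl] using h by (simp add: has_bochner_integral_iff)
  show "(LINT y|lebesgue. ?F y) = ?val"
    unfolding integral_completion[OF Fl] using h by (simp add: has_bochner_integral_iff)
qed

text \<open>The relation \<open>b * p = n\<close> makes the power of the radius cancel the density
  \<open>exp (n * t)\<close> of polar coordinates, so finite energy in space is integrability of
  \<open>V powr p\<close> on the line.\<close>

lemma radial_Lp:
  fixes V :: "real \<Rightarrow> real"
  assumes [measurable]: "V \<in> borel_measurable borel" and V0: "\<And>t. 0 < V t" and i: "integrable lborel (\<lambda>t. V t powr p)"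
    and bp: "b * p = CARD('n)"
  shows "(\<lambda>y :: real ^ 'n. exp (- b * ln (norm y)) * V (ln (norm y))) \<in> Lp_space p"
proof -
  let ?f = "\<lambda>y :: real ^ 'n. exp (- b * ln (norm y)) * V (ln (norm y))"
  have f: "\<bar>?f y\<bar> powr p = exp (- CARD('n) * ln (norm y)) * V (ln (norm y)) powr p" for y
    using V0[of "ln (norm y)"] bp by (simp add: abs_mult powr_mult exp_powr_real mult_ac)
  have "(\<integral>\<^sup>+y. ennreal (exp (- CARD('n) * ln (norm y)) * V (ln (norm y)) powr p) \<partial>(lborel :: (real ^ 'n) measure)) =
    ennreal (DIM(real ^ 'n)) * emeasure lborel (ball (0 :: real ^ 'n) 1) * (\<integral>\<^sup>+\<sigma>. ennreal (exp (DIM(real ^ 'n) * \<sigma>)) * ennreal (exp (- CARD('n) * \<sigma>) * V \<sigma> powr p) \<partial>lborel)"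
    by (rule nn_integral_radial[of "\<lambda>t. ennreal (exp (- CARD('n) * t) * V t powr p)"]) simp
  also have "(\<integral>\<^sup>+\<sigma>. ennreal (exp (DIM(real ^ 'n) * \<sigma>)) * ennreal (exp (- CARD('n) * \<sigma>) * V \<sigma> powr p) \<partial>lborel) = (\<integral>\<^sup>+\<sigma>. ennreal (V \<sigma> powr p) \<partial>lborel)"
    by (intro nn_integral_cong) (simp add: ennreal_mult'[symmetric] mult.assoc[symmetric] exp_add[symmetric])
  also have "\<dots> = ennreal (LINT t|lborel. V t powr p)" by (rule nn_integral_eq_integral[OF i]) simp
  finally have "(\<integral>\<^sup>+y. ennreal (exp (- CARD('n) * ln (norm y)) * V (ln (norm y)) powr p) \<partial>(lborel :: (real ^ 'n) measure)) < \<infinity>"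
    using emeasure_lborel_ball_finite[of "0 :: real ^ 'n" 1] by (simp add: ennreal_mult_less_top)
  then have "integrable lborel (\<lambda>y. \<bar>?f y\<bar> powr p)"
    unfolding f by (intro integrableI_nonneg) auto
  moreover have "?f \<in> borel_measurable lborel" by measurable
  ultimately show ?thesis
    unfolding Lp_space_def by (auto simp: integrable_completion intro: measurable_completion)
qed

text \<open>In terms of the decay exponents \<open>a = n / (q\<^sub>1 + 1)\<close> and
  \<open>b = n / (q\<^sub>2 + 1)\<close>, the critical condition reads
  \<open>a + b = s + \<beta>\<^sub>1 + \<beta>\<^sub>2\<close>. It is what allows one kernel and its
  reflection to serve both equations with these exponents.\<close>

theorem critical_solution_exists:
  fixes \<alpha> \<beta>\<^sub>1 \<beta>\<^sub>2 q\<^sub>1 q\<^sub>2 n :: real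
  assumes n_def: "n = real CARD('n)" and \<alpha>: "0 < \<alpha>" "\<alpha> < n" and q: "q\<^sub>1 > 1" "q\<^sub>2 > 1"
    and \<beta>: "\<beta>\<^sub>1 \<ge> 0" "\<beta>\<^sub>2 \<ge> 0" "\<beta>\<^sub>1 / n < 1 / (q\<^sub>1 + 1)" "\<beta>\<^sub>2 / n < 1 / (q\<^sub>2 + 1)"
    and crit: "1 / (q\<^sub>1 + 1) + 1 / (q\<^sub>2 + 1) = (n - \<alpha> + \<beta>\<^sub>1 + \<beta>\<^sub>2) / n"
  shows "\<exists>u v :: real ^ 'n \<Rightarrow> real.
            (\<forall>x. x \<noteq> 0 \<longrightarrow> u x > 0 \<and> v x > 0) \<and>
            C1_on (- {0}) u \<and> C1_on (- {0}) v \<and>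
            wHLS_solution \<alpha> \<beta>\<^sub>1 \<beta>\<^sub>2 q\<^sub>1 q\<^sub>2 u v \<and>
            finite_energy q\<^sub>1 q\<^sub>2 u v"
proof -
  have n: "n > 0" using \<alpha> by linarith
  define a where "a = n / (q\<^sub>1 + 1)"
  define b where "b = n / (q\<^sub>2 + 1)"
  define s where "s = n - \<alpha>"
  \<comment> \<open>The homogeneity of the first density is \<open>c - n\<close>. By criticality
    \<open>s - c = a - \<beta>\<^sub>1\<close>, so the two lower bounds on the exponents
    \<open>1 / (q\<^sub>i + 1)\<close> become \<open>0 < c < s\<close>, the condition for an
    integrable kernel.\<close>
  define c where "c = b - \<beta>\<^sub>2"
  have ab: "a > 0" "b > 0" using n q by (auto simp: a_def b_def)
  have ap: "a * (q\<^sub>1 + 1) = n" "b * (q\<^sub>2 + 1) = n" using q by (auto simp: a_def b_def)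
  have "n * (1 / (q\<^sub>1 + 1) + 1 / (q\<^sub>2 + 1)) = n - \<alpha> + \<beta>\<^sub>1 + \<beta>\<^sub>2" using crit n by simp
  then have abs: "a + b = s + \<beta>\<^sub>1 + \<beta>\<^sub>2" by (simp add: a_def b_def s_def distrib_left)
  have "a > \<beta>\<^sub>1" using \<beta>(3) n q by (simp add: a_def field_simps)
  have "b > \<beta>\<^sub>2" using \<beta>(4) n q by (simp add: b_def field_simps)
  have sca: "s - c = a - \<beta>\<^sub>1" using abs by (simp add: c_def)
  have sc: "0 < c" "c < s" "s < CARD('n)" using \<open>b > \<beta>\<^sub>2\<close> \<open>a > \<beta>\<^sub>1\<close> sca \<alpha> n_def by (auto simp: c_def s_def)
  then have sc1: "0 < c" "c < s" "s < DIM(real ^ 'n)" by auto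
  have sc2: "0 < s - c" "s - c < s" "s < DIM(real ^ 'n)" using sc by auto
  obtain \<theta> :: "real ^ 'n" where \<theta>: "norm \<theta> = 1" using vector_choose_size[of 1] by auto
  let ?K = "wker s c \<theta>"
  have Kr: "(\<lambda>t. ?K (- t)) = wker s (s - c) \<theta>" using wker_reflect[OF \<theta> sc1] by auto
  have e1: "- (b * q\<^sub>2) - \<beta>\<^sub>2 = c - CARD('n)" using ap n_def by (simp add: c_def algebra_simps)
  have e2: "- (a * q\<^sub>1) - \<beta>\<^sub>1 = (s - c) - CARD('n)" using ap n_def by (simp add: sca algebra_simps)
  interpret conv_system ?K a b q\<^sub>1 q\<^sub>2
  proof
    show "?K \<in> borel_measurable borel" by simp
    show "0 \<le> ?K t" for t by (rule wker_nonneg)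
    show "integrable lborel ?K" by (rule integrable_wker[OF \<theta> sc1])
    show "isCont ?K t" if "t \<noteq> 0" for t by (rule isCont_wker[OF \<theta> sc1 that])
    show "?K t > 0" if "t \<noteq> 0" for t by (rule wker_pos[OF \<theta> sc1 that])
    show "exp (- a * t) * conv ?K w t \<le> exp (- a * s') * conv ?K w s'"
      if w: "w \<in> borel_measurable borel" "\<And>t. 0 \<le> w t" "\<And>t. w t \<le> C"
        "\<And>s t. s \<le> t \<Longrightarrow> exp (- (b * q\<^sub>2) * t) * w t \<le> exp (- (b * q\<^sub>2) * s) * w s" and "s' \<le> t" for w C s' t
    proof -
      \<comment> \<open>With the weights \<open>\<beta>\<^sub>2\<close> inside and
        \<open>\<beta>\<^sub>1\<close> outside, the homogeneities become those of
        \<open>v powr q\<^sub>2\<close> and of \<open>u\<close>.\<close>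
      have x: "c - real DIM(real ^ 'n) + \<beta>\<^sub>2 = - (b * q\<^sub>2)" "s - c + \<beta>\<^sub>1 = a" using e1 sca by auto
      show ?thesis
        using wker_conv_weighted_antimono[OF \<theta> sc1 \<beta>(2,1) w(1-3), unfolded x, OF w(4) \<open>s' \<le> t\<close>] by simp
    qed
    show "exp (- b * t) * conv (\<lambda>t. ?K (- t)) w t \<le> exp (- b * s') * conv (\<lambda>t. ?K (- t)) w s'"
      if w: "w \<in> borel_measurable borel" "\<And>t. 0 \<le> w t" "\<And>t. w t \<le> C"
        "\<And>s t. s \<le> t \<Longrightarrow> exp (- (a * q\<^sub>1) * t) * w t \<le> exp (- (a * q\<^sub>1) * s) * w s" and "s' \<le> t" for w C s' t
    proof -
      have x: "s - c - real DIM(real ^ 'n) + \<beta>\<^sub>1 = - (a * q\<^sub>1)" "s - (s - c) + \<beta>\<^sub>2 = b" using e2 by (auto simp: c_def)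
      show ?thesis
        unfolding Kr using wker_conv_weighted_antimono[OF \<theta> sc2 \<beta>(1,2) w(1-3), unfolded x, OF w(4) \<open>s' \<le> t\<close>] by simp
    qed
  qed (use ab q in auto)
  obtain U V C where U: "\<And>t. 0 < U t" "\<And>t. U t \<le> C" and V: "\<And>t. 0 < V t" "\<And>t. V t \<le> C"
    and Um [measurable]: "U \<in> borel_measurable borel" and Vm [measurable]: "V \<in> borel_measurable borel"
    and iU: "integrable lborel (\<lambda>t. U t powr (q\<^sub>1 + 1))" and iV: "integrable lborel (\<lambda>t. V t powr (q\<^sub>2 + 1))"
    and Ueq: "\<And>t. U t = conv ?K (\<lambda>s. V s powr q\<^sub>2) t" and Veq: "\<And>t. V t = conv (\<lambda>t. ?K (- t)) (\<lambda>s. U s powr q\<^sub>1) t"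
    using solution_exists by metis
  obtain gU where gU: "continuous_on UNIV gU" "\<And>t. (U has_real_derivative gU t) (at t)"
    using system_C1(1)[OF q _ _ U V Ueq Veq] by auto
  obtain gV where gV: "continuous_on UNIV gV" "\<And>t. (V has_real_derivative gV t) (at t)"
    using system_C1(2)[OF q _ _ U V Ueq Veq] by auto
  have cont: "continuous_on UNIV f" if "\<And>t. (f has_real_derivative g t) (at t)" for f g :: "real \<Rightarrow> real"
    using that DERIV_isCont continuous_at_imp_continuous_on by blast
  define u where "u x = exp (- a * ln (norm x)) * U (ln (norm x))" for x :: "real ^ 'n"
  define v where "v x = exp (- b * ln (norm x)) * V (ln (norm x))" for x :: "real ^ 'n"
  have C1: "C1_on (- {0}) (\<lambda>x :: real ^ 'n. exp (- k * ln (norm x)) * F (ln (norm x)))"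
    if F: "continuous_on UNIV g" "\<And>t. (F has_real_derivative g t) (at t)" for F g k
  proof (rule C1_on_radial[of "\<lambda>t. exp (- k * t) * F t" "\<lambda>t. (- k * exp (- k * t)) * F t + exp (- k * t) * g t"])
    show "((\<lambda>t. exp (- k * t) * F t) has_real_derivative (- k * exp (- k * t)) * F t + exp (- k * t) * g t) (at t)" for t
      by (auto intro!: derivative_eq_intros F(2))
    show "continuous_on UNIV (\<lambda>t. - k * exp (- k * t) * F t + exp (- k * t) * g t)"
      by (intro continuous_intros F(1) cont[OF F(2)])
  qed
  have s_def': "s = real CARD('n) - \<alpha>" by (simp add: s_def n_def)
  have "wHLS_solution \<alpha> \<beta>\<^sub>1 \<beta>\<^sub>2 q\<^sub>1 q\<^sub>2 u v"
    unfolding wHLS_solution_def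
  proof (intro allI impI)
    fix x :: "real ^ 'n" assume x: "x \<noteq> 0"
    have q0: "q\<^sub>1 > 0" "q\<^sub>2 > 0" using q by auto
    have sc3: "c < real CARD('n) - \<alpha>" "real CARD('n) - \<alpha> < CARD('n)" "s - c < real CARD('n) - \<alpha>"
      using sc unfolding s_def'[symmetric] by auto
    have "(\<lambda>y. exp (- b * ln (norm y)) * V (ln (norm y))) = v" by (simp add: v_def[abs_def])
    then have A: "integrable lebesgue (wpot_integrand \<alpha> \<beta>\<^sub>2 q\<^sub>2 v x)"
      "(LINT y|lebesgue. wpot_integrand \<alpha> \<beta>\<^sub>2 q\<^sub>2 v x y) = norm x powr (- (s - c)) * U (ln (norm x))"
      using radial_potential_solution[OF \<theta> sc(1) sc3(1,2) Vm V q0(2) e1 x, folded s_def'] by (simp_all add: Ueq[symmetric])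
    have "(\<lambda>y. exp (- a * ln (norm y)) * U (ln (norm y))) = u" by (simp add: u_def[abs_def])
    then have B: "integrable lebesgue (wpot_integrand \<alpha> \<beta>\<^sub>1 q\<^sub>1 u x)"
      "(LINT y|lebesgue. wpot_integrand \<alpha> \<beta>\<^sub>1 q\<^sub>1 u x y) = norm x powr (- (s - (s - c))) * V (ln (norm x))"
      using radial_potential_solution[OF \<theta> sc2(1) sc3(3,2) Um U q0(1) e2 x, folded s_def'] by (simp_all add: Kr[symmetric] Veq[symmetric])
    have p: "1 / norm x powr p * norm x powr p' = exp (- k * ln (norm x))" if "k = p - p'" for p p' k
    proof -
      have "exp (- k * ln (norm x)) * exp (p * ln (norm x)) = exp (p' * ln (norm x))"
        by (simp add: that exp_add[symmetric] algebra_simps)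
      then show ?thesis using x by (simp add: powr_def divide_simps)
    qed
    have pu: "1 / norm x powr \<beta>\<^sub>1 * norm x powr (- (s - c)) = exp (- a * ln (norm x))"
      by (rule p) (simp add: sca)
    have pv: "1 / norm x powr \<beta>\<^sub>2 * norm x powr (- (s - (s - c))) = exp (- b * ln (norm x))"
      by (rule p) (simp add: c_def)
    have "u x = 1 / norm x powr \<beta>\<^sub>1 * (norm x powr (- (s - c)) * U (ln (norm x)))"
      by (simp only: u_def pu mult.assoc[symmetric])
    moreover have "v x = 1 / norm x powr \<beta>\<^sub>2 * (norm x powr (- (s - (s - c))) * V (ln (norm x)))"
      by (simp only: v_def pv mult.assoc[symmetric])
    ultimately show "integrable lebesgue (wpot_integrand \<alpha> \<beta>\<^sub>2 q\<^sub>2 v x) \<and>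
        u x = 1 / norm x powr \<beta>\<^sub>1 * (LINT y|lebesgue. wpot_integrand \<alpha> \<beta>\<^sub>2 q\<^sub>2 v x y) \<and>
        integrable lebesgue (wpot_integrand \<alpha> \<beta>\<^sub>1 q\<^sub>1 u x) \<and>
        v x = 1 / norm x powr \<beta>\<^sub>2 * (LINT y|lebesgue. wpot_integrand \<alpha> \<beta>\<^sub>1 q\<^sub>1 u x y)"
      unfolding A(2) B(2) using A(1) B(1) by blast
  qed
  moreover have "finite_energy q\<^sub>1 q\<^sub>2 u v"
    unfolding finite_energy_def u_def[abs_def] v_def[abs_def]
    using ap n_def by (intro conjI radial_Lp U V iU iV) auto
  moreover have "u x > 0" "v x > 0" for x using U V by (auto simp: u_def v_def)
  moreover have "C1_on (- {0}) u" "C1_on (- {0}) v"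
    unfolding u_def[abs_def] v_def[abs_def] by (rule C1[OF gU], rule C1[OF gV])
  ultimately show ?thesis by blast
qed

section \<open>The energy along a radial flow\<close>

lemma DERIV_max_zero_squared:
  "((\<lambda>s :: real. (max 0 s)\<^sup>2) has_real_derivative 2 * max 0 s) (at s)"
proof -
  consider "s > 0" | "s < 0" | "s = 0" by linarith
  then show ?thesis
  proof cases
    case 1
    have "((\<lambda>s :: real. s\<^sup>2) has_real_derivative 2 * max 0 s) (at s)" using 1 by (auto intro!: derivative_eq_intros)
    then show ?thesis
      by (rule has_field_derivative_transform_within_open[of _ _ _ "{0<..}"]) (use 1 in auto)
  next
    case 2
    have "((\<lambda>s :: real. 0) has_real_derivative 2 * max 0 s) (at s)" using 2 by (auto intro!: derivative_eq_intros)
    then show ?thesis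
      by (rule has_field_derivative_transform_within_open[of _ _ _ "{..<0}"]) (use 2 in auto)
  next
    case 3
    have "((\<lambda>h :: real. (max 0 h)\<^sup>2 / h) \<longlongrightarrow> 0) (at 0)"
    proof (rule tendsto_rabs_zero_cancel, rule tendsto_sandwich[of "\<lambda>_. 0" _ _ "\<lambda>h. \<bar>h\<bar>"])
      show "\<forall>\<^sub>F h in at 0. \<bar>(max 0 h)\<^sup>2 / h\<bar> \<le> \<bar>h :: real\<bar>"
        by (intro always_eventually allI) (auto simp: max_def power2_eq_square)
      show "((\<lambda>h :: real. \<bar>h\<bar>) \<longlongrightarrow> 0) (at 0)" by (intro tendsto_rabs_zero tendsto_ident_at)
    qed auto
    then show ?thesis using 3 by (simp add: DERIV_def)
  qed
qed

text \<open>The function \<open>c\<close> is taken in the logarithmic radius \<open>t\<close>. The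
  bound \<open>\<kappa> \<le> 1\<close> keeps \<open>t + \<delta> * c t\<close> increasing for
  \<open>\<bar>\<delta>\<bar> < 1\<close>, and the compact support keeps the deformation in an
  annulus away from the origin and infinity.\<close>

locale cutoff =
  fixes c c' :: "real \<Rightarrow> real" and \<kappa> R :: real
  assumes c_der: "\<And>t. (c has_real_derivative c' t) (at t)"
    and c'_cont: "continuous_on UNIV c'"
    and c_range: "\<And>t. 0 \<le> c t" "\<And>t. c t \<le> 1"
    and c'_bound: "\<And>t. \<bar>c' t\<bar> \<le> \<kappa>"
    and \<kappa>: "\<kappa> \<le> 1" and R: "R > 0"
    and supp: "\<And>t. \<bar>t\<bar> \<ge> R \<Longrightarrow> c t = 0" "\<And>t. \<bar>t\<bar> \<ge> R \<Longrightarrow> c' t = 0"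

text \<open>Squaring the positive part makes the truncated parabola continuously differentiable. Its
  derivative is at most \<open>4 * \<epsilon>\<close>, and \<open>\<epsilon> \<le> 1 / 4\<close> is
  what gives \<open>\<kappa> \<le> 1\<close>.\<close>

lemma cutoff_exists:
  fixes \<epsilon> :: real
  assumes \<epsilon>: "0 < \<epsilon>" "\<epsilon> \<le> 1/4"
  shows "cutoff (\<lambda>t. (max 0 (1 - (\<epsilon> * t)\<^sup>2))\<^sup>2) (\<lambda>t. - 4 * \<epsilon> * (\<epsilon> * t) * max 0 (1 - (\<epsilon> * t)\<^sup>2)) (4 * \<epsilon>) (1 / \<epsilon>)"
proof
  fix t :: real
  show "((\<lambda>t. (max 0 (1 - (\<epsilon> * t)\<^sup>2))\<^sup>2) has_real_derivative - 4 * \<epsilon> * (\<epsilon> * t) * max 0 (1 - (\<epsilon> * t)\<^sup>2)) (at t)"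
  proof -
    have "((\<lambda>t. 1 - (\<epsilon> * t)\<^sup>2) has_real_derivative - (2 * (\<epsilon> * t) * \<epsilon>)) (at t)"
      by (auto intro!: derivative_eq_intros)
    from DERIV_chain2[OF DERIV_max_zero_squared this] show ?thesis by (rule DERIV_cong) (simp add: algebra_simps)
  qed
  show "continuous_on UNIV (\<lambda>t. - 4 * \<epsilon> * (\<epsilon> * t) * max 0 (1 - (\<epsilon> * t)\<^sup>2))"
    by (intro continuous_intros)
  show "0 \<le> (max 0 (1 - (\<epsilon> * t)\<^sup>2))\<^sup>2" by simp
  have m: "0 \<le> max 0 (1 - (\<epsilon> * t)\<^sup>2)" "max 0 (1 - (\<epsilon> * t)\<^sup>2) \<le> 1" by auto
  then show "(max 0 (1 - (\<epsilon> * t)\<^sup>2))\<^sup>2 \<le> 1" by (intro power_le_one)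
  show "\<bar>- 4 * \<epsilon> * (\<epsilon> * t) * max 0 (1 - (\<epsilon> * t)\<^sup>2)\<bar> \<le> 4 * \<epsilon>"
  proof (cases "\<bar>\<epsilon> * t\<bar> \<le> 1")
    case True
    have "\<bar>\<epsilon> * t\<bar> * max 0 (1 - (\<epsilon> * t)\<^sup>2) \<le> 1 * 1" using True m by (intro mult_mono) auto
    then have "4 * \<epsilon> * (\<bar>\<epsilon> * t\<bar> * max 0 (1 - (\<epsilon> * t)\<^sup>2)) \<le> 4 * \<epsilon> * 1" using \<epsilon> by (intro mult_left_mono) auto
    moreover have "\<bar>- 4 * \<epsilon> * (\<epsilon> * t) * max 0 (1 - (\<epsilon> * t)\<^sup>2)\<bar> = 4 * \<epsilon> * (\<bar>\<epsilon> * t\<bar> * max 0 (1 - (\<epsilon> * t)\<^sup>2))"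
      using \<epsilon> m by (simp add: abs_mult)
    ultimately show ?thesis by simp
  next
    case False
    then have "1 < \<bar>\<epsilon> * t\<bar>\<^sup>2" by (intro one_less_power) auto
    then show ?thesis using \<epsilon> by simp
  qed
  have z: "max 0 (1 - (\<epsilon> * t)\<^sup>2) = 0" if "\<bar>t\<bar> \<ge> 1 / \<epsilon>"
  proof -
    have "1 \<le> \<bar>\<epsilon> * t\<bar>" using that \<epsilon> by (simp add: abs_mult field_simps)
    then have "1 \<le> \<bar>\<epsilon> * t\<bar>\<^sup>2" by (intro one_le_power) auto
    then show ?thesis by simp
  qed
  show "(max 0 (1 - (\<epsilon> * t)\<^sup>2))\<^sup>2 = 0" if "\<bar>t\<bar> \<ge> 1 / \<epsilon>" using z[OF that] by simp
  show "- 4 * \<epsilon> * (\<epsilon> * t) * max 0 (1 - (\<epsilon> * t)\<^sup>2) = 0" if "\<bar>t\<bar> \<ge> 1 / \<epsilon>" using z[OF that] by simp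
qed (use \<epsilon> in auto)

context cutoff
begin

lemma c_cont: "continuous_on UNIV c"
  using c_der DERIV_isCont continuous_at_imp_continuous_on by blast

lemma c_meas [measurable]: "c \<in> borel_measurable borel" "c' \<in> borel_measurable borel"
  using c_cont c'_cont by (auto intro: borel_measurable_continuous_onI)

lemma \<kappa>_nonneg: "\<kappa> \<ge> 0" using c'_bound[of 0] by linarith

lemma c_lipschitz: "\<bar>c t - c s\<bar> \<le> \<kappa> * \<bar>t - s\<bar>"
proof -
  have *: "\<bar>c v - c u\<bar> \<le> \<kappa> * (v - u)" if "u < v" for u v
  proof -
    have "\<exists>z. u < z \<and> z < v \<and> c v - c u = (v - u) * c' z" by (intro MVT2 that c_der)
    then obtain z where "c v - c u = (v - u) * c' z" by blast
    moreover have "\<bar>(v - u) * c' z\<bar> \<le> (v - u) * \<kappa>"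
      using that c'_bound[of z] by (simp add: abs_mult)
    ultimately show ?thesis by (simp add: mult.commute)
  qed
  consider "t < s" | "s < t" | "s = t" by linarith
  then show ?thesis using *[of t s] *[of s t] by cases (auto simp: abs_minus_commute)
qed

text \<open>Not the exact flow of the field \<open>c (ln |x|) x\<close>, but a family with the same
  derivative at \<open>\<delta> = 0\<close>. In logarithmic radius it is
  \<open>t + \<delta> * c t\<close>, which makes the Jacobian \<open>jac\<close> explicit.\<close>

definition flow :: "real \<Rightarrow> 'a::euclidean_space \<Rightarrow> 'a" where
  "flow \<delta> x = exp (\<delta> * c (ln (norm x))) *\<^sub>R x"

definition jac :: "real \<Rightarrow> 'a::euclidean_space \<Rightarrow> real" where
  "jac \<delta> x = exp (real DIM('a) * \<delta> * c (ln (norm x))) * (1 + \<delta> * c' (ln (norm x)))"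

lemma flow_measurable [measurable]: "flow \<delta> \<in> borel_measurable borel"
  unfolding flow_def[abs_def] by measurable

lemma jac_measurable [measurable]: "jac \<delta> \<in> borel_measurable borel"
  unfolding jac_def[abs_def] by measurable

lemma flow_eq_0 [simp]: "flow \<delta> x = 0 \<longleftrightarrow> x = 0"
  by (simp add: flow_def)

lemma one_plus_pos: "\<bar>\<delta>\<bar> < 1 \<Longrightarrow> 1 + \<delta> * c' t > 0"
proof -
  assume "\<bar>\<delta>\<bar> < 1"
  then have "\<bar>\<delta> * c' t\<bar> < 1"
    using c'_bound[of t] \<kappa> mult_mono[of "\<bar>\<delta>\<bar>" "\<bar>\<delta>\<bar>" "\<bar>c' t\<bar>" 1] by (simp add: abs_mult)
  then show ?thesis by linarith
qed

lemma jac_pos: "\<bar>\<delta>\<bar> < 1 \<Longrightarrow> jac \<delta> x > 0"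
  unfolding jac_def using one_plus_pos by simp

text \<open>The endpoints \<open>- R\<close> and \<open>R\<close> are fixed because \<open>c\<close>
  vanishes there. Substitution is applied inside the interval, and outside it the map is the
  identity.\<close>

lemma nn_integral_time_change:
  fixes F :: "real \<Rightarrow> ennreal"
  assumes [measurable]: "F \<in> borel_measurable borel" and \<delta>: "\<bar>\<delta>\<bar> < 1"
  shows "(\<integral>\<^sup>+t. F (t + \<delta> * c t) * ennreal (1 + \<delta> * c' t) \<partial>lborel) = (\<integral>\<^sup>+t. F t \<partial>lborel)"
proof -
  let ?h = "\<lambda>t. t + \<delta> * c t" and ?h' = "\<lambda>t. 1 + \<delta> * c' t"
  have hR: "?h (- R) = - R" "?h R = R" using supp R by auto
  have "(\<integral>\<^sup>+t. F t * indicator {?h (- R)..?h R} t \<partial>lborel) = (\<integral>\<^sup>+t. F (?h t) * ennreal (?h' t) * indicator {- R..R} t \<partial>lborel)"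
  proof (rule nn_integral_substitution_aux)
    show "(?h has_real_derivative ?h' t) (at t)" for t by (auto intro!: derivative_eq_intros c_der)
    show "continuous_on {- R..R} ?h'" by (intro continuous_intros continuous_on_subset[OF c'_cont]) auto
    show "0 \<le> ?h' t" for t using one_plus_pos[OF \<delta>] by (simp add: less_imp_le)
  qed (use R in auto)
  then have in': "(\<integral>\<^sup>+t. F t * indicator {- R..R} t \<partial>lborel) = (\<integral>\<^sup>+t. F (?h t) * ennreal (?h' t) * indicator {- R..R} t \<partial>lborel)"
    unfolding hR .
  have out: "(\<integral>\<^sup>+t. F (?h t) * ennreal (?h' t) * indicator (- {- R..R}) t \<partial>lborel) = (\<integral>\<^sup>+t. F t * indicator (- {- R..R}) t \<partial>lborel)"
  proof (intro nn_integral_cong)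
    fix t
    show "F (?h t) * ennreal (?h' t) * indicator (- {- R..R}) t = F t * indicator (- {- R..R}) t"
    proof (cases "t \<in> {- R..R}")
      case False
      then have "\<bar>t\<bar> \<ge> R" by auto
      then show ?thesis by (simp add: supp)
    qed simp
  qed
  have split: "(\<integral>\<^sup>+t. G t \<partial>lborel) = (\<integral>\<^sup>+t. G t * indicator {- R..R} t \<partial>lborel) + (\<integral>\<^sup>+t. G t * indicator (- {- R..R}) t \<partial>lborel)"
    if [measurable]: "G \<in> borel_measurable borel" for G :: "real \<Rightarrow> ennreal"
  proof -
    have "(\<integral>\<^sup>+t. G t \<partial>lborel) = (\<integral>\<^sup>+t. G t * indicator {- R..R} t + G t * indicator (- {- R..R}) t \<partial>lborel)"
      by (intro nn_integral_cong) (auto simp: indicator_def)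
    then show ?thesis by (simp add: nn_integral_add)
  qed
  show ?thesis by (subst (1 2) split) (simp_all add: in' out)
qed

lemma nn_integral_flow:
  fixes f :: "'a::euclidean_space \<Rightarrow> ennreal"
  assumes [measurable]: "f \<in> borel_measurable borel" and \<delta>: "\<bar>\<delta>\<bar> < 1"
  shows "(\<integral>\<^sup>+y. ennreal (jac \<delta> y) * f (flow \<delta> y) \<partial>lborel) = (\<integral>\<^sup>+y. f y \<partial>lborel)"
proof -
  let ?n = "real DIM('a)"
  define B where "B = ball (0::'a) 1"
  have [measurable]: "B \<in> sets borel" by (simp add: B_def)
  have "(\<integral>\<^sup>+y. ennreal (jac \<delta> y) * f (flow \<delta> y) \<partial>lborel) =
    (\<integral>\<^sup>+t. (\<integral>\<^sup>+y. ennreal (?n * exp (?n * t)) * (ennreal (jac \<delta> (exp t *\<^sub>R sgn y)) * f (flow \<delta> (exp t *\<^sub>R sgn y))) * indicator B y \<partial>lborel) \<partial>lborel)"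
    unfolding B_def by (rule nn_integral_polar) simp
  also have "\<dots> = (\<integral>\<^sup>+y. (\<integral>\<^sup>+t. ennreal (?n * exp (?n * t)) * (ennreal (jac \<delta> (exp t *\<^sub>R sgn y)) * f (flow \<delta> (exp t *\<^sub>R sgn y))) * indicator B y \<partial>lborel) \<partial>lborel)"
    by (rule lborel_pair.Fubini') measurable
  also have "\<dots> = (\<integral>\<^sup>+y. (\<integral>\<^sup>+t. ennreal (?n * exp (?n * t)) * f (exp t *\<^sub>R sgn y) * indicator B y \<partial>lborel) \<partial>lborel)"
  proof (rule nn_integral_cong_AE, rule eventually_mono[OF AE_lborel_nonzero])
    fix y :: 'a assume y: "y \<noteq> 0"
    define F where "F t = ennreal (?n * exp (?n * t)) * f (exp t *\<^sub>R sgn y) * indicator B y" for t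
    have [measurable]: "F \<in> borel_measurable borel" unfolding F_def[abs_def] by measurable
    have "(\<integral>\<^sup>+t. ennreal (?n * exp (?n * t)) * (ennreal (jac \<delta> (exp t *\<^sub>R sgn y)) * f (flow \<delta> (exp t *\<^sub>R sgn y))) * indicator B y \<partial>lborel)
      = (\<integral>\<^sup>+t. F (t + \<delta> * c t) * ennreal (1 + \<delta> * c' t) \<partial>lborel)"
    proof (intro nn_integral_cong)
      fix t
      have n: "ln (norm (exp t *\<^sub>R sgn y)) = t" using y by (simp add: norm_sgn)
      have fl: "flow \<delta> (exp t *\<^sub>R sgn y) = exp (t + \<delta> * c t) *\<^sub>R sgn y"
        unfolding flow_def n by (simp add: exp_add mult.commute)
      have nj: "?n * exp (?n * t) * jac \<delta> (exp t *\<^sub>R sgn y) = ?n * exp (?n * (t + \<delta> * c t)) * (1 + \<delta> * c' t)"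
        unfolding jac_def n by (simp add: distrib_left exp_add mult_ac)
      have "ennreal (?n * exp (?n * t)) * ennreal (jac \<delta> (exp t *\<^sub>R sgn y)) = ennreal (?n * exp (?n * t) * jac \<delta> (exp t *\<^sub>R sgn y))"
        by (rule ennreal_mult'[symmetric]) simp
      also have "\<dots> = ennreal (?n * exp (?n * (t + \<delta> * c t))) * ennreal (1 + \<delta> * c' t)"
        unfolding nj by (rule ennreal_mult') simp
      finally have ej: "ennreal (?n * exp (?n * t)) * ennreal (jac \<delta> (exp t *\<^sub>R sgn y)) = ennreal (?n * exp (?n * (t + \<delta> * c t))) * ennreal (1 + \<delta> * c' t)" .
      have "ennreal (?n * exp (?n * t)) * (ennreal (jac \<delta> (exp t *\<^sub>R sgn y)) * f (flow \<delta> (exp t *\<^sub>R sgn y))) * indicator B y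
        = (ennreal (?n * exp (?n * t)) * ennreal (jac \<delta> (exp t *\<^sub>R sgn y))) * (f (flow \<delta> (exp t *\<^sub>R sgn y)) * indicator B y)"
        by (simp only: mult.assoc)
      also have "\<dots> = F (t + \<delta> * c t) * ennreal (1 + \<delta> * c' t)"
        unfolding ej fl F_def by (simp only: mult_ac)
      finally show "ennreal (?n * exp (?n * t)) * (ennreal (jac \<delta> (exp t *\<^sub>R sgn y)) * f (flow \<delta> (exp t *\<^sub>R sgn y))) * indicator B y = F (t + \<delta> * c t) * ennreal (1 + \<delta> * c' t)" .
    qed
    also have "\<dots> = (\<integral>\<^sup>+t. F t \<partial>lborel)" by (rule nn_integral_time_change) (simp_all add: \<delta>)
    finally show "(\<integral>\<^sup>+t. ennreal (?n * exp (?n * t)) * (ennreal (jac \<delta> (exp t *\<^sub>R sgn y)) * f (flow \<delta> (exp t *\<^sub>R sgn y))) * indicator B y \<partial>lborel)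
      = (\<integral>\<^sup>+t. ennreal (?n * exp (?n * t)) * f (exp t *\<^sub>R sgn y) * indicator B y \<partial>lborel)"
      by (simp add: F_def)
  qed
  also have "\<dots> = (\<integral>\<^sup>+t. (\<integral>\<^sup>+y. ennreal (?n * exp (?n * t)) * f (exp t *\<^sub>R sgn y) * indicator B y \<partial>lborel) \<partial>lborel)"
    by (rule lborel_pair.Fubini') measurable
  also have "\<dots> = (\<integral>\<^sup>+y. f y \<partial>lborel)"
    unfolding B_def by (rule nn_integral_polar[symmetric]) simp
  finally show ?thesis .
qed

lemma exp_diff_le:
  fixes z w :: real
  assumes "\<bar>z\<bar> \<le> 1" "\<bar>w\<bar> \<le> 1"
  shows "\<bar>exp z - exp w\<bar> \<le> 3 * \<bar>z - w\<bar>"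
proof -
  have *: "exp v - exp u \<le> 3 * (v - u)" if "u < v" "v \<le> 1" for u v :: real
  proof -
    have "\<exists>x. u < x \<and> x < v \<and> exp v - exp u = (v - u) * exp x" by (intro MVT2 that DERIV_exp)
    then obtain x where x: "u < x" "x < v" "exp v - exp u = (v - u) * exp x" by blast
    have "exp x \<le> exp 1" using x that by simp
    also have "exp (1::real) \<le> 3" using e_less_272 by simp
    finally have "(v - u) * exp x \<le> (v - u) * 3" using that by (intro mult_left_mono) auto
    then show ?thesis using x by simp
  qed
  consider "z < w" | "w < z" | "w = z" by linarith
  then show ?thesis using *[of z w] *[of w z] assms by cases auto
qed

text \<open>For \<open>norm y \<le> norm x\<close>, the Lipschitz bound on \<open>c\<close> and
  \<open>ln z \<le> z - 1\<close> show that the cutoff values differ by at most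
  \<open>norm (x - y) / norm y\<close>. The relative displacement of two points is thus controlled
  by their distance, which tames the singularity of the kernel on the diagonal. The constant
  \<open>6\<close> is twice the Lipschitz bound \<open>3\<close> of the exponential.\<close>

lemma flow_near_isometry:
  fixes x y :: "'a::euclidean_space"
  assumes \<delta>: "0 \<le> \<delta>" "\<delta> \<le> 1" and xy: "x \<noteq> 0" "y \<noteq> 0"
  shows "\<bar>norm (flow \<delta> x - flow \<delta> y) - norm (x - y)\<bar> \<le> 6 * \<delta> * norm (x - y)"
proof -
  have main: "norm ((flow \<delta> x - flow \<delta> y) - (x - y)) \<le> 6 * \<delta> * norm (x - y)" if xy: "x \<noteq> 0" "y \<noteq> 0" and le: "norm y \<le> norm x" for x y :: 'a
  proof -
    define p where "p = c (ln (norm x))"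
    define r where "r = c (ln (norm y))"
    have pr: "0 \<le> p" "p \<le> 1" "0 \<le> r" "r \<le> 1" by (auto simp: p_def r_def c_range)
    have \<delta>p: "\<bar>\<delta> * p\<bar> \<le> \<delta>" "\<bar>\<delta> * r\<bar> \<le> \<delta>" using \<delta> pr by (auto simp: abs_mult mult_left_le)
    have e1: "\<bar>exp (\<delta> * p) - 1\<bar> \<le> 3 * \<delta>"
      using exp_diff_le[of "\<delta> * p" 0] \<delta>p \<delta> by simp
    have "\<bar>exp (\<delta> * p) - exp (\<delta> * r)\<bar> \<le> 3 * \<bar>\<delta> * p - \<delta> * r\<bar>"
      using \<delta>p \<delta> by (intro exp_diff_le) auto
    also have "\<dots> = 3 * \<delta> * \<bar>p - r\<bar>" using \<delta> by (simp add: right_diff_distrib[symmetric] abs_mult)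
    finally have e2: "\<bar>exp (\<delta> * p) - exp (\<delta> * r)\<bar> \<le> 3 * \<delta> * \<bar>p - r\<bar>" .
    have "\<bar>p - r\<bar> \<le> \<kappa> * \<bar>ln (norm x) - ln (norm y)\<bar>" unfolding p_def r_def by (rule c_lipschitz)
    also have "\<dots> \<le> 1 * \<bar>ln (norm x) - ln (norm y)\<bar>" using \<kappa> by (intro mult_right_mono) auto
    also have "\<bar>ln (norm x) - ln (norm y)\<bar> = ln (norm x / norm y)" using xy le by (simp add: ln_div)
    also have "\<dots> \<le> norm x / norm y - 1" using xy by (intro ln_le_minus_one) simp
    finally have "\<bar>p - r\<bar> * norm y \<le> (norm x / norm y - 1) * norm y" by (intro mult_right_mono) auto
    also have "\<dots> = norm x - norm y" using xy by (simp add: field_simps)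
    also have "\<dots> \<le> norm (x - y)" by (rule norm_triangle_ineq2)
    finally have e3: "\<bar>p - r\<bar> * norm y \<le> norm (x - y)" .
    have "(flow \<delta> x - flow \<delta> y) - (x - y) = (exp (\<delta> * p) - 1) *\<^sub>R (x - y) + (exp (\<delta> * p) - exp (\<delta> * r)) *\<^sub>R y"
      by (simp add: flow_def p_def r_def algebra_simps)
    then have "norm ((flow \<delta> x - flow \<delta> y) - (x - y)) \<le> \<bar>exp (\<delta> * p) - 1\<bar> * norm (x - y) + \<bar>exp (\<delta> * p) - exp (\<delta> * r)\<bar> * norm y"
      using norm_triangle_ineq by (metis norm_scaleR)
    also have "\<dots> \<le> 3 * \<delta> * norm (x - y) + (3 * \<delta> * \<bar>p - r\<bar>) * norm y"
      using e1 e2 by (intro add_mono mult_right_mono) auto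
    also have "\<dots> = 3 * \<delta> * norm (x - y) + 3 * \<delta> * (\<bar>p - r\<bar> * norm y)" by simp
    also have "\<dots> \<le> 3 * \<delta> * norm (x - y) + 3 * \<delta> * norm (x - y)"
      using e3 \<delta> by (intro add_left_mono mult_left_mono) auto
    finally show ?thesis by simp
  qed
  have "norm ((flow \<delta> x - flow \<delta> y) - (x - y)) \<le> 6 * \<delta> * norm (x - y)"
  proof (cases "norm y \<le> norm x")
    case True
    then show ?thesis by (rule main[OF xy])
  next
    case False
    then have "norm ((flow \<delta> y - flow \<delta> x) - (y - x)) \<le> 6 * \<delta> * norm (y - x)" by (intro main xy) auto
    moreover have "norm ((flow \<delta> y - flow \<delta> x) - (y - x)) = norm ((flow \<delta> x - flow \<delta> y) - (x - y))"
      by (metis minus_diff_eq norm_minus_cancel minus_diff_minus)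
    ultimately show ?thesis by (simp add: norm_minus_commute)
  qed
  then show ?thesis using norm_triangle_ineq3[of "flow \<delta> x - flow \<delta> y" "x - y"] by linarith
qed

end

section \<open>Difference quotients along a null sequence of parameters\<close>

definition dk :: "nat \<Rightarrow> real" where "dk k = 1 / (real k + 12)"

text \<open>The bound \<open>1 / 12\<close> gives \<open>6 * dk k \<le> 1 / 2\<close>, so by
  \<open>flow_near_isometry\<close> distances shrink by at most one half. A sequence is used because
  dominated convergence is stated for sequences.\<close>

lemma dk: "0 < dk k" "dk k \<le> 1 / 12" "dk k \<noteq> 0" "\<bar>dk k\<bar> < 1"
  by (simp_all add: dk_def field_simps)

lemma dk_tendsto: "dk \<longlonglongrightarrow> 0"
  unfolding dk_def by real_asymp

lemma quotient_tendsto_derivative: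
  fixes g :: "real \<Rightarrow> real"
  assumes "(g has_real_derivative D) (at 0)" "g 0 = 1"
  shows "(\<lambda>k. (g (dk k) - 1) / dk k) \<longlonglongrightarrow> D"
proof -
  have "((\<lambda>h. (g h - 1) / h) \<longlongrightarrow> D) (at 0)" using assms by (simp add: DERIV_def)
  moreover have "filterlim dk (at 0) sequentially"
    unfolding filterlim_at using dk_tendsto dk(3) by auto
  ultimately show ?thesis by (rule filterlim_compose)
qed

lemma quotient_tendsto_imp_tendsto_1:
  assumes "(\<lambda>k. (a k - 1) / dk k) \<longlonglongrightarrow> a'"
  shows "a \<longlonglongrightarrow> 1"
proof -
  have "(\<lambda>k. 1 + dk k * ((a k - 1) / dk k)) \<longlonglongrightarrow> 1 + 0 * a'"
    by (intro tendsto_intros assms dk_tendsto)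
  then show ?thesis using dk(3) by simp
qed

lemma quotient_tendsto_mult:
  assumes "(\<lambda>k. (a k - 1) / dk k) \<longlonglongrightarrow> a'" "(\<lambda>k. (b k - 1) / dk k) \<longlonglongrightarrow> b'"
  shows "(\<lambda>k. (a k * b k - 1) / dk k) \<longlonglongrightarrow> a' + b'"
proof -
  have "(\<lambda>k. (a k - 1) / dk k * b k + (b k - 1) / dk k) \<longlonglongrightarrow> a' * 1 + b'"
    by (intro tendsto_intros assms quotient_tendsto_imp_tendsto_1[OF assms(2)])
  moreover have "(a k - 1) / dk k * b k + (b k - 1) / dk k = (a k * b k - 1) / dk k" for k
    using dk(3)[of k] by (simp add: field_simps)
  ultimately show ?thesis by simp
qed

lemma quotient_tendsto_powr:
  assumes "(\<lambda>k. (a k - 1) / dk k) \<longlonglongrightarrow> a'"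
  shows "(\<lambda>k. (a k powr r - 1) / dk k) \<longlonglongrightarrow> r * a'"
proof -
  have "((\<lambda>x :: real. x powr r) has_real_derivative r) (at 1)"
    by (auto intro!: derivative_eq_intros)
  \<comment> \<open>Caratheodory's form of the derivative: the slope function is extended
    continuously by \<open>r\<close> at \<open>1\<close>, so indices with \<open>a k = 1\<close>
    cause no division by zero.\<close>
  then have "isCont (\<lambda>x :: real. if x = 1 then r else (x powr r - 1 powr r) / (x - 1)) 1"
    unfolding DERIV_caratheodory_within[of _ _ 1 UNIV]
    by (auto simp: has_field_derivative_iff isCont_def cong: LIM_cong)
  from isCont_tendsto_compose[OF this quotient_tendsto_imp_tendsto_1[OF assms]]
  have "(\<lambda>k. (if a k = 1 then r else (a k powr r - 1 powr r) / (a k - 1)) * ((a k - 1) / dk k)) \<longlonglongrightarrow> r * a'"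
    by (intro tendsto_mult assms) simp
  moreover have "(if a k = 1 then r else (a k powr r - 1 powr r) / (a k - 1)) * ((a k - 1) / dk k) = (a k powr r - 1) / dk k" for k
    by simp
  ultimately show ?thesis by (simp only:)
qed

lemma quotient_bound_mult:
  fixes a b A B d :: real
  assumes "\<bar>a - 1\<bar> \<le> A * d" "\<bar>b - 1\<bar> \<le> B * d" "0 < d" "d \<le> 1"
  shows "\<bar>a * b - 1\<bar> \<le> (A + B + A * B) * d"
proof -
  have A: "A \<ge> 0" using assms(1,3) by (smt (verit) abs_ge_zero mult_neg_pos)
  have "\<bar>a\<bar> \<le> 1 + A * d" using assms(1) by linarith
  also have "\<dots> \<le> 1 + A * 1" using A assms by (intro add_left_mono mult_left_mono) auto
  finally have "\<bar>a * (b - 1)\<bar> \<le> (1 + A) * (B * d)" unfolding abs_mult using assms(2) A by (intro mult_mono) auto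
  moreover have "a * b - 1 = a * (b - 1) + (a - 1)" by (simp add: algebra_simps)
  ultimately have "\<bar>a * b - 1\<bar> \<le> (1 + A) * (B * d) + A * d" using assms(1) by linarith
  then show ?thesis by (simp add: algebra_simps)
qed

lemma quotient_bound_powr:
  fixes a A d r :: real
  assumes "\<bar>a - 1\<bar> \<le> A * d" "0 < d" "d \<le> 1" "a > 0" "r > 1"
  shows "\<bar>a powr r - 1\<bar> \<le> (r * (1 + A) powr (r - 1) * A) * d"
proof -
  have A: "A \<ge> 0" using assms(1,2) by (smt (verit) abs_ge_zero mult_neg_pos)
  have "a \<le> 1 + A * d" using assms(1) by linarith
  also have "\<dots> \<le> 1 + A * 1" using A assms by (intro add_left_mono mult_left_mono) auto
  finally have "\<bar>a powr r - 1 powr r\<bar> \<le> r * (1 + A) powr (r - 1) * \<bar>a - 1\<bar>"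
    using A assms by (intro powr_lipschitz) auto
  also have "\<dots> \<le> r * (1 + A) powr (r - 1) * (A * d)" using assms by (intro mult_left_mono) auto
  finally show ?thesis by (simp add: mult.assoc)
qed

text \<open>Differentiation under the integral sign for factors close to one: on a finite measure
  the bound \<open>C\<close> on the quotients is an integrable majorant.\<close>

lemma (in finite_measure) integral_quotient_tendsto:
  assumes [measurable]: "\<And>k. T k \<in> borel_measurable M" "T' \<in> borel_measurable M"
    and b: "\<And>k. AE z in M. \<bar>T k z - 1\<bar> \<le> C * dk k"
    and l: "AE z in M. (\<lambda>k. (T k z - 1) / dk k) \<longlonglongrightarrow> T' z"
  shows "integrable M T'" "\<And>k. integrable M (T k)"
    and "(\<lambda>k. ((LINT z|M. T k z) - measure M (space M)) / dk k) \<longlonglongrightarrow> (LINT z|M. T' z)"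
proof -
  have b': "AE z in M. norm ((T k z - 1) / dk k) \<le> C" for k
    using b[of k] by eventually_elim (use dk(1)[of k] in \<open>simp add: abs_divide field_simps\<close>)
  show i: "integrable M (T k)" for k
  proof (rule integrable_const_bound)
    show "AE z in M. norm (T k z) \<le> 1 + C * dk k" using b[of k] by eventually_elim auto
  qed measurable
  have e: "((LINT z|M. T k z) - measure M (space M)) / dk k = (LINT z|M. (T k z - 1) / dk k)" for k
    using i[of k] by simp
  show "integrable M T'"
    by (rule integrable_dominated_convergence[OF _ _ _ l b']; simp)
  show "(\<lambda>k. ((LINT z|M. T k z) - measure M (space M)) / dk k) \<longlonglongrightarrow> (LINT z|M. T' z)"
    unfolding e by (rule integral_dominated_convergence[OF _ _ _ l b']; simp)
qed

section \<open>Relative change of functions, volume and kernel under the deformation\<close>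

context cutoff
begin

text \<open>Where the logarithmic radius is at least \<open>R\<close> in modulus the deformation is
  the identity. On the remaining compact annulus \<open>w\<close> is bounded below by a positive
  constant and its radial derivative is bounded, which gives the constant
  \<open>M / m\<close>.\<close>

lemma C1_flow_quotient:
  fixes w :: "'a::euclidean_space \<Rightarrow> real" and f' :: "'a \<Rightarrow> 'a \<Rightarrow>\<^sub>L real"
  assumes der: "\<And>x. x \<noteq> 0 \<Longrightarrow> (w has_derivative blinfun_apply (f' x)) (at x)"
    and cont: "continuous_on (- {0}) f'" and pos: "\<And>x. x \<noteq> 0 \<Longrightarrow> w x > 0"
  shows "\<exists>C. \<forall>x. x \<noteq> 0 \<longrightarrow> (\<forall>k. \<bar>w (flow (dk k) x) / w x - 1\<bar> \<le> C * dk k) \<and>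
      convergent (\<lambda>k. (w (flow (dk k) x) / w x - 1) / dk k)"
proof -
  define S where "S T = {x :: 'a. exp (- R) \<le> norm x \<and> norm x \<le> exp T}" for T
  have S: "compact (S T)" "S T \<subseteq> - {0}" for T
  proof -
    have "S T = cball 0 (exp T) - ball 0 (exp (- R))" by (auto simp: S_def)
    then show "compact (S T)" by (simp add: compact_diff)
    show "S T \<subseteq> - {0}" by (auto simp: S_def)
  qed
  \<comment> \<open>The annulus is enlarged by one because a point may be moved outward by a factor
    of up to \<open>exp 1\<close> for parameters at most one.\<close>
  have "continuous_on (S (R + 1)) (\<lambda>x. blinfun_apply (f' x) x)"
    by (intro continuous_intros continuous_on_subset[OF cont S(2)])
  then have "bounded ((\<lambda>x. blinfun_apply (f' x) x) ` S (R + 1))"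
    by (intro compact_imp_bounded compact_continuous_image S)
  then obtain M where M: "M > 0" "\<And>x. x \<in> S (R + 1) \<Longrightarrow> \<bar>blinfun_apply (f' x) x\<bar> \<le> M"
    unfolding bounded_pos by auto
  have "\<exists>m>0. \<forall>x\<in>S R. m \<le> w x"
  proof (cases "S R = {}")
    case True
    then show ?thesis by (intro exI[of _ 1]) auto
  next
    case False
    have "continuous_on (S R) w"
      using S(2)[of R] by (intro continuous_at_imp_continuous_on ballI has_derivative_continuous[OF der]) auto
    then obtain x0 where "x0 \<in> S R" "\<forall>x\<in>S R. w x0 \<le> w x"
      using continuous_attains_inf[OF S(1) False] by blast
    then show ?thesis using pos[of x0] S(2)[of R] by (intro exI[of _ "w x0"]) auto
  qed
  then obtain m where m: "m > 0" "\<And>x. x \<in> S R \<Longrightarrow> m \<le> w x" by blast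
  have "(\<forall>k. \<bar>w (flow (dk k) x) / w x - 1\<bar> \<le> M / m * dk k) \<and> convergent (\<lambda>k. (w (flow (dk k) x) / w x - 1) / dk k)"
    if x: "x \<noteq> 0" for x
  proof -
    define p where "p = c (ln (norm x))"
    have p: "0 \<le> p" "p \<le> 1" using c_range by (auto simp: p_def)
    define g where "g \<delta> = w (exp (\<delta> * p) *\<^sub>R x) / w x" for \<delta>
    have gd: "(g has_real_derivative blinfun_apply (f' (exp (\<sigma> * p) *\<^sub>R x)) (exp (\<sigma> * p) *\<^sub>R x) * p / w x) (at \<sigma>)" for \<sigma>
    proof -
      let ?z = "exp (\<sigma> * p) *\<^sub>R x"
      have "((\<lambda>\<delta>. exp (\<delta> * p) *\<^sub>R x) has_derivative (\<lambda>d. (d * p) *\<^sub>R ?z)) (at \<sigma>)"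
        by (auto intro!: derivative_eq_intros simp: mult_ac)
      moreover have "(w has_derivative blinfun_apply (f' ?z)) (at ?z)" using x by (intro der) simp
      ultimately have "((\<lambda>\<delta>. w (exp (\<delta> * p) *\<^sub>R x)) has_derivative (\<lambda>d. blinfun_apply (f' ?z) ((d * p) *\<^sub>R ?z))) (at \<sigma>)"
        by (rule has_derivative_compose)
      moreover have "blinfun_apply (f' ?z) ((d * p) *\<^sub>R ?z) = blinfun_apply (f' ?z) ?z * p * d" for d
        by (simp only: blinfun.scaleR_right real_scaleR_def mult_ac)
      ultimately have "((\<lambda>\<delta>. w (exp (\<delta> * p) *\<^sub>R x)) has_real_derivative blinfun_apply (f' ?z) ?z * p) (at \<sigma>)"
        by (simp only: has_field_derivative_def)
      then show ?thesis unfolding g_def[abs_def] by (rule DERIV_cdivide)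
    qed
    have g0: "g 0 = 1" using pos[OF x] by (simp add: g_def)
    have gk: "w (flow \<delta> x) / w x = g \<delta>" for \<delta> by (simp add: g_def flow_def p_def)
    have "\<bar>g \<delta> - 1\<bar> \<le> M / m * \<delta>" if d: "0 < \<delta>" "\<delta> \<le> 1" for \<delta>
    proof (cases "\<bar>ln (norm x)\<bar> \<ge> R")
      case True
      then have "p = 0" by (simp add: p_def supp)
      then show ?thesis using g0 d M m by (simp add: g_def)
    next
      case False
      then have "- R < ln (norm x)" "ln (norm x) < R" by auto
      then have "exp (- R) < norm x" "norm x < exp R" using x by (metis exp_less_cancel_iff exp_ln zero_less_norm_iff)+
      then have xS: "x \<in> S R" by (simp add: S_def)
      have "\<exists>z. 0 < z \<and> z < \<delta> \<and> g \<delta> - g 0 = (\<delta> - 0) * (blinfun_apply (f' (exp (z * p) *\<^sub>R x)) (exp (z * p) *\<^sub>R x) * p / w x)"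
        by (intro MVT2 d gd)
      then obtain z where z: "0 < z" "z < \<delta>" "g \<delta> - g 0 = (\<delta> - 0) * (blinfun_apply (f' (exp (z * p) *\<^sub>R x)) (exp (z * p) *\<^sub>R x) * p / w x)"
        by blast
      let ?z = "exp (z * p) *\<^sub>R x"
      have zp: "0 \<le> z * p" "z * p \<le> 1" using z d p mult_mono[of z 1 p 1] by auto
      have "exp (- R) * 1 \<le> norm x * exp (z * p)" using \<open>exp (- R) < norm x\<close> zp by (intro mult_mono) auto
      moreover have "norm x * exp (z * p) \<le> exp R * exp 1" using \<open>norm x < exp R\<close> zp by (intro mult_mono) auto
      ultimately have "?z \<in> S (R + 1)" by (simp add: S_def exp_add mult.commute)
      then have "\<bar>blinfun_apply (f' ?z) ?z * p\<bar> \<le> M * 1" unfolding abs_mult using M p by (intro mult_mono) auto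
      then have "\<bar>blinfun_apply (f' ?z) ?z * p\<bar> / w x \<le> M / m"
        using m xS M by (intro frac_le) auto
      then have "\<delta> * (\<bar>blinfun_apply (f' ?z) ?z * p\<bar> / w x) \<le> \<delta> * (M / m)" using d by (intro mult_left_mono) auto
      moreover have "\<bar>g \<delta> - 1\<bar> = \<delta> * (\<bar>blinfun_apply (f' ?z) ?z * p\<bar> / w x)"
        using z(3) g0 d pos[OF x] by (simp add: abs_mult abs_divide)
      ultimately show ?thesis by (simp add: mult.commute)
    qed
    then have "\<bar>g (dk k) - 1\<bar> \<le> M / m * dk k" for k using dk(1,2)[of k] by simp
    moreover have "convergent (\<lambda>k. (g (dk k) - 1) / dk k)"
      using quotient_tendsto_derivative[OF gd[of 0] g0] by (rule convergentI)
    ultimately show ?thesis unfolding gk by blast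
  qed
  then show ?thesis by blast
qed

text \<open>The derivative of \<open>jac\<close> at \<open>\<delta> = 0\<close>, that is, the
  divergence of the field \<open>c (ln |x|) x\<close>.\<close>

definition jd :: "'a::euclidean_space \<Rightarrow> real" where
  "jd x = real DIM('a) * c (ln (norm x)) + c' (ln (norm x))"

lemma jd_measurable [measurable]: "jd \<in> borel_measurable borel"
  unfolding jd_def[abs_def] by measurable

lemma jac_quotient:
  fixes x :: "'a::euclidean_space"
  shows "\<bar>jac (dk k) x - 1\<bar> \<le> (real DIM('a) * exp DIM('a) + 1 + real DIM('a) * exp DIM('a) * 1) * dk k"
    and "(\<lambda>k. (jac (dk k) x - 1) / dk k) \<longlonglongrightarrow> jd x"
proof -
  let ?n = "real DIM('a)" and ?c = "c (ln (norm x))" and ?c' = "c' (ln (norm x))"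
  show "\<bar>jac (dk k) x - 1\<bar> \<le> (?n * exp ?n + 1 + ?n * exp ?n * 1) * dk k"
    unfolding jac_def
  proof (rule quotient_bound_mult)
    have z: "0 \<le> ?n * dk k * ?c" "?n * dk k * ?c \<le> ?n * dk k"
      using c_range[of "ln (norm x)"] dk(1)[of k] by (auto simp: mult_left_le)
    have z1: "?n * dk k \<le> ?n" using dk(2)[of k] by (simp add: mult_left_le)
    have "exp (?n * dk k * ?c) - 1 \<le> exp (?n * dk k) - 1" using z by simp
    also have "\<dots> \<le> ?n * dk k * exp ?n"
    proof -
      have "1 + (- (?n * dk k)) \<le> exp (- (?n * dk k))" by (rule exp_ge_add_one_self)
      then have "exp (?n * dk k) * (1 - ?n * dk k) \<le> exp (?n * dk k) * exp (- (?n * dk k))" by (intro mult_left_mono) auto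
      then have "exp (?n * dk k) - 1 \<le> ?n * dk k * exp (?n * dk k)" by (simp add: exp_minus algebra_simps)
      also have "\<dots> \<le> ?n * dk k * exp ?n" using z1 dk(1)[of k] by (intro mult_left_mono) auto
      finally show ?thesis .
    qed
    finally show "\<bar>exp (?n * dk k * ?c) - 1\<bar> \<le> ?n * exp ?n * dk k" using z by (simp add: mult_ac)
    show "\<bar>1 + dk k * ?c' - 1\<bar> \<le> 1 * dk k"
      using c'_bound[of "ln (norm x)"] \<kappa> dk(1)[of k] by (simp add: abs_mult mult_left_le)
  qed (use dk[of k] in auto)
  have "((\<lambda>\<delta>. exp (?n * \<delta> * ?c) * (1 + \<delta> * ?c')) has_real_derivative jd x) (at 0)"
    by (auto intro!: derivative_eq_intros simp: jd_def)
  from quotient_tendsto_derivative[OF this] show "(\<lambda>k. (jac (dk k) x - 1) / dk k) \<longlonglongrightarrow> jd x"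
    unfolding jac_def by simp
qed

text \<open>The value of the weighted kernel \<open>mker\<close> at the two moved points divided by
  its value at the original points. Its derivative at \<open>\<delta> = 0\<close> is
  \<open>kd\<close>.\<close>

definition kq :: "real \<Rightarrow> real \<Rightarrow> real \<Rightarrow> real \<Rightarrow> 'a::euclidean_space \<Rightarrow> 'a \<Rightarrow> real" where
  "kq \<beta>1 \<beta>2 s \<delta> x y = exp (- (\<delta> * (\<beta>1 * c (ln (norm x)) + \<beta>2 * c (ln (norm y))))) * (norm (flow \<delta> x - flow \<delta> y) / norm (x - y)) powr (- s)"

definition kd :: "real \<Rightarrow> real \<Rightarrow> real \<Rightarrow> 'a::euclidean_space \<Rightarrow> 'a \<Rightarrow> real" where
  "kd \<beta>1 \<beta>2 s x y = - (\<beta>1 * c (ln (norm x)) + \<beta>2 * c (ln (norm y)))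
     - s * (((c (ln (norm x)) *\<^sub>R x - c (ln (norm y)) *\<^sub>R y) \<bullet> (x - y)) / (norm (x - y))\<^sup>2)"

text \<open>The quotient of distances is within \<open>6 * dk k\<close> of one, hence at least
  \<open>1 / 2\<close>, and on that range the power \<open>- s\<close> is Lipschitz. The resulting
  constant depends neither on the points nor on the cutoff, so it still dominates when the cutoff is
  removed.\<close>

lemma kq_quotient:
  fixes x y :: "'a::euclidean_space"
  assumes \<beta>: "\<beta>1 \<ge> 0" "\<beta>2 \<ge> 0" and s: "s > 0" and xy: "x \<noteq> 0" "y \<noteq> 0" "x \<noteq> y"
  shows "\<bar>kq \<beta>1 \<beta>2 s (dk k) x y - 1\<bar> \<le> ((\<beta>1 + \<beta>2) + 6 * s * (1/2) powr (- s - 1) + (\<beta>1 + \<beta>2) * (6 * s * (1/2) powr (- s - 1))) * dk k"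
    and "(\<lambda>k. (kq \<beta>1 \<beta>2 s (dk k) x y - 1) / dk k) \<longlonglongrightarrow> kd \<beta>1 \<beta>2 s x y"
proof -
  let ?p = "c (ln (norm x))" and ?r = "c (ln (norm y))"
  have nxy: "norm (x - y) > 0" using xy by simp
  show "\<bar>kq \<beta>1 \<beta>2 s (dk k) x y - 1\<bar> \<le> ((\<beta>1 + \<beta>2) + 6 * s * (1/2) powr (- s - 1) + (\<beta>1 + \<beta>2) * (6 * s * (1/2) powr (- s - 1))) * dk k"
    unfolding kq_def
  proof (rule quotient_bound_mult)
    let ?z = "dk k * (\<beta>1 * ?p + \<beta>2 * ?r)"
    have "\<beta>1 * ?p + \<beta>2 * ?r \<le> \<beta>1 * 1 + \<beta>2 * 1" using \<beta> c_range by (intro add_mono mult_left_mono) auto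
    then have z: "?z \<le> (\<beta>1 + \<beta>2) * dk k" using dk(1)[of k] by (simp add: mult.commute mult_right_mono)
    have "0 \<le> ?z" using \<beta> c_range dk(1)[of k] by (intro mult_nonneg_nonneg add_nonneg_nonneg) auto
    then have "exp (- ?z) \<le> 1" by simp
    moreover have "1 + (- ?z) \<le> exp (- ?z)" by (rule exp_ge_add_one_self)
    ultimately show "\<bar>exp (- ?z) - 1\<bar> \<le> (\<beta>1 + \<beta>2) * dk k" using z by linarith
    let ?\<rho> = "norm (flow (dk k) x - flow (dk k) y) / norm (x - y)"
    have "\<bar>norm (flow (dk k) x - flow (dk k) y) - norm (x - y)\<bar> \<le> 6 * dk k * norm (x - y)"
      using dk[of k] xy by (intro flow_near_isometry) auto
    then have "\<bar>norm (flow (dk k) x - flow (dk k) y) - norm (x - y)\<bar> / norm (x - y) \<le> 6 * dk k" using nxy by (simp add: field_simps)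
    moreover have "?\<rho> - 1 = (norm (flow (dk k) x - flow (dk k) y) - norm (x - y)) / norm (x - y)" using nxy by (simp add: field_simps)
    ultimately have \<rho>1: "\<bar>?\<rho> - 1\<bar> \<le> 6 * dk k" using nxy by (simp add: abs_divide)
    have half: "?\<rho> \<ge> 1/2" using \<rho>1 dk(2)[of k] by linarith
    have lip: "\<bar>v powr (- s) - u powr (- s)\<bar> \<le> s * (1/2) powr (- s - 1) * (v - u)" if uv: "1/2 \<le> u" "u < v" for u v
    proof -
      have "\<exists>z. u < z \<and> z < v \<and> v powr (- s) - u powr (- s) = (v - u) * (- s * z powr (- s - 1))"
        using uv by (intro MVT2) (auto intro!: derivative_eq_intros)
      then obtain z where z: "u < z" "z < v" "v powr (- s) - u powr (- s) = (v - u) * (- s * z powr (- s - 1))" by blast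
      have "z powr (- s - 1) \<le> (1/2) powr (- s - 1)" using z uv s by (intro powr_mono2') auto
      then have "(v - u) * (s * z powr (- s - 1)) \<le> (v - u) * (s * (1/2) powr (- s - 1))" using uv s by (intro mult_left_mono) auto
      then show ?thesis unfolding z(3) using uv s by (simp add: abs_mult mult_ac)
    qed
    have "\<bar>?\<rho> powr (- s) - 1 powr (- s)\<bar> \<le> s * (1/2) powr (- s - 1) * \<bar>?\<rho> - 1\<bar>"
    proof -
      consider "?\<rho> < 1" | "?\<rho> > 1" | "?\<rho> = 1" by linarith
      then show ?thesis
      proof cases
        case 1
        then show ?thesis using lip[of ?\<rho> 1] half by (simp add: abs_minus_commute)
      next
        case 2
        then show ?thesis using lip[of 1 ?\<rho>] by simp
      next
        case 3
        show ?thesis unfolding 3 by simp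
      qed
    qed
    also have "\<dots> \<le> s * (1/2) powr (- s - 1) * (6 * dk k)" using \<rho>1 s by (intro mult_left_mono) auto
    finally show "\<bar>?\<rho> powr (- s) - 1\<bar> \<le> 6 * s * (1/2) powr (- s - 1) * dk k" by simp
  qed (use dk[of k] in auto)
  define N where "N \<delta> = norm (exp (\<delta> * ?p) *\<^sub>R x - exp (\<delta> * ?r) *\<^sub>R y)" for \<delta>
  have N0: "N 0 = norm (x - y)" by (simp add: N_def)
  have "((\<lambda>\<delta>. exp (\<delta> * ?p) *\<^sub>R x - exp (\<delta> * ?r) *\<^sub>R y) has_derivative (\<lambda>d. d *\<^sub>R (?p *\<^sub>R x - ?r *\<^sub>R y))) (at 0)"
    by (auto intro!: derivative_eq_intros simp: algebra_simps)
  moreover have "(norm has_derivative (\<lambda>v. (x - y) \<bullet> v / norm (x - y))) (at (exp (0 * ?p) *\<^sub>R x - exp (0 * ?r) *\<^sub>R y))"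
    using has_derivative_norm[of "x - y"] xy by (simp add: sgn_div_norm divide_inverse inner_commute mult.commute)
  ultimately have "(N has_derivative (\<lambda>d. (x - y) \<bullet> (d *\<^sub>R (?p *\<^sub>R x - ?r *\<^sub>R y)) / norm (x - y))) (at 0)"
    unfolding N_def[abs_def] by (rule has_derivative_compose)
  moreover have "(x - y) \<bullet> (d *\<^sub>R (?p *\<^sub>R x - ?r *\<^sub>R y)) / norm (x - y) = (?p *\<^sub>R x - ?r *\<^sub>R y) \<bullet> (x - y) / norm (x - y) * d" for d
    by (simp only: inner_scaleR_right inner_commute) simp
  ultimately have Nd: "(N has_real_derivative (?p *\<^sub>R x - ?r *\<^sub>R y) \<bullet> (x - y) / norm (x - y)) (at 0)"
    by (simp only: has_field_derivative_def)
  have Nq: "((\<lambda>\<delta>. N \<delta> / norm (x - y)) has_real_derivative (?p *\<^sub>R x - ?r *\<^sub>R y) \<bullet> (x - y) / (norm (x - y))\<^sup>2) (at 0)"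
    using DERIV_cdivide[OF Nd, of "norm (x - y)"] by (simp add: power2_eq_square)
  have q1: "(\<lambda>k. (N (dk k) / norm (x - y) - 1) / dk k) \<longlonglongrightarrow> (?p *\<^sub>R x - ?r *\<^sub>R y) \<bullet> (x - y) / (norm (x - y))\<^sup>2"
    by (rule quotient_tendsto_derivative[OF Nq]) (use nxy in \<open>simp add: N0\<close>)
  have "((\<lambda>\<delta>. exp (- (\<delta> * (\<beta>1 * ?p + \<beta>2 * ?r)))) has_real_derivative - (\<beta>1 * ?p + \<beta>2 * ?r)) (at 0)"
    by (auto intro!: derivative_eq_intros)
  from quotient_tendsto_mult[OF quotient_tendsto_derivative[OF this] quotient_tendsto_powr[OF q1, of "- s"]]
  show "(\<lambda>k. (kq \<beta>1 \<beta>2 s (dk k) x y - 1) / dk k) \<longlonglongrightarrow> kd \<beta>1 \<beta>2 s x y"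
    by (simp add: kq_def kd_def N_def flow_def)
qed

lemma kq_measurable [measurable]: "(\<lambda>z. kq \<beta>1 \<beta>2 s \<delta> (fst z) (snd z)) \<in> borel_measurable (borel \<Otimes>\<^sub>M borel)"
  unfolding kq_def by measurable

lemma kd_measurable [measurable]: "(\<lambda>z. kd \<beta>1 \<beta>2 s (fst z) (snd z)) \<in> borel_measurable (borel \<Otimes>\<^sub>M borel)"
  unfolding kd_def by measurable

end

section \<open>The energy as a measure on pairs of points\<close>

definition mker :: "real \<Rightarrow> real \<Rightarrow> real \<Rightarrow> 'a::euclidean_space \<Rightarrow> 'a \<Rightarrow> real" where
  "mker \<beta>1 \<beta>2 s x y = norm x powr (- \<beta>1) * norm y powr (- \<beta>2) * norm (x - y) powr (- s)"

text \<open>Both equations are stated with one and the same kernel, integrated once in each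
  variable, and in \<open>ennreal\<close>, so that Tonelli can be used freely.\<close>

locale energy_pair =
  fixes u v :: "'a::euclidean_space \<Rightarrow> real" and u' v' :: "'a \<Rightarrow> 'a \<Rightarrow>\<^sub>L real" and \<beta>1 \<beta>2 s q1 q2 :: real
  assumes um [measurable]: "u \<in> borel_measurable borel" and vm [measurable]: "v \<in> borel_measurable borel"
    and upos: "\<And>x. u x > 0" and vpos: "\<And>x. v x > 0"
    and uder: "\<And>x. x \<noteq> 0 \<Longrightarrow> (u has_derivative blinfun_apply (u' x)) (at x)" and ucont: "continuous_on (- {0}) u'"
    and vder: "\<And>x. x \<noteq> 0 \<Longrightarrow> (v has_derivative blinfun_apply (v' x)) (at x)" and vcont: "continuous_on (- {0}) v'"
    and \<beta>: "\<beta>1 \<ge> 0" "\<beta>2 \<ge> 0" and s: "s > 0" and q: "q1 > 1" "q2 > 1"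
    and u_eq: "\<And>x. x \<noteq> 0 \<Longrightarrow> ennreal (u x) = (\<integral>\<^sup>+y. ennreal (mker \<beta>1 \<beta>2 s x y * v y powr q2) \<partial>lborel)"
    and v_eq: "\<And>y. y \<noteq> 0 \<Longrightarrow> ennreal (v y) = (\<integral>\<^sup>+x. ennreal (mker \<beta>1 \<beta>2 s x y * u x powr q1) \<partial>lborel)"
    and u_int: "integrable lborel (\<lambda>x. u x powr (q1 + 1))"
begin

abbreviation mk :: "'a \<Rightarrow> 'a \<Rightarrow> real" where "mk \<equiv> mker \<beta>1 \<beta>2 s"

lemma mk_nonneg: "mk x y \<ge> 0" by (simp add: mker_def)

lemma mk_measurable [measurable]: "(\<lambda>z. mk (fst z) (snd z)) \<in> borel_measurable (borel \<Otimes>\<^sub>M borel)"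
  unfolding mker_def by measurable

definition P :: "'a \<times> 'a \<Rightarrow> real" where
  "P z = u (fst z) powr q1 * (mk (fst z) (snd z) * v (snd z) powr q2)"

lemma P_measurable [measurable]: "P \<in> borel_measurable (borel \<Otimes>\<^sub>M borel)"
  unfolding P_def[abs_def] by measurable

lemma P_nonneg: "P z \<ge> 0" by (simp add: P_def mk_nonneg)

text \<open>By the two integral equations the marginals of this measure have densities
  \<open>u powr (q1 + 1)\<close> and \<open>v powr (q2 + 1)\<close>. Everything that is
  differentiated becomes an integral against this one finite measure of a quotient close to one, so
  no integrability of derivatives has to be known beforehand.\<close>

definition Qm :: "('a \<times> 'a) measure" where
  "Qm = density (lborel \<Otimes>\<^sub>M lborel) (\<lambda>z. ennreal (P z))"

lemma sets_Qm [measurable_cong]: "sets Qm = sets (borel \<Otimes>\<^sub>M borel)"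
  by (simp add: Qm_def cong: sets_pair_measure_cong)

lemma space_Qm [simp]: "space Qm = UNIV"
  by (simp add: Qm_def space_pair_measure)

lemma nn_Qm:
  assumes [measurable]: "\<phi> \<in> borel_measurable (borel \<Otimes>\<^sub>M borel)"
  shows "(\<integral>\<^sup>+z. \<phi> z \<partial>Qm) = (\<integral>\<^sup>+x. (\<integral>\<^sup>+y. ennreal (P (x, y)) * \<phi> (x, y) \<partial>lborel) \<partial>lborel)"
    and "(\<integral>\<^sup>+z. \<phi> z \<partial>Qm) = (\<integral>\<^sup>+y. (\<integral>\<^sup>+x. ennreal (P (x, y)) * \<phi> (x, y) \<partial>lborel) \<partial>lborel)"
proof -
  have "(\<integral>\<^sup>+z. \<phi> z \<partial>Qm) = (\<integral>\<^sup>+z. ennreal (P z) * \<phi> z \<partial>(lborel \<Otimes>\<^sub>M lborel))"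
    unfolding Qm_def by (rule nn_integral_density) simp_all
  also have "\<dots> = (\<integral>\<^sup>+x. (\<integral>\<^sup>+y. ennreal (P (x, y)) * \<phi> (x, y) \<partial>lborel) \<partial>lborel)"
    by (rule lborel.nn_integral_fst[symmetric]) simp
  finally show 1: "(\<integral>\<^sup>+z. \<phi> z \<partial>Qm) = (\<integral>\<^sup>+x. (\<integral>\<^sup>+y. ennreal (P (x, y)) * \<phi> (x, y) \<partial>lborel) \<partial>lborel)" .
  show "(\<integral>\<^sup>+z. \<phi> z \<partial>Qm) = (\<integral>\<^sup>+y. (\<integral>\<^sup>+x. ennreal (P (x, y)) * \<phi> (x, y) \<partial>lborel) \<partial>lborel)"
    unfolding 1 by (rule lborel_pair.Fubini') simp
qed

lemma nn_Qm_fst: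
  assumes [measurable]: "\<phi> \<in> borel_measurable borel"
  shows "(\<integral>\<^sup>+z. \<phi> (fst z) \<partial>Qm) = (\<integral>\<^sup>+x. ennreal (u x powr (q1 + 1)) * \<phi> x \<partial>lborel)"
proof -
  have "(\<integral>\<^sup>+z. \<phi> (fst z) \<partial>Qm) = (\<integral>\<^sup>+x. (\<integral>\<^sup>+y. ennreal (P (x, y)) * \<phi> x \<partial>lborel) \<partial>lborel)"
    by (subst nn_Qm(1)) simp_all
  also have "\<dots> = (\<integral>\<^sup>+x. ennreal (u x powr (q1 + 1)) * \<phi> x \<partial>lborel)"
  proof (rule nn_integral_cong_AE, rule eventually_mono[OF AE_lborel_nonzero])
    fix x :: 'a assume x: "x \<noteq> 0"
    have "(\<integral>\<^sup>+y. ennreal (P (x, y)) * \<phi> x \<partial>lborel) = (\<integral>\<^sup>+y. (ennreal (u x powr q1) * \<phi> x) * ennreal (mk x y * v y powr q2) \<partial>lborel)"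
      by (simp add: P_def ennreal_mult' mult_ac)
    also have "\<dots> = (ennreal (u x powr q1) * \<phi> x) * ennreal (u x)"
      unfolding u_eq[OF x] by (rule nn_integral_cmult) (simp add: mker_def)
    also have "\<dots> = ennreal (u x powr q1 * u x) * \<phi> x" using upos[of x] by (simp add: ennreal_mult' mult_ac)
    also have "u x powr q1 * u x = u x powr (q1 + 1)" using upos[of x] by (simp add: powr_add)
    finally show "(\<integral>\<^sup>+y. ennreal (P (x, y)) * \<phi> x \<partial>lborel) = ennreal (u x powr (q1 + 1)) * \<phi> x" .
  qed
  finally show ?thesis .
qed

lemma nn_Qm_snd:
  assumes [measurable]: "\<phi> \<in> borel_measurable borel"
  shows "(\<integral>\<^sup>+z. \<phi> (snd z) \<partial>Qm) = (\<integral>\<^sup>+y. ennreal (v y powr (q2 + 1)) * \<phi> y \<partial>lborel)"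
proof -
  have "(\<integral>\<^sup>+z. \<phi> (snd z) \<partial>Qm) = (\<integral>\<^sup>+y. (\<integral>\<^sup>+x. ennreal (P (x, y)) * \<phi> y \<partial>lborel) \<partial>lborel)"
    by (subst nn_Qm(2)) simp_all
  also have "\<dots> = (\<integral>\<^sup>+y. ennreal (v y powr (q2 + 1)) * \<phi> y \<partial>lborel)"
  proof (rule nn_integral_cong_AE, rule eventually_mono[OF AE_lborel_nonzero])
    fix y :: 'a assume y: "y \<noteq> 0"
    have "(\<integral>\<^sup>+x. ennreal (P (x, y)) * \<phi> y \<partial>lborel) = (\<integral>\<^sup>+x. (ennreal (v y powr q2) * \<phi> y) * ennreal (mk x y * u x powr q1) \<partial>lborel)"
      by (simp add: P_def ennreal_mult' ennreal_mult'' mk_nonneg mult_ac)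
    also have "\<dots> = (ennreal (v y powr q2) * \<phi> y) * ennreal (v y)"
      unfolding v_eq[OF y] by (rule nn_integral_cmult) (simp add: mker_def)
    also have "\<dots> = ennreal (v y powr q2 * v y) * \<phi> y" using vpos[of y] by (simp add: ennreal_mult' mult_ac)
    also have "v y powr q2 * v y = v y powr (q2 + 1)" using vpos[of y] by (simp add: powr_add)
    finally show "(\<integral>\<^sup>+x. ennreal (P (x, y)) * \<phi> y \<partial>lborel) = ennreal (v y powr (q2 + 1)) * \<phi> y" .
  qed
  finally show ?thesis .
qed

lemma emeasure_Qm: "emeasure Qm UNIV = ennreal (LINT x|lborel. u x powr (q1 + 1))"
proof -
  have "emeasure Qm UNIV = (\<integral>\<^sup>+z. 1 \<partial>Qm)" by simp
  also have "\<dots> = (\<integral>\<^sup>+x. ennreal (u x powr (q1 + 1)) \<partial>lborel)" using nn_Qm_fst[of "\<lambda>_. 1"] by simp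
  also have "\<dots> = ennreal (LINT x|lborel. u x powr (q1 + 1))" by (rule nn_integral_eq_integral[OF u_int]) simp
  finally show ?thesis .
qed

sublocale finite_measure Qm
  by (rule finite_measureI) (simp add: emeasure_Qm)

lemma nn_u: "(\<integral>\<^sup>+x. ennreal (u x powr (q1 + 1)) \<partial>lborel) = ennreal (measure Qm UNIV)"
  using nn_Qm_fst[of "\<lambda>_. 1"] by (simp add: emeasure_eq_measure)

text \<open>Both energies are the total mass of \<open>Qm\<close>; in particular they coincide, and
  finiteness of the one for \<open>v\<close> follows from that for \<open>u\<close>.\<close>

lemma nn_v: "(\<integral>\<^sup>+x. ennreal (v x powr (q2 + 1)) \<partial>lborel) = ennreal (measure Qm UNIV)"
  using nn_Qm_snd[of "\<lambda>_. 1"] by (simp add: emeasure_eq_measure)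

lemma measure_Qm_pos: "measure Qm UNIV > 0"
proof -
  have "\<not> (AE x in lborel. u x powr (q1 + 1) = 0)"
  proof
    assume "AE x in lborel. u x powr (q1 + 1) = 0"
    then have "AE x in (lborel :: 'a measure). False" by (rule eventually_mono) (use upos in \<open>simp add: less_imp_neq[THEN not_sym]\<close>)
    then have "emeasure (lborel :: 'a measure) (space lborel) = 0" by (simp add: AE_iff_null null_sets_def)
    then show False by simp
  qed
  then have "(\<integral>\<^sup>+x. ennreal (u x powr (q1 + 1)) \<partial>lborel) \<noteq> 0"
    by (subst nn_integral_0_iff_AE) auto
  then show ?thesis unfolding nn_u by (simp add: less_le)
qed

lemma AE_Qm: "AE z in Qm. fst z \<noteq> 0 \<and> snd z \<noteq> 0 \<and> fst z \<noteq> snd z"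
proof -
  have "AE z in (lborel \<Otimes>\<^sub>M lborel). fst z \<noteq> (0::'a) \<and> snd z \<noteq> (0::'a) \<and> fst z \<noteq> snd z"
  proof (rule lborel_pair.AE_pair_measure)
    show "{x \<in> space (lborel \<Otimes>\<^sub>M lborel). fst x \<noteq> (0::'a) \<and> snd x \<noteq> (0::'a) \<and> fst x \<noteq> snd x} \<in> sets (lborel \<Otimes>\<^sub>M lborel)"
      by measurable
    show "AE x in lborel. AE y in lborel. fst (x, y) \<noteq> (0::'a) \<and> snd (x, y) \<noteq> (0::'a) \<and> fst (x, y) \<noteq> snd (x, y)"
    proof (rule eventually_mono[OF AE_lborel_nonzero])
      fix x :: 'a assume "x \<noteq> 0"
      moreover have "AE y in lborel. y \<noteq> (0::'a) \<and> y \<noteq> x" by (intro AE_conjI AE_lborel_singleton)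
      ultimately show "AE y in lborel. fst (x, y) \<noteq> 0 \<and> snd (x, y) \<noteq> 0 \<and> fst (x, y) \<noteq> snd (x, y)"
        by (auto elim: eventually_mono)
    qed
  qed
  then show ?thesis unfolding Qm_def by (subst AE_density) (auto elim: eventually_mono)
qed

text \<open>First variation of the energy along the flow of a radial vector field: the cutoff keeps the
  field off the singularities of \<open>u\<close> and \<open>v\<close>, and only the bounded quotients of the kernel along
  the diagonal flow enter.\<close>

lemma first_variation:
  assumes "cutoff c c' \<kappa> R"
  shows "(LINT z|Qm. cutoff.jd c c' (fst z)) / (q1 + 1) + (LINT z|Qm. cutoff.jd c c' (snd z)) / (q2 + 1)
     + (LINT z|Qm. cutoff.kd c \<beta>1 \<beta>2 s (fst z) (snd z)) = 0"
proof -
  interpret cutoff c c' \<kappa> R by fact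
  let ?E = "measure Qm (space Qm)"
  obtain Cu where Cu: "\<And>x k. x \<noteq> 0 \<Longrightarrow> \<bar>u (flow (dk k) x) / u x - 1\<bar> \<le> Cu * dk k"
    and cu: "\<And>x. x \<noteq> 0 \<Longrightarrow> convergent (\<lambda>k. (u (flow (dk k) x) / u x - 1) / dk k)"
    using C1_flow_quotient[OF uder ucont upos] by auto
  obtain Cv where Cv: "\<And>x k. x \<noteq> 0 \<Longrightarrow> \<bar>v (flow (dk k) x) / v x - 1\<bar> \<le> Cv * dk k"
    and cv: "\<And>x. x \<noteq> 0 \<Longrightarrow> convergent (\<lambda>k. (v (flow (dk k) x) / v x - 1) / dk k)"
    using C1_flow_quotient[OF vder vcont vpos] by auto
  \<comment> \<open>The logarithmic derivative of \<open>u\<close> along the field. It is defined as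
    a limit to make it Borel measurable; its value is never computed, since it is eliminated at the
    end.\<close>
  define au where "au x = lim (\<lambda>k. (u (flow (dk k) x) / u x - 1) / dk k)" for x
  define av where "av x = lim (\<lambda>k. (v (flow (dk k) x) / v x - 1) / dk k)" for x
  have [measurable]: "au \<in> borel_measurable borel" "av \<in> borel_measurable borel"
    unfolding au_def[abs_def] av_def[abs_def] by measurable
  have lu: "(\<lambda>k. (u (flow (dk k) x) / u x - 1) / dk k) \<longlonglongrightarrow> au x" and lv: "(\<lambda>k. (v (flow (dk k) x) / v x - 1) / dk k) \<longlonglongrightarrow> av x"
    if "x \<noteq> 0" for x using cu[OF that] cv[OF that] by (simp_all add: au_def av_def convergent_LIMSEQ_iff)
  have ru: "u (flow (dk k) x) / u x > 0" and rv: "v (flow (dk k) x) / v x > 0" for x k using upos vpos by auto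
  have dk': "0 < dk k" "dk k \<le> 1" for k using dk(1,2)[of k] by auto
  define CJ where "CJ = real DIM('a) * exp (real DIM('a)) + 1 + real DIM('a) * exp (real DIM('a)) * 1"
  have jb: "\<bar>jac (dk k) x - 1\<bar> \<le> CJ * dk k" for x :: 'a and k unfolding CJ_def by (rule jac_quotient(1))
  define CK where "CK = (\<beta>1 + \<beta>2) + 6 * s * (1/2) powr (- s - 1) + (\<beta>1 + \<beta>2) * (6 * s * (1/2) powr (- s - 1))"
  have kb: "\<bar>kq \<beta>1 \<beta>2 s (dk k) x y - 1\<bar> \<le> CK * dk k" if "x \<noteq> 0" "y \<noteq> 0" "x \<noteq> y" for x y :: 'a and k
    unfolding CK_def by (rule kq_quotient(1)[OF \<beta> s that])
  \<comment> \<open>\<open>T1\<close> and \<open>T2\<close> are the relative changes of the two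
    sides of the equation for \<open>u\<close>, the integration variable being moved too;
    \<open>T3\<close> and \<open>T4\<close> are those of the two energies, with the Jacobian
    included.\<close>
  define T1 where "T1 k z = u (flow (dk k) (fst z)) / u (fst z)" for k and z :: "'a \<times> 'a"
  define T2 where "T2 k z = kq \<beta>1 \<beta>2 s (dk k) (fst z) (snd z) * ((v (flow (dk k) (snd z)) / v (snd z)) powr q2 * jac (dk k) (snd z))" for k and z :: "'a \<times> 'a"
  define T3 where "T3 k z = (u (flow (dk k) (fst z)) / u (fst z)) powr (q1 + 1) * jac (dk k) (fst z)" for k and z :: "'a \<times> 'a"
  define T4 where "T4 k z = (v (flow (dk k) (snd z)) / v (snd z)) powr (q2 + 1) * jac (dk k) (snd z)" for k and z :: "'a \<times> 'a"
  note Tdefs = T1_def T2_def T3_def T4_def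
  have [measurable]: "T1 k \<in> borel_measurable Qm" "T2 k \<in> borel_measurable Qm" "T3 k \<in> borel_measurable Qm" "T4 k \<in> borel_measurable Qm" for k
    unfolding Tdefs[abs_def] by measurable
  have Tm [measurable]: "T2 k \<in> borel_measurable (borel \<Otimes>\<^sub>M borel)" for k unfolding T2_def[abs_def] by measurable
  have jp: "jac (dk k) x > 0" for x :: 'a and k by (rule jac_pos[OF dk(4)])
  have T0: "0 \<le> T1 k z" "0 \<le> T2 k z" "0 \<le> T3 k z" "0 \<le> T4 k z" for k z
    using upos vpos jp unfolding Tdefs kq_def by (auto simp: less_imp_le)
  have "\<exists>C. \<forall>k. AE z in Qm. \<bar>T1 k z - 1\<bar> \<le> C * dk k"
    by (intro exI[of _ Cu] allI eventually_mono[OF AE_Qm]) (auto simp: T1_def Cu)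
  then obtain C1 where b1: "\<And>k. AE z in Qm. \<bar>T1 k z - 1\<bar> \<le> C1 * dk k" by blast
  have l1: "AE z in Qm. (\<lambda>k. (T1 k z - 1) / dk k) \<longlonglongrightarrow> au (fst z)"
    unfolding T1_def by (rule eventually_mono[OF AE_Qm]) (use lu in auto)
  note L1 = integral_quotient_tendsto[where T=T1 and T'="\<lambda>z. au (fst z)", OF _ _ b1 l1]
  have pvb: "\<bar>(v (flow (dk k) x) / v x) powr r - 1\<bar> \<le> (r * (1 + Cv) powr (r - 1) * Cv) * dk k" if "x \<noteq> 0" "r > 1" for x k r
    by (rule quotient_bound_powr[OF Cv dk' rv]) (use that in auto)
  have pub: "\<bar>(u (flow (dk k) x) / u x) powr r - 1\<bar> \<le> (r * (1 + Cu) powr (r - 1) * Cu) * dk k" if "x \<noteq> 0" "r > 1" for x k r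
    by (rule quotient_bound_powr[OF Cu dk' ru]) (use that in auto)
  have q': "q1 + 1 > 1" "q2 + 1 > 1" using q by auto
  have "\<exists>C. \<forall>k. AE z in Qm. \<bar>T2 k z - 1\<bar> \<le> C * dk k"
    unfolding T2_def
    by (rule exI, rule allI, rule eventually_mono[OF AE_Qm],
        rule quotient_bound_mult[OF kb quotient_bound_mult[OF pvb[OF _ q(2)] jb dk'] dk']) auto
  then obtain C2 where b2: "\<And>k. AE z in Qm. \<bar>T2 k z - 1\<bar> \<le> C2 * dk k" by blast
  have l2: "AE z in Qm. (\<lambda>k. (T2 k z - 1) / dk k) \<longlonglongrightarrow> kd \<beta>1 \<beta>2 s (fst z) (snd z) + (q2 * av (snd z) + jd (snd z))"
    unfolding T2_def by (rule eventually_mono[OF AE_Qm], intro quotient_tendsto_mult quotient_tendsto_powr lv jac_quotient(2) kq_quotient(2) \<beta> s) auto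
  note L2 = integral_quotient_tendsto[where T=T2 and T'="\<lambda>z. kd \<beta>1 \<beta>2 s (fst z) (snd z) + (q2 * av (snd z) + jd (snd z))", OF _ _ b2 l2]
  have "\<exists>C. \<forall>k. AE z in Qm. \<bar>T3 k z - 1\<bar> \<le> C * dk k"
    unfolding T3_def
    by (rule exI, rule allI, rule eventually_mono[OF AE_Qm], rule quotient_bound_mult[OF pub[OF _ q'(1)] jb dk']) auto
  then obtain C3 where b3: "\<And>k. AE z in Qm. \<bar>T3 k z - 1\<bar> \<le> C3 * dk k" by blast
  have l3: "AE z in Qm. (\<lambda>k. (T3 k z - 1) / dk k) \<longlonglongrightarrow> (q1 + 1) * au (fst z) + jd (fst z)"
    unfolding T3_def by (rule eventually_mono[OF AE_Qm], intro quotient_tendsto_mult quotient_tendsto_powr lu jac_quotient(2)) auto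
  note L3 = integral_quotient_tendsto[where T=T3 and T'="\<lambda>z. (q1 + 1) * au (fst z) + jd (fst z)", OF _ _ b3 l3]
  have "\<exists>C. \<forall>k. AE z in Qm. \<bar>T4 k z - 1\<bar> \<le> C * dk k"
    unfolding T4_def
    by (rule exI, rule allI, rule eventually_mono[OF AE_Qm], rule quotient_bound_mult[OF pvb[OF _ q'(2)] jb dk']) auto
  then obtain C4 where b4: "\<And>k. AE z in Qm. \<bar>T4 k z - 1\<bar> \<le> C4 * dk k" by blast
  have l4: "AE z in Qm. (\<lambda>k. (T4 k z - 1) / dk k) \<longlonglongrightarrow> (q2 + 1) * av (snd z) + jd (snd z)"
    unfolding T4_def by (rule eventually_mono[OF AE_Qm], intro quotient_tendsto_mult quotient_tendsto_powr lv jac_quotient(2)) auto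
  note L4 = integral_quotient_tendsto[where T=T4 and T'="\<lambda>z. (q2 + 1) * av (snd z) + jd (snd z)", OF _ _ b4 l4]
  have lint: "(LINT z|Qm. T z) = e" if "integrable Qm T" "\<And>z. 0 \<le> T z" "(\<integral>\<^sup>+z. ennreal (T z) \<partial>Qm) = ennreal e" "e \<ge> 0" for T e
    using that nn_integral_eq_integral[OF that(1)] by (simp add: integral_nonneg_AE)
  \<comment> \<open>By the change of variables this integral does not depend on the parameter, so
    its derivative vanishes. This expresses the derivative of \<open>u\<close> through
    \<open>jd\<close> alone.\<close>
  have I3: "(LINT z|Qm. T3 k z) = ?E" for k
  proof (rule lint)
    have "(\<integral>\<^sup>+z. ennreal (T3 k z) \<partial>Qm) = (\<integral>\<^sup>+x. ennreal (u x powr (q1 + 1)) * ennreal ((u (flow (dk k) x) / u x) powr (q1 + 1) * jac (dk k) x) \<partial>lborel)"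
      unfolding T3_def by (rule nn_Qm_fst[of "\<lambda>x. ennreal ((u (flow (dk k) x) / u x) powr (q1 + 1) * jac (dk k) x)"]) simp
    also have "\<dots> = (\<integral>\<^sup>+x. ennreal (jac (dk k) x) * ennreal (u (flow (dk k) x) powr (q1 + 1)) \<partial>lborel)"
    proof (intro nn_integral_cong)
      fix x :: 'a
      have "u x powr (q1 + 1) * ((u (flow (dk k) x) / u x) powr (q1 + 1) * jac (dk k) x) = jac (dk k) x * u (flow (dk k) x) powr (q1 + 1)"
        using upos[of x] upos[of "flow (dk k) x"] by (simp add: powr_divide)
      then show "ennreal (u x powr (q1 + 1)) * ennreal ((u (flow (dk k) x) / u x) powr (q1 + 1) * jac (dk k) x) = ennreal (jac (dk k) x) * ennreal (u (flow (dk k) x) powr (q1 + 1))"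
        using jac_pos[OF dk(4), of k x] by (simp add: ennreal_mult'[symmetric])
    qed
    also have "\<dots> = (\<integral>\<^sup>+x. ennreal (u x powr (q1 + 1)) \<partial>lborel)" by (rule nn_integral_flow[OF _ dk(4)]) simp
    finally show "(\<integral>\<^sup>+z. ennreal (T3 k z) \<partial>Qm) = ennreal ?E" using nn_u by simp
  qed (use L3(2) T0 in simp_all)
  have I4: "(LINT z|Qm. T4 k z) = ?E" for k
  proof (rule lint)
    have "(\<integral>\<^sup>+z. ennreal (T4 k z) \<partial>Qm) = (\<integral>\<^sup>+x. ennreal (v x powr (q2 + 1)) * ennreal ((v (flow (dk k) x) / v x) powr (q2 + 1) * jac (dk k) x) \<partial>lborel)"
      unfolding T4_def by (rule nn_Qm_snd[of "\<lambda>x. ennreal ((v (flow (dk k) x) / v x) powr (q2 + 1) * jac (dk k) x)"]) simp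
    also have "\<dots> = (\<integral>\<^sup>+x. ennreal (jac (dk k) x) * ennreal (v (flow (dk k) x) powr (q2 + 1)) \<partial>lborel)"
    proof (intro nn_integral_cong)
      fix x :: 'a
      have "v x powr (q2 + 1) * ((v (flow (dk k) x) / v x) powr (q2 + 1) * jac (dk k) x) = jac (dk k) x * v (flow (dk k) x) powr (q2 + 1)"
        using vpos[of x] vpos[of "flow (dk k) x"] by (simp add: powr_divide)
      then show "ennreal (v x powr (q2 + 1)) * ennreal ((v (flow (dk k) x) / v x) powr (q2 + 1) * jac (dk k) x) = ennreal (jac (dk k) x) * ennreal (v (flow (dk k) x) powr (q2 + 1))"
        using jac_pos[OF dk(4), of k x] by (simp add: ennreal_mult'[symmetric])
    qed
    also have "\<dots> = (\<integral>\<^sup>+x. ennreal (v x powr (q2 + 1)) \<partial>lborel)" by (rule nn_integral_flow[OF _ dk(4)]) simp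
    finally show "(\<integral>\<^sup>+z. ennreal (T4 k z) \<partial>Qm) = ennreal ?E" using nn_v by simp
  qed (use L4(2) T0 in simp_all)
  \<comment> \<open>The equation for \<open>u\<close> is evaluated at the moved point, and the
    integration variable is replaced by its image under the same deformation. The kernel then
    changes only by the bounded factor \<open>kq\<close>.\<close>
  have I12: "(LINT z|Qm. T1 k z) = (LINT z|Qm. T2 k z)" for k
  proof (rule lint)
    have "(\<integral>\<^sup>+z. ennreal (T1 k z) \<partial>Qm) = (\<integral>\<^sup>+x. ennreal (u x powr (q1 + 1)) * ennreal (u (flow (dk k) x) / u x) \<partial>lborel)"
      unfolding T1_def by (rule nn_Qm_fst[of "\<lambda>x. ennreal (u (flow (dk k) x) / u x)"]) simp
    also have "\<dots> = (\<integral>\<^sup>+x. (\<integral>\<^sup>+y. ennreal (P (x, y)) * ennreal (T2 k (x, y)) \<partial>lborel) \<partial>lborel)"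
    proof (rule nn_integral_cong_AE, rule eventually_mono[OF AE_lborel_nonzero])
      fix x :: 'a assume x: "x \<noteq> 0"
      let ?\<Phi> = "flow (dk k) :: 'a \<Rightarrow> 'a"
      have "ennreal (u x powr (q1 + 1)) * ennreal (u (?\<Phi> x) / u x) = ennreal (u x powr q1) * ennreal (u (?\<Phi> x))"
        using upos[of x] upos[of "?\<Phi> x"] by (simp add: ennreal_mult'[symmetric] powr_add)
      also have "ennreal (u (?\<Phi> x)) = (\<integral>\<^sup>+y. ennreal (mk (?\<Phi> x) y * v y powr q2) \<partial>lborel)" using x by (intro u_eq) simp
      also have "\<dots> = (\<integral>\<^sup>+y. ennreal (jac (dk k) y) * ennreal (mk (?\<Phi> x) (?\<Phi> y) * v (?\<Phi> y) powr q2) \<partial>lborel)"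
        by (rule nn_integral_flow[OF _ dk(4), symmetric]) (simp add: mker_def)
      also have "ennreal (u x powr q1) * \<dots> = (\<integral>\<^sup>+y. ennreal (u x powr q1) * (ennreal (jac (dk k) y) * ennreal (mk (?\<Phi> x) (?\<Phi> y) * v (?\<Phi> y) powr q2)) \<partial>lborel)"
        by (rule nn_integral_cmult[symmetric]) (simp add: mker_def)
      also have "\<dots> = (\<integral>\<^sup>+y. ennreal (P (x, y)) * ennreal (T2 k (x, y)) \<partial>lborel)"
      proof (rule nn_integral_cong_AE)
        have "AE y in lborel. y \<noteq> (0::'a) \<and> y \<noteq> x" by (intro AE_conjI AE_lborel_singleton)
        then show "AE y in lborel. ennreal (u x powr q1) * (ennreal (jac (dk k) y) * ennreal (mk (?\<Phi> x) (?\<Phi> y) * v (?\<Phi> y) powr q2)) = ennreal (P (x, y)) * ennreal (T2 k (x, y))"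
        proof eventually_elim
          case (elim y)
          have nf: "norm (?\<Phi> z) powr (- \<gamma>) = exp (- (dk k * (\<gamma> * c (ln (norm z))))) * norm z powr (- \<gamma>)" for z and \<gamma> :: real
            by (simp add: flow_def powr_mult exp_powr_real mult_ac)
          have "norm (?\<Phi> x - ?\<Phi> y) powr (- s) = (norm (?\<Phi> x - ?\<Phi> y) / norm (x - y)) powr (- s) * norm (x - y) powr (- s)"
            using elim by (simp add: powr_divide)
          then have mkf: "mk (?\<Phi> x) (?\<Phi> y) = kq \<beta>1 \<beta>2 s (dk k) x y * mk x y"
            unfolding mker_def kq_def nf by (simp add: distrib_left exp_add[symmetric] exp_diff[symmetric] mult_ac flip: exp_add)
          have "u x powr q1 * (jac (dk k) y * (mk (?\<Phi> x) (?\<Phi> y) * v (?\<Phi> y) powr q2)) = P (x, y) * T2 k (x, y)"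
            unfolding mkf P_def T2_def using vpos[of y] vpos[of "?\<Phi> y"] by (simp add: powr_divide)
          then show ?case
            using jac_pos[OF dk(4), of k y] P_nonneg[of "(x, y)"] T0(2)[of k "(x, y)"] mk_nonneg[of "?\<Phi> x" "?\<Phi> y"]
            by (simp add: ennreal_mult'[symmetric])
        qed
      qed
      finally show "ennreal (u x powr (q1 + 1)) * ennreal (u (?\<Phi> x) / u x) = (\<integral>\<^sup>+y. ennreal (P (x, y)) * ennreal (T2 k (x, y)) \<partial>lborel)" .
    qed
    also have "\<dots> = (\<integral>\<^sup>+z. ennreal (T2 k z) \<partial>Qm)" by (rule nn_Qm(1)[symmetric]) simp
    also have "\<dots> = ennreal (LINT z|Qm. T2 k z)" by (rule nn_integral_eq_integral) (use L2(2) T0 in simp_all)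
    finally show "(\<integral>\<^sup>+z. ennreal (T1 k z) \<partial>Qm) = ennreal (LINT z|Qm. T2 k z)" .
    show "0 \<le> (LINT z|Qm. T2 k z)" using T0 by (intro integral_nonneg_AE) simp
  qed (use L1(2) T0 in simp_all)
  have iau: "integrable Qm (\<lambda>z. au (fst z))" using L1(1) by simp
  have iav: "integrable Qm (\<lambda>z. av (snd z))"
    by (rule integral_quotient_tendsto(1)[where T="\<lambda>k z. v (flow (dk k) (snd z)) / v (snd z)" and C=Cv])
       (use eventually_mono[OF AE_Qm] Cv lv in auto)
  have ijf: "integrable Qm (\<lambda>z. jd (fst z))"
    by (rule integral_quotient_tendsto(1)[where T="\<lambda>k z. jac (dk k) (fst z)" and C=CJ]) (use jb jac_quotient(2) in auto)
  have ijs: "integrable Qm (\<lambda>z. jd (snd z))"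
    by (rule integral_quotient_tendsto(1)[where T="\<lambda>k z. jac (dk k) (snd z)" and C=CJ]) (use jb jac_quotient(2) in auto)
  have ik: "integrable Qm (\<lambda>z. kd \<beta>1 \<beta>2 s (fst z) (snd z))"
  proof (rule integral_quotient_tendsto(1)[where T="\<lambda>k z. kq \<beta>1 \<beta>2 s (dk k) (fst z) (snd z)" and C=CK])
    show "AE z in Qm. \<bar>kq \<beta>1 \<beta>2 s (dk k) (fst z) (snd z) - 1\<bar> \<le> CK * dk k" for k
      by (rule eventually_mono[OF AE_Qm]) (simp add: kb)
    show "AE z in Qm. (\<lambda>k. (kq \<beta>1 \<beta>2 s (dk k) (fst z) (snd z) - 1) / dk k) \<longlonglongrightarrow> kd \<beta>1 \<beta>2 s (fst z) (snd z)"
      by (rule eventually_mono[OF AE_Qm]) (simp add: kq_quotient(2)[OF \<beta> s])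
  qed simp_all
  have "(LINT z|Qm. au (fst z)) = (LINT z|Qm. kd \<beta>1 \<beta>2 s (fst z) (snd z) + (q2 * av (snd z) + jd (snd z)))"
    using LIMSEQ_unique[OF L1(3) L2(3)[folded I12]] by simp
  also have "\<dots> = (LINT z|Qm. kd \<beta>1 \<beta>2 s (fst z) (snd z)) + (q2 * (LINT z|Qm. av (snd z)) + (LINT z|Qm. jd (snd z)))"
    using ik iav ijs by simp
  finally have E1: "(LINT z|Qm. au (fst z)) = (LINT z|Qm. kd \<beta>1 \<beta>2 s (fst z) (snd z)) + (q2 * (LINT z|Qm. av (snd z)) + (LINT z|Qm. jd (snd z)))" .
  have "(LINT z|Qm. (q1 + 1) * au (fst z) + jd (fst z)) = 0"
    using L3(3) unfolding I3 by (simp add: LIMSEQ_const_iff)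
  then have E2: "(q1 + 1) * (LINT z|Qm. au (fst z)) + (LINT z|Qm. jd (fst z)) = 0" using iau ijf by simp
  have "(LINT z|Qm. (q2 + 1) * av (snd z) + jd (snd z)) = 0"
    using L4(3) unfolding I4 by (simp add: LIMSEQ_const_iff)
  then have E3: "(q2 + 1) * (LINT z|Qm. av (snd z)) + (LINT z|Qm. jd (snd z)) = 0" using iav ijs by simp
  \<comment> \<open>With \<open>A\<close> and \<open>B\<close> the integrals of \<open>au\<close>
    and \<open>av\<close>, the identity \<open>E3\<close> turns the right side of \<open>E1\<close>
    into the kernel term minus \<open>B\<close>. Thus \<open>A + B\<close> equals the kernel term,
    and \<open>E2\<close> and \<open>E3\<close> replace \<open>A\<close> and \<open>B\<close> by
    divergence terms.\<close>
  have "(LINT z|Qm. jd (fst z)) / (q1 + 1) = - (LINT z|Qm. au (fst z))" using E2 q by (simp add: field_simps)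
  moreover have "(LINT z|Qm. jd (snd z)) / (q2 + 1) = - (LINT z|Qm. av (snd z))" using E3 q by (simp add: field_simps)
  ultimately show ?thesis using E1 E3 by (simp add: algebra_simps)
qed

end

context energy_pair
begin

text \<open>As the cutoffs flatten, \<open>c\<close> tends to one and \<open>c'\<close> to zero, so
  the divergence tends to \<open>n\<close> and the kernel term to
  \<open>- (\<beta>1 + \<beta>2) - s\<close>, the degree of homogeneity of the kernel. Every limit
  integrand is constant, and dividing by the positive mass of \<open>Qm\<close> leaves the relation
  between the exponents.\<close>

theorem critical_exponents:
  "real DIM('a) / (q1 + 1) + real DIM('a) / (q2 + 1) = s + \<beta>1 + \<beta>2"
proof -
  let ?n = "real DIM('a)" and ?E = "measure Qm UNIV"
  define e where "e i = 1 / (real i + 4)" for i :: nat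
  have e: "0 < e i" "e i \<le> 1/4" for i by (simp_all add: e_def field_simps)
  have e0: "e \<longlonglongrightarrow> 0" unfolding e_def by real_asymp
  define ce where "ce i t = (max 0 (1 - (e i * t)\<^sup>2))\<^sup>2" for i t
  define ce' where "ce' i t = - 4 * e i * (e i * t) * max 0 (1 - (e i * t)\<^sup>2)" for i t
  have cut: "cutoff (ce i) (ce' i) (4 * e i) (1 / e i)" for i
    unfolding ce_def[abs_def] ce'_def[abs_def] by (rule cutoff_exists[OF e])
  have ce_lim: "(\<lambda>i. ce i t) \<longlonglongrightarrow> 1" for t
  proof -
    have "(\<lambda>i. (max 0 (1 - (e i * t)\<^sup>2))\<^sup>2) \<longlonglongrightarrow> (max 0 (1 - (0 * t)\<^sup>2))\<^sup>2"
      by (intro tendsto_intros e0)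
    then show ?thesis by (simp add: ce_def)
  qed
  have ce'_lim: "(\<lambda>i. ce' i t) \<longlonglongrightarrow> 0" for t
  proof -
    have "(\<lambda>i. - 4 * e i * (e i * t) * max 0 (1 - (e i * t)\<^sup>2)) \<longlonglongrightarrow> - 4 * 0 * (0 * t) * max 0 (1 - (0 * t)\<^sup>2)"
      by (intro tendsto_intros e0)
    then show ?thesis by (simp add: ce'_def)
  qed
  let ?jd = "\<lambda>i. cutoff.jd (ce i) (ce' i) :: 'a \<Rightarrow> real"
  let ?kd = "\<lambda>i. cutoff.kd (ce i) \<beta>1 \<beta>2 s :: 'a \<Rightarrow> 'a \<Rightarrow> real"
  have jd_lim: "(\<lambda>i. ?jd i x) \<longlonglongrightarrow> ?n" for x
  proof -
    have "(\<lambda>i. ?n * ce i (ln (norm x)) + ce' i (ln (norm x))) \<longlonglongrightarrow> ?n * 1 + 0"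
      by (intro tendsto_intros ce_lim ce'_lim)
    then show ?thesis by (simp add: cutoff.jd_def[OF cut])
  qed
  have jd_bound: "norm (?jd i x) \<le> ?n + 1" for i x
  proof -
    have "\<bar>ce' i (ln (norm x))\<bar> \<le> 1" using cutoff.c'_bound[OF cut, of i] cutoff.\<kappa>[OF cut, of i] by (rule order_trans)
    moreover have "0 \<le> ?n * ce i (ln (norm x))" using cutoff.c_range(1)[OF cut, of i] by simp
    moreover have "?n * ce i (ln (norm x)) \<le> ?n * 1" using cutoff.c_range(2)[OF cut, of i] by (intro mult_left_mono) auto
    ultimately have "\<bar>?n * ce i (ln (norm x)) + ce' i (ln (norm x))\<bar> \<le> ?n + 1" by linarith
    then show ?thesis by (simp add: cutoff.jd_def[OF cut])
  qed
  have kd_lim: "(\<lambda>i. ?kd i x y) \<longlonglongrightarrow> - (\<beta>1 + \<beta>2) - s" if "x \<noteq> y" for x y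
  proof -
    have "(\<lambda>i. - (\<beta>1 * ce i (ln (norm x)) + \<beta>2 * ce i (ln (norm y)))
        - s * (((ce i (ln (norm x)) *\<^sub>R x - ce i (ln (norm y)) *\<^sub>R y) \<bullet> (x - y)) / (norm (x - y))\<^sup>2))
      \<longlonglongrightarrow> - (\<beta>1 * 1 + \<beta>2 * 1) - s * (((1 *\<^sub>R x - 1 *\<^sub>R y) \<bullet> (x - y)) / (norm (x - y))\<^sup>2)"
      by (intro tendsto_intros ce_lim) (use that in auto)
    moreover have "((1 *\<^sub>R x - 1 *\<^sub>R y) \<bullet> (x - y)) / (norm (x - y))\<^sup>2 = 1"
      using that by (simp add: power2_norm_eq_inner)
    ultimately show ?thesis by (simp add: cutoff.kd_def[OF cut])
  qed
  define CK where "CK = (\<beta>1 + \<beta>2) + 6 * s * (1/2) powr (- s - 1) + (\<beta>1 + \<beta>2) * (6 * s * (1/2) powr (- s - 1))"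
  \<comment> \<open>The bound is inherited from the difference quotients, whose constant is the same
    for all cutoffs.\<close>
  have kd_bound: "norm (?kd i x y) \<le> CK" if "x \<noteq> 0" "y \<noteq> 0" "x \<noteq> y" for i x y
  proof -
    have "(\<lambda>k. \<bar>(cutoff.kq (ce i) \<beta>1 \<beta>2 s (dk k) x y - 1) / dk k\<bar>) \<longlonglongrightarrow> \<bar>?kd i x y\<bar>"
      by (intro tendsto_rabs cutoff.kq_quotient(2)[OF cut \<beta> s that])
    moreover have "\<bar>(cutoff.kq (ce i) \<beta>1 \<beta>2 s (dk k) x y - 1) / dk k\<bar> \<le> CK" for k
      using cutoff.kq_quotient(1)[OF cut \<beta> s that, of i k] dk(1)[of k] unfolding CK_def[symmetric]
      by (simp add: abs_divide field_simps)
    ultimately show ?thesis by (auto intro: LIMSEQ_le_const2)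
  qed
  have jm: "?jd i \<in> borel_measurable borel" for i by (rule cutoff.jd_measurable[OF cut])
  have km: "(\<lambda>z. ?kd i (fst z) (snd z)) \<in> borel_measurable (borel \<Otimes>\<^sub>M borel)" for i by (rule cutoff.kd_measurable[OF cut])
  have l1: "(\<lambda>i. LINT z|Qm. ?jd i (fst z)) \<longlonglongrightarrow> (LINT z|Qm. ?n)"
    by (rule integral_dominated_convergence[where w="\<lambda>_. ?n + 1"])
       (use jd_lim jd_bound measurable_compose[OF measurable_fst jm] in \<open>auto simp: measurable_cong_sets[OF sets_Qm refl]\<close>)
  have l2: "(\<lambda>i. LINT z|Qm. ?jd i (snd z)) \<longlonglongrightarrow> (LINT z|Qm. ?n)"
    by (rule integral_dominated_convergence[where w="\<lambda>_. ?n + 1"])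
       (use jd_lim jd_bound measurable_compose[OF measurable_snd jm] in \<open>auto simp: measurable_cong_sets[OF sets_Qm refl]\<close>)
  have l3: "(\<lambda>i. LINT z|Qm. ?kd i (fst z) (snd z)) \<longlonglongrightarrow> (LINT z|Qm. - (\<beta>1 + \<beta>2) - s)"
  proof (rule integral_dominated_convergence[where w="\<lambda>_. CK"])
    show "AE z in Qm. (\<lambda>i. ?kd i (fst z) (snd z)) \<longlonglongrightarrow> - (\<beta>1 + \<beta>2) - s"
      by (rule eventually_mono[OF AE_Qm]) (elim conjE, rule kd_lim)
    show "AE z in Qm. norm (?kd i (fst z) (snd z)) \<le> CK" for i
      by (rule eventually_mono[OF AE_Qm]) (elim conjE, rule kd_bound)
    show "(\<lambda>z. ?kd i (fst z) (snd z)) \<in> borel_measurable Qm" for i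
      using km by (simp add: measurable_cong_sets[OF sets_Qm refl])
  qed simp_all
  have "(\<lambda>i. (LINT z|Qm. ?jd i (fst z)) / (q1 + 1) + (LINT z|Qm. ?jd i (snd z)) / (q2 + 1) + (LINT z|Qm. ?kd i (fst z) (snd z)))
    \<longlonglongrightarrow> (LINT z|Qm. ?n) / (q1 + 1) + (LINT z|Qm. ?n) / (q2 + 1) + (LINT z|Qm. - (\<beta>1 + \<beta>2) - s)"
    using q by (intro tendsto_intros l1 l2 l3) auto
  then have "(LINT z|Qm. ?n) / (q1 + 1) + (LINT z|Qm. ?n) / (q2 + 1) + (LINT z|Qm. - (\<beta>1 + \<beta>2) - s) = 0"
    unfolding first_variation[OF cut] by (simp only: LIMSEQ_const_iff)
  then have "?E * (?n / (q1 + 1) + ?n / (q2 + 1) - (s + \<beta>1 + \<beta>2)) = 0"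
    by (simp add: algebra_simps)
  then show ?thesis using measure_Qm_pos by simp
qed

end

section \<open>From solutions in the Lebesgue setting to Borel functions and the energy
  identity\<close>

lemma positive_solution_critical:
  fixes u v :: "real ^ 'n \<Rightarrow> real" and \<alpha> \<beta>\<^sub>1 \<beta>\<^sub>2 q\<^sub>1 q\<^sub>2 n :: real
  assumes n_def: "n = real CARD('n)" and \<alpha>: "\<alpha> < n" and q: "q\<^sub>1 > 1" "q\<^sub>2 > 1" and \<beta>: "\<beta>\<^sub>1 \<ge> 0" "\<beta>\<^sub>2 \<ge> 0"
    and pos: "\<And>x. x \<noteq> 0 \<Longrightarrow> u x > 0 \<and> v x > 0" and C1: "C1_on (- {0}) u" "C1_on (- {0}) v"
    and sol: "wHLS_solution \<alpha> \<beta>\<^sub>1 \<beta>\<^sub>2 q\<^sub>1 q\<^sub>2 u v" and fin: "finite_energy q\<^sub>1 q\<^sub>2 u v"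
  shows "1 / (q\<^sub>1 + 1) + 1 / (q\<^sub>2 + 1) = (n - \<alpha> + \<beta>\<^sub>1 + \<beta>\<^sub>2) / n"
proof -
  define s where "s = n - \<alpha>"
  obtain u' :: "real ^ 'n \<Rightarrow> (real ^ 'n) \<Rightarrow>\<^sub>L real" where u': "\<And>x. x \<noteq> 0 \<Longrightarrow> (u has_derivative blinfun_apply (u' x)) (at x)" "continuous_on (- {0}) u'"
    using C1(1) unfolding C1_on_def by auto
  obtain v' :: "real ^ 'n \<Rightarrow> (real ^ 'n) \<Rightarrow>\<^sub>L real" where v': "\<And>x. x \<noteq> 0 \<Longrightarrow> (v has_derivative blinfun_apply (v' x)) (at x)" "continuous_on (- {0}) v'"
    using C1(2) unfolding C1_on_def by auto
  text \<open>The values at the origin are arbitrary; the value \<open>1\<close> makes the functions positive and Borel.\<close>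
  define h where "h w x = (if x = 0 then 1 else w x)" for w :: "real ^ 'n \<Rightarrow> real" and x
  have h0: "h w x = w x" if "x \<noteq> 0" for w x using that by (simp add: h_def)
  have hm: "h w \<in> borel_measurable borel" if d: "\<And>x. x \<noteq> 0 \<Longrightarrow> (w has_derivative blinfun_apply (w' x)) (at x)" for w and w' :: "real ^ 'n \<Rightarrow> (real ^ 'n) \<Rightarrow>\<^sub>L real"
  proof -
    have "continuous_on (- {0}) w"
      by (intro continuous_at_imp_continuous_on ballI has_derivative_continuous[OF d]) auto
    then have "(\<lambda>x. indicator (- {0}) x *\<^sub>R w x) \<in> borel_measurable borel"
      by (intro borel_measurable_continuous_on_indicator) auto
    then have "(\<lambda>x. indicator (- {0}) x *\<^sub>R w x + indicator {0} x) \<in> borel_measurable borel" by measurable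
    moreover have "(\<lambda>x. indicator (- {0}) x *\<^sub>R w x + indicator {0} x) = h w" by (auto simp: h_def indicator_def)
    ultimately show ?thesis by simp
  qed
  have hd: "(h w has_derivative D) (at x)" if "(w has_derivative D) (at x)" "x \<noteq> 0" for w D x
    by (rule has_derivative_transform_within_open[OF that(1), of "- {0}"]) (use that in \<open>auto simp: h_def\<close>)
  have eq: "ennreal (h w1 x) = (\<integral>\<^sup>+y. ennreal (mker b1 b2 s x y * h w2 y powr p) \<partial>lborel)"
    if x: "x \<noteq> 0" and m2 [measurable]: "h w2 \<in> borel_measurable borel" and i: "integrable lebesgue (wpot_integrand \<alpha> b2 p w2 x)"
      and e: "w1 x = 1 / norm x powr b1 * (LINT y|lebesgue. wpot_integrand \<alpha> b2 p w2 x y)" for w1 w2 :: "real ^ 'n \<Rightarrow> real" and b1 b2 p x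
  proof -
    have W0: "0 \<le> wpot_integrand \<alpha> b2 p w2 x y" for y by (simp add: wpot_integrand_def)
    have "(\<integral>\<^sup>+y. ennreal (mker b1 b2 s x y * h w2 y powr p) \<partial>lborel) = (\<integral>\<^sup>+y. ennreal (mker b1 b2 s x y * h w2 y powr p) \<partial>lebesgue)"
      by (simp add: nn_integral_completion)
    also have "\<dots> = (\<integral>\<^sup>+y. ennreal (norm x powr (- b1) * wpot_integrand \<alpha> b2 p w2 x y) \<partial>lebesgue)"
    proof (rule nn_integral_cong_AE, rule AE_completion, rule eventually_mono[OF AE_lborel_nonzero])
      fix y :: "real ^ 'n" assume "y \<noteq> 0"
      moreover have "real CARD('n) - \<alpha> = s" by (simp add: s_def n_def)
      ultimately show "ennreal (mker b1 b2 s x y * h w2 y powr p) = ennreal (norm x powr (- b1) * wpot_integrand \<alpha> b2 p w2 x y)"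
        by (simp add: mker_def h0 wpot_integrand_def powr_minus divide_simps mult.assoc)
    qed
    also have "\<dots> = ennreal (norm x powr (- b1)) * (\<integral>\<^sup>+y. ennreal (wpot_integrand \<alpha> b2 p w2 x y) \<partial>lebesgue)"
      using i by (subst nn_integral_cmult[symmetric]) (auto simp: ennreal_mult' borel_measurable_integrable)
    also have "(\<integral>\<^sup>+y. ennreal (wpot_integrand \<alpha> b2 p w2 x y) \<partial>lebesgue) = ennreal (LINT y|lebesgue. wpot_integrand \<alpha> b2 p w2 x y)"
      by (rule nn_integral_eq_integral[OF i]) (simp add: W0)
    also have "ennreal (norm x powr (- b1)) * \<dots> = ennreal (w1 x)"
      unfolding e by (simp add: ennreal_mult'[symmetric] powr_minus divide_inverse)
    finally show ?thesis using x by (simp add: h0)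
  qed
  have sd: "integrable lebesgue (wpot_integrand \<alpha> \<beta>\<^sub>2 q\<^sub>2 v x)"
     "u x = 1 / norm x powr \<beta>\<^sub>1 * (LINT y|lebesgue. wpot_integrand \<alpha> \<beta>\<^sub>2 q\<^sub>2 v x y)"
     "integrable lebesgue (wpot_integrand \<alpha> \<beta>\<^sub>1 q\<^sub>1 u x)"
     "v x = 1 / norm x powr \<beta>\<^sub>2 * (LINT y|lebesgue. wpot_integrand \<alpha> \<beta>\<^sub>1 q\<^sub>1 u x y)" if "x \<noteq> 0" for x
    using sol that unfolding wHLS_solution_def by blast+
  have hum: "h u \<in> borel_measurable borel" and hvm: "h v \<in> borel_measurable borel"
    using hm[OF u'(1)] hm[OF v'(1)] by auto
  have ui: "integrable lborel (\<lambda>x. h u x powr (q\<^sub>1 + 1))"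
  proof -
    have i: "integrable lebesgue (\<lambda>x. \<bar>u x\<bar> powr (q\<^sub>1 + 1))" using fin by (auto simp: finite_energy_def Lp_space_def)
    have ae: "AE x in lebesgue. \<bar>u x\<bar> powr (q\<^sub>1 + 1) = h u x powr (q\<^sub>1 + 1)"
    proof (rule AE_completion, rule eventually_mono[OF AE_lborel_nonzero])
      fix x :: "real ^ 'n" assume "x \<noteq> 0"
      then show "\<bar>u x\<bar> powr (q\<^sub>1 + 1) = h u x powr (q\<^sub>1 + 1)" using pos[of x] by (simp add: h0)
    qed
    have hp: "(\<lambda>x. h u x powr (q\<^sub>1 + 1)) \<in> borel_measurable lborel" using hum by measurable
    have "integrable lebesgue (\<lambda>x. h u x powr (q\<^sub>1 + 1))"
      by (rule integrable_cong_AE[THEN iffD1, OF borel_measurable_integrable[OF i] measurable_completion[OF hp] ae i])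
    then show ?thesis by (simp add: integrable_completion[OF hp])
  qed
  interpret energy_pair "h u" "h v" u' v' \<beta>\<^sub>1 \<beta>\<^sub>2 s q\<^sub>1 q\<^sub>2
  proof
    show "h u x > 0" "h v x > 0" for x using pos[of x] by (auto simp: h_def)
    show "ennreal (h u x) = (\<integral>\<^sup>+y. ennreal (mker \<beta>\<^sub>1 \<beta>\<^sub>2 s x y * h v y powr q\<^sub>2) \<partial>lborel)" if "x \<noteq> 0" for x
      by (rule eq[where ?w1.0=u and ?w2.0=v, OF that hvm sd(1,2)[OF that]])
    show "ennreal (h v y) = (\<integral>\<^sup>+x. ennreal (mker \<beta>\<^sub>1 \<beta>\<^sub>2 s x y * h u x powr q\<^sub>1) \<partial>lborel)" if "y \<noteq> 0" for y
    proof -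
      have "mker \<beta>\<^sub>1 \<beta>\<^sub>2 s x y = mker \<beta>\<^sub>2 \<beta>\<^sub>1 s y x" for x by (simp add: mker_def norm_minus_commute mult_ac)
      then show ?thesis using eq[where ?w1.0=v and ?w2.0=u, OF that hum sd(3,4)[OF that]] by simp
    qed
    show "(h u has_derivative blinfun_apply (u' x)) (at x)" if "x \<noteq> 0" for x by (rule hd[OF u'(1)[OF that] that])
    show "(h v has_derivative blinfun_apply (v' x)) (at x)" if "x \<noteq> 0" for x by (rule hd[OF v'(1)[OF that] that])
  qed (use hum hvm u'(2) v'(2) \<beta> q ui \<alpha> in \<open>auto simp: s_def\<close>)
  have "n / (q\<^sub>1 + 1) + n / (q\<^sub>2 + 1) = n - \<alpha> + \<beta>\<^sub>1 + \<beta>\<^sub>2"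
    using critical_exponents by (simp add: n_def s_def)
  moreover have "n > 0" by (simp add: n_def)
  ultimately show ?thesis by (simp add: field_simps)
qed

theorem theorem2p5:
  fixes \<alpha> \<beta>\<^sub>1 \<beta>\<^sub>2 q\<^sub>1 q\<^sub>2 n :: real
  assumes n_def: "n = real CARD('n)"
    and "CARD('n) \<ge> 3"
    and "0 < \<alpha>" and "\<alpha> < n"
    and "q\<^sub>1 > 1" and "q\<^sub>2 > 1"
    and "\<beta>\<^sub>1 \<ge> 0" and "\<beta>\<^sub>2 \<ge> 0" and "\<beta>\<^sub>1 + \<beta>\<^sub>2 \<le> \<alpha>"
    and "\<beta>\<^sub>1 / n < 1 / (q\<^sub>1 + 1)" and "1 / (q\<^sub>1 + 1) < (n - \<alpha> + \<beta>\<^sub>1) / n"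
    and "\<beta>\<^sub>2 / n < 1 / (q\<^sub>2 + 1)" and "1 / (q\<^sub>2 + 1) < (n - \<alpha> + \<beta>\<^sub>2) / n"
  shows "(\<exists>u v :: real ^ 'n \<Rightarrow> real.
            (\<forall>x. x \<noteq> 0 \<longrightarrow> u x > 0 \<and> v x > 0) \<and>
            C1_on (- {0}) u \<and> C1_on (- {0}) v \<and>
            wHLS_solution \<alpha> \<beta>\<^sub>1 \<beta>\<^sub>2 q\<^sub>1 q\<^sub>2 u v \<and>
            finite_energy q\<^sub>1 q\<^sub>2 u v)
         \<longleftrightarrow> 1 / (q\<^sub>1 + 1) + 1 / (q\<^sub>2 + 1) = (n - \<alpha> + \<beta>\<^sub>1 + \<beta>\<^sub>2) / n"
proof
  assume "\<exists>u v :: real ^ 'n \<Rightarrow> real.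
            (\<forall>x. x \<noteq> 0 \<longrightarrow> u x > 0 \<and> v x > 0) \<and>
            C1_on (- {0}) u \<and> C1_on (- {0}) v \<and>
            wHLS_solution \<alpha> \<beta>\<^sub>1 \<beta>\<^sub>2 q\<^sub>1 q\<^sub>2 u v \<and>
            finite_energy q\<^sub>1 q\<^sub>2 u v"
  then obtain u v :: "real ^ 'n \<Rightarrow> real" where "\<And>x. x \<noteq> 0 \<Longrightarrow> u x > 0 \<and> v x > 0"
    "C1_on (- {0}) u" "C1_on (- {0}) v" "wHLS_solution \<alpha> \<beta>\<^sub>1 \<beta>\<^sub>2 q\<^sub>1 q\<^sub>2 u v" "finite_energy q\<^sub>1 q\<^sub>2 u v"
    by blast
  then show "1 / (q\<^sub>1 + 1) + 1 / (q\<^sub>2 + 1) = (n - \<alpha> + \<beta>\<^sub>1 + \<beta>\<^sub>2) / n"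
    using assms by (intro positive_solution_critical[of n \<alpha> q\<^sub>1 q\<^sub>2 \<beta>\<^sub>1 \<beta>\<^sub>2 u v]) auto
next
  assume "1 / (q\<^sub>1 + 1) + 1 / (q\<^sub>2 + 1) = (n - \<alpha> + \<beta>\<^sub>1 + \<beta>\<^sub>2) / n"
  then show "\<exists>u v :: real ^ 'n \<Rightarrow> real.
            (\<forall>x. x \<noteq> 0 \<longrightarrow> u x > 0 \<and> v x > 0) \<and>
            C1_on (- {0}) u \<and> C1_on (- {0}) v \<and>
            wHLS_solution \<alpha> \<beta>\<^sub>1 \<beta>\<^sub>2 q\<^sub>1 q\<^sub>2 u v \<and>
            finite_energy q\<^sub>1 q\<^sub>2 u v"
    using assms by (intro critical_solution_exists[of n \<alpha> q\<^sub>1 q\<^sub>2 \<beta>\<^sub>1 \<beta>\<^sub>2]) auto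
qed

end
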